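(* Let $d\ge3$ and $L=-\Delta+1$ on $\mathbb R^d$. Then, for every $T\in\mathcal K_L$ and every $b\in BMO(\mathbb R^d)$, the commutator $[b,T]$ is bounded from $H^{1,1}_L(\mathbb R^d)$ into $L^1(\mathbb R^d)$.
   Context: Here $V\equiv1$. Hardy space: $\mathcal M_Lf(x)=\sup_{t>0}|e^{-tL}f(x)|$ and $H^1_L(\mathbb R^d)$ is the space of $f\in L^1(\mathbb R^d)$ with $\|f\|_{H^1_L}:=\|\mathcal M_Lf\|_{L^1}<\infty$. $H^{1,1}_L(\mathbb R^d)$ is the (inhomogeneous) Hardy-Sobolev space of all $f\in H^1_L(\mathbb R^d)$ with $\partial_{x_1}f,\dots,\partial_{x_d}f\in H^1_L(\mathbb R^d)$, with norm $\|f\|_{H^{1,1}_L}=\|f\|_{H^1_L}+\sum_{j=1}^d\|\partial_{x_j}f\|_{H^1_L}$. Auxiliary function: $\rho(x)=\sup\{r>0: \frac1{r^{d-2}}\int_{B(x,r)}V(y)\,dy\le 1\}$ (a positive constant here). Generalized atoms: for $1<q\le\infty$, $\varepsilon>0$, a function $a$ is a generalized $(H^1_L,q,\varepsilon)$-atom related to the ball $B=B(x_0,r)$ if supp $a\subset B$, $\|a\|_{L^q}\le |B|^{1/q-1}$ and $|\int a\,dx|\le (r/\rho(x_0))^\varepsilon$. Class $\mathcal K_L$: all sublinear operators $T$ (i.e. $|T(\alpha f+\beta g)(x)|\le|\alpha||Tf(x)|+|\beta||Tg(x)|$) bounded from $H^1_L(\mathbb R^d)$ into $L^1(\mathbb R^d)$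 for which there are $q\in(1,\infty]$, $\varepsilon>0$ and $C>0$ such that $\|(b-b_B)Ta\|_{L^1}\le C\|b\|_{BMO}$ for all $b\in BMO(\mathbb R^d)$ (the classical space) and all generalized $(H^1_L,q,\varepsilon)$-atoms $a$ related to a ball $B$, where $b_B=\frac1{|B|}\int_Bb$. Commutator: $[b,T](f)(x):=T\big((b(x)-b(\cdot))f(\cdot)\big)(x)$. Convention: $T$ is implicitly taken to be defined and sublinear on all functions to which it is applied.
   Formalization: [b,T]f is taken literally only when (b(x)-b)f lies in H^1_L for a.e. x, a set of f proved dense in H^{1,1}_L; for other f, boundedness means the bounded sublinear extension of |[b,T]f|, since arbitrary values of T off H^1_L make the literal claim false. *)

theory Defs
  imports "HOL-Analysis.Analysis" "HOL-Probability.Essential_Supremum" "HOL-Probability.Distributions"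
begin

text \<open>
  Functions on \<open>\<real>\<^sup>d\<close> are functions on \<^typ>\<open>real^'n\<close> with \<open>d = CARD('n)\<close>. The scalar type
  \<open>'k :: {real_normed_field, euclidean_space}\<close> covers \<^typ>\<open>real\<close> and \<^typ>\<open>complex\<close>. Functions are
  everywhere defined and not identified when equal almost everywhere; norms take values in
  \<^typ>\<open>ennreal\<close>.
\<close>

section \<open>Smooth test functions and weak derivatives\<close>

definition partial :: "'n \<Rightarrow> (real^'n \<Rightarrow> real) \<Rightarrow> real^'n \<Rightarrow> real" where
  "partial i u x = frechet_derivative u (at x) (axis i 1)"

coinductive smooth :: "(real^'n \<Rightarrow> real) \<Rightarrow> bool" where
  "(\<And>x. u differentiable (at x)) \<Longrightarrow> (\<And>i. smooth (partial i u)) \<Longrightarrow> smooth u"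

definition test_function :: "(real^'n \<Rightarrow> real) \<Rightarrow> bool" where
  "test_function \<phi> \<longleftrightarrow> smooth \<phi> \<and> (\<exists>K. compact K \<and> (\<forall>x. x \<notin> K \<longrightarrow> \<phi> x = 0))"

definition loc_integrable :: "(real^'n \<Rightarrow> 'k::{real_normed_field,euclidean_space}) \<Rightarrow> bool" where
  "loc_integrable f \<longleftrightarrow> (\<forall>K. compact K \<longrightarrow> set_integrable lebesgue K f)"

definition has_weak_partial ::
  "'n \<Rightarrow> (real^'n \<Rightarrow> 'k::{real_normed_field,euclidean_space}) \<Rightarrow> (real^'n \<Rightarrow> 'k) \<Rightarrow> bool" where
  "has_weak_partial j f g \<longleftrightarrow> loc_integrable f \<and> loc_integrable g \<and>
     (\<forall>\<phi>. test_function \<phi> \<longrightarrow>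
        (LINT x|lebesgue. partial j \<phi> x *\<^sub>R f x) = - (LINT x|lebesgue. \<phi> x *\<^sub>R g x))"

text \<open>Determined up to almost everywhere equality only.\<close>

definition weak_partial ::
  "'n \<Rightarrow> (real^'n \<Rightarrow> 'k::{real_normed_field,euclidean_space}) \<Rightarrow> real^'n \<Rightarrow> 'k" where
  "weak_partial j f = (SOME g. has_weak_partial j f g)"

section \<open>The operator \<open>L = -\<Delta> + 1\<close> and its semigroup\<close>

definition schroedinger :: "(real^'n \<Rightarrow> real) \<Rightarrow> (real^'n \<Rightarrow> real) \<Rightarrow> real^'n \<Rightarrow> real" where
  "schroedinger V u x = - (\<Sum>i\<in>UNIV. partial i (partial i u) x) + V x * u x"

text \<open>
  Convolution kernel of \<open>e\<^sup>-\<^sup>t\<^sup>L = e\<^sup>-\<^sup>t e\<^sup>t\<^sup>\<Delta>\<close>: the Gauss--Weierstrass kernel multiplied by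
  \<open>e\<^sup>-\<^sup>t\<close>. It solves \<open>\<partial>\<^sub>t p = -L p\<close> and has total mass \<open>e\<^sup>-\<^sup>t\<close>; see \<open>L_kernel_equation\<close> and
  \<open>L_kernel_mass\<close>.
\<close>

definition L_kernel :: "real \<Rightarrow> real^'n \<Rightarrow> real" where
  "L_kernel t z = exp (- t) * ((4 * pi * t) powr (- (real CARD('n) / 2)) * exp (- (norm z)\<^sup>2 / (4 * t)))"

lemma partial_has_derivative: "(u has_derivative D) (at x) \<Longrightarrow> partial i u x = D (axis i 1)"
  unfolding partial_def by (metis frechet_derivative_at)

lemma L_kernel_has_derivative:
  fixes z :: "real^'n"
  assumes "t \<noteq> 0"
  shows "(L_kernel t has_derivative (\<lambda>h. - (z \<bullet> h) / (2 * t) * L_kernel t z)) (at z)"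
  using assms unfolding L_kernel_def power2_norm_eq_inner
  by (auto intro!: derivative_eq_intros simp: fun_eq_iff inner_commute field_simps)

lemma partial_L_kernel: "t \<noteq> 0 \<Longrightarrow> partial i (L_kernel t) = (\<lambda>z. - (z $ i) / (2 * t) * L_kernel t z)"
  by (rule ext) (simp add: partial_has_derivative[OF L_kernel_has_derivative] inner_axis)

lemma partial2_L_kernel:
  fixes z :: "real^'n"
  assumes t: "t \<noteq> 0"
  shows "partial i (partial i (L_kernel t)) z = ((z $ i)\<^sup>2 / (4 * t\<^sup>2) - 1 / (2 * t)) * L_kernel t z"
proof -
  have "((\<lambda>z. - (z $ i) / (2 * t) * L_kernel t z) has_derivative
     (\<lambda>h. - (z $ i) / (2 * t) * (- (z \<bullet> h) / (2 * t) * L_kernel t z) + (- (h $ i) / (2 * t)) * L_kernel t z)) (at z)"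
    using t by (auto intro!: derivative_eq_intros L_kernel_has_derivative
       bounded_linear_imp_has_derivative[OF bounded_linear_vec_nth] simp: fun_eq_iff)
      (simp add: field_simps power2_eq_square)?
  from partial_has_derivative[OF this, of i] show ?thesis
    using t by (simp add: partial_L_kernel inner_axis axis_nth) (simp add: field_simps power2_eq_square)
qed

lemma L_kernel_equation:
  fixes z :: "real^'n"
  assumes t: "0 < t"
  shows "((\<lambda>s. L_kernel s z) has_real_derivative - schroedinger (\<lambda>_. 1) (L_kernel t) z) (at t)"
proof -
  have n2: "(norm z)\<^sup>2 = (\<Sum>i\<in>UNIV. (z $ i)\<^sup>2)"
    unfolding power2_norm_eq_inner by (simp add: inner_vec_def power2_eq_square)
  have S: "- schroedinger (\<lambda>_. 1) (L_kernel t) z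
     = ((norm z)\<^sup>2 / (4 * t\<^sup>2) - real CARD('n) / (2 * t) - 1) * L_kernel t z"
    using t by (simp add: schroedinger_def partial2_L_kernel n2 algebra_simps sum_subtractf
       sum_distrib_left sum_distrib_right sum_divide_distrib)
  have "((\<lambda>s. L_kernel s z) has_real_derivative 
     ((norm z)\<^sup>2 / (4 * t\<^sup>2) - real CARD('n) / (2 * t) - 1) * L_kernel t z) (at t)"
  proof -
    let ?d = "real CARD('n) / 2" and ?n = "(norm z)\<^sup>2"
    have 1: "((\<lambda>s. (4 * pi * s) powr - ?d) has_real_derivative - ?d / t * (4 * pi * t) powr - ?d) (at t)"
    proof -
      have "((\<lambda>s. (4 * pi * s) powr - ?d) has_real_derivative
          - ?d * (4 * pi * t) powr (- ?d - 1) * (4 * pi)) (at t)"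
        using t by (intro DERIV_chain2[OF has_real_derivative_powr]) (auto intro!: derivative_eq_intros)
      moreover have "(4 * pi * t) powr (- ?d - 1) = (4 * pi * t) powr - ?d / (4 * pi * t)"
        using t by (subst powr_diff) auto
      ultimately show ?thesis using t by simp
    qed
    have 2: "((\<lambda>s. exp (- ?n / (4 * s))) has_real_derivative ?n / (4 * t\<^sup>2) * exp (- ?n / (4 * t))) (at t)"
      using t by (auto intro!: derivative_eq_intros simp: field_simps power2_eq_square)
    have 3: "((\<lambda>s::real. exp (- s)) has_real_derivative - exp (- t)) (at t)"
      by (auto intro!: derivative_eq_intros)
    show ?thesis
      unfolding L_kernel_def
      by (rule DERIV_cong[OF DERIV_mult[OF 3 DERIV_mult[OF 1 2]]]) (simp add: algebra_simps)
  qed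
  then show ?thesis unfolding S .
qed

lemma L_kernel_mass:
  assumes t: "0 < t"
  shows "integrable lebesgue (L_kernel t :: real^'n \<Rightarrow> real)"
    and "(LINT z|lebesgue. L_kernel t (z :: real^'n)) = exp (- t)"
proof -
  define \<sigma> where "\<sigma> = sqrt (2 * t)"
  have s: "\<sigma> > 0" "\<sigma>\<^sup>2 = 2 * t" using t by (auto simp: \<sigma>_def)
  have K: "L_kernel t z = exp (- t) * (\<Prod>b\<in>Basis. normal_density 0 \<sigma> (z \<bullet> b))" for z :: "real^'n"
  proof -
    have "(\<Prod>b\<in>Basis. normal_density 0 \<sigma> (z \<bullet> b))
        = (\<Prod>b\<in>(Basis::(real^'n) set). 1 / sqrt (4 * pi * t)) * exp (\<Sum>b\<in>Basis. - (z \<bullet> b)\<^sup>2 / (4 * t))"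
      unfolding normal_density_def s by (simp add: exp_sum prod_dividef algebra_simps power_one_over)
    also have "(\<Sum>b\<in>Basis. - (z \<bullet> b)\<^sup>2 / (4 * t)) = - (norm z)\<^sup>2 / (4 * t)"
      unfolding power2_norm_eq_inner euclidean_inner[of z z]
      by (simp add: sum_divide_distrib sum_negf power2_eq_square)
    also have "(\<Prod>b\<in>(Basis::(real^'n) set). 1 / sqrt (4 * pi * t)) = (4 * pi * t) powr (- (real CARD('n) / 2))"
    proof -
      have "1 / sqrt (4 * pi * t) = (4 * pi * t) powr (-1/2)"
        using t by (simp add: powr_minus powr_half_sqrt inverse_eq_divide)
      then show ?thesis using t by (simp add: powr_powr flip: powr_realpow)
    qed
    finally show ?thesis by (simp add: L_kernel_def)
  qed
  have m: "(\<lambda>z::real^'n. \<Prod>b\<in>Basis. normal_density 0 \<sigma> (z \<bullet> b)) \<in> borel_measurable borel"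
    by measurable
  have one: "(\<integral>\<^sup>+x. ennreal (normal_density 0 \<sigma> x) \<partial>lborel) = 1"
    using s by (subst nn_integral_eq_integral) (auto simp: integrable_normal_density)
  have "(\<integral>\<^sup>+z. ennreal (\<Prod>b\<in>Basis. normal_density 0 \<sigma> ((z::real^'n) \<bullet> b)) \<partial>lborel) = 1"
    using nn_integral_lborel_prod[where f="\<lambda>b::real^'n. \<lambda>x. normal_density 0 \<sigma> x"] by (simp add: one prod_ennreal)
  then have hb: "has_bochner_integral lborel (\<lambda>z::real^'n. \<Prod>b\<in>Basis. normal_density 0 \<sigma> (z \<bullet> b)) 1"
    by (intro has_bochner_integral_nn_integral) (auto simp: prod_nonneg m)
  then have hb2: "has_bochner_integral lborel (L_kernel t :: real^'n \<Rightarrow> real) (exp (-t))"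
    using has_bochner_integral_mult_right[of "exp (-t)", OF hb] unfolding K[abs_def] by simp
  then have me: "(L_kernel t :: real^'n \<Rightarrow> real) \<in> borel_measurable lborel"
    by (auto simp: has_bochner_integral_iff)
  show "integrable lebesgue (L_kernel t :: real^'n \<Rightarrow> real)"
    using hb2 me by (simp add: integrable_completion has_bochner_integral_iff)
  show "(LINT z|lebesgue. L_kernel t (z :: real^'n)) = exp (- t)"
    using hb2 me by (simp add: integral_completion has_bochner_integral_iff)
qed

definition L_semigroup ::
  "real \<Rightarrow> (real^'n \<Rightarrow> 'k::{real_normed_field,euclidean_space}) \<Rightarrow> real^'n \<Rightarrow> 'k" where
  "L_semigroup t f x = (LINT y|lebesgue. L_kernel t (x - y) *\<^sub>R f y)"

section \<open>The spaces \<open>H\<^sup>1\<^sub>L\<close> and \<open>H\<^sup>1\<^sup>,\<^sup>1\<^sub>L\<close>\<close>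

definition L1_norm :: "(real^'n \<Rightarrow> 'k::real_normed_vector) \<Rightarrow> ennreal" where
  "L1_norm f = (\<integral>\<^sup>+x. ennreal (norm (f x)) \<partial>lebesgue)"

definition maximal_L ::
  "(real^'n \<Rightarrow> 'k::{real_normed_field,euclidean_space}) \<Rightarrow> real^'n \<Rightarrow> ennreal" where
  "maximal_L f x = (SUP t\<in>{0<..}. ennreal (norm (L_semigroup t f x)))"

definition H1_norm :: "(real^'n \<Rightarrow> 'k::{real_normed_field,euclidean_space}) \<Rightarrow> ennreal" where
  "H1_norm f = (\<integral>\<^sup>+x. maximal_L f x \<partial>lebesgue)"

definition H1 :: "(real^'n \<Rightarrow> 'k::{real_normed_field,euclidean_space}) set" where
  "H1 = {f. integrable lebesgue f \<and> H1_norm f < \<infinity>}"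

definition H11 :: "(real^'n \<Rightarrow> 'k::{real_normed_field,euclidean_space}) set" where
  "H11 = {f \<in> H1. \<forall>j. \<exists>g\<in>H1. has_weak_partial j f g}"

definition H11_norm :: "(real^'n \<Rightarrow> 'k::{real_normed_field,euclidean_space}) \<Rightarrow> ennreal" where
  "H11_norm f = H1_norm f + (\<Sum>j\<in>UNIV. H1_norm (weak_partial j f))"

section \<open>\<open>BMO\<close>\<close>

definition ball_mean ::
  "(real^'n \<Rightarrow> 'k::{real_normed_field,euclidean_space}) \<Rightarrow> real^'n \<Rightarrow> real \<Rightarrow> 'k" where
  "ball_mean b x r = (1 / measure lebesgue (ball x r)) *\<^sub>R (LINT y:ball x r|lebesgue. b y)"

definition BMO_norm :: "(real^'n \<Rightarrow> 'k::{real_normed_field,euclidean_space}) \<Rightarrow> ennreal" where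
  "BMO_norm b = (SUP (x, r)\<in>UNIV \<times> {0<..}.
     (\<integral>\<^sup>+y\<in>ball x r. ennreal (norm (b y - ball_mean b x r)) \<partial>lebesgue) / emeasure lebesgue (ball x r))"

definition BMO :: "(real^'n \<Rightarrow> 'k::{real_normed_field,euclidean_space}) set" where
  "BMO = {b. loc_integrable b \<and> BMO_norm b < \<infinity>}"

section \<open>Generalized atoms\<close>

text \<open>The function \<open>\<rho>\<close> associated with a potential \<open>V\<close>; the exponent \<open>d - 2\<close> is a natural number.\<close>

definition critical_radius :: "(real^'n \<Rightarrow> real) \<Rightarrow> real^'n \<Rightarrow> real" where
  "critical_radius V x =
     Sup {r. 0 < r \<and> 1 / r ^ (CARD('n) - 2) * (LINT y:ball x r|lebesgue. V y) \<le> 1}"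

definition Lq_norm :: "ereal \<Rightarrow> (real^'n \<Rightarrow> 'k::real_normed_vector) \<Rightarrow> ereal" where
  "Lq_norm q f =
    (if q = \<infinity> then esssup lebesgue (\<lambda>x. ereal (norm (f x)))
     else if integrable lebesgue (\<lambda>x. norm (f x) powr real_of_ereal q)
     then ereal ((LINT x|lebesgue. norm (f x) powr real_of_ereal q) powr (1 / real_of_ereal q))
     else \<infinity>)"

text \<open>For \<open>q = \<infinity>\<close> the term \<^term>\<open>real_of_ereal (1 / q)\<close> is \<open>0\<close>.\<close>

definition generalized_atom ::
  "ereal \<Rightarrow> real \<Rightarrow> real^'n \<Rightarrow> real \<Rightarrow> (real^'n \<Rightarrow> 'k::{real_normed_field,euclidean_space}) \<Rightarrow> bool" where
  "generalized_atom q \<epsilon> x0 r a \<longleftrightarrow>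
     0 < r \<and>
     a \<in> borel_measurable lebesgue \<and>
     (\<forall>x. x \<notin> ball x0 r \<longrightarrow> a x = 0) \<and>
     Lq_norm q a \<le> ereal (measure lebesgue (ball x0 r) powr (real_of_ereal (1 / q) - 1)) \<and>
     norm (LINT x|lebesgue. a x) \<le> (r / critical_radius (\<lambda>_. 1) x0) powr \<epsilon>"

section \<open>The class \<open>K\<^sub>L\<close> and commutators\<close>

text \<open>
  Operators are total in HOL, but an operator \<open>T\<close> is only ever constrained on its domain \<open>H\<^sup>1\<^sub>L\<close>;
  generalized atoms belong to it because \<open>q > 1\<close>. Sublinearity is pointwise at every point: the
  commutator at \<open>x\<close> evaluates, at \<open>x\<close>, the image of a function that itself depends on \<open>x\<close>.
\<close>

definition sublinear_on_H1 ::
  "((real^'n \<Rightarrow> 'k::{real_normed_field,euclidean_space}) \<Rightarrow> real^'n \<Rightarrow> 'k) \<Rightarrow> bool" where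
  "sublinear_on_H1 T \<longleftrightarrow>
     (\<forall>f\<in>H1. \<forall>g\<in>H1. \<forall>\<alpha> \<beta> x.
        norm (T (\<lambda>y. \<alpha> * f y + \<beta> * g y) x) \<le> norm \<alpha> * norm (T f x) + norm \<beta> * norm (T g x))"

definition bounded_H1_L1 ::
  "((real^'n \<Rightarrow> 'k::{real_normed_field,euclidean_space}) \<Rightarrow> real^'n \<Rightarrow> 'k) \<Rightarrow> bool" where
  "bounded_H1_L1 T \<longleftrightarrow>
     (\<exists>C::real. \<forall>f\<in>H1. integrable lebesgue (T f) \<and> L1_norm (T f) \<le> ennreal C * H1_norm f)"

definition class_K ::
  "((real^'n \<Rightarrow> 'k::{real_normed_field,euclidean_space}) \<Rightarrow> real^'n \<Rightarrow> 'k) set" where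
  "class_K = {T. sublinear_on_H1 T \<and> bounded_H1_L1 T \<and>
     (\<exists>q>1. \<exists>\<epsilon>>0. \<exists>C>0. \<forall>b\<in>BMO. \<forall>x0 r a. generalized_atom q \<epsilon> x0 r a \<longrightarrow>
        L1_norm (\<lambda>x. (b x - ball_mean b x0 r) * T a x) \<le> ennreal C * BMO_norm b)}"

definition commutator ::
  "(real^'n \<Rightarrow> 'k::{real_normed_field,euclidean_space}) \<Rightarrow> ((real^'n \<Rightarrow> 'k) \<Rightarrow> real^'n \<Rightarrow> 'k) \<Rightarrow>
   (real^'n \<Rightarrow> 'k) \<Rightarrow> real^'n \<Rightarrow> 'k" where
  "commutator b T f x = T (\<lambda>y. (b x - b y) * f y) x"

text \<open>
  The functions \<open>f\<close> for which \<open>[b,T] f\<close> makes sense almost everywhere, i.e. for which \<open>T\<close> is only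
  applied to elements of its domain \<open>H\<^sup>1\<^sub>L\<close>. In general this is not all of \<open>H\<^sup>1\<^sup>,\<^sup>1\<^sub>L\<close>, as \<open>b f\<close> need
  not be integrable, and a \<open>T\<close> extended arbitrarily beyond \<open>H\<^sup>1\<^sub>L\<close> admits no estimate there.
\<close>

definition commutator_domain ::
  "(real^'n \<Rightarrow> 'k::{real_normed_field,euclidean_space}) \<Rightarrow> (real^'n \<Rightarrow> 'k) set" where
  "commutator_domain b = {f \<in> H11. AE x in lebesgue. (\<lambda>y. (b x - b y) * f y) \<in> H1}"

text \<open>
  \<open>[b,T]\<close> is bounded from \<open>H\<^sup>1\<^sup>,\<^sup>1\<^sub>L\<close> into \<open>L\<^sup>1\<close>: it is defined on a dense subset, and its modulus
  \<open>A f = |[b,T] f|\<close> extends from there to a bounded sublinear operator on all of \<open>H\<^sup>1\<^sup>,\<^sup>1\<^sub>L\<close>.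
  Boundedness and sublinearity make \<open>A\<close> continuous, so by density it is unique up to equality
  almost everywhere. The modulus is used because sublinearity controls nothing else: the phase of
  \<open>[b,T] f\<close> need be neither measurable nor continuous in \<open>f\<close>.
\<close>

definition commutator_bounded ::
  "(real^'n \<Rightarrow> 'k::{real_normed_field,euclidean_space}) \<Rightarrow> ((real^'n \<Rightarrow> 'k) \<Rightarrow> real^'n \<Rightarrow> 'k) \<Rightarrow> bool" where
  "commutator_bounded b T \<longleftrightarrow>
     (\<forall>f\<in>H11. \<forall>e>0. \<exists>g\<in>commutator_domain b. H11_norm (\<lambda>x. f x - g x) < e) \<and>
     (\<exists>(A :: (real^'n \<Rightarrow> 'k) \<Rightarrow> real^'n \<Rightarrow> real) (C::real).
        (\<forall>f x. 0 \<le> A f x) \<and>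
        (\<forall>f\<in>commutator_domain b. AE x in lebesgue. A f x = norm (commutator b T f x)) \<and>
        (\<forall>f\<in>H11. integrable lebesgue (A f) \<and> L1_norm (A f) \<le> ennreal C * H11_norm f) \<and>
        (\<forall>f\<in>H11. \<forall>g\<in>H11. \<forall>\<alpha> \<beta>. AE x in lebesgue.
           A (\<lambda>y. \<alpha> * f y + \<beta> * g y) x \<le> norm \<alpha> * A f x + norm \<beta> * A g x))"

end

theory Submission
  imports Defs
begin

text \<open>
  For compactly supported \<open>f\<close> expand \<open>f\<close> in dyadic Haar pieces \<open>h\<^sub>Q\<close>. A function with gradient in
  \<open>L\<^sup>1\<close> differs from its average over cubes of side \<open>2\<^sup>-\<^sup>k\<close> by \<open>O(2\<^sup>-\<^sup>k)\<close> in \<open>L\<^sup>1\<close>, so the pieces at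
  scale \<open>2\<^sup>-\<^sup>k\<close> have total mass \<open>O(2\<^sup>-\<^sup>k)\<close>. This pays for losses of order \<open>2\<^sup>k\<^sup>/\<^sup>2\<close> at each scale.
  With \<open>b\<^sub>Q\<close> the mean of \<open>b\<close> near \<open>Q\<close>,
  \<open>|[b,T] h\<^sub>Q| \<le> |(b - b\<^sub>Q) T h\<^sub>Q| + |T ((b - b\<^sub>Q) h\<^sub>Q)|\<close>. The first term is bounded by the atom
  condition defining the class of \<open>T\<close>. In the second, \<open>(b - b\<^sub>Q) h\<^sub>Q\<close> lies in \<open>H\<^sup>1\<^sub>L\<close>: a
  John--Nirenberg stopping argument writes it as a geometric series of pieces, and its mean costs only
  a factor \<open>2\<^sup>k\<^sup>/\<^sup>2\<close>. Only \<open>L\<^sup>1\<close> bounds on \<open>f\<close> and its gradient enter. For general \<open>f\<close> use smooth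
  cutoffs, which converge in \<open>H\<^sup>1\<^sup>,\<^sup>1\<^sub>L\<close> because the commutator of the heat semigroup with
  a Lipschitz function of small constant is small; sublinearity then extends \<open>|[b,T]|\<close> by continuity.
\<close>

section \<open>Lebesgue measure\<close>

text \<open>Of \<open>T\<close> only sublinearity, the bound from \<open>H1\<close> to
  \<open>L1\<close> and the atom condition are available, and \<open>T\<close> acts on (b(x) - b) f
  with x frozen. For fixed x this is a combination of f and b f, so limits are taken in
  \<open>H1\<close> for these two functions, and b f must first be shown to lie in
  \<open>H1\<close>. That step is qualitative: on a fixed box the means b_Q grow at most like
  2^(k/2), with a constant depending on the box, whereas the estimate of the commutator uses only
  differences b - b_Q and does not see the box. The factor 2^(k/2) is the price of missing
  cancellation: the kernels of the semigroup decay like |z|^(-d-2\<gamma>), uniformly in t, for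
  every \<gamma> \<ge> 0, and \<gamma> = 1/4 bounds a function of height M on a cube Q of side
  2^(-k) by a multiple of M |Q| 2^(k/2) in \<open>H1\<close>. Against the Sobolev gain 2^(-k) this
  leaves a geometric series of ratio sqrt 2 / 2. No scale above 1 occurs: on a ball of at least the
  critical radius the size condition of an atom already implies its mean condition.\<close>

lemma ex_borel_representative:
  fixes f :: "'a::euclidean_space \<Rightarrow> 'b::euclidean_space"
  assumes f: "f \<in> borel_measurable lebesgue"
  shows "\<exists>f'\<in>borel_measurable borel. AE x in lborel. f x = f' x"
proof -
  have "\<exists>g\<in>borel_measurable lborel. AE x in lborel. f x \<bullet> i = g x" if "i \<in> Basis" for i
  proof -
    have "(\<lambda>x. f x \<bullet> i) \<in> borel_measurable lebesgue" using f by simp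
    then show ?thesis by (rule completion_ex_borel_measurable_real)
  qed
  then obtain g where g: "\<And>i. i \<in> Basis \<Longrightarrow> g i \<in> borel_measurable lborel"
     "\<And>i. i \<in> Basis \<Longrightarrow> AE x in lborel. f x \<bullet> i = g i x" by metis
  have "AE x in lborel. \<forall>i\<in>Basis. f x \<bullet> i = g i x"
    using g(2) by (intro AE_finite_allI) auto
  then have "AE x in lborel. f x = (\<Sum>i\<in>Basis. g i x *\<^sub>R i)"
  proof eventually_elim
    case (elim x)
    then have "(\<Sum>i\<in>Basis. g i x *\<^sub>R i) = (\<Sum>i\<in>Basis. (f x \<bullet> i) *\<^sub>R i)" by (intro sum.cong) auto
    then show ?case by (simp add: euclidean_representation)
  qed
  moreover have "(\<lambda>x. \<Sum>i\<in>Basis. g i x *\<^sub>R i) \<in> borel_measurable borel"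
  proof (rule borel_measurable_sum)
    fix i :: 'b assume "i \<in> Basis"
    then have [measurable]: "g i \<in> borel_measurable borel" using g(1) by simp
    show "(\<lambda>x. g i x *\<^sub>R i) \<in> borel_measurable borel" by measurable
  qed
  ultimately show ?thesis by (intro bexI)
qed

lemma nn_integral_lborel_affine:
  fixes t :: "'a::euclidean_space"
  assumes c: "c \<noteq> 0" and [measurable]: "F \<in> borel_measurable borel"
  shows "(\<integral>\<^sup>+x. F x \<partial>lborel) = ennreal (\<bar>c\<bar>^DIM('a)) * (\<integral>\<^sup>+x. F (t + c *\<^sub>R x) \<partial>lborel)"
  by (subst lborel_affine[OF c, of t])
     (simp add: nn_integral_density nn_integral_distr nn_integral_cmult)

lemma nn_integral_lborel_translate:
  fixes t :: "'a::euclidean_space"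
  assumes "F \<in> borel_measurable borel"
  shows "(\<integral>\<^sup>+x. F (t + x) \<partial>lborel) = (\<integral>\<^sup>+x. F x \<partial>lborel)"
  using nn_integral_lborel_affine[of 1 F t] assms by simp

lemma nn_integral_lborel_reflect:
  fixes t :: "'a::euclidean_space"
  assumes "F \<in> borel_measurable borel"
  shows "(\<integral>\<^sup>+x. F (t - x) \<partial>lborel) = (\<integral>\<^sup>+x. F x \<partial>lborel)"
  using nn_integral_lborel_affine[of "-1" F t] assms by simp

lemma integral_lborel_affine:
  fixes t :: "'a::euclidean_space" and F :: "'a \<Rightarrow> 'b::{banach, second_countable_topology}"
  assumes c: "c \<noteq> 0" and [measurable]: "F \<in> borel_measurable borel"
  shows "(LINT x|lborel. F x) = (\<bar>c\<bar>^DIM('a)) *\<^sub>R (LINT x|lborel. F (t + c *\<^sub>R x))"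
  by (subst lborel_affine[OF c, of t])
     (simp add: integral_density integral_distr)

lemma integrable_lborel_affine:
  fixes t :: "'a::euclidean_space" and F :: "'a \<Rightarrow> 'b::{banach, second_countable_topology}"
  assumes c: "c \<noteq> 0" and "integrable lborel F"
  shows "integrable lborel (\<lambda>x. F (t + c *\<^sub>R x))"
proof -
  have [measurable]: "F \<in> borel_measurable borel" using assms by auto
  have "integrable (density (distr lborel borel (\<lambda>x. t + c *\<^sub>R x)) (\<lambda>_. ennreal (\<bar>c\<bar>^DIM('a)))) F"
    using assms lborel_affine[OF c, of t] by simp
  then have "integrable lborel (\<lambda>x. (\<bar>c\<bar>^DIM('a)) *\<^sub>R F (t + c *\<^sub>R x))"
    by (simp add: integrable_density integrable_distr_eq)
  then have "integrable lborel (\<lambda>x. (1 / \<bar>c\<bar>^DIM('a)) *\<^sub>R ((\<bar>c\<bar>^DIM('a)) *\<^sub>R F (t + c *\<^sub>R x)))"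
    by (rule integrable_scaleR_right)
  then show ?thesis using c by simp
qed

lemma L1_norm_lborel: "L1_norm f = (\<integral>\<^sup>+x. ennreal (norm (f x)) \<partial>lborel)"
  by (simp add: L1_norm_def nn_integral_completion)

lemma loc_integrable_measurable:
  assumes "loc_integrable (f :: real^'n \<Rightarrow> 'k::{real_normed_field,euclidean_space})"
  shows "f \<in> borel_measurable lebesgue"
proof (rule borel_measurable_LIMSEQ_metric)
  fix i :: nat
  have "set_integrable lebesgue (cball 0 (real i)) f"
    using assms by (auto simp: loc_integrable_def)
  then show "(\<lambda>x. indicator (cball 0 (real i)) x *\<^sub>R f x) \<in> borel_measurable lebesgue"
    unfolding set_integrable_def by auto
next
  fix x :: "real^'n"
  have "eventually (\<lambda>i. norm x \<le> real i) sequentially"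
    using eventually_ge_at_top[of "nat \<lceil>norm x\<rceil>"] by eventually_elim linarith
  then have "eventually (\<lambda>i. indicator (cball 0 (real i)) x *\<^sub>R f x = f x) sequentially"
    by eventually_elim auto
  then show "(\<lambda>i. indicator (cball 0 (real i)) x *\<^sub>R f x) \<longlonglongrightarrow> f x"
    by (rule tendsto_eventually)
qed

lemma integrable_imp_loc_integrable:
  assumes "integrable lebesgue (f :: real^'n \<Rightarrow> 'k::{real_normed_field,euclidean_space})"
  shows "loc_integrable f"
  unfolding loc_integrable_def set_integrable_def
  using assms by (auto intro!: integrable_mult_indicator dest: lmeasurable_compact)

text \<open>Riesz-Fischer: along a subsequence with increments at most 2^(-k) the series of absolute
  increments is integrable, hence finite almost everywhere, and Fatou's lemma turns pointwise
  convergence into a rate for the full sequence. It supplies the limit of |[b,T] w| along the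
  cutoffs w of a function.\<close>

lemma L1_complete:
  fixes u :: "nat \<Rightarrow> 'a \<Rightarrow> real"
  assumes int: "\<And>n. integrable M (u n)"
    and cauchy: "\<And>e. e > 0 \<Longrightarrow> \<exists>N. \<forall>m\<ge>N. \<forall>n\<ge>N. (\<integral>\<^sup>+x. ennreal \<bar>u m x - u n x\<bar> \<partial>M) < ennreal e"
  shows "\<exists>v. integrable M v \<and> (\<lambda>n. \<integral>\<^sup>+x. ennreal \<bar>u n x - v x\<bar> \<partial>M) \<longlonglongrightarrow> 0"
proof -
  have [measurable]: "u n \<in> borel_measurable M" for n using int by auto
  have "\<forall>k. \<exists>N. \<forall>m\<ge>N. \<forall>n\<ge>N. (\<integral>\<^sup>+x. ennreal \<bar>u m x - u n x\<bar> \<partial>M) < ennreal ((1/2)^k)"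
    using cauchy by simp
  then obtain N where N: "\<And>k m n. m \<ge> N k \<Longrightarrow> n \<ge> N k \<Longrightarrow>
     (\<integral>\<^sup>+x. ennreal \<bar>u m x - u n x\<bar> \<partial>M) < ennreal ((1/2)^k)" by metis
  \<comment> \<open>Partial sums of \<open>N\<close> dominate \<open>N\<close> and are
    nondecreasing, which gives a monotone choice of indices without maxima.\<close>
  define r where "r = (\<lambda>k. \<Sum>i\<le>k. N i)"
  have r: "r k \<ge> N k" for k unfolding r_def by (rule member_le_sum) auto
  have rm: "r k \<le> r (Suc k)" for k unfolding r_def by simp
  have step: "(\<integral>\<^sup>+x. ennreal \<bar>u (r (Suc k)) x - u (r k) x\<bar> \<partial>M) \<le> ennreal ((1/2)^k)" for k
    using N[of k "r (Suc k)" "r k"] r[of k] rm[of k] by simp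
  have "(\<integral>\<^sup>+x. (\<Sum>k. ennreal \<bar>u (r (Suc k)) x - u (r k) x\<bar>) \<partial>M)
      = (\<Sum>k. \<integral>\<^sup>+x. ennreal \<bar>u (r (Suc k)) x - u (r k) x\<bar> \<partial>M)"
    by (rule nn_integral_suminf) auto
  also have "\<dots> \<le> (\<Sum>k. ennreal ((1/2)^k))" by (intro suminf_le step) auto
  also have "\<dots> = ennreal 2" by (subst suminf_ennreal2) (auto simp: suminf_geometric)
  also have "\<dots> < top" by simp
  finally have fin: "(\<integral>\<^sup>+x. (\<Sum>k. ennreal \<bar>u (r (Suc k)) x - u (r k) x\<bar>) \<partial>M) \<noteq> \<infinity>"
    by simp
  have "AE x in M. (\<Sum>k. ennreal \<bar>u (r (Suc k)) x - u (r k) x\<bar>) \<noteq> \<infinity>"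
    by (rule nn_integral_PInf_AE[OF _ fin]) measurable
  then have conv: "AE x in M. convergent (\<lambda>k. u (r k) x)"
  proof eventually_elim
    case (elim x)
    then have "summable (\<lambda>k. \<bar>u (r (Suc k)) x - u (r k) x\<bar>)"
      unfolding infinity_ennreal_def by (intro summable_suminf_not_top abs_ge_zero)
    then have "summable (\<lambda>k. u (r (Suc k)) x - u (r k) x)" by (rule summable_rabs_cancel)
    then have "convergent (\<lambda>n. \<Sum>k<n. u (r (Suc k)) x - u (r k) x)"
      by (simp add: summable_iff_convergent)
    then have "convergent (\<lambda>n. (u (r n) x - u (r 0) x) + u (r 0) x)"
      by (intro convergent_add convergent_const) (subst (asm) sum_lessThan_telescope)
    then show ?case by simp
  qed
  define v where "v = (\<lambda>x. lim (\<lambda>k. u (r k) x))"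
  have [measurable]: "v \<in> borel_measurable M" unfolding v_def by (rule borel_measurable_lim_metric) auto
  have lim: "AE x in M. (\<lambda>k. u (r k) x) \<longlonglongrightarrow> v x"
    using conv unfolding v_def by eventually_elim (simp add: convergent_LIMSEQ_iff)
  have bound: "(\<integral>\<^sup>+x. ennreal \<bar>u n x - v x\<bar> \<partial>M) \<le> ennreal ((1/2)^k)" if n: "n \<ge> N k" for n k
  proof -
    have "(\<integral>\<^sup>+x. ennreal \<bar>u n x - v x\<bar> \<partial>M) = (\<integral>\<^sup>+x. liminf (\<lambda>j. ennreal \<bar>u n x - u (r j) x\<bar>) \<partial>M)"
      using lim by (intro nn_integral_cong_AE) (auto elim!: eventually_mono intro!: lim_imp_Liminf[symmetric] tendsto_intros)
    also have "\<dots> \<le> liminf (\<lambda>j. \<integral>\<^sup>+x. ennreal \<bar>u n x - u (r j) x\<bar> \<partial>M)"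
      by (rule nn_integral_liminf) auto
    also have "\<dots> \<le> ennreal ((1/2)^k)"
    proof (rule Liminf_le)
      have "eventually (\<lambda>j. j \<ge> k) sequentially" by (rule eventually_ge_at_top)
      then show "\<forall>\<^sub>F j in sequentially. (\<integral>\<^sup>+x. ennreal \<bar>u n x - u (r j) x\<bar> \<partial>M) \<le> ennreal ((1/2)^k)"
      proof eventually_elim
        case (elim j)
        have "r k \<le> r j" using elim rm by (rule lift_Suc_mono_le[rotated])
        then show ?case using N[of k n "r j"] n r[of k] by simp
      qed
    qed simp
    finally show ?thesis .
  qed
  have "integrable M v"
  proof -
    have "integrable M (\<lambda>x. u (N 0) x - v x)"
      using bound[of 0 "N 0"] by (intro integrableI_bounded) (auto intro: le_less_trans)
    then have "integrable M (\<lambda>x. u (N 0) x - (u (N 0) x - v x))" by (rule Bochner_Integration.integrable_diff[OF int])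
    then show ?thesis by simp
  qed
  moreover have "(\<lambda>n. \<integral>\<^sup>+x. ennreal \<bar>u n x - v x\<bar> \<partial>M) \<longlonglongrightarrow> 0"
  proof (rule tendsto_0_if_Limsup_eq_0_ennreal)
    have "limsup (\<lambda>n. \<integral>\<^sup>+x. ennreal \<bar>u n x - v x\<bar> \<partial>M) \<le> ennreal ((1/2)^k)" for k
    proof (rule Limsup_bounded)
      show "\<forall>\<^sub>F n in sequentially. (\<integral>\<^sup>+x. ennreal \<bar>u n x - v x\<bar> \<partial>M) \<le> ennreal ((1/2)^k)"
        using eventually_ge_at_top[of "N k"] by eventually_elim (rule bound)
    qed
    moreover have "(\<lambda>k. ennreal ((1/2)^k)) \<longlonglongrightarrow> ennreal 0"
      by (intro tendsto_ennrealI LIMSEQ_power_zero) auto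
    ultimately have "limsup (\<lambda>n. \<integral>\<^sup>+x. ennreal \<bar>u n x - v x\<bar> \<partial>M) \<le> 0"
      by (intro LIMSEQ_le_const[of "\<lambda>k. ennreal ((1/2)^k)"]) auto
    then show "limsup (\<lambda>n. \<integral>\<^sup>+x. ennreal \<bar>u n x - v x\<bar> \<partial>M) = 0" by simp
  qed
  ultimately show ?thesis by blast
qed

section \<open>Smooth functions\<close>

lemma smooth_differentiable: "smooth u \<Longrightarrow> u differentiable (at x)"
  by (auto elim: smooth.cases)

lemma smooth_partial: "smooth u \<Longrightarrow> smooth (partial i u)"
  by (auto elim: smooth.cases)

lemma smooth_continuous: "smooth u \<Longrightarrow> continuous_on S u"
  by (meson continuous_at_imp_continuous_on differentiable_imp_continuous_within smooth_differentiable)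

text \<open>For s > 0 this is exp(-1/s) s^(-m). The exponent \<open>m\<close> is there because
  differentiation maps the family into its own span: the derivative of \<open>flat m\<close> is a
  combination of \<open>flat (m + 2)\<close> and \<open>flat (m + 1)\<close>.\<close>

definition flat :: "nat \<Rightarrow> real \<Rightarrow> real" where
  "flat m s = (if s > 0 then exp (- (1 / s)) * (1 / s) ^ m else 0)"

lemma power_div_fact_le_exp:
  assumes "(x::real) \<ge> 0" shows "x ^ n / fact n \<le> exp x"
proof -
  have "(\<Sum>k\<in>{n}. x ^ k /\<^sub>R fact k) \<le> (\<Sum>k. x ^ k /\<^sub>R fact k)"
    using assms by (intro sum_le_suminf summable_exp_generic) auto
  then show ?thesis by (simp add: exp_def divide_inverse mult.commute)
qed

lemma flat_nonneg: "flat m s \<ge> 0"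
  by (simp add: flat_def)

text \<open>A single term, of order m + 2, of the exponential series gives quadratic vanishing at 0;
  this makes the difference quotient at the gluing point tend to 0.\<close>

lemma flat_le: "flat m s \<le> fact (m + 2) * s\<^sup>2"
proof (cases "s > 0")
  case True
  have gen: "exp (- x) * a \<le> F" if "a / F \<le> exp x" "F > 0" for a F x :: real
    using that by (simp add: exp_minus field_simps)
  have "(1/s) ^ (m+2) / fact (m+2) \<le> exp (1/s)"
    using True by (intro power_div_fact_le_exp) auto
  then have "exp (- (1/s)) * (1/s) ^ (m+2) \<le> fact (m+2)"
    by (rule gen) (rule fact_gt_zero)
  then have "exp (- (1/s)) * (1/s) ^ (m+2) * s\<^sup>2 \<le> fact (m+2) * s\<^sup>2"
    by (rule mult_right_mono) simp
  moreover have "flat m s = exp (- (1/s)) * (1/s) ^ (m+2) * s\<^sup>2"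
    using True by (simp add: flat_def power_add power2_eq_square)
  ultimately show ?thesis by simp
qed (simp add: flat_def)

lemma flat_deriv: "(flat m has_real_derivative (flat (m + 2) s - real m * flat (m + 1) s)) (at s)"
proof -
  consider "s > 0" | "s < 0" | "s = 0" by linarith
  then show ?thesis
  proof cases
    case 1
    have 1: "((\<lambda>s. exp (- (1 / s))) has_real_derivative exp (- (1 / s)) * (1 / s)\<^sup>2) (at s)"
      using 1 by (auto intro!: derivative_eq_intros simp: power2_eq_square)
    have 2: "((\<lambda>s. (1 / s) ^ m) has_real_derivative - (real m * (1 / s) ^ (m + 1))) (at s)"
    proof -
      have "((\<lambda>s::real. 1 / s) has_real_derivative - (1 / s)\<^sup>2) (at s)"
        using \<open>s > 0\<close> by (auto intro!: derivative_eq_intros simp: power2_eq_square)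
      from DERIV_power[OF this, of m] show ?thesis
        by (cases m) (auto simp: power2_eq_square mult_ac)
    qed
    have "((\<lambda>s. exp (- (1 / s)) * (1 / s) ^ m) has_real_derivative (flat (m + 2) s - real m * flat (m + 1) s)) (at s)"
      by (rule DERIV_cong[OF DERIV_mult[OF 1 2]])
         (use \<open>s > 0\<close> in \<open>simp add: flat_def power_add power2_eq_square algebra_simps\<close>)
    then show ?thesis
      by (rule has_field_derivative_transform_within_open[of _ _ _ "{0<..}"]) (use \<open>s > 0\<close> in \<open>auto simp: flat_def\<close>)
  next
    case 2
    have "((\<lambda>s. 0) has_real_derivative (flat (m + 2) s - real m * flat (m + 1) s)) (at s)"
      using 2 by (simp add: flat_def)
    then show ?thesis
      by (rule has_field_derivative_transform_within_open[of _ _ _ "{..<0}"]) (use 2 in \<open>auto simp: flat_def\<close>)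
  next
    case 3
    have "((\<lambda>h. flat m h / h) \<longlongrightarrow> 0) (at 0)"
    proof (rule Lim_null_comparison)
      show "\<forall>\<^sub>F h in at 0. norm (flat m h / h) \<le> fact (m + 2) * \<bar>h\<bar>"
      proof (rule always_eventually, rule allI)
        fix h :: real
        show "norm (flat m h / h) \<le> fact (m + 2) * \<bar>h\<bar>" using flat_le[of m h] flat_nonneg[of m h]
          by (cases "h = 0") (simp_all add: divide_le_eq power2_eq_square mult.assoc del: fact_Suc)
      qed
      show "((\<lambda>h. fact (m + 2) * \<bar>h\<bar>) \<longlongrightarrow> (0::real)) (at 0)"
        by (auto intro!: tendsto_eq_intros)
    qed
    then show ?thesis using 3 by (simp add: DERIV_def flat_def)
  qed
qed

text \<open>\<open>smooth\<close> is coinductive, so a proof of smoothness needs a class of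
  differentiable functions whose partial derivatives stay in the class. This algebra is such an
  invariant. It contains what is used to build cutoffs, and the clause \<open>affine\<close> imports
  every smooth function, so that products and rescalings of smooth functions are covered by the same
  invariant.\<close>

inductive smooth_alg :: "(real^'n \<Rightarrow> real) \<Rightarrow> bool" where
  affine: "smooth u \<Longrightarrow> smooth_alg (\<lambda>x. u (a + c *\<^sub>R x))"
| const: "smooth_alg (\<lambda>x. c)"
| coord: "smooth_alg (\<lambda>x. x $ i)"
| flat: "smooth_alg (\<lambda>x. flat m (1 - x \<bullet> x))"
| add: "smooth_alg u \<Longrightarrow> smooth_alg v \<Longrightarrow> smooth_alg (\<lambda>x. u x + v x)"
| mult: "smooth_alg u \<Longrightarrow> smooth_alg v \<Longrightarrow> smooth_alg (\<lambda>x. u x * v x)"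

lemma partial_frechet:
  assumes "u differentiable (at x)"
  shows "(u has_derivative frechet_derivative u (at x)) (at x)"
  using assms by (simp add: frechet_derivative_works)

text \<open>Every generator differentiates into the algebra: \<open>affine\<close> through the chain
  rule, \<open>flat\<close> because its family is closed under differentiation and the inner
  derivative is -2 times a coordinate.\<close>

lemma smooth_alg_step:
  "smooth_alg u \<Longrightarrow> (\<forall>x. u differentiable (at x)) \<and> (\<forall>i. smooth_alg (partial i u))"
proof (induction rule: smooth_alg.induct)
  case (affine u a c)
  have der: "((\<lambda>x. u (a + c *\<^sub>R x)) has_derivative (\<lambda>h. frechet_derivative u (at (a + c *\<^sub>R x)) (c *\<^sub>R h))) (at x)" for x
    by (rule has_derivative_compose[of "\<lambda>x. a + c *\<^sub>R x" "\<lambda>h. c *\<^sub>R h" x UNIV u])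
       (auto intro!: derivative_eq_intros partial_frechet smooth_differentiable affine)
  have "partial i (\<lambda>x. u (a + c *\<^sub>R x)) = (\<lambda>x. c * partial i u (a + c *\<^sub>R x))" for i
  proof
    fix x
    have "linear (frechet_derivative u (at (a + c *\<^sub>R x)))"
      by (rule linear_frechet_derivative[OF smooth_differentiable[OF affine]])
    then show "partial i (\<lambda>x. u (a + c *\<^sub>R x)) x = c * partial i u (a + c *\<^sub>R x)"
      by (simp add: partial_has_derivative[OF der] partial_def linear_cmul)
  qed
  moreover have "smooth_alg (\<lambda>x. c * partial i u (a + c *\<^sub>R x))" for i
    by (intro smooth_alg.intros smooth_partial affine)
  ultimately show ?case using differentiableI[OF der] by simp
next
  case (const c)
  have der: "((\<lambda>x. c) has_derivative (\<lambda>h. 0)) (at x)" for x :: "real^'a" by simp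
  have "partial i (\<lambda>x::real^'a. c) = (\<lambda>x. 0)" for i
    by (rule ext) (simp add: partial_has_derivative[OF der])
  then show ?case by (auto intro!: smooth_alg.intros)
next
  case (coord j)
  have der: "((\<lambda>x::real^'a. x $ j) has_derivative (\<lambda>h. h $ j)) (at x)" for x
    by (rule bounded_linear_imp_has_derivative[OF bounded_linear_vec_nth])
  have "partial i (\<lambda>x::real^'a. x $ j) = (\<lambda>x. axis i 1 $ j)" for i
    by (rule ext) (simp add: partial_has_derivative[OF der])
  then show ?case using differentiableI[OF der] by (simp add: smooth_alg.const)
next
  case (flat m)
  let ?D = "\<lambda>x::real^'a. flat (m + 2) (1 - x \<bullet> x) - real m * flat (m + 1) (1 - x \<bullet> x)"
  have der: "((\<lambda>x::real^'a. flat m (1 - x \<bullet> x)) has_derivative (\<lambda>h. (- 2 * (x \<bullet> h)) * ?D x)) (at x)" for x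
    by (rule DERIV_compose_FDERIV[OF flat_deriv]) (auto intro!: derivative_eq_intros simp: inner_commute)
  have "partial i (\<lambda>x::real^'a. flat m (1 - x \<bullet> x))
     = (\<lambda>x. (- 2 * x $ i) * (flat (m + 2) (1 - x \<bullet> x) + (- real m) * flat (m + 1) (1 - x \<bullet> x)))" for i
    by (rule ext) (simp add: partial_has_derivative[OF der] inner_axis)
  moreover have "smooth_alg (\<lambda>x::real^'a. (- 2 * x $ i) * (flat (m + 2) (1 - x \<bullet> x) + (- real m) * flat (m + 1) (1 - x \<bullet> x)))" for i
    by (intro smooth_alg.intros)
  ultimately show ?case using differentiableI[OF der] by simp
next
  case (add u v)
  have der: "((\<lambda>x. u x + v x) has_derivative (\<lambda>h. frechet_derivative u (at x) h + frechet_derivative v (at x) h)) (at x)" for x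
    using add by (intro derivative_intros partial_frechet) auto
  have "partial i (\<lambda>x. u x + v x) = (\<lambda>x. partial i u x + partial i v x)" for i
    by (rule ext) (simp add: partial_has_derivative[OF der] partial_def)
  then show ?case using add differentiableI[OF der] by (simp add: smooth_alg.add)
next
  case (mult u v)
  have der: "((\<lambda>x. u x * v x) has_derivative (\<lambda>h. u x * frechet_derivative v (at x) h + frechet_derivative u (at x) h * v x)) (at x)" for x
    using mult by (intro has_derivative_mult partial_frechet) auto
  have "partial i (\<lambda>x. u x * v x) = (\<lambda>x. u x * partial i v x + partial i u x * v x)" for i
    by (rule ext) (simp add: partial_has_derivative[OF der] partial_def)
  then show ?case using mult differentiableI[OF der] by (simp add: smooth_alg.add smooth_alg.mult)
qed

lemma smooth_alg_smooth: "smooth_alg u \<Longrightarrow> smooth u"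
proof (coinduction arbitrary: u)
  case smooth
  then show ?case using smooth_alg_step[of u] by auto
qed

lemma smooth_affine: "smooth u \<Longrightarrow> smooth (\<lambda>x. u (a + c *\<^sub>R x))"
  by (drule smooth_alg.affine) (rule smooth_alg_smooth)

lemma smooth_imp_alg:
  assumes "smooth u"
  shows "smooth_alg u"
  using smooth_alg.affine[OF assms, of 0 1] by simp

lemma smooth_mult: "smooth u \<Longrightarrow> smooth v \<Longrightarrow> smooth (\<lambda>x. u x * v x)"
  by (rule smooth_alg_smooth, rule smooth_alg.mult) (auto intro: smooth_imp_alg)

lemma partial_mult:
  assumes "smooth u" "smooth v"
  shows "partial i (\<lambda>x. u x * v x) x = u x * partial i v x + partial i u x * v x"
proof -
  have der: "((\<lambda>x. u x * v x) has_derivative (\<lambda>h. u x * frechet_derivative v (at x) h + frechet_derivative u (at x) h * v x)) (at x)"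
    using assms by (intro has_derivative_mult partial_frechet smooth_differentiable)
  show ?thesis unfolding partial_has_derivative[OF der] by (simp add: partial_def)
qed

lemma partial_affine:
  assumes "smooth u"
  shows "partial i (\<lambda>x. u (a + c *\<^sub>R x)) x = c * partial i u (a + c *\<^sub>R x)"
proof -
  have der: "((\<lambda>x. u (a + c *\<^sub>R x)) has_derivative (\<lambda>h. frechet_derivative u (at (a + c *\<^sub>R x)) (c *\<^sub>R h))) (at x)" for x
    by (rule has_derivative_compose[of "\<lambda>x. a + c *\<^sub>R x" "\<lambda>h. c *\<^sub>R h" x UNIV u])
       (auto intro!: derivative_eq_intros partial_frechet smooth_differentiable assms)
  have "linear (frechet_derivative u (at (a + c *\<^sub>R x)))"
    by (rule linear_frechet_derivative[OF smooth_differentiable[OF assms]])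
  then show ?thesis
    by (simp add: partial_has_derivative[OF der] partial_def linear_cmul)
qed

section \<open>Bump functions and test functions\<close>

definition bump :: "real^'n \<Rightarrow> real" where
  "bump x = flat 0 (1 - x \<bullet> x)"

lemma smooth_bump: "smooth bump"
  unfolding bump_def[abs_def] by (intro smooth_alg_smooth smooth_alg.flat)

lemma bump_nonneg: "bump x \<ge> 0" and bump_le_1: "bump x \<le> 1" and bump_0: "bump 0 > 0"
  by (auto simp: bump_def flat_def)

lemma bump_pos: "norm x < 1 \<Longrightarrow> bump x > 0"
  using abs_square_less_1[of "norm x"] by (simp add: bump_def flat_def power2_norm_eq_inner[symmetric])

lemma bump_outside: "norm x \<ge> 1 \<Longrightarrow> bump x = 0"
  using one_le_power[of "norm x" 2] by (simp add: bump_def flat_def not_less power2_norm_eq_inner[symmetric])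

lemma test_function_bump: "test_function bump"
  unfolding test_function_def
  by (intro conjI smooth_bump exI[of _ "cball 0 1"]) (auto intro!: bump_outside)

lemma test_function_affine:
  assumes "test_function u" "c \<noteq> 0"
  shows "test_function (\<lambda>x. u (a + c *\<^sub>R x))"
proof -
  obtain K where K: "compact K" "\<And>x. x \<notin> K \<Longrightarrow> u x = 0" using assms by (auto simp: test_function_def)
  have "compact ((\<lambda>y. (1/c) *\<^sub>R (y - a)) ` K)"
    by (intro compact_continuous_image continuous_intros K)
  moreover have "u (a + c *\<^sub>R x) = 0" if "x \<notin> (\<lambda>y. (1/c) *\<^sub>R (y - a)) ` K" for x
  proof (rule K(2))
    show "a + c *\<^sub>R x \<notin> K" using that assms(2) by (auto simp: image_iff)
  qed
  ultimately show ?thesis using assms by (auto simp: test_function_def intro!: smooth_affine)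
qed

lemma test_function_mult:
  "test_function u \<Longrightarrow> smooth v \<Longrightarrow> test_function (\<lambda>x. u x * v x)"
  by (auto simp: test_function_def intro!: smooth_mult)

lemma test_function_smooth: "test_function u \<Longrightarrow> smooth u"
  by (simp add: test_function_def)

lemma partial_zero_outside:
  assumes K: "closed K" "\<And>x. x \<notin> K \<Longrightarrow> u x = 0" and x: "x \<notin> K"
  shows "partial i u x = 0"
proof -
  have "(u has_derivative (\<lambda>h. 0)) (at x)"
    by (rule has_derivative_transform_within_open[of "\<lambda>_. 0" _ _ UNIV "- K"]) (use K x in auto)
  then show ?thesis by (simp add: partial_has_derivative)
qed

lemma test_function_partial:
  assumes "test_function u"
  shows "test_function (partial i u)"
  using assms unfolding test_function_def
  by (metis smooth_partial partial_zero_outside compact_imp_closed)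

lemma test_function_bounded:
  assumes "test_function u"
  shows "\<exists>B. \<forall>x. \<bar>u x\<bar> \<le> B"
proof -
  obtain K where K: "compact K" "\<And>x. x \<notin> K \<Longrightarrow> u x = 0" using assms by (auto simp: test_function_def)
  have "compact (u ` K)" by (intro compact_continuous_image K smooth_continuous test_function_smooth assms)
  then have "bounded (u ` K)" by (rule compact_imp_bounded)
  then obtain B where "\<forall>y\<in>u ` K. norm y \<le> B"
    unfolding bounded_iff by blast
  then have B: "\<bar>u x\<bar> \<le> B" if "x \<in> K" for x using that by auto
  have "\<bar>u x\<bar> \<le> max B 0" for x using B[of x] K(2)[of x] by (cases "x \<in> K") auto
  then show ?thesis by blast
qed

lemma frechet_partial:
  assumes "u differentiable (at x)"
  shows "frechet_derivative u (at x) h = (\<Sum>i\<in>UNIV. h $ i * partial i u x)"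
proof -
  have l: "linear (frechet_derivative u (at x))" by (rule linear_frechet_derivative[OF assms])
  have "h = (\<Sum>i\<in>UNIV. h $ i *\<^sub>R axis i 1)"
    by (simp add: vec_eq_iff axis_def if_distrib cong: if_cong)
  then have "frechet_derivative u (at x) h = frechet_derivative u (at x) (\<Sum>i\<in>UNIV. h $ i *\<^sub>R axis i 1)" by simp
  also have "\<dots> = (\<Sum>i\<in>UNIV. h $ i * partial i u x)"
    by (simp add: linear_sum[OF l] linear_cmul[OF l] partial_def)
  finally show ?thesis .
qed

text \<open>Bounded partial derivatives bound the operator norm of the derivative, and the mean
  value inequality applies on the whole space. Dilates of a cutoff thereby have small Lipschitz
  constants.\<close>

lemma test_function_Lipschitz:
  assumes "test_function u"
  shows "\<exists>\<Lambda>\<ge>0. \<forall>x y. \<bar>u x - u y\<bar> \<le> \<Lambda> * norm (x - y)"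
proof -
  have "\<exists>B. \<forall>x. \<bar>partial i u x\<bar> \<le> B" for i
    by (intro test_function_bounded test_function_partial assms)
  then obtain B where B: "\<And>i x. \<bar>partial i u x\<bar> \<le> B i" by metis
  have d: "u differentiable (at x)" for x using assms by (intro smooth_differentiable test_function_smooth)
  have "onorm (frechet_derivative u (at x)) \<le> (\<Sum>i\<in>UNIV. B i)" for x
  proof (rule onorm_le)
    fix h :: "real^'a"
    have "norm (frechet_derivative u (at x) h) \<le> (\<Sum>i\<in>UNIV. \<bar>h $ i * partial i u x\<bar>)"
      unfolding frechet_partial[OF d] by (simp add: sum_abs)
    also have "\<dots> \<le> (\<Sum>i\<in>UNIV. norm h * B i)"
      by (intro sum_mono) (simp add: abs_mult B mult_mono component_le_norm_cart)
    finally show "norm (frechet_derivative u (at x) h) \<le> (\<Sum>i\<in>UNIV. B i) * norm h"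
      by (simp add: sum_distrib_left mult.commute)
  qed
  then have "norm (u x - u y) \<le> (\<Sum>i\<in>UNIV. B i) * norm (x - y)" for x y
    by (intro differentiable_bound[of UNIV u "\<lambda>x. frechet_derivative u (at x)"]) (auto intro: partial_frechet d)
  moreover have "(\<Sum>i\<in>UNIV. B i) \<ge> 0" using B by (intro sum_nonneg) (metis abs_ge_zero order_trans)
  ultimately show ?thesis by auto
qed

lemma test_function_measurable: "test_function u \<Longrightarrow> u \<in> borel_measurable borel"
  by (intro borel_measurable_continuous_onI smooth_continuous test_function_smooth)

lemma test_function_integrable:
  assumes "test_function u"
  shows "integrable lborel u"
proof -
  obtain K where K: "compact K" "\<And>x. x \<notin> K \<Longrightarrow> u x = 0" using assms by (auto simp: test_function_def)
  have "integrable lborel (\<lambda>x. indicator K x *\<^sub>R u x)"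
    using borel_integrable_compact[OF K(1), of u] assms
    by (simp add: smooth_continuous test_function_smooth)
  moreover have "(\<lambda>x. indicator K x *\<^sub>R u x) = u"
    using K(2) by (auto simp: fun_eq_iff indicator_def)
  ultimately show ?thesis by simp
qed

lemma partial_line_derivative:
  assumes "smooth u"
  shows "((\<lambda>s. u (a + s *\<^sub>R axis i 1)) has_real_derivative partial i u (a + s *\<^sub>R axis i 1)) (at s)"
proof -
  have "((\<lambda>s. u (a + s *\<^sub>R axis i 1)) has_derivative
     (\<lambda>h. frechet_derivative u (at (a + s *\<^sub>R axis i 1)) (h *\<^sub>R axis i 1))) (at s)"
    by (rule has_derivative_compose[of "\<lambda>s. a + s *\<^sub>R axis i 1" "\<lambda>h. h *\<^sub>R axis i 1" s UNIV u])
       (auto intro!: derivative_eq_intros partial_frechet smooth_differentiable assms)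
  moreover have "linear (frechet_derivative u (at (a + s *\<^sub>R axis i 1)))"
    by (rule linear_frechet_derivative[OF smooth_differentiable[OF assms]])
  moreover have "(*) (partial i u (a + s *\<^sub>R axis i 1)) = (\<lambda>h. h * partial i u (a + s *\<^sub>R axis i 1))"
    by (simp add: fun_eq_iff mult.commute)
  ultimately show ?thesis
    by (simp add: has_field_derivative_def partial_def linear_cmul)
qed

section \<open>Translations and approximate identities in \<open>L\<^sup>1\<close>\<close>

lemma clamp_norm_le: "M > 0 \<Longrightarrow> norm ((M / max M (norm v)) *\<^sub>R v) \<le> min M (norm (v::'a::real_normed_vector))"
proof -
  assume M: "M > 0"
  have "M * norm v / max M (norm v) \<le> M"
    using M by (simp add: pos_divide_le_eq max_def mult_left_mono)
  moreover have "M * norm v / max M (norm v) \<le> norm v"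
    using M by (simp add: pos_divide_le_eq max_def mult.commute mult_left_mono)
  ultimately show ?thesis using M by simp
qed

definition cutoff :: "real \<Rightarrow> 'a::real_normed_vector \<Rightarrow> real" where
  "cutoff M x = max 0 (min 1 (M + 1 - norm x))"

lemma cutoff_bounds: "0 \<le> cutoff M x" "cutoff M x \<le> 1"
  by (auto simp: cutoff_def)

lemma cutoff_outside: "M + 1 \<le> norm x \<Longrightarrow> cutoff M x = 0"
  by (auto simp: cutoff_def)

lemma cutoff_inside: "norm x \<le> M \<Longrightarrow> cutoff M x = 1"
  by (auto simp: cutoff_def)

lemma continuous_cutoff: "continuous_on UNIV (cutoff M)"
  unfolding cutoff_def by (intro continuous_intros)

text \<open>Truncation in height and in space is done by continuous maps. It is applied to f itself,
  with an error controlled by dominated convergence, and then to continuous functions converging to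
  f almost everywhere. Nothing is known about the size of the latter, but after truncation they are
  uniformly bounded with a common compact support, so dominated convergence applies again.\<close>

lemma L1_dense_continuous:
  fixes f :: "'a::euclidean_space \<Rightarrow> 'b::euclidean_space"
  assumes f: "integrable lborel f" and e: "e > 0"
  shows "\<exists>g R. continuous_on UNIV g \<and> (\<forall>x. R \<le> norm x \<longrightarrow> g x = 0) \<and>
     (\<integral>\<^sup>+x. ennreal (norm (f x - g x)) \<partial>lborel) < ennreal e"
proof -
  have fm[measurable]: "f \<in> borel_measurable borel" using f by auto
  define c where "c = (\<lambda>M (v::'b). (M / max M (norm v)) *\<^sub>R v)"
  have c_le: "norm (c M v) \<le> min M (norm v)" if "M > 0" for M v
    unfolding c_def using that by (rule clamp_norm_le)
  have c_cont: "continuous_on UNIV (c M)" if "M > 0" for M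
    unfolding c_def using that by (intro continuous_intros) auto
  have c_id: "c M v = v" if "norm v \<le> M" "M > 0" for M v
    using that by (simp add: c_def max_def)
  define F where "F = (\<lambda>(n::nat) x. cutoff (real (Suc n)) x *\<^sub>R c (real (Suc n)) (f x))"
  have [measurable]: "cutoff M \<in> borel_measurable borel" for M
    by (intro borel_measurable_continuous_onI continuous_cutoff)
  have [measurable]: "c (real (Suc n)) \<in> borel_measurable borel" for n
    by (intro borel_measurable_continuous_onI c_cont) simp
  have Fm[measurable]: "F n \<in> borel_measurable borel" for n unfolding F_def by measurable
  have finf: "(\<integral>\<^sup>+x. ennreal (norm (f x)) \<partial>lborel) < \<infinity>"
    using f by (simp add: integrable_iff_bounded)
  have "(\<lambda>n. \<integral>\<^sup>+x. ennreal (norm (f x - F n x)) \<partial>lborel) \<longlonglongrightarrow> (\<integral>\<^sup>+x. ennreal 0 \<partial>(lborel :: 'a measure))"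
  proof (rule nn_integral_dominated_convergence[where w = "\<lambda>x. 2 * ennreal (norm (f x))"])
    show "(\<integral>\<^sup>+x. 2 * ennreal (norm (f x)) \<partial>lborel) < \<infinity>"
      using finf by (simp add: nn_integral_cmult ennreal_mult_less_top)
    show "AE x in lborel. ennreal (norm (f x - F n x)) \<le> 2 * ennreal (norm (f x))" for n
    proof (rule AE_I2)
      fix x
      have "norm (F n x) \<le> 1 * norm (f x)"
        unfolding F_def norm_scaleR using c_le[of "real (Suc n)" "f x"] cutoff_bounds[of "real (Suc n)" x]
        by (intro mult_mono) auto
      then have "norm (f x - F n x) \<le> 2 * norm (f x)" using norm_triangle_ineq4[of "f x" "F n x"] by simp
      then show "ennreal (norm (f x - F n x)) \<le> 2 * ennreal (norm (f x))"
        by (metis ennreal_leI ennreal_mult' ennreal_numeral zero_le_numeral)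
    qed
    show "AE x in lborel. (\<lambda>n. ennreal (norm (f x - F n x))) \<longlonglongrightarrow> ennreal 0"
    proof (rule AE_I2)
      fix x
      have "eventually (\<lambda>n. norm x \<le> real (Suc n) \<and> norm (f x) \<le> real (Suc n)) sequentially"
        using eventually_ge_at_top[of "nat \<lceil>max (norm x) (norm (f x))\<rceil>"] by eventually_elim linarith
      then have "eventually (\<lambda>n. ennreal (norm (f x - F n x)) = ennreal 0) sequentially"
        by eventually_elim (simp add: F_def cutoff_inside c_id)
      then show "(\<lambda>n. ennreal (norm (f x - F n x))) \<longlonglongrightarrow> ennreal 0" by (rule tendsto_eventually)
    qed
  qed auto
  then have "(\<lambda>n. \<integral>\<^sup>+x. ennreal (norm (f x - F n x)) \<partial>lborel) \<longlonglongrightarrow> 0" by simp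
  then have "eventually (\<lambda>n. (\<integral>\<^sup>+x. ennreal (norm (f x - F n x)) \<partial>lborel) < ennreal (e/2)) sequentially"
    using e by (intro order_tendstoD(2)) auto
  then obtain n where n: "(\<integral>\<^sup>+x. ennreal (norm (f x - F n x)) \<partial>lborel) < ennreal (e/2)"
    by (auto simp: eventually_sequentially)
  define M where "M = real (Suc n)"
  have M: "M > 0" by (simp add: M_def)
  have "f measurable_on UNIV"
    by (rule lebesgue_measurable_imp_measurable_on) (auto intro: measurable_completion)
  then obtain N g where N: "negligible N" and g: "\<And>n. continuous_on UNIV (g n)"
    and lim: "\<And>x. x \<notin> N \<Longrightarrow> (\<lambda>n. g n x) \<longlonglongrightarrow> f x"
    by (auto simp: measurable_on_def)
  define G where "G = (\<lambda>(m::nat) x. cutoff M x *\<^sub>R c M (g m x))"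
  have Gc: "continuous_on UNIV (G m)" for m
  proof -
    have "continuous_on UNIV (\<lambda>x. c M (g m x))"
      using continuous_on_compose2[OF c_cont[OF M] g] by auto
    then show ?thesis unfolding G_def by (intro continuous_intros continuous_cutoff)
  qed
  have [measurable]: "G m \<in> borel_measurable borel" for m
    by (intro borel_measurable_continuous_onI Gc)
  have AEN: "AE x in lborel. x \<notin> N"
    using N unfolding negligible_iff_null_sets
    by (subst AE_completion_iff[symmetric]) (auto intro: AE_not_in)
  have "(\<lambda>m. \<integral>\<^sup>+x. ennreal (norm (F n x - G m x)) \<partial>lborel) \<longlonglongrightarrow> (\<integral>\<^sup>+x. ennreal 0 \<partial>(lborel :: 'a measure))"
  proof (rule nn_integral_dominated_convergence[where w = "\<lambda>x. ennreal (2 * M) * indicator (cball (0::'a) (M + 1)) x"])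
    show "(\<integral>\<^sup>+x. ennreal (2 * M) * indicator (cball (0::'a) (M + 1)) x \<partial>lborel) < \<infinity>"
      using M by (simp add: nn_integral_cmult_indicator emeasure_cball ennreal_mult_less_top)
    show "AE x in lborel. ennreal (norm (F n x - G m x)) \<le> ennreal (2 * M) * indicator (cball (0::'a) (M + 1)) x" for m
    proof (rule AE_I2)
      fix x
      show "ennreal (norm (F n x - G m x)) \<le> ennreal (2 * M) * indicator (cball (0::'a) (M + 1)) x"
      proof (cases "norm x \<le> M + 1")
        case True
        have "norm (F n x) \<le> 1 * M"
          unfolding F_def norm_scaleR M_def[symmetric] using c_le[OF M, of "f x"] cutoff_bounds[of M x]
          by (intro mult_mono) auto
        moreover have "norm (G m x) \<le> 1 * M"
          unfolding G_def norm_scaleR using c_le[OF M, of "g m x"] cutoff_bounds[of M x]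
          by (intro mult_mono) auto
        ultimately have "norm (F n x - G m x) \<le> 2 * M" using norm_triangle_ineq4[of "F n x" "G m x"] by simp
        then show ?thesis using True by (auto intro: ennreal_leI)
      next
        case False
        then have "cutoff M x = 0" by (intro cutoff_outside) simp
        then show ?thesis unfolding F_def G_def M_def[symmetric] by simp
      qed
    qed
    show "AE x in lborel. (\<lambda>m. ennreal (norm (F n x - G m x))) \<longlonglongrightarrow> ennreal 0"
      using AEN
    proof eventually_elim
      case (elim x)
      have "isCont (c M) (f x)" using c_cont[OF M] by (simp add: continuous_on_eq_continuous_at)
      then have "(\<lambda>m. c M (g m x)) \<longlonglongrightarrow> c M (f x)" using lim[OF elim] by (rule isCont_tendsto_compose)
      then have "(\<lambda>m. norm (F n x - G m x)) \<longlonglongrightarrow> norm (F n x - cutoff M x *\<^sub>R c M (f x))"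
        unfolding G_def by (intro tendsto_intros)
      then show ?case by (intro tendsto_ennrealI) (simp add: F_def M_def)
    qed
    show "(\<lambda>x. ennreal (2 * M) * indicator (cball (0::'a) (M + 1)) x) \<in> borel_measurable lborel"
      by (intro borel_measurable_times_ennreal borel_measurable_const borel_measurable_indicator) simp
  qed auto
  then have "(\<lambda>m. \<integral>\<^sup>+x. ennreal (norm (F n x - G m x)) \<partial>lborel) \<longlonglongrightarrow> 0" by simp
  then have "eventually (\<lambda>m. (\<integral>\<^sup>+x. ennreal (norm (F n x - G m x)) \<partial>lborel) < ennreal (e/2)) sequentially"
    using e by (intro order_tendstoD(2)) auto
  then obtain m where m: "(\<integral>\<^sup>+x. ennreal (norm (F n x - G m x)) \<partial>lborel) < ennreal (e/2)"
    by (auto simp: eventually_sequentially)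
  have "(\<integral>\<^sup>+x. ennreal (norm (f x - G m x)) \<partial>lborel)
     \<le> (\<integral>\<^sup>+x. ennreal (norm (f x - F n x)) + ennreal (norm (F n x - G m x)) \<partial>lborel)"
    by (intro nn_integral_mono) (auto simp flip: ennreal_plus intro!: ennreal_leI norm_diff_triangle_ineq order_trans[OF _ norm_triangle_ineq])
  also have "\<dots> = (\<integral>\<^sup>+x. ennreal (norm (f x - F n x)) \<partial>lborel) + (\<integral>\<^sup>+x. ennreal (norm (F n x - G m x)) \<partial>lborel)"
    by (intro nn_integral_add) auto
  also have "\<dots> < ennreal (e/2) + ennreal (e/2)" using n m by (rule add_strict_mono)
  also have "\<dots> = ennreal e" using e by (simp flip: ennreal_plus)
  finally have "(\<integral>\<^sup>+x. ennreal (norm (f x - G m x)) \<partial>lborel) < ennreal e" .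
  moreover have "\<forall>x. M + 1 \<le> norm x \<longrightarrow> G m x = 0" by (auto simp: G_def cutoff_outside)
  ultimately show ?thesis using Gc by blast
qed

text \<open>The \<open>L1\<close> modulus of continuity. The gradient enters the Haar estimates only
  through a linear bound for this quantity.\<close>

definition shift_norm :: "('a::euclidean_space \<Rightarrow> 'b::euclidean_space) \<Rightarrow> 'a \<Rightarrow> ennreal" where
  "shift_norm f h = (\<integral>\<^sup>+x. ennreal (norm (f (x + h) - f x)) \<partial>lborel)"

lemma shift_norm_triangle:
  assumes [measurable]: "f \<in> borel_measurable borel" "g \<in> borel_measurable borel"
  shows "shift_norm f h \<le> shift_norm g h + 2 * (\<integral>\<^sup>+x. ennreal (norm (f x - g x)) \<partial>lborel)"
proof -
  have "shift_norm f h \<le> (\<integral>\<^sup>+x. ennreal (norm (g (x + h) - g x)) +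
     (ennreal (norm (f (h + x) - g (h + x))) + ennreal (norm (f x - g x))) \<partial>lborel)"
    unfolding shift_norm_def
  proof (rule nn_integral_mono)
    fix x
    have "f (x + h) - f x = (g (x + h) - g x) + ((f (h + x) - g (h + x)) - (f x - g x))" by (simp add: add.commute)
    then have "norm (f (x + h) - f x) \<le> norm (g (x + h) - g x) + (norm (f (h + x) - g (h + x)) + norm (f x - g x))"
      by (metis (no_types) order_trans[OF norm_triangle_ineq add_left_mono[OF norm_triangle_ineq4]])
    then show "ennreal (norm (f (x + h) - f x)) \<le> ennreal (norm (g (x + h) - g x)) +
     (ennreal (norm (f (h + x) - g (h + x))) + ennreal (norm (f x - g x)))"
      by (simp flip: ennreal_plus)
  qed
  also have "\<dots> = shift_norm g h + ((\<integral>\<^sup>+x. ennreal (norm (f (h + x) - g (h + x))) \<partial>lborel) + (\<integral>\<^sup>+x. ennreal (norm (f x - g x)) \<partial>lborel))"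
    unfolding shift_norm_def by (simp add: nn_integral_add)
  also have "(\<integral>\<^sup>+x. ennreal (norm (f (h + x) - g (h + x))) \<partial>lborel) = (\<integral>\<^sup>+x. ennreal (norm (f x - g x)) \<partial>lborel)"
    by (rule nn_integral_lborel_translate) measurable
  finally show ?thesis by (simp add: mult_2)
qed

lemma shift_norm_le:
  assumes [measurable]: "f \<in> borel_measurable borel"
  shows "shift_norm f h \<le> 2 * (\<integral>\<^sup>+x. ennreal (norm (f x)) \<partial>lborel)"
  using shift_norm_triangle[of f "\<lambda>_. 0" h] by (simp add: shift_norm_def)

text \<open>Uniform continuity settles the case of a compactly supported continuous function;
  density and translation invariance transfer it to f.\<close>

lemma shift_norm_small:
  fixes f :: "'a::euclidean_space \<Rightarrow> 'b::euclidean_space"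
  assumes f: "integrable lborel f" and e: "e > 0"
  shows "\<exists>\<delta>>0. \<forall>h. norm h < \<delta> \<longrightarrow> shift_norm f h < ennreal e"
proof -
  obtain g R where g: "continuous_on UNIV g" "\<And>x. R \<le> norm x \<Longrightarrow> g x = 0"
     and fg: "(\<integral>\<^sup>+x. ennreal (norm (f x - g x)) \<partial>lborel) < ennreal (e/4)"
    using L1_dense_continuous[OF f, of "e/4"] e by auto
  have [measurable]: "g \<in> borel_measurable borel" "f \<in> borel_measurable borel"
    using g f by (auto intro: borel_measurable_continuous_onI)
  define K where "K = cball (0::'a) (\<bar>R\<bar> + 1)"
  have mK: "emeasure lborel K < \<infinity>" unfolding K_def by (simp add: emeasure_cball)
  then obtain m where m: "emeasure lborel K = ennreal m" "m \<ge> 0" by (cases "emeasure lborel K") auto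
  \<comment> \<open>A pointwise error \<eta> on a set of measure m costs at most e/4 in the
    integral; the two approximation errors cost e/4 each.\<close>
  define \<eta> where "\<eta> = e / (4 * (m + 1))"
  have \<eta>: "\<eta> > 0" using e m by (simp add: \<eta>_def)
  have "compact (cball (0::'a) (\<bar>R\<bar> + 2))" by simp
  then have "uniformly_continuous_on (cball (0::'a) (\<bar>R\<bar> + 2)) g"
    using g(1) by (intro compact_uniformly_continuous) (auto intro: continuous_on_subset)
  then obtain d where d: "d > 0" "\<And>x y. x \<in> cball 0 (\<bar>R\<bar> + 2) \<Longrightarrow> y \<in> cball 0 (\<bar>R\<bar> + 2) \<Longrightarrow> dist y x < d \<Longrightarrow> dist (g y) (g x) < \<eta>"
    unfolding uniformly_continuous_on_def using \<eta> by meson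
  define \<delta> where "\<delta> = min d 1"
  have "shift_norm f h < ennreal e" if h: "norm h < \<delta>" for h
  proof -
    have "norm (g (x + h) - g x) \<le> \<eta> * indicator K x" for x
    proof (cases "x \<in> K")
      case True
      then have nx: "norm x \<le> \<bar>R\<bar> + 1" by (simp add: K_def)
      then have "norm (x + h) \<le> \<bar>R\<bar> + 2" using h norm_triangle_ineq[of x h] by (simp add: \<delta>_def)
      then have "dist (g (x + h)) (g x) < \<eta>" using nx h by (intro d(2)) (simp_all add: \<delta>_def dist_norm[of "x + h" x])
      then show ?thesis using True by (simp add: dist_norm)
    next
      case False
      then have "norm x > \<bar>R\<bar> + 1" by (simp add: K_def)
      moreover have "norm x \<le> norm (x + h) + norm h" using norm_triangle_ineq4[of "x + h" h] by simp
      ultimately have "g x = 0" "g (x + h) = 0" using h by (auto intro!: g(2) simp: \<delta>_def)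
      then show ?thesis using False by simp
    qed
    then have "ennreal (norm (g (x + h) - g x)) \<le> ennreal (\<eta> * indicator K x)" for x
      by (rule ennreal_leI)
    moreover have "ennreal (\<eta> * indicator K x) = ennreal \<eta> * indicator K x" for x
      by (simp add: indicator_def)
    ultimately have "ennreal (norm (g (x + h) - g x)) \<le> ennreal \<eta> * indicator K x" for x
      by metis
    then have "shift_norm g h \<le> (\<integral>\<^sup>+x. ennreal \<eta> * indicator K x \<partial>lborel)"
      unfolding shift_norm_def by (intro nn_integral_mono) auto
    also have "\<dots> = ennreal \<eta> * ennreal m" using m by (subst nn_integral_cmult_indicator) (auto simp: K_def)
    also have "\<dots> = ennreal (\<eta> * m)" using \<eta> m by (simp add: ennreal_mult)
    also have "\<dots> \<le> ennreal (e/4)" using e m by (intro ennreal_leI) (simp add: \<eta>_def field_simps)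
    finally have "shift_norm g h \<le> ennreal (e/4)" .
    moreover have "2 * (\<integral>\<^sup>+x. ennreal (norm (f x - g x)) \<partial>lborel) \<le> ennreal (e/4) + ennreal (e/4)"
      using fg by (simp add: mult_2 add_mono less_imp_le)
    ultimately have "shift_norm f h \<le> ennreal (e/4) + (ennreal (e/4) + ennreal (e/4))"
      using shift_norm_triangle[of f g h] by (meson add_mono order_trans \<open>f \<in> _\<close> \<open>g \<in> _\<close>)
    also have "\<dots> < ennreal e" using e by (simp flip: ennreal_plus add: ennreal_less_iff)
    finally show ?thesis .
  qed
  moreover have "\<delta> > 0" using d by (simp add: \<delta>_def)
  ultimately show ?thesis by blast
qed

lemma ennreal_tendsto_0I:
  fixes u :: "'a \<Rightarrow> ennreal"
  assumes "\<And>e::real. e > 0 \<Longrightarrow> eventually (\<lambda>n. u n < ennreal e) F"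
  shows "(u \<longlongrightarrow> 0) F"
proof (rule order_tendstoI)
  fix a :: ennreal assume "0 < a"
  then obtain e where "e > 0" "ennreal e \<le> a"
    by (cases a) (auto intro: that[of 1] simp: top_unique)
  then show "eventually (\<lambda>n. u n < a) F"
    using assms[of e] by (auto elim!: eventually_mono)
qed simp

lemma shift_norm_tendsto:
  fixes f :: "'a::euclidean_space \<Rightarrow> 'b::euclidean_space"
  assumes f: "integrable lborel f" and h: "h \<longlonglongrightarrow> 0"
  shows "(\<lambda>n. shift_norm f (h n)) \<longlonglongrightarrow> 0"
proof (rule ennreal_tendsto_0I)
  fix e :: real assume "e > 0"
  then obtain d where d: "d > 0" "\<And>h. norm h < d \<Longrightarrow> shift_norm f h < ennreal e"
    using shift_norm_small[OF f] by metis
  have "eventually (\<lambda>n. norm (h n) < d) sequentially"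
    using h d(1) tendstoD[of h 0 sequentially d] by simp
  then show "eventually (\<lambda>n. shift_norm f (h n) < ennreal e) sequentially"
    by eventually_elim (rule d(2))
qed

text \<open>Since k has integral 1, the error is the k-average of the differences f(x - \<epsilon>
  u) - f(x). Integration in x bounds it by the k-average of \<open>shift_norm f\<close>, which tends
  to 0 pointwise and is dominated by twice the norm of f. Boundedness of k makes the convolution
  integral converge for every x, not merely for almost every x.\<close>

lemma approx_identity:
  fixes f :: "'a::euclidean_space \<Rightarrow> 'b::euclidean_space" and k :: "'a \<Rightarrow> real"
  assumes f: "integrable lborel f"
    and k[measurable]: "k \<in> borel_measurable borel" and k_bounds: "\<And>u. 0 \<le> k u" "\<And>u. k u \<le> B"
    and k_int: "integrable lborel k" "(LINT u|lborel. k u) = 1"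
    and \<epsilon>: "\<epsilon> \<longlonglongrightarrow> 0" "\<And>m. \<epsilon> m \<noteq> 0"
  shows "(\<lambda>m. \<integral>\<^sup>+x. ennreal (norm ((LINT u|lborel. k u *\<^sub>R f (x - \<epsilon> m *\<^sub>R u)) - f x)) \<partial>lborel) \<longlonglongrightarrow> 0"
proof -
  have [measurable]: "f \<in> borel_measurable borel" using f by auto
  have int: "integrable lborel (\<lambda>u. k u *\<^sub>R f (x - \<epsilon> m *\<^sub>R u))" for x m
  proof (rule Bochner_Integration.integrable_bound)
    have "integrable lborel (\<lambda>u. f (x + (- \<epsilon> m) *\<^sub>R u))"
      using \<epsilon>(2)[of m] by (intro integrable_lborel_affine f) simp
    then show "integrable lborel (\<lambda>u. B *\<^sub>R f (x - \<epsilon> m *\<^sub>R u))" by simp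
    show "AE u in lborel. norm (k u *\<^sub>R f (x - \<epsilon> m *\<^sub>R u)) \<le> norm (B *\<^sub>R f (x - \<epsilon> m *\<^sub>R u))"
    proof (rule AE_I2)
      fix u
      have "\<bar>k u\<bar> \<le> \<bar>B\<bar>" using k_bounds[of u] by simp
      then show "norm (k u *\<^sub>R f (x - \<epsilon> m *\<^sub>R u)) \<le> norm (B *\<^sub>R f (x - \<epsilon> m *\<^sub>R u))"
        by (simp add: mult_right_mono)
    qed
  qed measurable
  have bound: "(\<integral>\<^sup>+x. ennreal (norm ((LINT u|lborel. k u *\<^sub>R f (x - \<epsilon> m *\<^sub>R u)) - f x)) \<partial>lborel)
     \<le> (\<integral>\<^sup>+u. ennreal (k u) * shift_norm f (- (\<epsilon> m *\<^sub>R u)) \<partial>lborel)" for m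
  proof -
    have "ennreal (norm ((LINT u|lborel. k u *\<^sub>R f (x - \<epsilon> m *\<^sub>R u)) - f x))
       \<le> (\<integral>\<^sup>+u. ennreal (k u) * ennreal (norm (f (x + (- (\<epsilon> m *\<^sub>R u))) - f x)) \<partial>lborel)" for x
    proof -
      have "f x = (LINT u|lborel. k u *\<^sub>R f x)" using k_int by simp
      then have "(LINT u|lborel. k u *\<^sub>R f (x - \<epsilon> m *\<^sub>R u)) - f x
         = (LINT u|lborel. k u *\<^sub>R f (x - \<epsilon> m *\<^sub>R u)) - (LINT u|lborel. k u *\<^sub>R f x)" by simp
      also have "\<dots> = (LINT u|lborel. k u *\<^sub>R f (x - \<epsilon> m *\<^sub>R u) - k u *\<^sub>R f x)"
        by (rule Bochner_Integration.integral_diff[symmetric]) (auto intro: int k_int)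
      finally have "ennreal (norm ((LINT u|lborel. k u *\<^sub>R f (x - \<epsilon> m *\<^sub>R u)) - f x))
        \<le> (\<integral>\<^sup>+u. ennreal (norm (k u *\<^sub>R f (x - \<epsilon> m *\<^sub>R u) - k u *\<^sub>R f x)) \<partial>lborel)"
        using integral_norm_bound_ennreal[of lborel "\<lambda>u. k u *\<^sub>R f (x - \<epsilon> m *\<^sub>R u) - k u *\<^sub>R f x"] int[of x m] k_int by simp
      also have "\<dots> = (\<integral>\<^sup>+u. ennreal (k u) * ennreal (norm (f (x + (- (\<epsilon> m *\<^sub>R u))) - f x)) \<partial>lborel)"
        by (intro nn_integral_cong) (simp add: k_bounds ennreal_mult[symmetric] flip: scaleR_diff_right)
      finally show ?thesis .
    qed
    then have "(\<integral>\<^sup>+x. ennreal (norm ((LINT u|lborel. k u *\<^sub>R f (x - \<epsilon> m *\<^sub>R u)) - f x)) \<partial>lborel)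
       \<le> (\<integral>\<^sup>+x. (\<integral>\<^sup>+u. ennreal (k u) * ennreal (norm (f (x + (- (\<epsilon> m *\<^sub>R u))) - f x)) \<partial>lborel) \<partial>lborel)"
      by (intro nn_integral_mono) auto
    also have "\<dots> = (\<integral>\<^sup>+u. (\<integral>\<^sup>+x. ennreal (k u) * ennreal (norm (f (x + (- (\<epsilon> m *\<^sub>R u))) - f x)) \<partial>lborel) \<partial>lborel)"
      by (rule lborel_pair.Fubini') measurable
    also have "\<dots> = (\<integral>\<^sup>+u. ennreal (k u) * shift_norm f (- (\<epsilon> m *\<^sub>R u)) \<partial>lborel)"
      unfolding shift_norm_def by (intro nn_integral_cong nn_integral_cmult) measurable
    finally show ?thesis .
  qed
  define N where "N = (\<integral>\<^sup>+x. ennreal (norm (f x)) \<partial>lborel)"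
  have N: "N < \<infinity>" using f by (simp add: integrable_iff_bounded N_def)
  have [measurable]: "(\<lambda>u. shift_norm f (- (\<epsilon> m *\<^sub>R u))) \<in> borel_measurable borel" for m
    unfolding shift_norm_def by measurable
  have "(\<lambda>m. \<integral>\<^sup>+u. ennreal (k u) * shift_norm f (- (\<epsilon> m *\<^sub>R u)) \<partial>lborel) \<longlonglongrightarrow> (\<integral>\<^sup>+u. 0 \<partial>(lborel :: 'a measure))"
  proof (rule nn_integral_dominated_convergence[where w = "\<lambda>u. ennreal (k u) * (2 * N)"])
    have "(\<integral>\<^sup>+u. ennreal (k u) * (2 * N) \<partial>lborel) = (\<integral>\<^sup>+u. ennreal (k u) \<partial>lborel) * (2 * N)"
      by (rule nn_integral_multc) measurable
    also have "(\<integral>\<^sup>+u. ennreal (k u) \<partial>lborel) = 1"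
      using k_int k_bounds by (simp add: nn_integral_eq_integral)
    finally show "(\<integral>\<^sup>+u. ennreal (k u) * (2 * N) \<partial>lborel) < \<infinity>" using N by (simp add: ennreal_mult_less_top)
    show "AE u in lborel. ennreal (k u) * shift_norm f (- (\<epsilon> m *\<^sub>R u)) \<le> ennreal (k u) * (2 * N)" for m
      unfolding N_def by (intro AE_I2 mult_left_mono shift_norm_le) auto
    show "AE u in lborel. (\<lambda>m. ennreal (k u) * shift_norm f (- (\<epsilon> m *\<^sub>R u))) \<longlonglongrightarrow> 0"
    proof (rule AE_I2)
      fix u :: 'a
      have "(\<lambda>m. - (\<epsilon> m *\<^sub>R u)) \<longlonglongrightarrow> - (0 *\<^sub>R u)" by (intro tendsto_intros \<epsilon>)
      then have "(\<lambda>m. shift_norm f (- (\<epsilon> m *\<^sub>R u))) \<longlonglongrightarrow> 0" by (intro shift_norm_tendsto f) simp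
      then have "(\<lambda>m. ennreal (k u) * shift_norm f (- (\<epsilon> m *\<^sub>R u))) \<longlonglongrightarrow> ennreal (k u) * 0"
        by (intro ennreal_tendsto_cmult) auto
      then show "(\<lambda>m. ennreal (k u) * shift_norm f (- (\<epsilon> m *\<^sub>R u))) \<longlonglongrightarrow> 0" by simp
    qed
  qed auto
  then have lim: "(\<lambda>m. \<integral>\<^sup>+u. ennreal (k u) * shift_norm f (- (\<epsilon> m *\<^sub>R u)) \<partial>lborel) \<longlonglongrightarrow> 0" by simp
  show ?thesis
    by (rule tendsto_sandwich[OF _ _ tendsto_const lim]) (auto intro!: always_eventually bound)
qed

lemma convolution_rescale:
  fixes f :: "'a::euclidean_space \<Rightarrow> 'b::{banach, second_countable_topology}" and k :: "'a \<Rightarrow> real"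
  assumes [measurable]: "f \<in> borel_measurable borel" "k \<in> borel_measurable borel" and c: "c > 0"
  shows "(LINT y|lborel. (c ^ DIM('a) * k (c *\<^sub>R (x - y))) *\<^sub>R f y) = (LINT u|lborel. k u *\<^sub>R f (x - (1/c) *\<^sub>R u))"
proof -
  have "(LINT y|lborel. (c ^ DIM('a) * k (c *\<^sub>R (x - y))) *\<^sub>R f y)
      = (\<bar>- (1/c)\<bar> ^ DIM('a)) *\<^sub>R (LINT u|lborel. (c ^ DIM('a) * k (c *\<^sub>R (x - (x + (- (1/c)) *\<^sub>R u)))) *\<^sub>R f (x + (- (1/c)) *\<^sub>R u))"
    using c by (intro integral_lborel_affine) auto
  also have "\<dots> = (\<bar>- (1/c)\<bar> ^ DIM('a)) *\<^sub>R (LINT u|lborel. c ^ DIM('a) *\<^sub>R (k u *\<^sub>R f (x - (1/c) *\<^sub>R u)))"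
    using c by simp
  also have "\<dots> = (LINT u|lborel. k u *\<^sub>R f (x - (1/c) *\<^sub>R u))"
    unfolding integral_scaleR_right using c by (simp add: power_divide)
  finally show ?thesis .
qed

section \<open>Weak derivatives\<close>

text \<open>\<open>c\<close> is the reciprocal of the radius of the support.\<close>

definition mollifier :: "real \<Rightarrow> real^'n \<Rightarrow> real" where
  "mollifier c z = c ^ CARD('n) * (bump (c *\<^sub>R z) / (LINT u|lborel. bump (u::real^'n)))"

lemma bump_integral_pos: "(LINT u|lborel. bump (u::real^'n)) > 0"
proof -
  have i: "integrable lborel (bump :: real^'n \<Rightarrow> real)" by (intro test_function_integrable test_function_bump)
  have "(LINT u|lborel. bump (u::real^'n)) \<noteq> 0"
  proof
    assume "(LINT u|lborel. bump (u::real^'n)) = 0"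
    then have "AE u::real^'n in lborel. bump u = 0"
      using integral_nonneg_eq_0_iff_AE[OF i] bump_nonneg by auto
    then have "AE u::real^'n in lborel. u \<notin> ball 0 1"
      using bump_pos by (auto elim!: eventually_mono simp: less_le)
    then have "emeasure lborel (ball (0::real^'n) 1) = 0"
      by (subst (asm) AE_iff_measurable[of "ball 0 1"]) auto
    then show False using unit_ball_vol_pos[of "real CARD('n)"] by (simp add: emeasure_ball)
  qed
  moreover have "(LINT u|lborel. bump (u::real^'n)) \<ge> 0"
    by (intro Bochner_Integration.integral_nonneg bump_nonneg)
  ultimately show ?thesis by simp
qed

lemma test_function_mollifier: "c > 0 \<Longrightarrow> test_function (mollifier c)"
proof -
  assume c: "c > 0"
  have "test_function (\<lambda>z::real^'a. bump (0 + c *\<^sub>R z) * (c ^ CARD('a) / (LINT u|lborel. bump (u::real^'a))))"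
    using c by (intro test_function_mult test_function_affine test_function_bump smooth_alg_smooth smooth_alg.const) simp
  then show ?thesis by (simp add: mollifier_def[abs_def] mult.commute)
qed

lemma mollifier_nonneg: "c > 0 \<Longrightarrow> mollifier c z \<ge> 0"
  using bump_integral_pos by (auto simp: mollifier_def bump_nonneg less_imp_le)

lemma mollifier_approx:
  fixes f :: "real^'n \<Rightarrow> 'b::euclidean_space"
  assumes f: "integrable lborel f"
  shows "(\<lambda>m. \<integral>\<^sup>+x. ennreal (norm ((LINT y|lborel. mollifier (real (Suc m)) (x - y) *\<^sub>R f y) - f x)) \<partial>lborel) \<longlonglongrightarrow> 0"
proof -
  let ?I = "LINT u|lborel. bump (u::real^'n)"
  let ?k = "\<lambda>u::real^'n. bump u / ?I"
  have [measurable]: "f \<in> borel_measurable borel" using f by auto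
  have [measurable]: "(bump :: real^'n \<Rightarrow> real) \<in> borel_measurable borel"
    by (intro test_function_measurable test_function_bump)
  have conv: "(LINT y|lborel. mollifier (real (Suc m)) (x - y) *\<^sub>R f y)
     = (LINT u|lborel. ?k u *\<^sub>R f (x - (1 / real (Suc m)) *\<^sub>R u))" for m x
    using convolution_rescale[of f ?k "real (Suc m)" x] by (simp add: mollifier_def)
  show ?thesis unfolding conv
  proof (rule approx_identity[OF f, where B = "1 / ?I"])
    show "(\<lambda>m. 1 / real (Suc m)) \<longlonglongrightarrow> 0" by (rule LIMSEQ_Suc[OF lim_1_over_n])
  qed (use bump_integral_pos[where 'n='n] in \<open>auto simp: bump_nonneg bump_le_1 divide_right_mono test_function_integrable test_function_bump\<close>)
qed

text \<open>A mollification at x is the integral of u against a translated and reflected mollifier,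
  which is again a test function. All mollifications therefore vanish, and they converge to u in
  \<open>L1\<close>.\<close>

lemma zero_if_test_zero:
  fixes u :: "real^'n \<Rightarrow> 'b::euclidean_space"
  assumes u: "integrable lborel u"
    and z: "\<And>\<phi>. test_function \<phi> \<Longrightarrow> (LINT x|lborel. \<phi> x *\<^sub>R u x) = 0"
  shows "AE x in lborel. u x = 0"
proof -
  have [measurable]: "u \<in> borel_measurable borel" using u by auto
  have "(LINT y|lborel. mollifier (real (Suc m)) (x - y) *\<^sub>R u y) = 0" for m x
    using z[OF test_function_affine[OF test_function_mollifier[of "real (Suc m)"], of "-1" x]] by simp
  then have "(\<lambda>m. \<integral>\<^sup>+x. ennreal (norm (0 - u x)) \<partial>lborel) \<longlonglongrightarrow> 0"
    using mollifier_approx[OF u] by simp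
  then have "(\<integral>\<^sup>+x. ennreal (norm (u x)) \<partial>lborel) = 0" by (simp add: LIMSEQ_const_iff)
  then have "AE x in lborel. ennreal (norm (u x)) = 0" by (subst (asm) nn_integral_0_iff_AE) auto
  then show ?thesis by (auto elim!: eventually_mono simp: ennreal_eq_0_iff)
qed

lemma integrable_bounded_scaleR:
  fixes f :: "'a \<Rightarrow> 'b::{banach, second_countable_topology}"
  assumes f: "integrable M f" and [measurable]: "k \<in> borel_measurable M" and k: "\<And>x. \<bar>k x\<bar> \<le> B"
  shows "integrable M (\<lambda>x. k x *\<^sub>R f x)"
proof (rule Bochner_Integration.integrable_bound)
  show "integrable M (\<lambda>x. B *\<^sub>R f x)" using f by simp
  show "(\<lambda>x. k x *\<^sub>R f x) \<in> borel_measurable M" using f by measurable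
  show "AE x in M. norm (k x *\<^sub>R f x) \<le> norm (B *\<^sub>R f x)"
  proof (rule AE_I2)
    fix x
    have "\<bar>k x\<bar> \<le> \<bar>B\<bar>" using k[of x] by simp
    then show "norm (k x *\<^sub>R f x) \<le> norm (B *\<^sub>R f x)" by (simp add: mult_right_mono)
  qed
qed

lemma mollifier_nn_integral:
  assumes c: "c > 0"
  shows "(\<integral>\<^sup>+x. ennreal (mollifier c (x::real^'n)) \<partial>lborel) = 1"
proof -
  let ?I = "LINT u|lborel. bump (u::real^'n)"
  have [measurable]: "(bump :: real^'n \<Rightarrow> real) \<in> borel_measurable borel"
    by (intro test_function_measurable test_function_bump)
  have "(LINT x|lborel. bump (x::real^'n) / ?I) = (\<bar>c\<bar>^DIM(real^'n)) *\<^sub>R (LINT x|lborel. bump (0 + c *\<^sub>R (x::real^'n)) / ?I)"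
    using c by (intro integral_lborel_affine) auto
  moreover have "(LINT x|lborel. bump (x::real^'n) / ?I) = 1"
    using bump_integral_pos[where 'n='n] by simp
  moreover have "(LINT x|lborel. mollifier c (x::real^'n)) = (\<bar>c\<bar>^DIM(real^'n)) *\<^sub>R (LINT x|lborel. bump (0 + c *\<^sub>R (x::real^'n)) / ?I)"
    using c by (simp add: mollifier_def)
  ultimately have "(LINT x|lborel. mollifier c (x::real^'n)) = 1" by metis
  then show ?thesis
    using c by (subst nn_integral_eq_integral) (auto intro!: test_function_integrable test_function_mollifier mollifier_nonneg)
qed

text \<open>Mollification makes the weak derivative classical: F(x + s e) - F(x) is the integral
  over [0, s] of G(x + \<sigma> e), where G is the mollification of g. Integrating in x, and using
  that averaging does not increase the \<open>L1\<close> norm, gives the linear bound with constant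
  exactly s.\<close>

lemma mollify_shift:
  fixes f g :: "real^'n \<Rightarrow> 'b::euclidean_space"
  assumes f: "integrable lborel f" and g: "integrable lborel g"
    and wp: "\<And>\<phi>. test_function \<phi> \<Longrightarrow> (LINT x|lborel. partial j \<phi> x *\<^sub>R f x) = - (LINT x|lborel. \<phi> x *\<^sub>R g x)"
    and s: "s \<ge> 0" and c: "c > 0"
  defines "F \<equiv> \<lambda>x. LINT y|lborel. mollifier c (x - y) *\<^sub>R f y"
  shows "shift_norm F (s *\<^sub>R axis j 1) \<le> ennreal s * (\<integral>\<^sup>+x. ennreal (norm (g x)) \<partial>lborel)"
proof -
  define \<psi> :: "real^'n \<Rightarrow> real" where "\<psi> = mollifier c"
  define D where "D = partial j \<psi>"
  define e :: "real^'n" where "e = axis j 1"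
  have [measurable]: "f \<in> borel_measurable borel" "g \<in> borel_measurable borel" using f g by auto
  have t\<psi>: "test_function \<psi>" unfolding \<psi>_def by (rule test_function_mollifier[OF c])
  have tD: "test_function D" unfolding D_def by (rule test_function_partial[OF t\<psi>])
  have [measurable]: "\<psi> \<in> borel_measurable borel" "D \<in> borel_measurable borel"
    using t\<psi> tD by (auto intro: test_function_measurable)
  obtain B where B: "\<And>x. \<bar>D x\<bar> \<le> B" using test_function_bounded[OF tD] by blast
  obtain B' where B': "\<And>x. \<bar>\<psi> x\<bar> \<le> B'" using test_function_bounded[OF t\<psi>] by blast
  define G where "G = (\<lambda>x. LINT y|lborel. \<psi> (x - y) *\<^sub>R g y)"
  have [measurable]: "G \<in> borel_measurable borel" unfolding G_def by measurable
  \<comment> \<open>Differentiating \<psi>(x - y) in y produces a minus sign, which cancels the one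
    in the definition of the weak derivative.\<close>
  have DG: "(LINT y|lborel. D (x - y) *\<^sub>R f y) = G x" for x
  proof -
    have "(LINT y|lborel. partial j (\<lambda>y. \<psi> (x + (-1) *\<^sub>R y)) y *\<^sub>R f y) = - (LINT y|lborel. \<psi> (x + (-1) *\<^sub>R y) *\<^sub>R g y)"
      by (intro wp test_function_affine t\<psi>) simp
    then show ?thesis
      unfolding partial_affine[OF test_function_smooth[OF t\<psi>]] by (simp add: G_def D_def)
  qed
  have ftc: "(LINT \<sigma>|lborel. D (z + \<sigma> *\<^sub>R e) * indicator {0..s} \<sigma>) = \<psi> (z + s *\<^sub>R e) - \<psi> z" for z
  proof -
    have "(LINT \<sigma>|lborel. D (z + \<sigma> *\<^sub>R e) * indicator {0..s} \<sigma>) = \<psi> (z + s *\<^sub>R e) - \<psi> (z + 0 *\<^sub>R e)"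
    proof (rule integral_FTC_Icc_real[OF s])
      fix \<sigma> :: real
      show "((\<lambda>\<sigma>. \<psi> (z + \<sigma> *\<^sub>R e)) has_real_derivative D (z + \<sigma> *\<^sub>R e)) (at \<sigma>)"
        unfolding D_def e_def by (intro partial_line_derivative test_function_smooth t\<psi>)
      have "continuous_on UNIV (\<lambda>\<sigma>. D (z + \<sigma> *\<^sub>R e))"
        by (rule continuous_on_compose2[OF smooth_continuous[OF test_function_smooth[OF tD], of UNIV]])
           (auto intro!: continuous_intros)
      then show "isCont (\<lambda>\<sigma>. D (z + \<sigma> *\<^sub>R e)) \<sigma>" by (simp add: continuous_on_eq_continuous_at)
    qed
    then show ?thesis by simp
  qed
  have rep: "F (x + s *\<^sub>R e) - F x = (LINT \<sigma>|lborel. indicator {0..s} \<sigma> *\<^sub>R G (x + \<sigma> *\<^sub>R e))" for x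
  proof -
    let ?H = "\<lambda>y \<sigma>. (D (x - y + \<sigma> *\<^sub>R e) * indicator {0..s} \<sigma>) *\<^sub>R f y"
    have "F (x + s *\<^sub>R e) - F x = (LINT y|lborel. \<psi> (x + s *\<^sub>R e - y) *\<^sub>R f y - \<psi> (x - y) *\<^sub>R f y)"
      unfolding F_def \<psi>_def[symmetric]
      by (rule Bochner_Integration.integral_diff[symmetric]; rule integrable_bounded_scaleR[OF f]) (auto intro: B')
    also have "\<dots> = (LINT y|lborel. (LINT \<sigma>|lborel. ?H y \<sigma>))"
    proof (rule Bochner_Integration.integral_cong[OF refl])
      fix y
      have "(LINT \<sigma>|lborel. ?H y \<sigma>) = (LINT \<sigma>|lborel. D (x - y + \<sigma> *\<^sub>R e) * indicator {0..s} \<sigma>) *\<^sub>R f y"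
      proof (rule integral_scaleR_left)
        have "integrable lborel (\<lambda>\<sigma>. D (x - y + \<sigma> *\<^sub>R e) *\<^sub>R (indicator {0..s} \<sigma> :: real))"
          by (rule integrable_bounded_scaleR[OF _ _ B])
             (auto intro!: integrable_real_indicator simp: emeasure_lborel_Icc_eq)
        then show "integrable lborel (\<lambda>\<sigma>. D (x - y + \<sigma> *\<^sub>R e) * indicator {0..s} \<sigma>)" by simp
      qed
      also have "\<dots> = \<psi> (x + s *\<^sub>R e - y) *\<^sub>R f y - \<psi> (x - y) *\<^sub>R f y"
        unfolding ftc by (simp add: algebra_simps)
      finally show "\<psi> (x + s *\<^sub>R e - y) *\<^sub>R f y - \<psi> (x - y) *\<^sub>R f y = (LINT \<sigma>|lborel. ?H y \<sigma>)" by simp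
    qed
    also have "\<dots> = (LINT \<sigma>|lborel. (LINT y|lborel. ?H y \<sigma>))"
    proof (rule lborel_pair.Fubini_integral[symmetric])
      have m: "case_prod ?H \<in> borel_measurable (lborel \<Otimes>\<^sub>M lborel)" by measurable
      have "(\<integral>\<^sup>+z. ennreal (norm (case_prod ?H z)) \<partial>(lborel \<Otimes>\<^sub>M lborel)) = (\<integral>\<^sup>+y. \<integral>\<^sup>+\<sigma>. ennreal (norm (?H y \<sigma>)) \<partial>lborel \<partial>lborel)"
        using m by (subst lborel.nn_integral_fst[symmetric]) auto
      also have "\<dots> \<le> (\<integral>\<^sup>+y. \<integral>\<^sup>+\<sigma>. ennreal (B * norm (f y)) * indicator {0..s} \<sigma> \<partial>lborel \<partial>lborel)"
      proof (intro nn_integral_mono)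
        fix y \<sigma>
        show "ennreal (norm (?H y \<sigma>)) \<le> ennreal (B * norm (f y)) * indicator {0..s} \<sigma>"
          using B[of "x - y + \<sigma> *\<^sub>R e"] by (auto simp: indicator_def intro!: ennreal_leI mult_right_mono)
      qed
      also have "\<dots> = (\<integral>\<^sup>+y. ennreal (B * norm (f y)) * ennreal s \<partial>lborel)"
        using s by (simp add: nn_integral_cmult_indicator)
      also have "\<dots> = (\<integral>\<^sup>+y. ennreal (norm ((B * s) *\<^sub>R f y)) \<partial>lborel)"
        using s B[of 0] by (intro nn_integral_cong) (simp add: ennreal_mult[symmetric] abs_mult mult_ac)
      also have "\<dots> < \<infinity>"
        using integrable_scaleR_right[OF f, of "B * s"] by (simp add: integrable_iff_bounded)
      finally show "integrable (lborel \<Otimes>\<^sub>M lborel) (case_prod ?H)" using m by (intro integrableI_bounded)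
    qed
    also have "\<dots> = (LINT \<sigma>|lborel. indicator {0..s} \<sigma> *\<^sub>R G (x + \<sigma> *\<^sub>R e))"
    proof (rule Bochner_Integration.integral_cong[OF refl])
      fix \<sigma> :: real
      have "(LINT y|lborel. ?H y \<sigma>) = (LINT y|lborel. indicator {0..s} \<sigma> *\<^sub>R (D ((x + \<sigma> *\<^sub>R e) - y) *\<^sub>R f y))"
        by (rule Bochner_Integration.integral_cong[OF refl]) (simp add: algebra_simps)
      then show "(LINT y|lborel. ?H y \<sigma>) = indicator {0..s} \<sigma> *\<^sub>R G (x + \<sigma> *\<^sub>R e)"
        by (simp only: integral_scaleR_right DG)
    qed
    finally show ?thesis .
  qed
  have G1: "(\<integral>\<^sup>+x. ennreal (norm (G x)) \<partial>lborel) \<le> (\<integral>\<^sup>+x. ennreal (norm (g x)) \<partial>lborel)"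
  proof -
    have pos: "\<psi> z \<ge> 0" for z unfolding \<psi>_def by (rule mollifier_nonneg[OF c])
    have "(\<integral>\<^sup>+x. ennreal (norm (G x)) \<partial>lborel) \<le> (\<integral>\<^sup>+x. \<integral>\<^sup>+y. ennreal (\<psi> (x - y)) * ennreal (norm (g y)) \<partial>lborel \<partial>lborel)"
    proof (rule nn_integral_mono)
      fix x
      have "ennreal (norm (G x)) \<le> (\<integral>\<^sup>+y. ennreal (norm (\<psi> (x - y) *\<^sub>R g y)) \<partial>lborel)"
        unfolding G_def by (intro integral_norm_bound_ennreal integrable_bounded_scaleR[OF g]) (auto intro: B')
      then show "ennreal (norm (G x)) \<le> (\<integral>\<^sup>+y. ennreal (\<psi> (x - y)) * ennreal (norm (g y)) \<partial>lborel)"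
        using pos by (simp add: ennreal_mult)
    qed
    also have "\<dots> = (\<integral>\<^sup>+y. \<integral>\<^sup>+x. ennreal (\<psi> (x - y)) * ennreal (norm (g y)) \<partial>lborel \<partial>lborel)"
      by (rule lborel_pair.Fubini') measurable
    also have "\<dots> = (\<integral>\<^sup>+y. 1 * ennreal (norm (g y)) \<partial>lborel)"
    proof (rule nn_integral_cong)
      fix y :: "real^'n"
      have "(\<integral>\<^sup>+x. ennreal (\<psi> (x - y)) * ennreal (norm (g y)) \<partial>lborel) = (\<integral>\<^sup>+x. ennreal (\<psi> (x - y)) \<partial>lborel) * ennreal (norm (g y))"
        by (rule nn_integral_multc) measurable
      also have "(\<integral>\<^sup>+x. ennreal (\<psi> (x - y)) \<partial>lborel) = (\<integral>\<^sup>+x. ennreal (\<psi> x) \<partial>lborel)"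
        using nn_integral_lborel_translate[of "\<lambda>x. ennreal (\<psi> x)" "- y"] by simp
      also have "\<dots> = 1" unfolding \<psi>_def by (rule mollifier_nn_integral[OF c])
      finally show "(\<integral>\<^sup>+x. ennreal (\<psi> (x - y)) * ennreal (norm (g y)) \<partial>lborel) = 1 * ennreal (norm (g y))" .
    qed
    finally show ?thesis by simp
  qed
  have "shift_norm F (s *\<^sub>R e) \<le> (\<integral>\<^sup>+x. \<integral>\<^sup>+\<sigma>. indicator {0..s} \<sigma> * ennreal (norm (G (\<sigma> *\<^sub>R e + x))) \<partial>lborel \<partial>lborel)"
    unfolding shift_norm_def rep
  proof (rule nn_integral_mono)
    fix x
    have "ennreal (norm (LINT \<sigma>|lborel. indicator {0..s} \<sigma> *\<^sub>R G (x + \<sigma> *\<^sub>R e))) \<le> (\<integral>\<^sup>+\<sigma>. ennreal (norm (indicator {0..s} \<sigma> *\<^sub>R G (x + \<sigma> *\<^sub>R e))) \<partial>lborel)"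
    proof (cases "integrable lborel (\<lambda>\<sigma>. indicator {0..s} \<sigma> *\<^sub>R G (x + \<sigma> *\<^sub>R e))")
      case True
      then show ?thesis by (rule integral_norm_bound_ennreal)
    qed (simp add: not_integrable_integral_eq)
    also have "\<dots> = (\<integral>\<^sup>+\<sigma>. indicator {0..s} \<sigma> * ennreal (norm (G (\<sigma> *\<^sub>R e + x))) \<partial>lborel)"
      by (intro nn_integral_cong) (auto simp: indicator_def add.commute)
    finally show "ennreal (norm (LINT \<sigma>|lborel. indicator {0..s} \<sigma> *\<^sub>R G (x + \<sigma> *\<^sub>R e))) \<le> (\<integral>\<^sup>+\<sigma>. indicator {0..s} \<sigma> * ennreal (norm (G (\<sigma> *\<^sub>R e + x))) \<partial>lborel)" .
  qed
  also have "\<dots> = (\<integral>\<^sup>+\<sigma>. \<integral>\<^sup>+x. indicator {0..s} \<sigma> * ennreal (norm (G (\<sigma> *\<^sub>R e + x))) \<partial>lborel \<partial>lborel)"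
    by (rule lborel_pair.Fubini') measurable
  also have "\<dots> = (\<integral>\<^sup>+\<sigma>. (\<integral>\<^sup>+x. ennreal (norm (G x)) \<partial>lborel) * indicator {0..s} \<sigma> \<partial>lborel)"
  proof (rule nn_integral_cong)
    fix \<sigma> :: real
    have "(\<integral>\<^sup>+x. indicator {0..s} \<sigma> * ennreal (norm (G (\<sigma> *\<^sub>R e + x))) \<partial>lborel) = indicator {0..s} \<sigma> * (\<integral>\<^sup>+x. ennreal (norm (G (\<sigma> *\<^sub>R e + x))) \<partial>lborel)"
      by (rule nn_integral_cmult) measurable
    also have "(\<integral>\<^sup>+x. ennreal (norm (G (\<sigma> *\<^sub>R e + x))) \<partial>lborel) = (\<integral>\<^sup>+x. ennreal (norm (G x)) \<partial>lborel)"
      by (rule nn_integral_lborel_translate) measurable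
    finally show "(\<integral>\<^sup>+x. indicator {0..s} \<sigma> * ennreal (norm (G (\<sigma> *\<^sub>R e + x))) \<partial>lborel) = (\<integral>\<^sup>+x. ennreal (norm (G x)) \<partial>lborel) * indicator {0..s} \<sigma>"
      by (simp add: mult.commute)
  qed
  also have "\<dots> = (\<integral>\<^sup>+x. ennreal (norm (G x)) \<partial>lborel) * ennreal s"
    using s by (simp add: nn_integral_cmult_indicator)
  also have "\<dots> \<le> (\<integral>\<^sup>+x. ennreal (norm (g x)) \<partial>lborel) * ennreal s"
    by (intro mult_right_mono G1) simp
  finally show ?thesis by (simp add: e_def mult.commute)
qed

lemma shift_norm_uminus:
  assumes [measurable]: "f \<in> borel_measurable borel"
  shows "shift_norm f (- h) = shift_norm f h"
proof -
  have "shift_norm f (- h) = (\<integral>\<^sup>+x. ennreal (norm (f (h + x - h) - f (h + x))) \<partial>lborel)"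
    unfolding shift_norm_def using nn_integral_lborel_translate[of "\<lambda>x. ennreal (norm (f (x - h) - f x))" h] by simp
  also have "\<dots> = shift_norm f h"
    unfolding shift_norm_def by (simp add: norm_minus_commute add.commute)
  finally show ?thesis .
qed

text \<open>The bound for mollifications survives the limit, because replacing f by a mollification
  changes \<open>shift_norm\<close> by at most twice their \<open>L1\<close> distance. Negative s
  reduces to positive s by the symmetry of \<open>shift_norm\<close>.\<close>

lemma shift_norm_weak_partial:
  fixes f g :: "real^'n \<Rightarrow> 'b::euclidean_space"
  assumes f: "integrable lborel f" and g: "integrable lborel g"
    and wp: "\<And>\<phi>. test_function \<phi> \<Longrightarrow> (LINT x|lborel. partial j \<phi> x *\<^sub>R f x) = - (LINT x|lborel. \<phi> x *\<^sub>R g x)"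
  shows "shift_norm f (s *\<^sub>R axis j 1) \<le> ennreal \<bar>s\<bar> * (\<integral>\<^sup>+x. ennreal (norm (g x)) \<partial>lborel)"
proof -
  have [measurable]: "f \<in> borel_measurable borel" using f by auto
  have [measurable]: "(mollifier (real (Suc m)) :: real^'n \<Rightarrow> real) \<in> borel_measurable borel" for m
    by (intro test_function_measurable test_function_mollifier) simp
  define F where "F = (\<lambda>m x. LINT y|lborel. mollifier (real (Suc m)) (x - y) *\<^sub>R f y)"
  have [measurable]: "F m \<in> borel_measurable borel" for m unfolding F_def by measurable
  have Flim: "(\<lambda>m. \<integral>\<^sup>+x. ennreal (norm (f x - F m x)) \<partial>lborel) \<longlonglongrightarrow> 0"
    using mollifier_approx[OF f] unfolding F_def by (simp add: norm_minus_commute)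
  have pos: "shift_norm f (s *\<^sub>R axis j 1) \<le> ennreal s * (\<integral>\<^sup>+x. ennreal (norm (g x)) \<partial>lborel)" (is "_ \<le> ?R") if s: "s \<ge> 0" for s
  proof (rule tendsto_lowerbound)
    have "(\<lambda>m. ?R + 2 * (\<integral>\<^sup>+x. ennreal (norm (f x - F m x)) \<partial>lborel)) \<longlonglongrightarrow> ?R + 2 * 0"
      by (intro tendsto_add tendsto_const ennreal_tendsto_cmult Flim) simp
    then show "(\<lambda>m. ?R + 2 * (\<integral>\<^sup>+x. ennreal (norm (f x - F m x)) \<partial>lborel)) \<longlonglongrightarrow> ?R" by simp
    show "\<forall>\<^sub>F m in sequentially. shift_norm f (s *\<^sub>R axis j 1) \<le> ?R + 2 * (\<integral>\<^sup>+x. ennreal (norm (f x - F m x)) \<partial>lborel)"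
    proof (rule always_eventually, rule allI)
      fix m
      have "shift_norm (F m) (s *\<^sub>R axis j 1) \<le> ?R"
        unfolding F_def by (rule mollify_shift[OF f g wp s]) auto
      then show "shift_norm f (s *\<^sub>R axis j 1) \<le> ?R + 2 * (\<integral>\<^sup>+x. ennreal (norm (f x - F m x)) \<partial>lborel)"
        by (intro order_trans[OF shift_norm_triangle[of f "F m"]] add_right_mono) auto
    qed
  qed simp
  show ?thesis
  proof (cases "s \<ge> 0")
    case False
    then have "shift_norm f ((- s) *\<^sub>R axis j 1) \<le> ennreal (- s) * (\<integral>\<^sup>+x. ennreal (norm (g x)) \<partial>lborel)"
      by (intro pos) simp
    then show ?thesis using False shift_norm_uminus[of f "s *\<^sub>R axis j 1"] by simp
  qed (use pos in simp)
qed

lemma shift_norm_add: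
  assumes [measurable]: "f \<in> borel_measurable borel"
  shows "shift_norm f (h + k) \<le> shift_norm f h + shift_norm f k"
proof -
  have "shift_norm f (h + k) \<le> (\<integral>\<^sup>+x. ennreal (norm (f ((k + x) + h) - f (k + x))) + ennreal (norm (f (x + k) - f x)) \<partial>lborel)"
    unfolding shift_norm_def
  proof (rule nn_integral_mono)
    fix x
    have "f (x + (h + k)) - f x = (f ((k + x) + h) - f (k + x)) + (f (x + k) - f x)" by (simp add: add_ac)
    then have "norm (f (x + (h + k)) - f x) \<le> norm (f ((k + x) + h) - f (k + x)) + norm (f (x + k) - f x)"
      by (metis norm_triangle_ineq)
    then show "ennreal (norm (f (x + (h + k)) - f x)) \<le> ennreal (norm (f ((k + x) + h) - f (k + x))) + ennreal (norm (f (x + k) - f x))"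
      by (simp flip: ennreal_plus)
  qed
  also have "\<dots> = (\<integral>\<^sup>+x. ennreal (norm (f ((k + x) + h) - f (k + x))) \<partial>lborel) + shift_norm f k"
    unfolding shift_norm_def by (intro nn_integral_add) measurable
  also have "(\<integral>\<^sup>+x. ennreal (norm (f ((k + x) + h) - f (k + x))) \<partial>lborel) = shift_norm f h"
    unfolding shift_norm_def using nn_integral_lborel_translate[of "\<lambda>x. ennreal (norm (f (x + h) - f x))" k] by simp
  finally show ?thesis .
qed

lemma shift_norm_sum:
  assumes [measurable]: "f \<in> borel_measurable borel" and "finite I"
  shows "shift_norm f (\<Sum>i\<in>I. h i) \<le> (\<Sum>i\<in>I. shift_norm f (h i))"
  using assms(2)
proof induction
  case (insert i I)
  then show ?case using order_trans[OF shift_norm_add[of f "h i" "\<Sum>i\<in>I. h i"] add_left_mono] by simp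
qed (simp add: shift_norm_def)

text \<open>The translation is carried out one coordinate at a time; \<open>shift_norm\<close> is
  subadditive in the translation.\<close>

lemma shift_norm_gradient:
  fixes f :: "real^'n \<Rightarrow> 'b::euclidean_space" and g :: "'n \<Rightarrow> real^'n \<Rightarrow> 'b"
  assumes f: "integrable lborel f" and g: "\<And>j. integrable lborel (g j)"
    and wp: "\<And>j \<phi>. test_function \<phi> \<Longrightarrow> (LINT x|lborel. partial j \<phi> x *\<^sub>R f x) = - (LINT x|lborel. \<phi> x *\<^sub>R g j x)"
    and h: "\<And>j. \<bar>h $ j\<bar> \<le> s"
  shows "shift_norm f h \<le> ennreal s * (\<Sum>j\<in>UNIV. \<integral>\<^sup>+x. ennreal (norm (g j x)) \<partial>lborel)"
proof -
  have [measurable]: "f \<in> borel_measurable borel" using f by auto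
  have "h = (\<Sum>j\<in>UNIV. h $ j *\<^sub>R axis j 1)"
    by (simp add: vec_eq_iff axis_def if_distrib cong: if_cong)
  then have "shift_norm f h \<le> (\<Sum>j\<in>UNIV. shift_norm f (h $ j *\<^sub>R axis j 1))"
    using shift_norm_sum[of f UNIV "\<lambda>j. h $ j *\<^sub>R axis j 1"] by simp
  also have "\<dots> \<le> (\<Sum>j\<in>UNIV. ennreal s * (\<integral>\<^sup>+x. ennreal (norm (g j x)) \<partial>lborel))"
  proof (rule sum_mono)
    fix j
    have "shift_norm f (h $ j *\<^sub>R axis j 1) \<le> ennreal \<bar>h $ j\<bar> * (\<integral>\<^sup>+x. ennreal (norm (g j x)) \<partial>lborel)"
      by (rule shift_norm_weak_partial[OF f g wp])
    also have "\<dots> \<le> ennreal s * (\<integral>\<^sup>+x. ennreal (norm (g j x)) \<partial>lborel)"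
      by (intro mult_right_mono ennreal_leI h) simp
    finally show "shift_norm f (h $ j *\<^sub>R axis j 1) \<le> ennreal s * (\<integral>\<^sup>+x. ennreal (norm (g j x)) \<partial>lborel)" .
  qed
  finally show ?thesis by (simp add: sum_distrib_left)
qed

section \<open>Borel representatives and uniqueness of weak derivatives\<close>

lemma integral_lebesgue_rep:
  fixes f f' :: "'a::euclidean_space \<Rightarrow> 'b::{banach, second_countable_topology}"
  assumes "f \<in> borel_measurable lebesgue" "f' \<in> borel_measurable borel" "AE x in lborel. f x = f' x"
  shows "(LINT x|lebesgue. f x) = (LINT x|lborel. f' x)"
proof -
  have "(LINT x|lebesgue. f x) = (LINT x|lebesgue. f' x)"
    using assms by (intro integral_cong_AE) (auto simp: AE_completion_iff measurable_completion)
  also have "\<dots> = (LINT x|lborel. f' x)" using assms by (intro integral_completion) auto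
  finally show ?thesis .
qed

text \<open>Convolutions and Fubini arguments need joint measurability of f(x - y), which is
  immediate for a Borel function and is not for one that is only Lebesgue measurable.\<close>

lemma integrable_borel_representative:
  fixes f :: "'a::euclidean_space \<Rightarrow> 'b::euclidean_space"
  assumes "integrable lebesgue f"
  shows "\<exists>f'. integrable lborel f' \<and> (AE x in lborel. f x = f' x)"
proof -
  obtain f' where f': "f' \<in> borel_measurable borel" "AE x in lborel. f x = f' x"
    using ex_borel_representative[of f] assms by auto
  have "integrable lebesgue f'"
    using assms f' by (subst integrable_cong_AE[of _ _ f]) (auto simp: AE_completion_iff measurable_completion elim!: eventually_mono)
  then show ?thesis using f' integrable_completion[of f' lborel] by auto
qed

lemma has_weak_partial_rep:
  assumes w: "has_weak_partial j f g"
    and f': "integrable lborel f'" "AE x in lborel. f x = f' x"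
    and g': "integrable lborel g'" "AE x in lborel. g x = g' x"
    and t: "test_function \<phi>"
  shows "(LINT x|lborel. partial j \<phi> x *\<^sub>R f' x) = - (LINT x|lborel. \<phi> x *\<^sub>R g' x)"
proof -
  have [measurable]: "f \<in> borel_measurable lebesgue" "g \<in> borel_measurable lebesgue"
    using w by (auto simp: has_weak_partial_def intro: loc_integrable_measurable)
  have [measurable]: "\<phi> \<in> borel_measurable borel" "partial j \<phi> \<in> borel_measurable borel"
    using t by (auto intro: test_function_measurable test_function_partial)
  have [measurable]: "\<phi> \<in> borel_measurable lebesgue" "partial j \<phi> \<in> borel_measurable lebesgue"
    by (auto intro: measurable_completion)
  have [measurable]: "f' \<in> borel_measurable borel" "g' \<in> borel_measurable borel" using f' g' by auto
  have "(LINT x|lebesgue. partial j \<phi> x *\<^sub>R f x) = (LINT x|lborel. partial j \<phi> x *\<^sub>R f' x)"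
    by (rule integral_lebesgue_rep) (use f' in \<open>auto elim!: eventually_mono\<close>)
  moreover have "(LINT x|lebesgue. \<phi> x *\<^sub>R g x) = (LINT x|lborel. \<phi> x *\<^sub>R g' x)"
    by (rule integral_lebesgue_rep) (use g' in \<open>auto elim!: eventually_mono\<close>)
  ultimately show ?thesis using w t by (simp add: has_weak_partial_def)
qed

text \<open>The two candidates are only locally integrable, so both are multiplied by a bump that is
  positive on a large ball; testing with \<phi> times the bump gives zero. This uniqueness makes
  \<open>H11_norm\<close>, which is defined through a choice operator, well determined.\<close>

lemma weak_partial_unique:
  fixes f g1 g2 :: "real^'n \<Rightarrow> 'k::{real_normed_field,euclidean_space}"
  assumes w1: "has_weak_partial j f g1" and w2: "has_weak_partial j f g2"
  shows "AE x in lborel. g1 x = g2 x"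
proof -
  have loc: "loc_integrable g1" "loc_integrable g2" using w1 w2 by (auto simp: has_weak_partial_def)
  have [measurable]: "g1 \<in> borel_measurable lebesgue" "g2 \<in> borel_measurable lebesgue"
    using loc by (auto intro: loc_integrable_measurable)
  have int: "integrable lebesgue (\<lambda>x. \<phi> x *\<^sub>R g x)" if t: "test_function \<phi>" and g: "loc_integrable g" for \<phi> and g :: "real^'n \<Rightarrow> 'k"
  proof -
    obtain K where K: "compact K" "\<And>x. x \<notin> K \<Longrightarrow> \<phi> x = 0" using t by (auto simp: test_function_def)
    obtain B where B: "\<And>x. \<bar>\<phi> x\<bar> \<le> B" using test_function_bounded[OF t] by blast
    have "\<phi> \<in> borel_measurable borel" by (rule test_function_measurable[OF t])
    then have "\<phi> \<in> borel_measurable lebesgue" by (auto intro: measurable_completion)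
    then have "integrable lebesgue (\<lambda>x. \<phi> x *\<^sub>R (indicator K x *\<^sub>R g x))"
      using g K(1) by (intro integrable_bounded_scaleR[OF _ _ B])
         (auto simp: loc_integrable_def set_integrable_def)
    moreover have "(\<lambda>x. \<phi> x *\<^sub>R (indicator K x *\<^sub>R g x)) = (\<lambda>x. \<phi> x *\<^sub>R g x)"
      using K(2) by (auto simp: fun_eq_iff indicator_def)
    ultimately show ?thesis by simp
  qed
  have ae: "AE x in lborel. norm x < real (Suc R) \<longrightarrow> g1 x = g2 x" for R
  proof -
    define cut :: "real^'n \<Rightarrow> real" where "cut = (\<lambda>x. bump (0 + (1 / real (Suc R)) *\<^sub>R x))"
    have t: "test_function cut" unfolding cut_def by (intro test_function_affine test_function_bump) simp
    define u where "u = (\<lambda>x. cut x *\<^sub>R g1 x - cut x *\<^sub>R g2 x)"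
    have ui: "integrable lebesgue u" unfolding u_def by (intro Bochner_Integration.integrable_diff int t loc)
    obtain u' where u': "integrable lborel u'" "AE x in lborel. u x = u' x"
      using integrable_borel_representative[OF ui] by blast
    have "AE x in lborel. u' x = 0"
    proof (rule zero_if_test_zero[OF u'(1)])
      fix \<phi> :: "real^'n \<Rightarrow> real" assume \<phi>: "test_function \<phi>"
      have [measurable]: "\<phi> \<in> borel_measurable borel" by (rule test_function_measurable[OF \<phi>])
      have [measurable]: "\<phi> \<in> borel_measurable lebesgue" by (auto intro: measurable_completion)
      have t2: "test_function (\<lambda>x. \<phi> x * cut x)" by (intro test_function_mult \<phi> test_function_smooth t)
      have "(LINT x|lborel. \<phi> x *\<^sub>R u' x) = (LINT x|lebesgue. \<phi> x *\<^sub>R u x)"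
        using ui u' by (intro integral_lebesgue_rep[symmetric]) (auto elim!: eventually_mono)
      also have "\<dots> = (LINT x|lebesgue. (\<phi> x * cut x) *\<^sub>R g1 x - (\<phi> x * cut x) *\<^sub>R g2 x)"
        by (simp add: u_def scaleR_diff_right)
      also have "\<dots> = (LINT x|lebesgue. (\<phi> x * cut x) *\<^sub>R g1 x) - (LINT x|lebesgue. (\<phi> x * cut x) *\<^sub>R g2 x)"
        by (intro Bochner_Integration.integral_diff int t2 loc)
      also have "\<dots> = 0"
        using w1[unfolded has_weak_partial_def, THEN conjunct2, THEN conjunct2, rule_format, OF t2]
          w2[unfolded has_weak_partial_def, THEN conjunct2, THEN conjunct2, rule_format, OF t2] by simp
      finally show "(LINT x|lborel. \<phi> x *\<^sub>R u' x) = 0" .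
    qed
    with u'(2) show ?thesis
    proof eventually_elim
      case (elim x)
      show ?case
      proof
        assume "norm x < real (Suc R)"
        then have "cut x > 0" unfolding cut_def by (intro bump_pos) (simp add: divide_less_eq)
        then show "g1 x = g2 x" using elim by (simp add: u_def flip: scaleR_diff_right)
      qed
    qed
  qed
  then have "AE x in lborel. \<forall>R. norm x < real (Suc R) \<longrightarrow> g1 x = g2 x" unfolding AE_all_countable by blast
  then show ?thesis
  proof eventually_elim
    case (elim x)
    obtain R :: nat where "norm x < real R" using reals_Archimedean2 by blast
    then have "norm x < real (Suc R)" by simp
    then show ?case using elim by blast
  qed
qed

section \<open>Heat kernel estimates\<close>

text \<open>Raising x/a \<le> exp(x/a) to the power a gives x^a exp(-x) \<le> a^a.\<close>

lemma powr_exp_bounded: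
  assumes "a \<ge> 0"
  shows "\<exists>C>0. \<forall>x>0. x powr a * exp (- x) \<le> (C::real)"
proof (cases "a = 0")
  case True
  then show ?thesis by (intro exI[of _ 1]) auto
next
  case False
  then have a: "a > 0" using assms by simp
  have "x powr a * exp (- x) \<le> a powr a" if x: "x > 0" for x
  proof -
    have "x / a \<le> exp (x / a)" using exp_ge_add_one_self[of "x / a"] by linarith
    then have "(x / a) powr a \<le> exp (x / a) powr a" using a x by (intro powr_mono2) auto
    also have "\<dots> = exp x" using a by (simp add: powr_def)
    finally have "x powr a / a powr a \<le> exp x" using a x by (simp add: powr_divide)
    then show ?thesis using a by (simp add: exp_minus field_simps)
  qed
  then show ?thesis using a by (intro exI[of _ "a powr a"]) auto
qed

lemma L_kernel_nonneg: "L_kernel t z \<ge> 0"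
  by (simp add: L_kernel_def)

text \<open>In the variable s = |z|^2/(4t) the expression is, up to constants, |z|^(-d-2\<gamma>)
  times the bounded function s^(d/2+\<gamma>) exp(-s); the powers of t cancel.\<close>

lemma heat_kernel_bound:
  assumes "\<gamma> \<ge> 0"
  shows "\<exists>C>0. \<forall>t>0. \<forall>z::real^'n. z \<noteq> 0 \<longrightarrow>
     t powr (- \<gamma>) * ((4 * pi * t) powr (- (real CARD('n) / 2)) * exp (- (norm z)\<^sup>2 / (4 * t)))
     \<le> C * norm z powr (- (real CARD('n) + 2 * \<gamma>))"
proof -
  define d where "d = real CARD('n)"
  define a where "a = d / 2 + \<gamma>"
  have a: "a \<ge> 0" using assms by (simp add: a_def d_def)
  obtain C where C: "C > 0" "\<And>x. x > 0 \<Longrightarrow> x powr a * exp (- x) \<le> C"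
    using powr_exp_bounded[OF a] by blast
  have "t powr (- \<gamma>) * ((4 * pi * t) powr (- (d / 2)) * exp (- (norm z)\<^sup>2 / (4 * t)))
     \<le> C * (4 * pi) powr (- (d / 2)) * 4 powr a * norm z powr (- (d + 2 * \<gamma>))" if t: "t > 0" and z: "z \<noteq> 0" for t and z :: "real^'n"
  proof -
    define s where "s = (norm z)\<^sup>2 / (4 * t)"
    have s: "s > 0" using t z by (simp add: s_def)
    have e: "exp (- s) \<le> C * s powr (- a)" using C(2)[OF s] s by (simp add: powr_minus field_simps)
    have "s powr (- a) = norm z powr (- (d + 2 * \<gamma>)) * 4 powr a * t powr a"
    proof -
      have "s powr (- a) = ((norm z)\<^sup>2) powr (- a) * (4 * t) powr a"
        using t z unfolding s_def by (simp add: powr_divide powr_minus field_simps)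
      also have "((norm z)\<^sup>2) powr (- a) = norm z powr (- (d + 2 * \<gamma>))"
      proof -
        have "((norm z)\<^sup>2) powr (- a) = norm z powr (2 * (- a))"
          using z by (simp add: powr_powr flip: powr_numeral)
        also have "2 * (- a) = - (d + 2 * \<gamma>)" by (simp add: a_def)
        finally show ?thesis .
      qed
      also have "(4 * t) powr a = 4 powr a * t powr a" using t by (simp add: powr_mult)
      finally show ?thesis by simp
    qed
    note s_eq = this
    have p_eq: "(4 * pi * t) powr (- (d / 2)) = (4 * pi) powr (- (d / 2)) * t powr (- (d / 2))"
      using t by (simp add: powr_mult)
    have one: "t powr (- \<gamma>) * (t powr (- (d / 2)) * t powr a) = 1"
      using t by (simp add: a_def flip: powr_add)
    have "t powr (- \<gamma>) * ((4 * pi * t) powr (- (d / 2)) * exp (- s))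
       \<le> t powr (- \<gamma>) * ((4 * pi * t) powr (- (d / 2)) * (C * s powr (- a)))"
      by (intro mult_left_mono e) auto
    also have "\<dots> = C * (4 * pi) powr (- (d / 2)) * 4 powr a * norm z powr (- (d + 2 * \<gamma>)) * (t powr (- \<gamma>) * (t powr (- (d / 2)) * t powr a))"
      unfolding s_eq p_eq by (simp only: mult_ac)
    finally show ?thesis unfolding one by (simp add: s_def)
  qed
  moreover have "C * (4 * pi) powr (- (d / 2)) * 4 powr a > 0" using C(1) by simp
  ultimately show ?thesis unfolding d_def by blast
qed

text \<open>The factor exp(-t), which comes from the potential 1, absorbs t^\<gamma>. This decay
  beyond |z|^(-d) is what gives functions without cancellation a finite \<open>H1\<close>
  norm.\<close>

lemma L_kernel_bound:
  assumes \<gamma>: "\<gamma> \<ge> 0"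
  shows "\<exists>C>0. \<forall>t>0. \<forall>z::real^'n. z \<noteq> 0 \<longrightarrow> L_kernel t z \<le> C * norm z powr (- (real CARD('n) + 2 * \<gamma>))"
proof -
  obtain C where C: "C > 0" and hk: "\<And>t z::real^'n. t > 0 \<Longrightarrow> z \<noteq> 0 \<Longrightarrow>
     t powr (- \<gamma>) * ((4 * pi * t) powr (- (real CARD('n) / 2)) * exp (- (norm z)\<^sup>2 / (4 * t)))
     \<le> C * norm z powr (- (real CARD('n) + 2 * \<gamma>))"
    using heat_kernel_bound[OF \<gamma>, where 'n='n] by blast
  obtain C' where C': "C' > 0" "\<And>x. x > 0 \<Longrightarrow> x powr \<gamma> * exp (- x) \<le> C'"
    using powr_exp_bounded[OF \<gamma>] by blast
  have "L_kernel t z \<le> C' * C * norm z powr (- (real CARD('n) + 2 * \<gamma>))" if t: "t > 0" and z: "z \<noteq> 0" for t and z :: "real^'n"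
  proof -
    let ?H = "(4 * pi * t) powr (- (real CARD('n) / 2)) * exp (- (norm z)\<^sup>2 / (4 * t))"
    have "t powr \<gamma> * t powr (- \<gamma>) = 1" using t by (simp flip: powr_add)
    then have "L_kernel t z = (t powr \<gamma> * t powr (- \<gamma>)) * (exp (- t) * ?H)"
      unfolding L_kernel_def by simp
    also have "\<dots> = (t powr \<gamma> * exp (- t)) * (t powr (- \<gamma>) * ?H)" by (simp only: mult_ac)
    also have "\<dots> \<le> C' * (C * norm z powr (- (real CARD('n) + 2 * \<gamma>)))"
      by (rule mult_mono[OF C'(2)[OF t] hk[OF t z]]) (use C' in auto)
    finally show ?thesis by (simp add: mult.assoc)
  qed
  then show ?thesis using C C' by (intro exI[of _ "C' * C"]) auto
qed

text \<open>The quantity on the left is the length of the gradient of the kernel. The heat kernel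
  estimate with \<gamma> = 1 absorbs its factor 1/t, and exp(-t) is bounded by 1.\<close>

lemma L_kernel_gradient_bound:
  "\<exists>C>0. \<forall>t>0. \<forall>z::real^'n. z \<noteq> 0 \<longrightarrow> norm z / (2 * t) * L_kernel t z \<le> C * norm z powr (- (real CARD('n) + 1))"
proof -
  obtain C where C: "C > 0" and hk: "\<And>t z::real^'n. t > 0 \<Longrightarrow> z \<noteq> 0 \<Longrightarrow>
     t powr (- 1) * ((4 * pi * t) powr (- (real CARD('n) / 2)) * exp (- (norm z)\<^sup>2 / (4 * t)))
     \<le> C * norm z powr (- (real CARD('n) + 2 * 1))"
    using heat_kernel_bound[of 1, where 'n='n] by auto
  have "norm z / (2 * t) * L_kernel t z \<le> C * norm z powr (- (real CARD('n) + 1))" if t: "t > 0" and z: "z \<noteq> 0" for t and z :: "real^'n"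
  proof -
    let ?H = "(4 * pi * t) powr (- (real CARD('n) / 2)) * exp (- (norm z)\<^sup>2 / (4 * t))"
    have "norm z / (2 * t) * L_kernel t z = norm z * (exp (- t) / 2) * (t powr (- 1) * ?H)"
      using t by (simp add: L_kernel_def powr_minus_divide)
    also have "\<dots> \<le> norm z * 1 * (C * norm z powr (- (real CARD('n) + 2 * 1)))"
    proof (rule mult_mono[OF _ hk[OF t z]])
      have "exp (- t) \<le> 1" using t by simp
      then have "exp (- t) / 2 \<le> 1" by linarith
      then show "norm z * (exp (- t) / 2) \<le> norm z * 1" by (rule mult_left_mono) simp
    qed auto
    also have "\<dots> = C * (norm z powr 1 * norm z powr (- (real CARD('n) + 2 * 1)))"
      using z by simp
    also have "\<dots> = C * norm z powr (- (real CARD('n) + 1))"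
      unfolding powr_add[symmetric] by (simp add: algebra_simps)
    finally show ?thesis .
  qed
  then show ?thesis using C by blast
qed

lemma L_kernel_le:
  assumes "t > 0"
  shows "L_kernel t (z::real^'n) \<le> (4 * pi * t) powr (- (real CARD('n) / 2))"
proof -
  let ?P = "(4 * pi * t) powr (- (real CARD('n) / 2))"
  have "?P * exp (- (norm z)\<^sup>2 / (4 * t)) \<le> ?P * 1"
    using assms by (intro mult_left_mono) auto
  then have "exp (- t) * (?P * exp (- (norm z)\<^sup>2 / (4 * t))) \<le> 1 * (?P * 1)"
    by (intro mult_mono) (use assms in auto)
  then show ?thesis by (simp add: L_kernel_def)
qed

lemma continuous_L_kernel: "t > 0 \<Longrightarrow> continuous_on S (L_kernel t)"
  by (intro continuous_at_imp_continuous_on ballI has_derivative_continuous[OF L_kernel_has_derivative]) simp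

lemma L_kernel_measurable [measurable]: "L_kernel t \<in> borel_measurable borel"
  unfolding L_kernel_def[abs_def] by measurable

lemma nn_integral_L_kernel:
  assumes t: "t > 0"
  shows "(\<integral>\<^sup>+y. ennreal (L_kernel t (x - y :: real^'n)) \<partial>lborel) = ennreal (exp (- t))"
proof -
  have "(\<integral>\<^sup>+y. ennreal (L_kernel t (x - y :: real^'n)) \<partial>lborel) = (\<integral>\<^sup>+y. ennreal (L_kernel t (y :: real^'n)) \<partial>lborel)"
    by (rule nn_integral_lborel_reflect) measurable
  also have "\<dots> = (\<integral>\<^sup>+y. ennreal (L_kernel t (y :: real^'n)) \<partial>lebesgue)" by (simp add: nn_integral_completion)
  also have "\<dots> = ennreal (exp (- t))"
    using L_kernel_mass[OF t, where 'n='n] by (subst nn_integral_eq_integral) (auto simp: L_kernel_nonneg)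
  finally show ?thesis .
qed

section \<open>Radial integrals over dyadic annuli\<close>

lemma ennreal_le_suminf: "f j \<le> (\<Sum>i. f i :: ennreal)"
  using sum_le_suminf[of f "{j}"] by simp

text \<open>On the annulus between the radii 2^j r and 2^(j+1) r the power is at most its value at
  the inner radius; with the volume of the larger ball this is the j-th term of a geometric series
  of ratio 2^(-\<beta>).\<close>

lemma radial_tail:
  assumes \<beta>: "\<beta> > 0"
  shows "\<exists>C>0. \<forall>r>0. (\<integral>\<^sup>+z. ennreal (norm z powr (- (real CARD('n) + \<beta>))) * indicator {z. r \<le> norm z} (z::real^'n) \<partial>lborel)
     \<le> ennreal (C * r powr (- \<beta>))"
proof -
  define d where "d = real CARD('n)"
  define \<omega> where "\<omega> = unit_ball_vol d"
  have \<omega>: "\<omega> > 0" unfolding \<omega>_def d_def by (intro unit_ball_vol_pos) simp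
  define q where "q = 2 powr (- \<beta>)"
  have q: "0 < q" "q < 1" using \<beta> by (auto simp: q_def powr_less_one)
  have "(\<integral>\<^sup>+z. ennreal (norm z powr (- (d + \<beta>))) * indicator {z. r \<le> norm z} (z::real^'n) \<partial>lborel)
     \<le> ennreal (\<omega> * 2 ^ CARD('n) / (1 - q) * r powr (- \<beta>))" if r: "r > 0" for r
  proof -
    let ?a = "\<lambda>j::nat. (2 ^ j * r) powr (- (d + \<beta>))"
    have pw: "ennreal (norm z powr (- (d + \<beta>))) * indicator {z. r \<le> norm z} z
        \<le> (\<Sum>j. ennreal (?a j) * indicator (ball (0::real^'n) (2 ^ Suc j * r)) z)" for z :: "real^'n"
    proof (cases "r \<le> norm z")
      case True
      have "\<exists>j. norm z < 2 ^ Suc j * r"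
      proof -
        obtain j where "norm z / r < 2 ^ j" using real_arch_pow[of 2 "norm z / r"] by auto
        then have "norm z < 2 ^ j * r" using r by (simp add: field_simps)
        also have "\<dots> \<le> 2 ^ Suc j * r" using r by simp
        finally show ?thesis by blast
      qed
      then obtain j where j: "norm z < 2 ^ Suc j * r" "\<And>i. i < j \<Longrightarrow> \<not> norm z < 2 ^ Suc i * r"
        using exists_least_iff[of "\<lambda>j. norm z < 2 ^ Suc j * r"] by blast
      have "2 ^ j * r \<le> norm z"
      proof (cases j)
        case (Suc i)
        then show ?thesis using j(2)[of i] by (simp add: not_less)
      qed (use True in simp)
      then have "norm z powr (- (d + \<beta>)) \<le> ?a j"
        using r \<beta> by (intro powr_mono2') (auto simp: d_def)
      then have "ennreal (norm z powr (- (d + \<beta>))) * indicator {z. r \<le> norm z} z \<le> ennreal (?a j) * indicator (ball (0::real^'n) (2 ^ Suc j * r)) z"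
        using True j(1) by (simp add: ennreal_leI)
      also have "\<dots> \<le> (\<Sum>i. ennreal (?a i) * indicator (ball (0::real^'n) (2 ^ Suc i * r)) z)"
        by (rule ennreal_le_suminf)
      finally show ?thesis .
    qed simp
    have tm: "(\<integral>\<^sup>+z. ennreal (?a j) * indicator (ball (0::real^'n) (2 ^ Suc j * r)) z \<partial>lborel) = ennreal (\<omega> * 2 ^ CARD('n) * r powr (- \<beta>) * q ^ j)" for j
    proof -
      have "(\<integral>\<^sup>+z. ennreal (?a j) * indicator (ball (0::real^'n) (2 ^ Suc j * r)) z \<partial>lborel) = ennreal (?a j) * ennreal (\<omega> * (2 ^ Suc j * r) ^ CARD('n))"
        using r by (simp add: nn_integral_cmult_indicator emeasure_ball \<omega>_def d_def)
      also have "\<dots> = ennreal (?a j * (\<omega> * (2 ^ Suc j * r) ^ CARD('n)))" using \<omega> r by (simp add: ennreal_mult)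
      also have "?a j * (\<omega> * (2 ^ Suc j * r) ^ CARD('n)) = \<omega> * 2 ^ CARD('n) * (?a j * (2 ^ j * r) ^ CARD('n))"
        by (simp add: power_mult_distrib)
      also have "?a j * (2 ^ j * r) ^ CARD('n) = (2 ^ j * r) powr (- \<beta>)"
        using r by (simp add: d_def flip: powr_realpow powr_add)
      also have "\<dots> = r powr (- \<beta>) * q ^ j"
        using r by (simp add: powr_mult q_def powr_powr mult.commute flip: powr_realpow)
      finally show ?thesis by (simp add: mult.assoc)
    qed
    have "(\<integral>\<^sup>+z. ennreal (norm z powr (- (d + \<beta>))) * indicator {z. r \<le> norm z} (z::real^'n) \<partial>lborel)
       \<le> (\<integral>\<^sup>+z. (\<Sum>j. ennreal (?a j) * indicator (ball (0::real^'n) (2 ^ Suc j * r)) z) \<partial>lborel)"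
      by (intro nn_integral_mono pw)
    also have "\<dots> = (\<Sum>j. \<integral>\<^sup>+z. ennreal (?a j) * indicator (ball (0::real^'n) (2 ^ Suc j * r)) z \<partial>lborel)"
      by (intro nn_integral_suminf borel_measurable_times_ennreal borel_measurable_const borel_measurable_indicator) simp
    also have "\<dots> = (\<Sum>j. ennreal (\<omega> * 2 ^ CARD('n) * r powr (- \<beta>) * q ^ j))" unfolding tm ..
    also have "\<dots> = ennreal (\<Sum>j. \<omega> * 2 ^ CARD('n) * r powr (- \<beta>) * q ^ j)"
      using q \<omega> by (intro suminf_ennreal2 summable_mult summable_geometric) auto
    also have "(\<Sum>j. \<omega> * 2 ^ CARD('n) * r powr (- \<beta>) * q ^ j) = \<omega> * 2 ^ CARD('n) * r powr (- \<beta>) * (1 / (1 - q))"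
      using q by (subst suminf_mult) (auto intro!: summable_geometric simp: suminf_geometric)
    finally show ?thesis by (simp add: mult_ac)
  qed
  moreover have "\<omega> * 2 ^ CARD('n) / (1 - q) > 0" using \<omega> q by simp
  ultimately show ?thesis unfolding d_def by blast
qed

text \<open>The annuli shrink to the origin: volume 2^(-jd) against the power 2^(j(d-1)) leaves
  2^(-j). At the origin the integrand is 0 by the convention for \<open>powr\<close>.\<close>

lemma radial_local:
  "(\<integral>\<^sup>+z. ennreal (norm z powr (1 - real CARD('n))) * indicator (ball (0::real^'n) 1) (z::real^'n) \<partial>lborel) < \<infinity>"
proof -
  define d where "d = real CARD('n)"
  define \<omega> where "\<omega> = unit_ball_vol d"
  have \<omega>: "\<omega> > 0" unfolding \<omega>_def d_def by (intro unit_ball_vol_pos) simp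
  have d1: "d \<ge> 1" unfolding d_def by (simp add: Suc_leI)
  let ?a = "\<lambda>j::nat. ((1/2) ^ Suc j) powr (1 - d)"
  have pw: "ennreal (norm z powr (1 - d)) * indicator (ball (0::real^'n) 1) z
      \<le> (\<Sum>j. ennreal (?a j) * indicator (ball (0::real^'n) ((1/2) ^ j)) z)" for z :: "real^'n"
  proof (cases "z \<noteq> 0 \<and> norm z < 1")
    case True
    obtain j0 where "(1/2) ^ j0 < norm z" using real_arch_pow_inv[of "norm z" "1/2"] True by auto
    moreover have "(1/2) ^ Suc j0 \<le> (1/2::real) ^ j0" by simp
    ultimately have "\<exists>j. (1/2) ^ Suc j \<le> norm z" by (intro exI[of _ j0]) linarith
    then obtain j where j: "(1/2) ^ Suc j \<le> norm z" "\<And>i. i < j \<Longrightarrow> \<not> (1/2) ^ Suc i \<le> norm z"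
      using exists_least_iff[of "\<lambda>j. (1/2) ^ Suc j \<le> norm z"] by blast
    have "norm z < (1/2) ^ j"
    proof (cases j)
      case (Suc i)
      then show ?thesis using j(2)[of i] by (simp add: not_le)
    qed (use True in simp)
    moreover have "norm z powr (1 - d) \<le> ?a j"
      using j(1) d1 by (intro powr_mono2') auto
    ultimately have "ennreal (norm z powr (1 - d)) * indicator (ball (0::real^'n) 1) z \<le> ennreal (?a j) * indicator (ball (0::real^'n) ((1/2) ^ j)) z"
      using True by (simp add: ennreal_leI)
    also have "\<dots> \<le> (\<Sum>i. ennreal (?a i) * indicator (ball (0::real^'n) ((1/2) ^ i)) z)"
      by (rule ennreal_le_suminf)
    finally show ?thesis .
  qed auto
  have tm: "(\<integral>\<^sup>+z. ennreal (?a j) * indicator (ball (0::real^'n) ((1/2) ^ j)) z \<partial>lborel) = ennreal (\<omega> * 2 powr (d - 1) * (1/2) ^ j)" for j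
  proof -
    have "(\<integral>\<^sup>+z. ennreal (?a j) * indicator (ball (0::real^'n) ((1/2) ^ j)) z \<partial>lborel) = ennreal (?a j) * ennreal (\<omega> * ((1/2) ^ j) ^ CARD('n))"
      by (simp add: nn_integral_cmult_indicator emeasure_ball \<omega>_def d_def)
    also have "\<dots> = ennreal (?a j * (\<omega> * ((1/2) ^ j) ^ CARD('n)))" using \<omega> by (simp add: ennreal_mult)
    also have "?a j * (\<omega> * ((1/2) ^ j) ^ CARD('n)) = \<omega> * 2 powr (d - 1) * (1/2) ^ j"
    proof -
      have a: "?a j = 2 powr (d - 1) * ((1/2) ^ j) powr (1 - d)"
      proof -
        have "?a j = (1/2) powr (1 - d) * ((1/2) ^ j) powr (1 - d)"
          unfolding power_Suc by (simp only: powr_mult)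
        also have "(1/2::real) powr (1 - d) = 2 powr (d - 1)" by (simp add: powr_divide powr_minus_divide[symmetric])
        finally show ?thesis .
      qed
      have b: "((1/2::real) ^ j) ^ CARD('n) = ((1/2) ^ j) powr d" by (simp add: d_def flip: powr_realpow)
      have c: "((1/2::real) ^ j) powr (1 - d) * ((1/2) ^ j) powr d = (1/2) ^ j" by (simp flip: powr_add)
      have "?a j * (\<omega> * ((1/2) ^ j) ^ CARD('n)) = \<omega> * 2 powr (d - 1) * (((1/2) ^ j) powr (1 - d) * ((1/2) ^ j) powr d)"
        unfolding a b by (simp only: mult_ac)
      then show ?thesis unfolding c .
    qed
    finally show ?thesis .
  qed
  have "(\<integral>\<^sup>+z. ennreal (norm z powr (1 - d)) * indicator (ball (0::real^'n) 1) (z::real^'n) \<partial>lborel)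
     \<le> (\<integral>\<^sup>+z. (\<Sum>j. ennreal (?a j) * indicator (ball (0::real^'n) ((1/2) ^ j)) z) \<partial>lborel)"
    by (intro nn_integral_mono pw)
  also have "\<dots> = (\<Sum>j. \<integral>\<^sup>+z. ennreal (?a j) * indicator (ball (0::real^'n) ((1/2) ^ j)) z \<partial>lborel)"
    by (intro nn_integral_suminf borel_measurable_times_ennreal borel_measurable_const borel_measurable_indicator) simp
  also have "\<dots> = (\<Sum>j. ennreal (\<omega> * 2 powr (d - 1) * (1/2) ^ j))" unfolding tm ..
  also have "\<dots> = ennreal (\<Sum>j. \<omega> * 2 powr (d - 1) * (1/2) ^ j)"
    using \<omega> by (intro suminf_ennreal2 summable_mult summable_geometric) auto
  also have "\<dots> < \<infinity>" by simp
  finally show ?thesis unfolding d_def .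
qed

text \<open>A majorant of \<open>|z|\<close> times the heat kernel, uniformly in \<open>t\<close>; it is integrable because the
  factor \<open>e\<^sup>-\<^sup>t\<close> provides decay at infinity.\<close>

lemma L_kernel_commutator_majorant:
  "\<exists>K::real^'n \<Rightarrow> real. K \<in> borel_measurable borel \<and> (\<forall>z. 0 \<le> K z) \<and>
     (\<forall>t>0. \<forall>z. norm z * L_kernel t z \<le> K z) \<and> integrable lborel K"
proof -
  \<comment> \<open>Two decay rates are combined: \<gamma> = 0 gives |z|^(1-d) inside the unit ball,
    \<gamma> = 1 gives |z|^(-d-1) outside.\<close>
  obtain C0 where C0: "C0 > 0" "\<And>t z::real^'n. t > 0 \<Longrightarrow> z \<noteq> 0 \<Longrightarrow> L_kernel t z \<le> C0 * norm z powr (- (real CARD('n) + 2 * 0))"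
    using L_kernel_bound[of 0, where 'n='n] by blast
  obtain C1 where C1: "C1 > 0" "\<And>t z::real^'n. t > 0 \<Longrightarrow> z \<noteq> 0 \<Longrightarrow> L_kernel t z \<le> C1 * norm z powr (- (real CARD('n) + 2 * 1))"
    using L_kernel_bound[of 1, where 'n='n] by (metis zero_le_one)
  obtain C2 where C2: "\<And>r. r > 0 \<Longrightarrow> (\<integral>\<^sup>+z. ennreal (norm z powr (- (real CARD('n) + 1))) * indicator {z. r \<le> norm z} (z::real^'n) \<partial>lborel)
     \<le> ennreal (C2 * r powr (- 1))"
    using radial_tail[of 1, where 'n='n] by auto
  define K1 where "K1 = (\<lambda>z::real^'n. norm z powr (1 - real CARD('n)) * indicator (ball (0::real^'n) 1) z)"
  define K2 where "K2 = (\<lambda>z::real^'n. norm z powr (- (real CARD('n) + 1)) * indicator {z. 1 \<le> norm z} z)"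
  have cl: "closed {z::real^'n. 1 \<le> norm z}" by (intro closed_Collect_le continuous_intros)
  have pm: "(\<lambda>z::real^'n. norm z powr c) \<in> borel_measurable borel" for c by measurable
  have [measurable]: "K1 \<in> borel_measurable borel" "K2 \<in> borel_measurable borel"
    unfolding K1_def K2_def using cl by (auto intro!: borel_measurable_times borel_measurable_indicator pm)
  have i1: "integrable lborel K1"
  proof (rule integrableI_bounded)
    show "(\<integral>\<^sup>+z. ennreal (norm (K1 z)) \<partial>lborel) < \<infinity>"
      using radial_local[where 'n='n] by (simp add: K1_def ennreal_mult'' ennreal_indicator abs_mult)
  qed measurable
  have i2: "integrable lborel K2"
  proof (rule integrableI_bounded)
    have "(\<integral>\<^sup>+z. ennreal (norm (K2 z)) \<partial>lborel) \<le> ennreal (C2 * 1 powr (- 1))"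
      using C2[of 1] by (simp add: K2_def ennreal_mult'' ennreal_indicator abs_mult)
    also have "\<dots> < \<infinity>" by simp
    finally show "(\<integral>\<^sup>+z. ennreal (norm (K2 z)) \<partial>lborel) < \<infinity>" .
  qed measurable
  define K where "K = (\<lambda>z. C0 * K1 z + C1 * K2 z)"
  have "norm z * L_kernel t z \<le> K z" if t: "t > 0" for t z
  proof (cases "z = 0")
    case True
    then show ?thesis using C0 C1 by (simp add: K_def K1_def K2_def)
  next
    case False
    show ?thesis
    proof (cases "norm z < 1")
      case True
      have "norm z * L_kernel t z \<le> norm z * (C0 * norm z powr (- (real CARD('n) + 2 * 0)))"
        by (intro mult_left_mono C0 t False) auto
      also have "\<dots> = C0 * (norm z powr 1 * norm z powr (- (real CARD('n) + 2 * 0)))" using False by simp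
      also have "\<dots> = K z" unfolding powr_add[symmetric] using True by (simp add: K_def K1_def K2_def)
      finally show ?thesis .
    next
      case nt: False
      have "norm z * L_kernel t z \<le> norm z * (C1 * norm z powr (- (real CARD('n) + 2 * 1)))"
        by (intro mult_left_mono C1 t False) auto
      also have "\<dots> = C1 * (norm z powr 1 * norm z powr (- (real CARD('n) + 2 * 1)))" using False by simp
      also have "\<dots> = K z" unfolding powr_add[symmetric] using nt by (simp add: K_def K1_def K2_def algebra_simps)
      finally show ?thesis .
    qed
  qed
  moreover have "K z \<ge> 0" for z using C0 C1 by (simp add: K_def K1_def K2_def)
  moreover have "integrable lborel K" unfolding K_def using i1 i2 by simp
  moreover have "K \<in> borel_measurable borel" unfolding K_def by measurable
  ultimately show ?thesis by blast
qed

section \<open>The Hardy space\<close>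

lemma L_kernel_shift_measurable [measurable]: "(\<lambda>y. L_kernel t (x - y)) \<in> borel_measurable lebesgue"
proof -
  have "(\<lambda>y. L_kernel t (x - y)) \<in> borel_measurable lborel" by measurable
  then show ?thesis by (rule measurable_completion)
qed

lemma L_kernel_abs_le: "t > 0 \<Longrightarrow> \<bar>L_kernel t (z::real^'n)\<bar> \<le> (4 * pi * t) powr (- (real CARD('n) / 2))"
  using L_kernel_le[of t z] L_kernel_nonneg[of t z] by simp

lemma L_semigroup_integrable:
  fixes f :: "real^'n \<Rightarrow> 'k::{real_normed_field,euclidean_space}"
  assumes "integrable lebesgue f" "t > 0"
  shows "integrable lebesgue (\<lambda>y. L_kernel t (x - y) *\<^sub>R f y)"
  by (rule integrable_bounded_scaleR[OF assms(1) _ L_kernel_abs_le[OF assms(2)]]) measurable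

lemma L_semigroup_cong_AE:
  fixes f g :: "real^'n \<Rightarrow> 'k::{real_normed_field,euclidean_space}"
  assumes [measurable]: "f \<in> borel_measurable lebesgue" "g \<in> borel_measurable lebesgue" and "AE x in lebesgue. f x = g x"
  shows "L_semigroup t f x = L_semigroup t g x"
  unfolding L_semigroup_def
proof (rule integral_cong_AE)
  show "AE y in lebesgue. L_kernel t (x - y) *\<^sub>R f y = L_kernel t (x - y) *\<^sub>R g y"
    using assms(3) by eventually_elim simp
qed measurable

lemma H1_norm_cong_AE:
  fixes f g :: "real^'n \<Rightarrow> 'k::{real_normed_field,euclidean_space}"
  assumes "f \<in> borel_measurable lebesgue" "g \<in> borel_measurable lebesgue" "AE x in lebesgue. f x = g x"
  shows "H1_norm f = H1_norm g"
  unfolding H1_norm_def maximal_L_def L_semigroup_cong_AE[OF assms] ..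

lemma L_semigroup_rep:
  fixes f f' :: "real^'n \<Rightarrow> 'k::{real_normed_field,euclidean_space}"
  assumes "integrable lebesgue f" "integrable lborel f'" "AE x in lborel. f x = f' x"
  shows "L_semigroup t f x = (LINT y|lborel. L_kernel t (x - y) *\<^sub>R f' y)"
  unfolding L_semigroup_def
proof (rule integral_lebesgue_rep)
  show "(\<lambda>y. L_kernel t (x - y) *\<^sub>R f y) \<in> borel_measurable lebesgue" using assms by measurable
  show "(\<lambda>y. L_kernel t (x - y) *\<^sub>R f' y) \<in> borel_measurable borel" using assms by measurable
  show "AE y in lborel. L_kernel t (x - y) *\<^sub>R f y = L_kernel t (x - y) *\<^sub>R f' y"
    using assms(3) by eventually_elim simp
qed

lemma L_semigroup_add:
  fixes f g :: "real^'n \<Rightarrow> 'k::{real_normed_field,euclidean_space}"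
  assumes "integrable lebesgue f" "integrable lebesgue g" "t > 0"
  shows "L_semigroup t (\<lambda>y. f y + g y) x = L_semigroup t f x + L_semigroup t g x"
  unfolding L_semigroup_def scaleR_add_right
  by (intro Bochner_Integration.integral_add L_semigroup_integrable assms)

lemma L_semigroup_diff:
  fixes f g :: "real^'n \<Rightarrow> 'k::{real_normed_field,euclidean_space}"
  assumes "integrable lebesgue f" "integrable lebesgue g" "t > 0"
  shows "L_semigroup t (\<lambda>y. f y - g y) x = L_semigroup t f x - L_semigroup t g x"
  unfolding L_semigroup_def scaleR_diff_right
  by (intro Bochner_Integration.integral_diff L_semigroup_integrable assms)

lemma L_semigroup_cmult:
  fixes f :: "real^'n \<Rightarrow> 'k::{real_normed_field,euclidean_space}"
  assumes "integrable lebesgue f" "t > 0"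
  shows "L_semigroup t (\<lambda>y. \<alpha> * f y) x = \<alpha> * L_semigroup t f x"
  unfolding L_semigroup_def mult_scaleR_right[symmetric]
  by (rule integral_mult_right_zero)

lemma L_semigroup_norm_le:
  fixes f :: "real^'n \<Rightarrow> 'k::{real_normed_field,euclidean_space}"
  assumes "integrable lebesgue f" "t > 0"
  shows "ennreal (norm (L_semigroup t f x)) \<le> (\<integral>\<^sup>+y. ennreal (L_kernel t (x - y)) * ennreal (norm (f y)) \<partial>lborel)"
proof -
  have "ennreal (norm (L_semigroup t f x)) \<le> (\<integral>\<^sup>+y. ennreal (norm (L_kernel t (x - y) *\<^sub>R f y)) \<partial>lebesgue)"
    unfolding L_semigroup_def by (intro integral_norm_bound_ennreal L_semigroup_integrable assms)
  then show ?thesis by (simp add: nn_integral_completion L_kernel_nonneg ennreal_mult)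
qed

lemma continuous_L_semigroup:
  fixes f :: "real^'n \<Rightarrow> 'k::{real_normed_field,euclidean_space}"
  assumes f: "integrable lebesgue f" and t: "t > 0"
  shows "continuous_on UNIV (L_semigroup t f)"
proof (rule continuous_on_sequentiallyI)
  fix u :: "nat \<Rightarrow> real^'n" and a assume u: "u \<longlonglongrightarrow> a"
  let ?B = "(4 * pi * t) powr (- (real CARD('n) / 2))"
  have "(\<lambda>n. LINT y|lebesgue. L_kernel t (u n - y) *\<^sub>R f y) \<longlonglongrightarrow> (LINT y|lebesgue. L_kernel t (a - y) *\<^sub>R f y)"
  proof (rule integral_dominated_convergence[where w = "\<lambda>y. ?B * norm (f y)"])
    show "integrable lebesgue (\<lambda>y. ?B * norm (f y))" using f by simp
    show "AE y in lebesgue. (\<lambda>n. L_kernel t (u n - y) *\<^sub>R f y) \<longlonglongrightarrow> L_kernel t (a - y) *\<^sub>R f y"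
    proof (rule AE_I2)
      fix y
      have "isCont (L_kernel t) (a - y)"
        using continuous_L_kernel[OF t, of UNIV] unfolding continuous_on_eq_continuous_at[OF open_UNIV] by blast
      then have "(\<lambda>n. L_kernel t (u n - y)) \<longlonglongrightarrow> L_kernel t (a - y)"
        by (rule isCont_tendsto_compose) (intro tendsto_intros u)
      then show "(\<lambda>n. L_kernel t (u n - y) *\<^sub>R f y) \<longlonglongrightarrow> L_kernel t (a - y) *\<^sub>R f y"
        by (intro tendsto_intros)
    qed
    show "AE y in lebesgue. norm (L_kernel t (u n - y) *\<^sub>R f y) \<le> ?B * norm (f y)" for n
      using L_kernel_abs_le[OF t] by (intro AE_I2) (auto intro!: mult_right_mono)
  qed (use f in measurable)
  then show "(\<lambda>n. L_semigroup t f (u n)) \<longlonglongrightarrow> L_semigroup t f a" by (simp add: L_semigroup_def)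
qed

text \<open>The supremum runs over uncountably many t; continuity of each
  \<open>L_semigroup t f\<close> makes the superlevel sets open.\<close>

lemma maximal_L_measurable [measurable]:
  fixes f :: "real^'n \<Rightarrow> 'k::{real_normed_field,euclidean_space}"
  assumes f: "integrable lebesgue f"
  shows "maximal_L f \<in> borel_measurable borel"
proof (rule borel_measurableI_greater)
  fix a :: ennreal
  have "{x \<in> space borel. a < maximal_L f x} = (\<Union>t\<in>{0<..}. {x. a < ennreal (norm (L_semigroup t f x))})"
    by (auto simp: maximal_L_def less_SUP_iff)
  also have "open \<dots>"
  proof (intro open_UN ballI)
    fix t :: real assume "t \<in> {0<..}"
    then have "continuous_on UNIV (\<lambda>x. ennreal (norm (L_semigroup t f x)))"
      using continuous_L_semigroup[OF f, of t]
      by (intro continuous_on_ennreal continuous_intros) simp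
    then show "open {x. a < ennreal (norm (L_semigroup t f x))}"
      by (intro open_Collect_less continuous_intros)
  qed
  finally show "{x \<in> space borel. a < maximal_L f x} \<in> sets borel" by simp
qed

lemma maximal_L_ge: "t > 0 \<Longrightarrow> ennreal (norm (L_semigroup t f x)) \<le> maximal_L f x"
  unfolding maximal_L_def by (rule SUP_upper) simp

lemma maximal_L_leI: "(\<And>t. t > 0 \<Longrightarrow> ennreal (norm (L_semigroup t f x)) \<le> A) \<Longrightarrow> maximal_L f x \<le> A"
  unfolding maximal_L_def by (rule SUP_least) simp

lemma H1_norm_lborel: "H1_norm f = (\<integral>\<^sup>+x. maximal_L f x \<partial>lborel)"
  by (simp add: H1_norm_def nn_integral_completion)

lemma H1_norm_add:
  fixes f g :: "real^'n \<Rightarrow> 'k::{real_normed_field,euclidean_space}"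
  assumes f: "integrable lebesgue f" and g: "integrable lebesgue g"
  shows "H1_norm (\<lambda>x. f x + g x) \<le> H1_norm f + H1_norm g"
proof -
  have pw: "maximal_L (\<lambda>x. f x + g x) x \<le> maximal_L f x + maximal_L g x" for x
  proof (rule maximal_L_leI)
    fix t :: real assume t: "t > 0"
    have "ennreal (norm (L_semigroup t (\<lambda>x. f x + g x) x)) \<le> ennreal (norm (L_semigroup t f x)) + ennreal (norm (L_semigroup t g x))"
      unfolding L_semigroup_add[OF f g t] by (simp add: norm_triangle_ineq flip: ennreal_plus)
    also have "\<dots> \<le> maximal_L f x + maximal_L g x" by (intro add_mono maximal_L_ge t)
    finally show "ennreal (norm (L_semigroup t (\<lambda>x. f x + g x) x)) \<le> maximal_L f x + maximal_L g x" .
  qed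
  have "H1_norm (\<lambda>x. f x + g x) \<le> (\<integral>\<^sup>+x. maximal_L f x + maximal_L g x \<partial>lborel)"
    unfolding H1_norm_lborel by (rule nn_integral_mono[OF pw])
  also have "\<dots> = H1_norm f + H1_norm g"
    unfolding H1_norm_lborel using f g by (intro nn_integral_add) auto
  finally show ?thesis .
qed

lemma H1_norm_cmult:
  fixes f :: "real^'n \<Rightarrow> 'k::{real_normed_field,euclidean_space}"
  assumes f: "integrable lebesgue f"
  shows "H1_norm (\<lambda>x. \<alpha> * f x) \<le> ennreal (norm \<alpha>) * H1_norm f"
proof -
  have pw: "maximal_L (\<lambda>x. \<alpha> * f x) x \<le> ennreal (norm \<alpha>) * maximal_L f x" for x
  proof (rule maximal_L_leI)
    fix t :: real assume t: "t > 0"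
    show "ennreal (norm (L_semigroup t (\<lambda>x. \<alpha> * f x) x)) \<le> ennreal (norm \<alpha>) * maximal_L f x"
      unfolding L_semigroup_cmult[OF f t] norm_mult
      by (subst ennreal_mult) (auto intro!: mult_left_mono maximal_L_ge t)
  qed
  have "H1_norm (\<lambda>x. \<alpha> * f x) \<le> (\<integral>\<^sup>+x. ennreal (norm \<alpha>) * maximal_L f x \<partial>lborel)"
    unfolding H1_norm_lborel by (rule nn_integral_mono[OF pw])
  also have "\<dots> = ennreal (norm \<alpha>) * H1_norm f"
    unfolding H1_norm_lborel using f by (intro nn_integral_cmult) auto
  finally show ?thesis .
qed

lemma H1_D: "f \<in> H1 \<Longrightarrow> integrable lebesgue f" "f \<in> H1 \<Longrightarrow> H1_norm f < \<infinity>"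
  by (auto simp: H1_def)

lemma H1_zero:
  "(\<lambda>x::real^'n. 0 :: 'k::{real_normed_field,euclidean_space}) \<in> H1"
  "H1_norm (\<lambda>x::real^'n. 0 :: 'k) = 0"
proof -
  have "H1_norm (\<lambda>x::real^'n. 0 :: 'k) = 0"
    unfolding H1_norm_def maximal_L_def L_semigroup_def by (simp add: SUP_constant)
  then show "(\<lambda>x::real^'n. 0 :: 'k) \<in> H1" "H1_norm (\<lambda>x::real^'n. 0 :: 'k) = 0" by (auto simp: H1_def)
qed

lemma H1_add: "f \<in> H1 \<Longrightarrow> g \<in> H1 \<Longrightarrow> (\<lambda>x. f x + g x) \<in> H1"
  using H1_norm_add[of f g] by (auto simp: H1_def intro: le_less_trans)

lemma H1_cmult: "f \<in> H1 \<Longrightarrow> (\<lambda>x. \<alpha> * f x) \<in> H1"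
  using H1_norm_cmult[of f \<alpha>] by (auto simp: H1_def ennreal_mult_less_top intro: le_less_trans)

lemma H1_diff: "f \<in> H1 \<Longrightarrow> g \<in> H1 \<Longrightarrow> (\<lambda>x. f x - g x) \<in> H1"
  using H1_add[OF _ H1_cmult[of g "-1"], of f] by simp

lemma H1_norm_diff:
  fixes f g :: "real^'n \<Rightarrow> 'k::{real_normed_field,euclidean_space}"
  assumes f: "integrable lebesgue f" and g: "integrable lebesgue g"
  shows "H1_norm (\<lambda>x. f x - g x) \<le> H1_norm f + H1_norm g"
proof -
  have "H1_norm (\<lambda>x. f x + (-1) * g x) \<le> H1_norm f + H1_norm (\<lambda>x. (-1) * g x)"
    using f g by (intro H1_norm_add) auto
  also have "\<dots> \<le> H1_norm f + H1_norm g"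
    using H1_norm_cmult[OF g, of "-1"] by (intro add_left_mono) simp
  finally show ?thesis by simp
qed

lemma H1_sum: "(\<And>i. i \<in> I \<Longrightarrow> f i \<in> H1) \<Longrightarrow> (\<lambda>x. \<Sum>i\<in>I. f i x) \<in> H1"
  by (induction I rule: infinite_finite_induct) (auto intro!: H1_zero H1_add)

lemma H1_norm_sum:
  "(\<And>i. i \<in> I \<Longrightarrow> integrable lebesgue (f i)) \<Longrightarrow> H1_norm (\<lambda>x. \<Sum>i\<in>I. f i x) \<le> (\<Sum>i\<in>I. H1_norm (f i))"
proof (induction I rule: infinite_finite_induct)
  case (insert i I)
  then have "H1_norm (\<lambda>x. f i x + (\<Sum>i\<in>I. f i x)) \<le> H1_norm (f i) + H1_norm (\<lambda>x. \<Sum>i\<in>I. f i x)"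
    by (intro H1_norm_add) auto
  also have "\<dots> \<le> H1_norm (f i) + (\<Sum>i\<in>I. H1_norm (f i))" using insert by (intro add_left_mono) auto
  finally show ?case using insert by simp
qed (auto simp: H1_zero)

text \<open>Parabolic scaling: the exponential factors compensate for exp(-t), so both sides are the
  pure heat kernel at time 1/c^2. Dilations of one fixed kernel, as they occur in
  \<open>approx_identity\<close>, thus become the semigroup at small times.\<close>

lemma L_kernel_rescale:
  assumes c: "c > 0"
  shows "c ^ CARD('n) * (exp 1 * L_kernel 1 (c *\<^sub>R z)) = exp (1 / c\<^sup>2) * L_kernel (1 / c\<^sup>2) (z::real^'n)"
proof -
  let ?d = "real CARD('n) / 2"
  have "(4 * pi * (1 / c\<^sup>2)) powr - ?d = (4 * pi) powr - ?d * (1 / c\<^sup>2) powr - ?d"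
    by (rule powr_mult)
  also have "(1 / c\<^sup>2) powr - ?d = c ^ CARD('n)"
  proof -
    have "(1 / c\<^sup>2) powr - ?d = (c\<^sup>2) powr ?d" using c by (simp add: powr_divide powr_minus_divide)
    also have "\<dots> = c powr (2 * ?d)" using c by (simp add: powr_powr flip: powr_numeral)
    also have "\<dots> = c ^ CARD('n)" using c by (simp flip: powr_realpow)
    finally show ?thesis .
  qed
  finally have P: "(4 * pi * (1 / c\<^sup>2)) powr - ?d = (4 * pi) powr - ?d * c ^ CARD('n)" .
  have E: "exp 1 * exp (- 1) = (1::real)" "exp (1 / c\<^sup>2) * exp (- (1 / c\<^sup>2)) = (1::real)"
    by (simp_all flip: exp_add)
  have N: "- (norm (c *\<^sub>R z))\<^sup>2 / (4 * 1) = - (norm z)\<^sup>2 / (4 * (1 / c\<^sup>2))"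
    using c by (simp add: power_mult_distrib)
  have "c ^ CARD('n) * (exp 1 * L_kernel 1 (c *\<^sub>R z))
     = (exp 1 * exp (- 1)) * (c ^ CARD('n) * ((4 * pi * 1) powr - ?d * exp (- (norm (c *\<^sub>R z))\<^sup>2 / (4 * 1))))"
    unfolding L_kernel_def by (simp only: mult_ac)
  also have "\<dots> = c ^ CARD('n) * ((4 * pi * 1) powr - ?d * exp (- (norm z)\<^sup>2 / (4 * (1 / c\<^sup>2))))"
    unfolding E N by simp
  also have "\<dots> = (exp (1 / c\<^sup>2) * exp (- (1 / c\<^sup>2))) * ((4 * pi * (1 / c\<^sup>2)) powr - ?d * exp (- (norm z)\<^sup>2 / (4 * (1 / c\<^sup>2))))"
    unfolding E P by simp
  also have "\<dots> = exp (1 / c\<^sup>2) * L_kernel (1 / c\<^sup>2) z"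
    unfolding L_kernel_def by (simp only: mult_ac)
  finally show ?thesis .
qed

text \<open>Normalised to mass 1, the semigroup is an approximate identity as t tends to 0. So f is
  an \<open>L1\<close> limit of functions exp(t) \<open>L_semigroup t f\<close>, each of which is at
  most exp(t) times the maximal function.\<close>

lemma L1_norm_le_H1_norm:
  fixes f :: "real^'n \<Rightarrow> 'k::{real_normed_field,euclidean_space}"
  assumes f: "integrable lebesgue f"
  shows "L1_norm f \<le> H1_norm f"
proof (cases "H1_norm f")
  case top
  then show ?thesis by simp
next
  case (real h)
  obtain f' where f': "integrable lborel f'" and ae: "AE x in lborel. f x = f' x"
    using integrable_borel_representative[OF f] by blast
  have [measurable]: "f' \<in> borel_measurable borel" using f' by auto
  define k where "k = (\<lambda>z::real^'n. exp 1 * L_kernel 1 z)"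
  have kint: "integrable lborel k" "(LINT z|lborel. k z) = 1"
  proof -
    have "integrable lborel (L_kernel 1 :: real^'n \<Rightarrow> real)"
      using L_kernel_mass(1)[OF zero_less_one, where 'n='n] by (subst (asm) integrable_completion) auto
    moreover have "(LINT z|lborel. L_kernel 1 (z::real^'n)) = exp (- 1)"
      using L_kernel_mass(2)[OF zero_less_one, where 'n='n] by (subst (asm) integral_completion) auto
    ultimately show "integrable lborel k" "(LINT z|lborel. k z) = 1"
      unfolding k_def by (simp_all flip: exp_add)
  qed
  define c where "c = (\<lambda>m. real (Suc m))"
  have c: "c m > 0" for m by (simp add: c_def)
  define F where "F = (\<lambda>m x. LINT u|lborel. k u *\<^sub>R f' (x - (1 / c m) *\<^sub>R u))"
  have [measurable]: "k \<in> borel_measurable borel" unfolding k_def by measurable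
  have [measurable]: "F m \<in> borel_measurable borel" for m unfolding F_def by measurable
  have lim: "(\<lambda>m. \<integral>\<^sup>+x. ennreal (norm (F m x - f' x)) \<partial>lborel) \<longlonglongrightarrow> 0"
    unfolding F_def
  proof (rule approx_identity[OF f', where B = "exp 1 * (4 * pi * 1) powr (- (real CARD('n) / 2))"])
    show "k u \<le> exp 1 * (4 * pi * 1) powr (- (real CARD('n) / 2))" for u
      unfolding k_def by (intro mult_left_mono L_kernel_le) auto
    show "(\<lambda>m. 1 / c m) \<longlonglongrightarrow> 0" unfolding c_def by (rule LIMSEQ_Suc[OF lim_1_over_n])
    show "1 / c m \<noteq> 0" for m using c[of m] by simp
    show "0 \<le> k u" for u by (simp add: k_def L_kernel_nonneg)
  qed (use kint in auto)
  have Fx: "F m x = exp (1 / (c m)\<^sup>2) *\<^sub>R L_semigroup (1 / (c m)\<^sup>2) f x" for m x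
  proof -
    have "F m x = (LINT y|lborel. (c m ^ CARD('n) * k (c m *\<^sub>R (x - y))) *\<^sub>R f' y)"
      unfolding F_def using convolution_rescale[of f' k "c m" x] c by simp
    also have "\<dots> = (LINT y|lborel. exp (1 / (c m)\<^sup>2) *\<^sub>R (L_kernel (1 / (c m)\<^sup>2) (x - y) *\<^sub>R f' y))"
      unfolding k_def L_kernel_rescale[OF c] by simp
    finally show ?thesis by (simp only: integral_scaleR_right L_semigroup_rep[OF f f' ae])
  qed
  have "(\<integral>\<^sup>+x. ennreal (norm (f' x)) \<partial>lborel) \<le> ennreal h"
  proof (rule tendsto_lowerbound)
    have "(\<lambda>m. 1 / (c m)\<^sup>2) \<longlonglongrightarrow> 0"
      unfolding c_def using tendsto_power[OF LIMSEQ_Suc[OF lim_1_over_n[where 'a=real]], of 2] by (simp add: power_one_over)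
    then have "(\<lambda>m. exp (1 / (c m)\<^sup>2) * h) \<longlonglongrightarrow> exp 0 * h" by (intro tendsto_intros)
    then have "(\<lambda>m. (\<integral>\<^sup>+x. ennreal (norm (F m x - f' x)) \<partial>lborel) + ennreal (exp (1 / (c m)\<^sup>2) * h)) \<longlonglongrightarrow> 0 + ennreal (exp 0 * h)"
      by (intro tendsto_add lim tendsto_ennrealI)
    then show "(\<lambda>m. (\<integral>\<^sup>+x. ennreal (norm (F m x - f' x)) \<partial>lborel) + ennreal (exp (1 / (c m)\<^sup>2) * h)) \<longlonglongrightarrow> ennreal h"
      by simp
    show "\<forall>\<^sub>F m in sequentially. (\<integral>\<^sup>+x. ennreal (norm (f' x)) \<partial>lborel)
       \<le> (\<integral>\<^sup>+x. ennreal (norm (F m x - f' x)) \<partial>lborel) + ennreal (exp (1 / (c m)\<^sup>2) * h)"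
    proof (rule always_eventually, rule allI)
      fix m
      have "(\<integral>\<^sup>+x. ennreal (norm (f' x)) \<partial>lborel) \<le> (\<integral>\<^sup>+x. ennreal (norm (F m x - f' x)) + ennreal (exp (1 / (c m)\<^sup>2)) * maximal_L f x \<partial>lborel)"
      proof (rule nn_integral_mono)
        fix x
        have "ennreal (norm (f' x)) \<le> ennreal (norm (F m x - f' x)) + ennreal (norm (F m x))"
          using norm_triangle_ineq4[of "F m x" "F m x - f' x"] by (simp add: add.commute flip: ennreal_plus)
        also have "ennreal (norm (F m x)) = ennreal (exp (1 / (c m)\<^sup>2)) * ennreal (norm (L_semigroup (1 / (c m)\<^sup>2) f x))"
          unfolding Fx by (simp add: ennreal_mult)
        also have "\<dots> \<le> ennreal (exp (1 / (c m)\<^sup>2)) * maximal_L f x"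
          using c[of m] by (intro mult_left_mono maximal_L_ge) auto
        finally show "ennreal (norm (f' x)) \<le> ennreal (norm (F m x - f' x)) + ennreal (exp (1 / (c m)\<^sup>2)) * maximal_L f x"
          by (simp add: add_left_mono)
      qed
      also have "\<dots> = (\<integral>\<^sup>+x. ennreal (norm (F m x - f' x)) \<partial>lborel) + ennreal (exp (1 / (c m)\<^sup>2)) * H1_norm f"
        using f by (simp add: nn_integral_add nn_integral_cmult H1_norm_lborel)
      finally show "(\<integral>\<^sup>+x. ennreal (norm (f' x)) \<partial>lborel)
       \<le> (\<integral>\<^sup>+x. ennreal (norm (F m x - f' x)) \<partial>lborel) + ennreal (exp (1 / (c m)\<^sup>2) * h)"
        using real by (simp add: ennreal_mult)
    qed
  qed simp
  moreover have "L1_norm f = (\<integral>\<^sup>+x. ennreal (norm (f' x)) \<partial>lborel)"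
    unfolding L1_norm_lborel using ae by (intro nn_integral_cong_AE) (auto elim!: eventually_mono)
  ultimately show ?thesis using real by simp
qed

lemma integrable_L1_norm:
  fixes f :: "real^'n \<Rightarrow> 'k::{real_normed_field,euclidean_space}"
  shows "integrable lebesgue f \<Longrightarrow> L1_norm f < \<infinity>"
  by (simp add: L1_norm_def integrable_iff_bounded)

lemma integrableI_L1_norm:
  fixes f :: "real^'n \<Rightarrow> 'k::{real_normed_field,euclidean_space}"
  shows "f \<in> borel_measurable lebesgue \<Longrightarrow> L1_norm f < \<infinity> \<Longrightarrow> integrable lebesgue f"
  by (simp add: L1_norm_def integrable_iff_bounded)

text \<open>Each kernel is bounded, so convergence in \<open>L1\<close> gives pointwise convergence
  of \<open>L_semigroup t\<close> for every t and x, and Fatou's lemma does the rest. This lets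
  estimates for dyadic averages pass to the function itself.\<close>

lemma H1_norm_le_liminf:
  fixes u :: "nat \<Rightarrow> real^'n \<Rightarrow> 'k::{real_normed_field,euclidean_space}"
  assumes u: "\<And>n. integrable lebesgue (u n)" and v: "integrable lebesgue v"
    and lim: "(\<lambda>n. L1_norm (\<lambda>x. u n x - v x)) \<longlonglongrightarrow> 0"
  shows "H1_norm v \<le> liminf (\<lambda>n. H1_norm (u n))"
proof -
  have conv: "(\<lambda>n. L_semigroup t (u n) x) \<longlonglongrightarrow> L_semigroup t v x" if t: "t > 0" for t x
  proof -
    let ?B = "(4 * pi * t) powr (- (real CARD('n) / 2))"
    have "(\<lambda>n. ennreal (norm (L_semigroup t (u n) x - L_semigroup t v x))) \<longlonglongrightarrow> 0"
    proof (rule tendsto_sandwich[OF _ _ tendsto_const])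
      show "\<forall>\<^sub>F n in sequentially. ennreal (norm (L_semigroup t (u n) x - L_semigroup t v x)) \<le> ennreal ?B * L1_norm (\<lambda>x. u n x - v x)"
      proof (rule always_eventually, rule allI)
        fix n
        have i: "integrable lebesgue (\<lambda>x. u n x - v x)" using u v by simp
        have [measurable]: "(\<lambda>x. u n x - v x) \<in> borel_measurable lebesgue" using i by auto
        have "ennreal (norm (L_semigroup t (\<lambda>x. u n x - v x) x)) \<le> (\<integral>\<^sup>+y. ennreal (L_kernel t (x - y)) * ennreal (norm (u n y - v y)) \<partial>lebesgue)"
          using L_semigroup_norm_le[OF i t, of x] by (simp add: nn_integral_completion)
        also have "\<dots> \<le> (\<integral>\<^sup>+y. ennreal ?B * ennreal (norm (u n y - v y)) \<partial>lebesgue)"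
          by (intro nn_integral_mono mult_right_mono ennreal_leI L_kernel_le t) simp
        also have "\<dots> = ennreal ?B * L1_norm (\<lambda>x. u n x - v x)"
          unfolding L1_norm_def by (rule nn_integral_cmult) measurable
        finally show "ennreal (norm (L_semigroup t (u n) x - L_semigroup t v x)) \<le> ennreal ?B * L1_norm (\<lambda>x. u n x - v x)"
          unfolding L_semigroup_diff[OF u v t] .
      qed
      have "(\<lambda>n. ennreal ?B * L1_norm (\<lambda>x. u n x - v x)) \<longlonglongrightarrow> ennreal ?B * 0"
        by (intro ennreal_tendsto_cmult lim) simp
      then show "(\<lambda>n. ennreal ?B * L1_norm (\<lambda>x. u n x - v x)) \<longlonglongrightarrow> 0" by simp
    qed simp
    then have "(\<lambda>n. norm (L_semigroup t (u n) x - L_semigroup t v x)) \<longlonglongrightarrow> 0"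
      by (simp add: tendsto_ennreal_iff[of _ _ 0, simplified] ennreal_0[symmetric] del: ennreal_0)
    then show ?thesis by (simp add: tendsto_norm_zero_iff LIM_zero_cancel)
  qed
  have pw: "maximal_L v x \<le> liminf (\<lambda>n. maximal_L (u n) x)" for x
  proof (rule maximal_L_leI)
    fix t :: real assume t: "t > 0"
    have "(\<lambda>n. ennreal (norm (L_semigroup t (u n) x))) \<longlonglongrightarrow> ennreal (norm (L_semigroup t v x))"
      by (intro tendsto_ennrealI tendsto_norm conv t)
    then have "ennreal (norm (L_semigroup t v x)) = liminf (\<lambda>n. ennreal (norm (L_semigroup t (u n) x)))"
      by (rule lim_imp_Liminf[OF trivial_limit_sequentially, symmetric])
    also have "\<dots> \<le> liminf (\<lambda>n. maximal_L (u n) x)"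
      by (intro Liminf_mono always_eventually allI maximal_L_ge t)
    finally show "ennreal (norm (L_semigroup t v x)) \<le> liminf (\<lambda>n. maximal_L (u n) x)" .
  qed
  have "H1_norm v \<le> (\<integral>\<^sup>+x. liminf (\<lambda>n. maximal_L (u n) x) \<partial>lborel)"
    unfolding H1_norm_lborel by (rule nn_integral_mono[OF pw])
  also have "\<dots> \<le> liminf (\<lambda>n. \<integral>\<^sup>+x. maximal_L (u n) x \<partial>lborel)"
    using u by (intro nn_integral_liminf) auto
  finally show ?thesis by (simp add: H1_norm_lborel)
qed

text \<open>The limit v is prescribed, in the applications as f or b f, and is reached almost
  everywhere along a subsequence; integrability of v belongs to the conclusion. Fatou's lemma
  identifies v with the \<open>L1\<close> limit, and lower semicontinuity of \<open>H1_norm\<close>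
  transfers the rate.\<close>

lemma H1_limit:
  fixes u :: "nat \<Rightarrow> real^'n \<Rightarrow> 'k::{real_normed_field,euclidean_space}"
  assumes u: "\<And>n. u n \<in> H1" and v[measurable]: "v \<in> borel_measurable lebesgue"
    and r: "strict_mono (r :: nat \<Rightarrow> nat)" and ae: "AE x in lebesgue. (\<lambda>n. u (r n) x) \<longlonglongrightarrow> v x"
    and cauchy: "\<And>n m. n \<le> m \<Longrightarrow> H1_norm (\<lambda>x. u m x - u n x) \<le> \<epsilon> n" and \<epsilon>: "\<epsilon> \<longlonglongrightarrow> 0"
  shows "v \<in> H1 \<and> (\<forall>n. H1_norm (\<lambda>x. v x - u n x) \<le> \<epsilon> n)"
proof -
  have ui: "integrable lebesgue (u n)" for n using u by (rule H1_D)
  have [measurable]: "u n \<in> borel_measurable lebesgue" for n using ui by auto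
  have L1: "L1_norm (\<lambda>x. v x - u n x) \<le> \<epsilon> n" for n
  proof -
    have "L1_norm (\<lambda>x. v x - u n x) = (\<integral>\<^sup>+x. liminf (\<lambda>m. ennreal (norm (u (r m) x - u n x))) \<partial>lebesgue)"
      unfolding L1_norm_def
    proof (rule nn_integral_cong_AE)
      show "AE x in lebesgue. ennreal (norm (v x - u n x)) = liminf (\<lambda>m. ennreal (norm (u (r m) x - u n x)))"
        using ae by eventually_elim (intro lim_imp_Liminf[symmetric] tendsto_ennrealI tendsto_norm tendsto_diff tendsto_const; simp)
    qed
    also have "\<dots> \<le> liminf (\<lambda>m. \<integral>\<^sup>+x. ennreal (norm (u (r m) x - u n x)) \<partial>lebesgue)"
      by (rule nn_integral_liminf) measurable
    also have "\<dots> \<le> \<epsilon> n"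
    proof (rule Liminf_le)
      show "\<forall>\<^sub>F m in sequentially. (\<integral>\<^sup>+x. ennreal (norm (u (r m) x - u n x)) \<partial>lebesgue) \<le> \<epsilon> n"
        using eventually_ge_at_top[of n]
      proof eventually_elim
        case (elim m)
        then have "n \<le> r m" using seq_suble[OF r, of m] by simp
        have "L1_norm (\<lambda>x. u (r m) x - u n x) \<le> H1_norm (\<lambda>x. u (r m) x - u n x)"
          using ui by (intro L1_norm_le_H1_norm) simp
        also have "\<dots> \<le> \<epsilon> n" by (rule cauchy[OF \<open>n \<le> r m\<close>])
        finally show ?case by (simp add: L1_norm_def)
      qed
    qed simp
    finally show ?thesis .
  qed
  have lim: "(\<lambda>n. L1_norm (\<lambda>x. v x - u n x)) \<longlonglongrightarrow> 0"
    by (rule tendsto_sandwich[OF _ _ tendsto_const \<epsilon>]) (auto intro!: always_eventually L1)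
  have "eventually (\<lambda>n. \<epsilon> n < 1) sequentially" using \<epsilon> by (rule order_tendstoD) simp
  then obtain n0 where n0: "\<epsilon> n0 < 1" by (auto simp: eventually_sequentially)
  have "L1_norm (\<lambda>x. v x - u n0 x) < \<infinity>" using le_less_trans[OF L1 n0] by (rule less_trans) simp
  then have "integrable lebesgue (\<lambda>x. v x - u n0 x)" by (intro integrableI_L1_norm) measurable
  then have "integrable lebesgue (\<lambda>x. (v x - u n0 x) + u n0 x)" using ui by (rule Bochner_Integration.integrable_add)
  then have vi: "integrable lebesgue v" by simp
  have H: "H1_norm (\<lambda>x. v x - u n x) \<le> \<epsilon> n" for n
  proof -
    have "H1_norm (\<lambda>x. v x - u n x) \<le> liminf (\<lambda>m. H1_norm (\<lambda>x. u m x - u n x))"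
    proof (rule H1_norm_le_liminf)
      show "(\<lambda>m. L1_norm (\<lambda>x. u m x - u n x - (v x - u n x))) \<longlonglongrightarrow> 0"
        using lim by (simp add: L1_norm_def norm_minus_commute)
    qed (use ui vi in auto)
    also have "\<dots> \<le> \<epsilon> n"
    proof (rule Liminf_le)
      show "\<forall>\<^sub>F m in sequentially. H1_norm (\<lambda>x. u m x - u n x) \<le> \<epsilon> n"
        using eventually_ge_at_top[of n] by eventually_elim (rule cauchy)
    qed simp
    finally show ?thesis .
  qed
  have "H1_norm (\<lambda>x. v x - u n0 x) < \<infinity>" using le_less_trans[OF H n0] by (rule less_trans) simp
  then have "(\<lambda>x. v x - u n0 x) \<in> H1" using vi ui by (simp add: H1_def)
  then have "(\<lambda>x. (v x - u n0 x) + u n0 x) \<in> H1" by (rule H1_add[OF _ u])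
  then show ?thesis using H by simp
qed

section \<open>Hardy norm of functions supported in a ball\<close>

lemma maximal_L_bounded:
  fixes h :: "real^'n \<Rightarrow> 'k::{real_normed_field,euclidean_space}"
  assumes h: "integrable lebesgue h" and M: "\<And>y. norm (h y) \<le> M"
  shows "maximal_L h x \<le> ennreal M"
proof (rule maximal_L_leI)
  fix t :: real assume t: "t > 0"
  have "ennreal (norm (L_semigroup t h x)) \<le> (\<integral>\<^sup>+y. ennreal (L_kernel t (x - y)) * ennreal (norm (h y)) \<partial>lborel)"
    by (rule L_semigroup_norm_le[OF h t])
  also have "\<dots> \<le> (\<integral>\<^sup>+y. ennreal (L_kernel t (x - y)) * ennreal M \<partial>lborel)"
    by (intro nn_integral_mono mult_left_mono ennreal_leI M) simp
  also have "\<dots> = ennreal (exp (- t)) * ennreal M"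
    by (subst nn_integral_multc) (auto simp: nn_integral_L_kernel[OF t])
  also have "\<dots> \<le> 1 * ennreal M" using t by (intro mult_right_mono) (auto simp: ennreal_le_1)
  finally show "ennreal (norm (L_semigroup t h x)) \<le> ennreal M" by simp
qed

lemma integral_kernel_local:
  fixes h :: "real^'n \<Rightarrow> 'k::{real_normed_field,euclidean_space}"
  assumes M: "\<And>y. norm (h y) \<le> M" and supp: "\<And>y. y \<notin> ball c r \<Longrightarrow> h y = 0" and r: "r > 0"
    and A: "\<And>y. y \<in> ball c r \<Longrightarrow> \<bar>k y\<bar> \<le> A"
  shows "norm (LINT y|lebesgue. k y *\<^sub>R h y) \<le> A * M * (unit_ball_vol (real CARD('n)) * r ^ CARD('n))"
proof -
  have A0: "A \<ge> 0" using A[of c] r by (metis abs_ge_zero centre_in_ball order_trans)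
  have M0: "M \<ge> 0" using M[of c] by (metis norm_ge_zero order_trans)
  have \<omega>: "unit_ball_vol (real CARD('n)) \<ge> 0" by (simp add: unit_ball_vol_nonneg)
  have "ennreal (norm (LINT y|lebesgue. k y *\<^sub>R h y)) \<le> (\<integral>\<^sup>+y. ennreal (norm (k y *\<^sub>R h y)) \<partial>lebesgue)"
  proof (cases "integrable lebesgue (\<lambda>y. k y *\<^sub>R h y)")
    case True
    then show ?thesis by (rule integral_norm_bound_ennreal)
  qed (simp add: not_integrable_integral_eq)
  also have "\<dots> \<le> (\<integral>\<^sup>+y. ennreal (A * M) * indicator (ball c r) y \<partial>lebesgue)"
  proof (rule nn_integral_mono)
    fix y
    show "ennreal (norm (k y *\<^sub>R h y)) \<le> ennreal (A * M) * indicator (ball c r) y"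
    proof (cases "y \<in> ball c r")
      case True
      have "norm (k y *\<^sub>R h y) \<le> A * M" unfolding norm_scaleR by (intro mult_mono A True M A0) simp
      then show ?thesis using True by (simp add: ennreal_leI)
    qed (use supp in simp)
  qed
  also have "\<dots> = ennreal (A * M) * ennreal (unit_ball_vol (real CARD('n)) * r ^ CARD('n))"
    using r by (simp add: nn_integral_cmult_indicator nn_integral_completion emeasure_ball)
  also have "\<dots> = ennreal (A * M * (unit_ball_vol (real CARD('n)) * r ^ CARD('n)))"
    using A0 M0 \<omega> r by (simp add: ennreal_mult)
  finally show ?thesis using A0 M0 \<omega> r by (subst (asm) ennreal_le_iff) auto
qed

text \<open>On the ball of radius 2r the maximal function is at most M; outside it the decay is
  integrated. The exponent \<beta> is left open because functions with and without mean zero have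
  different rates.\<close>

lemma H1_norm_from_decay:
  fixes \<beta> :: real
  assumes \<beta>: "\<beta> > 0"
  obtains C where "C > 0"
    and "\<And>(h :: real^'n \<Rightarrow> 'k::{real_normed_field,euclidean_space}) r A M c. integrable lebesgue h \<Longrightarrow> r > 0 \<Longrightarrow> A \<ge> 0 \<Longrightarrow>
     (\<And>y. norm (h y) \<le> M) \<Longrightarrow>
     (\<And>x. 2 * r \<le> norm (x - c) \<Longrightarrow> maximal_L h x \<le> ennreal (A * norm (x - c) powr (- (real CARD('n) + \<beta>)))) \<Longrightarrow>
     H1_norm h \<le> ennreal (C * (M * r ^ CARD('n) + A * r powr (- \<beta>)))"
proof -
  obtain C0 where C0: "C0 > 0" "\<And>r. r > 0 \<Longrightarrow> (\<integral>\<^sup>+z. ennreal (norm z powr (- (real CARD('n) + \<beta>))) * indicator {z. r \<le> norm z} (z::real^'n) \<partial>lborel)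
     \<le> ennreal (C0 * r powr (- \<beta>))"
    using radial_tail[OF \<beta>, where 'n='n] by blast
  define \<omega> where "\<omega> = unit_ball_vol (real CARD('n))"
  have \<omega>: "\<omega> > 0" unfolding \<omega>_def by (intro unit_ball_vol_pos) simp
  define C where "C = max (\<omega> * 2 ^ CARD('n)) (C0 * 2 powr (- \<beta>))"
  have C: "C > 0" using \<omega> C0(1) by (simp add: C_def less_max_iff_disj)
  have main: "H1_norm h \<le> ennreal (C * (M * r ^ CARD('n) + A * r powr (- \<beta>)))"
    if h: "integrable lebesgue h" and r: "r > 0" and A: "A \<ge> 0" and M: "\<And>y. norm (h y) \<le> M"
      and dec: "\<And>x. 2 * r \<le> norm (x - c) \<Longrightarrow> maximal_L h x \<le> ennreal (A * norm (x - c) powr (- (real CARD('n) + \<beta>)))"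
    for h :: "real^'n \<Rightarrow> 'k" and r A M c
  proof -
    have M0: "M \<ge> 0" using M[of 0] by (metis norm_ge_zero order_trans)
    let ?F = "\<lambda>z::real^'n. ennreal (norm z powr (- (real CARD('n) + \<beta>))) * indicator {z. 2 * r \<le> norm z} z"
    have cl: "closed {z::real^'n. 2 * r \<le> norm z}" by (intro closed_Collect_le continuous_intros)
    have Fm[measurable]: "?F \<in> borel_measurable borel"
      using cl by (intro borel_measurable_times_ennreal borel_measurable_indicator) auto
    have Fc[measurable]: "(\<lambda>x. ?F (- c + x)) \<in> borel_measurable borel"
      by (rule measurable_compose[OF _ Fm]) measurable
    have pw: "maximal_L h x \<le> ennreal M * indicator (ball c (2 * r)) x + ennreal A * ?F (- c + x)" for x
    proof (cases "x \<in> ball c (2 * r)")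
      case True
      have "maximal_L h x \<le> ennreal M" using M by (intro maximal_L_bounded h) auto
      then show ?thesis using True by (simp add: add_increasing2)
    next
      case False
      then have n: "2 * r \<le> norm (x - c)" by (simp add: dist_norm norm_minus_commute)
      then have "maximal_L h x \<le> ennreal (A * norm (x - c) powr (- (real CARD('n) + \<beta>)))" using dec by blast
      also have "\<dots> = ennreal A * ?F (- c + x)" using A n by (simp add: ennreal_mult)
      finally show ?thesis by (simp add: add_increasing)
    qed
    have "H1_norm h \<le> (\<integral>\<^sup>+x. ennreal M * indicator (ball c (2 * r)) x + ennreal A * ?F (- c + x) \<partial>lborel)"
      unfolding H1_norm_lborel by (intro nn_integral_mono pw)
    also have "\<dots> = (\<integral>\<^sup>+x. ennreal M * indicator (ball c (2 * r)) x \<partial>lborel) + (\<integral>\<^sup>+x. ennreal A * ?F (- c + x) \<partial>lborel)"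
      by (intro nn_integral_add borel_measurable_times_ennreal borel_measurable_indicator) (use Fc in auto)
    also have "(\<integral>\<^sup>+x. ennreal M * indicator (ball c (2 * r)) x \<partial>lborel) = ennreal (M * (\<omega> * (2 * r) ^ CARD('n)))"
      using r M0 \<omega> by (simp add: nn_integral_cmult_indicator emeasure_ball \<omega>_def[symmetric] ennreal_mult)
    also have "(\<integral>\<^sup>+x. ennreal A * ?F (- c + x) \<partial>lborel) = ennreal A * (\<integral>\<^sup>+x. ?F (- c + x) \<partial>lborel)"
      using Fc by (intro nn_integral_cmult) simp
    also have "(\<integral>\<^sup>+x. ?F (- c + x) \<partial>lborel) = (\<integral>\<^sup>+x. ?F x \<partial>lborel)"
      by (rule nn_integral_lborel_translate[OF Fm])
    finally have "H1_norm h \<le> ennreal (M * (\<omega> * (2 * r) ^ CARD('n))) + ennreal A * (\<integral>\<^sup>+x. ?F x \<partial>lborel)" .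
    also have "\<dots> \<le> ennreal (M * (\<omega> * (2 * r) ^ CARD('n))) + ennreal A * ennreal (C0 * (2 * r) powr (- \<beta>))"
      using r by (intro add_left_mono mult_left_mono C0(2)) auto
    also have "\<dots> = ennreal ((\<omega> * 2 ^ CARD('n)) * (M * r ^ CARD('n)) + (C0 * 2 powr (- \<beta>)) * (A * r powr (- \<beta>)))"
      using r M0 A C0(1) \<omega> by (simp add: ennreal_mult[symmetric] ennreal_plus[symmetric] power_mult_distrib powr_mult mult_ac del: ennreal_plus)
    also have "\<dots> \<le> ennreal (C * (M * r ^ CARD('n)) + C * (A * r powr (- \<beta>)))"
      using M0 A r by (intro ennreal_leI add_mono mult_right_mono) (auto simp: C_def)
    finally show ?thesis by (simp add: distrib_left)
  qed
  show thesis by (rule that[OF C]) (fact main)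
qed

lemma ball_dist_half:
  fixes x c y :: "'a::real_normed_vector"
  assumes "2 * r \<le> norm (x - c)" "y \<in> ball c r"
  shows "norm (x - c) / 2 \<le> norm (x - y)" "x \<noteq> y"
proof -
  have "norm (c - y) < r" using assms(2) by (simp add: dist_norm)
  moreover have "norm (x - c) \<le> norm (x - y) + norm (c - y)"
    using norm_triangle_ineq4[of "x - y" "c - y"] by simp
  ultimately show "norm (x - c) / 2 \<le> norm (x - y)" using assms(1) by linarith
  then show "x \<noteq> y" using \<open>norm (c - y) < r\<close> assms(1) by auto
qed

text \<open>Without cancellation only the size of the kernel helps. The choice \<gamma> = 1/4 gives
  decay of order d + 1/2 and produces the factor r^(-1/2). The true loss for small r is logarithmic,
  but any power of 1/r below the first is affordable against the Sobolev gain.\<close>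

lemma H1_norm_bounded_support:
  obtains C where "C > 0"
    and "\<And>(h :: real^'n \<Rightarrow> 'k::{real_normed_field,euclidean_space}) r M c. integrable lebesgue h \<Longrightarrow> r > 0 \<Longrightarrow>
     (\<And>y. norm (h y) \<le> M) \<Longrightarrow> (\<And>y. y \<notin> ball c r \<Longrightarrow> h y = 0) \<Longrightarrow>
     H1_norm h \<le> ennreal (C * M * r ^ CARD('n) * (1 + r powr (- (1/2))))"
proof -
  define d where "d = real CARD('n)"
  obtain C0 where C0: "C0 > 0" and H: "\<And>(h :: real^'n \<Rightarrow> 'k) r A M c. integrable lebesgue h \<Longrightarrow> r > 0 \<Longrightarrow> A \<ge> 0 \<Longrightarrow>
     (\<And>y. norm (h y) \<le> M) \<Longrightarrow>
     (\<And>x. 2 * r \<le> norm (x - c) \<Longrightarrow> maximal_L h x \<le> ennreal (A * norm (x - c) powr (- (real CARD('n) + 1/2)))) \<Longrightarrow>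
     H1_norm h \<le> ennreal (C0 * (M * r ^ CARD('n) + A * r powr (- (1/2))))"
    by (fact H1_norm_from_decay[where \<beta> = "1/2" and 'n='n and 'k='k, OF half_gt_zero[OF zero_less_one]])
  obtain C1 where C1: "C1 > 0" "\<And>t z::real^'n. t > 0 \<Longrightarrow> z \<noteq> 0 \<Longrightarrow> L_kernel t z \<le> C1 * norm z powr (- (d + 2 * (1/4)))"
    using L_kernel_bound[of "1/4", where 'n='n] unfolding d_def by auto
  define \<omega> where "\<omega> = unit_ball_vol d"
  have \<omega>: "\<omega> > 0" unfolding \<omega>_def d_def by (intro unit_ball_vol_pos) simp
  define B where "B = C1 * 2 powr (d + 1/2) * \<omega>"
  have B: "B > 0" using C1 \<omega> by (simp add: B_def)
  have main: "H1_norm h \<le> ennreal (C0 * (1 + B) * M * r ^ CARD('n) * (1 + r powr (- (1/2))))"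
    if h: "integrable lebesgue h" and r: "r > 0" and M: "\<And>y. norm (h y) \<le> M" and supp: "\<And>y. y \<notin> ball c r \<Longrightarrow> h y = 0"
    for h :: "real^'n \<Rightarrow> 'k" and r M c
  proof -
    have M0: "M \<ge> 0" using M[of 0] by (metis norm_ge_zero order_trans)
    have "H1_norm h \<le> ennreal (C0 * (M * r ^ CARD('n) + (B * M * r ^ CARD('n)) * r powr (- (1/2))))"
    proof (rule H[where c = c, OF h r, folded d_def])
      show "B * M * r ^ CARD('n) \<ge> 0" using B M0 r by simp
      show "norm (h y) \<le> M" for y using M by simp
      fix x assume x: "2 * r \<le> norm (x - c)"
      show "maximal_L h x \<le> ennreal (B * M * r ^ CARD('n) * norm (x - c) powr (- (d + 1/2)))"
      proof (rule maximal_L_leI, rule ennreal_leI)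
        fix t :: real assume t: "t > 0"
        have "norm (LINT y|lebesgue. L_kernel t (x - y) *\<^sub>R h y) \<le> (C1 * (norm (x - c) / 2) powr (- (d + 1/2))) * M * (\<omega> * r ^ CARD('n))"
        proof (rule integral_kernel_local[where c = c, OF _ _ r, folded d_def \<omega>_def])
          fix y assume y: "y \<in> ball c r"
          have ge: "norm (x - c) / 2 \<le> norm (x - y)" and ne: "x - y \<noteq> 0" using ball_dist_half[OF x y] by auto
          have "L_kernel t (x - y) \<le> C1 * norm (x - y) powr (- (d + 1/2))" using C1(2)[OF t ne] by simp
          also have "\<dots> \<le> C1 * (norm (x - c) / 2) powr (- (d + 1/2))"
            using C1(1) x r by (intro mult_left_mono powr_mono2' ge) (auto simp: d_def)
          finally show "\<bar>L_kernel t (x - y)\<bar> \<le> C1 * (norm (x - c) / 2) powr (- (d + 1/2))" by (simp add: L_kernel_nonneg)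
        qed (use M supp in auto)
        also have "(norm (x - c) / 2) powr (- (d + 1/2)) = 2 powr (d + 1/2) * norm (x - c) powr (- (d + 1/2))"
          by (simp only: powr_divide powr_minus) (simp add: field_simps)
        finally show "norm (L_semigroup t h x) \<le> B * M * r ^ CARD('n) * norm (x - c) powr (- (d + 1/2))"
          unfolding L_semigroup_def B_def by (simp only: mult_ac)
      qed
    qed
    also have "\<dots> \<le> ennreal (C0 * (1 + B) * M * r ^ CARD('n) * (1 + r powr (- (1/2))))"
    proof (rule ennreal_leI)
      have "M * r ^ CARD('n) + (B * M * r ^ CARD('n)) * r powr (- (1/2)) \<le> (M * r ^ CARD('n)) * ((1 + B) * (1 + r powr (- (1/2))))"
        using M0 r B by (simp add: algebra_simps)
      then have "C0 * (M * r ^ CARD('n) + (B * M * r ^ CARD('n)) * r powr (- (1/2))) \<le> C0 * ((M * r ^ CARD('n)) * ((1 + B) * (1 + r powr (- (1/2)))))"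
        using C0 by (intro mult_left_mono) auto
      then show "C0 * (M * r ^ CARD('n) + (B * M * r ^ CARD('n)) * r powr (- (1/2))) \<le> C0 * (1 + B) * M * r ^ CARD('n) * (1 + r powr (- (1/2)))"
        by (simp only: mult_ac)
    qed
    finally show ?thesis .
  qed
  have "C0 * (1 + B) > 0" using C0 B by simp
  then show thesis by (rule that) (fact main)
qed

text \<open>The whole ball of radius r around x - c stays at distance at least |x - c|/2 from the
  origin, so the gradient estimate holds throughout and the mean value inequality gains one power of
  r.\<close>

lemma L_kernel_differentiable_bound:
  obtains C where "C > 0"
    and "\<And>t r (x::real^'n) c y. t > 0 \<Longrightarrow> 2 * r \<le> norm (x - c) \<Longrightarrow> y \<in> ball c r \<Longrightarrow>
     \<bar>L_kernel t (x - y) - L_kernel t (x - c)\<bar> \<le> C * r * norm (x - c) powr (- (real CARD('n) + 1))"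
proof -
  define d where "d = real CARD('n)"
  obtain C where C: "C > 0" "\<And>t z::real^'n. t > 0 \<Longrightarrow> z \<noteq> 0 \<Longrightarrow> norm z / (2 * t) * L_kernel t z \<le> C * norm z powr (- (d + 1))"
    using L_kernel_gradient_bound[where 'n='n] unfolding d_def by blast
  have main: "\<bar>L_kernel t (x - y) - L_kernel t (x - c)\<bar> \<le> (C * 2 powr (d + 1)) * r * norm (x - c) powr (- (real CARD('n) + 1))"
    if t: "t > 0" and x: "2 * r \<le> norm (x - c)" and y: "y \<in> ball c r" for t r and x c y :: "real^'n"
  proof -
    have r: "r > 0" using y by (metis ball_eq_empty emptyE not_less)
    let ?B = "C * (norm (x - c) / 2) powr (- (d + 1))"
    have "norm (L_kernel t (x - y) - L_kernel t (x - c)) \<le> ?B * norm ((x - y) - (x - c))"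
    proof (rule differentiable_bound[of "ball (x - c) r" "L_kernel t" "\<lambda>z h. - (z \<bullet> h) / (2 * t) * L_kernel t z"])
      show "convex (ball (x - c) r)" by (rule convex_ball)
      fix z assume z: "z \<in> ball (x - c) r"
      show "(L_kernel t has_derivative (\<lambda>h. - (z \<bullet> h) / (2 * t) * L_kernel t z)) (at z within ball (x - c) r)"
        by (rule has_derivative_at_withinI[OF L_kernel_has_derivative]) (use t in simp)
      have "x - z \<in> ball c r" using z by (simp add: dist_norm algebra_simps norm_minus_commute)
      then have ge: "norm (x - c) / 2 \<le> norm z" and ne: "z \<noteq> 0" using ball_dist_half[OF x, of "x - z"] by auto
      show "onorm (\<lambda>h. - (z \<bullet> h) / (2 * t) * L_kernel t z) \<le> ?B"
      proof (rule onorm_le)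
        fix h
        have "norm (- (z \<bullet> h) / (2 * t) * L_kernel t z) = \<bar>z \<bullet> h\<bar> * (L_kernel t z / (2 * t))"
          using t by (simp add: abs_mult L_kernel_nonneg)
        also have "\<dots> \<le> (norm z * norm h) * (L_kernel t z / (2 * t))"
          using t by (intro mult_right_mono Cauchy_Schwarz_ineq2) (simp add: L_kernel_nonneg)
        also have "\<dots> = (norm z / (2 * t) * L_kernel t z) * norm h" by simp
        also have "\<dots> \<le> (C * norm z powr (- (d + 1))) * norm h"
          by (intro mult_right_mono C t ne) simp
        also have "\<dots> \<le> ?B * norm h"
          using C(1) x r by (intro mult_right_mono mult_left_mono powr_mono2' ge) (auto simp: d_def)
        finally show "norm (- (z \<bullet> h) / (2 * t) * L_kernel t z) \<le> ?B * norm h" .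
      qed
    next
      show "x - y \<in> ball (x - c) r" using y by (simp add: dist_norm norm_minus_commute)
      show "x - c \<in> ball (x - c) r" using r by simp
    qed
    also have "\<dots> \<le> ?B * r"
      using y C(1) by (intro mult_left_mono) (auto simp: dist_norm norm_minus_commute)
    also have "(norm (x - c) / 2) powr (- (d + 1)) = 2 powr (d + 1) * norm (x - c) powr (- (d + 1))"
      by (simp only: powr_divide powr_minus) (simp add: field_simps)
    finally show ?thesis by (simp only: real_norm_def mult_ac d_def)
  qed
  have "C * 2 powr (d + 1) > 0" using C by simp
  then show thesis by (rule that) (fact main)
qed

text \<open>Mean zero allows the value of the kernel at x - c to be subtracted. The gain r from the
  mean value estimate cancels the r^(-1) of the tail integral with \<beta> = 1, so no power of r
  beyond r^d is left.\<close>

lemma H1_norm_mean_zero: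
  obtains C where "C > 0"
    and "\<And>(h :: real^'n \<Rightarrow> 'k::{real_normed_field,euclidean_space}) r M c. integrable lebesgue h \<Longrightarrow> r > 0 \<Longrightarrow>
     (\<And>y. norm (h y) \<le> M) \<Longrightarrow> (\<And>y. y \<notin> ball c r \<Longrightarrow> h y = 0) \<Longrightarrow> (LINT y|lebesgue. h y) = 0 \<Longrightarrow>
     H1_norm h \<le> ennreal (C * M * r ^ CARD('n))"
proof -
  define d where "d = real CARD('n)"
  obtain C0 where C0: "C0 > 0" and H: "\<And>(h :: real^'n \<Rightarrow> 'k) r A M c. integrable lebesgue h \<Longrightarrow> r > 0 \<Longrightarrow> A \<ge> 0 \<Longrightarrow>
     (\<And>y. norm (h y) \<le> M) \<Longrightarrow>
     (\<And>x. 2 * r \<le> norm (x - c) \<Longrightarrow> maximal_L h x \<le> ennreal (A * norm (x - c) powr (- (real CARD('n) + 1)))) \<Longrightarrow>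
     H1_norm h \<le> ennreal (C0 * (M * r ^ CARD('n) + A * r powr (- 1)))"
    by (fact H1_norm_from_decay[where \<beta> = 1 and 'n='n and 'k='k, OF zero_less_one])
  obtain C1 where C1: "C1 > 0" "\<And>t r (x::real^'n) c y. t > 0 \<Longrightarrow> 2 * r \<le> norm (x - c) \<Longrightarrow> y \<in> ball c r \<Longrightarrow>
     \<bar>L_kernel t (x - y) - L_kernel t (x - c)\<bar> \<le> C1 * r * norm (x - c) powr (- (real CARD('n) + 1))"
    by (fact L_kernel_differentiable_bound[where 'n='n])
  define \<omega> where "\<omega> = unit_ball_vol d"
  have \<omega>: "\<omega> > 0" unfolding \<omega>_def d_def by (intro unit_ball_vol_pos) simp
  have main: "H1_norm h \<le> ennreal (C0 * (1 + C1 * \<omega>) * M * r ^ CARD('n))"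
    if h: "integrable lebesgue h" and r: "r > 0" and M: "\<And>y. norm (h y) \<le> M" and supp: "\<And>y. y \<notin> ball c r \<Longrightarrow> h y = 0"
      and zero: "(LINT y|lebesgue. h y) = 0"
    for h :: "real^'n \<Rightarrow> 'k" and r M c
  proof -
    have M0: "M \<ge> 0" using M[of 0] by (metis norm_ge_zero order_trans)
    have "H1_norm h \<le> ennreal (C0 * (M * r ^ CARD('n) + (C1 * r * M * \<omega> * r ^ CARD('n)) * r powr (- 1)))"
    proof (rule H[where c = c, OF h r, folded d_def])
      show "C1 * r * M * \<omega> * r ^ CARD('n) \<ge> 0" using C1 \<omega> M0 r by simp
      show "norm (h y) \<le> M" for y using M by simp
      fix x assume x: "2 * r \<le> norm (x - c)"
      show "maximal_L h x \<le> ennreal (C1 * r * M * \<omega> * r ^ CARD('n) * norm (x - c) powr (- (d + 1)))"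
      proof (rule maximal_L_leI, rule ennreal_leI)
        fix t :: real assume t: "t > 0"
        have "L_semigroup t h x = (LINT y|lebesgue. L_kernel t (x - y) *\<^sub>R h y) - L_kernel t (x - c) *\<^sub>R (LINT y|lebesgue. h y)"
          by (simp add: zero L_semigroup_def)
        also have "\<dots> = (LINT y|lebesgue. L_kernel t (x - y) *\<^sub>R h y - L_kernel t (x - c) *\<^sub>R h y)"
          using L_semigroup_integrable[OF h t, of x] h by simp
        also have "\<dots> = (LINT y|lebesgue. (L_kernel t (x - y) - L_kernel t (x - c)) *\<^sub>R h y)"
          by (simp add: scaleR_diff_left)
        finally have "norm (L_semigroup t h x) \<le> (C1 * r * norm (x - c) powr (- (d + 1))) * M * (\<omega> * r ^ CARD('n))"
          unfolding \<omega>_def d_def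
          by (simp only:) (rule integral_kernel_local[OF _ _ r], use M supp C1(2)[OF t x] in auto)
        then show "norm (L_semigroup t h x) \<le> C1 * r * M * \<omega> * r ^ CARD('n) * norm (x - c) powr (- (d + 1))"
          by (simp only: mult_ac)
      qed
    qed
    also have "C0 * (M * r ^ CARD('n) + (C1 * r * M * \<omega> * r ^ CARD('n)) * r powr (- 1)) = C0 * (1 + C1 * \<omega>) * M * r ^ CARD('n)"
      using r by (simp add: powr_minus_divide algebra_simps)
    finally show ?thesis .
  qed
  have "C0 * (1 + C1 * \<omega>) > 0" using C0 C1 \<omega> by (simp add: add_pos_pos)
  then show thesis by (rule that) (fact main)
qed

section \<open>Multiplication by bounded Lipschitz functions\<close>

lemma maximal_L_mult:
  fixes K :: "real^'n \<Rightarrow> real" and f :: "real^'n \<Rightarrow> 'k::{real_normed_field,euclidean_space}"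
  assumes Km[measurable]: "K \<in> borel_measurable borel" and K: "\<And>t z. t > 0 \<Longrightarrow> norm z * L_kernel t z \<le> K z"
    and v: "v \<in> borel_measurable borel" "\<And>x. \<bar>v x\<bar> \<le> A" "\<And>x y. \<bar>v x - v y\<bar> \<le> \<Lambda> * norm (x - y)" and \<Lambda>: "\<Lambda> \<ge> 0"
    and f: "integrable lebesgue f"
  shows "maximal_L (\<lambda>y. v y *\<^sub>R f y) x \<le> ennreal \<bar>v x\<bar> * maximal_L f x
     + ennreal \<Lambda> * (\<integral>\<^sup>+y. ennreal (K (x - y)) * ennreal (norm (f y)) \<partial>lebesgue)"
proof (rule maximal_L_leI)
  fix t :: real assume t: "t > 0"
  have K0: "K z \<ge> 0" for z using K[OF t, of z] L_kernel_nonneg[of t z] by (meson mult_nonneg_nonneg norm_ge_zero order_trans)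
  have [measurable]: "v \<in> borel_measurable lebesgue" using v(1) by (auto intro: measurable_completion)
  have [measurable]: "f \<in> borel_measurable lebesgue" using f by auto
  have vf: "integrable lebesgue (\<lambda>y. v y *\<^sub>R f y)" by (rule integrable_bounded_scaleR[OF f _ v(2)]) measurable
  \<comment> \<open>Freezing v at x leaves the kernel at x - y times v(y) - v(x); by the Lipschitz
    bound this is at most \<Lambda> K(x - y), uniformly in t.\<close>
  have "L_semigroup t (\<lambda>y. v y *\<^sub>R f y) x - v x *\<^sub>R L_semigroup t f x
     = (LINT y|lebesgue. L_kernel t (x - y) *\<^sub>R (v y *\<^sub>R f y) - v x *\<^sub>R (L_kernel t (x - y) *\<^sub>R f y))"
    unfolding L_semigroup_def
    by (subst Bochner_Integration.integral_diff)
       (use L_semigroup_integrable[OF f t, of x] L_semigroup_integrable[OF vf t, of x] in \<open>auto simp del: scaleR_scaleR\<close>)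
  also have "\<dots> = (LINT y|lebesgue. (L_kernel t (x - y) * (v y - v x)) *\<^sub>R f y)"
    by (simp add: algebra_simps)
  finally have eq: "L_semigroup t (\<lambda>y. v y *\<^sub>R f y) x - v x *\<^sub>R L_semigroup t f x = (LINT y|lebesgue. (L_kernel t (x - y) * (v y - v x)) *\<^sub>R f y)" .
  let ?I = "\<integral>\<^sup>+y. ennreal (K (x - y)) * ennreal (norm (f y)) \<partial>lebesgue"
  have "ennreal (norm (L_semigroup t (\<lambda>y. v y *\<^sub>R f y) x - v x *\<^sub>R L_semigroup t f x))
      \<le> (\<integral>\<^sup>+y. ennreal (norm ((L_kernel t (x - y) * (v y - v x)) *\<^sub>R f y)) \<partial>lebesgue)"
  proof (cases "integrable lebesgue (\<lambda>y. (L_kernel t (x - y) * (v y - v x)) *\<^sub>R f y)")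
    case True
    then show ?thesis unfolding eq by (rule integral_norm_bound_ennreal)
  qed (simp add: eq not_integrable_integral_eq)
  also have "\<dots> \<le> (\<integral>\<^sup>+y. ennreal \<Lambda> * (ennreal (K (x - y)) * ennreal (norm (f y))) \<partial>lebesgue)"
  proof (rule nn_integral_mono)
    fix y
    have "L_kernel t (x - y) * \<bar>v y - v x\<bar> \<le> L_kernel t (x - y) * (\<Lambda> * norm (x - y))"
      using v(3)[of x y] by (intro mult_left_mono L_kernel_nonneg) (simp add: abs_minus_commute)
    also have "\<dots> = \<Lambda> * (norm (x - y) * L_kernel t (x - y))" by simp
    also have "\<dots> \<le> \<Lambda> * K (x - y)" by (intro mult_left_mono K t \<Lambda>)
    finally have "norm ((L_kernel t (x - y) * (v y - v x)) *\<^sub>R f y) \<le> \<Lambda> * K (x - y) * norm (f y)"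
      by (simp add: abs_mult L_kernel_nonneg mult_right_mono)
    then have "ennreal (norm ((L_kernel t (x - y) * (v y - v x)) *\<^sub>R f y)) \<le> ennreal (\<Lambda> * K (x - y) * norm (f y))" by (rule ennreal_leI)
    also have "\<dots> = ennreal \<Lambda> * (ennreal (K (x - y)) * ennreal (norm (f y)))"
      using \<Lambda> K0 by (simp add: ennreal_mult mult.assoc)
    finally show "ennreal (norm ((L_kernel t (x - y) * (v y - v x)) *\<^sub>R f y)) \<le> ennreal \<Lambda> * (ennreal (K (x - y)) * ennreal (norm (f y)))" .
  qed
  finally have 1: "ennreal (norm (L_semigroup t (\<lambda>y. v y *\<^sub>R f y) x - v x *\<^sub>R L_semigroup t f x)) \<le> (\<integral>\<^sup>+y. ennreal \<Lambda> * (ennreal (K (x - y)) * ennreal (norm (f y))) \<partial>lebesgue)" .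
  have [measurable]: "(\<lambda>y. K (x - y)) \<in> borel_measurable lebesgue"
    by (rule measurable_completion) measurable
  have 2: "(\<integral>\<^sup>+y. ennreal \<Lambda> * (ennreal (K (x - y)) * ennreal (norm (f y))) \<partial>lebesgue) = ennreal \<Lambda> * ?I"
    by (rule nn_integral_cmult) measurable
  have "ennreal (norm (L_semigroup t (\<lambda>y. v y *\<^sub>R f y) x))
     \<le> ennreal (norm (v x *\<^sub>R L_semigroup t f x)) + ennreal (norm (L_semigroup t (\<lambda>y. v y *\<^sub>R f y) x - v x *\<^sub>R L_semigroup t f x))"
    using norm_triangle_ineq[of "v x *\<^sub>R L_semigroup t f x" "L_semigroup t (\<lambda>y. v y *\<^sub>R f y) x - v x *\<^sub>R L_semigroup t f x"]
    by (simp flip: ennreal_plus)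
  also have "\<dots> \<le> ennreal \<bar>v x\<bar> * maximal_L f x + ennreal \<Lambda> * ?I"
  proof (rule add_mono)
    show "ennreal (norm (v x *\<^sub>R L_semigroup t f x)) \<le> ennreal \<bar>v x\<bar> * maximal_L f x"
      by (simp add: ennreal_mult mult_left_mono maximal_L_ge[OF t])
  qed (use 1 2 in simp)
  finally show "ennreal (norm (L_semigroup t (\<lambda>y. v y *\<^sub>R f y) x)) \<le> ennreal \<bar>v x\<bar> * maximal_L f x + ennreal \<Lambda> * ?I" .
qed

text \<open>Tonelli and translation invariance. The inner integral is first rewritten with a Borel
  representative of f, which provides the joint measurability.\<close>

lemma nn_integral_convolution:
  fixes K :: "real^'n \<Rightarrow> real" and f :: "real^'n \<Rightarrow> 'k::{real_normed_field,euclidean_space}"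
  assumes K[measurable]: "K \<in> borel_measurable borel" and f: "integrable lebesgue f"
  shows "(\<integral>\<^sup>+x. \<integral>\<^sup>+y. ennreal (K (x - y)) * ennreal (norm (f y)) \<partial>lebesgue \<partial>lebesgue) = (\<integral>\<^sup>+z. ennreal (K z) \<partial>lborel) * L1_norm f"
    and "(\<lambda>x. \<integral>\<^sup>+y. ennreal (K (x - y)) * ennreal (norm (f y)) \<partial>lebesgue) \<in> borel_measurable borel"
proof -
  obtain f' where f': "integrable lborel f'" and ae: "AE x in lborel. f x = f' x"
    using integrable_borel_representative[OF f] by blast
  have [measurable]: "f' \<in> borel_measurable borel" using f' by auto
  have eq: "(\<integral>\<^sup>+y. ennreal (K (x - y)) * ennreal (norm (f y)) \<partial>lebesgue) = (\<integral>\<^sup>+y. ennreal (K (x - y)) * ennreal (norm (f' y)) \<partial>lborel)" for x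
    unfolding nn_integral_completion using ae by (intro nn_integral_cong_AE) (auto elim!: eventually_mono)
  show "(\<lambda>x. \<integral>\<^sup>+y. ennreal (K (x - y)) * ennreal (norm (f y)) \<partial>lebesgue) \<in> borel_measurable borel"
    unfolding eq by measurable
  have "(\<integral>\<^sup>+x. \<integral>\<^sup>+y. ennreal (K (x - y)) * ennreal (norm (f y)) \<partial>lebesgue \<partial>lebesgue)
      = (\<integral>\<^sup>+x. \<integral>\<^sup>+y. ennreal (K (x - y)) * ennreal (norm (f' y)) \<partial>lborel \<partial>lborel)"
    unfolding eq by (simp add: nn_integral_completion)
  also have "\<dots> = (\<integral>\<^sup>+y. \<integral>\<^sup>+x. ennreal (K (x - y)) * ennreal (norm (f' y)) \<partial>lborel \<partial>lborel)"
    by (rule lborel_pair.Fubini') measurable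
  also have "\<dots> = (\<integral>\<^sup>+y. (\<integral>\<^sup>+z. ennreal (K z) \<partial>lborel) * ennreal (norm (f' y)) \<partial>lborel)"
  proof (rule nn_integral_cong)
    fix y :: "real^'n"
    have "(\<integral>\<^sup>+x. ennreal (K (x - y)) * ennreal (norm (f' y)) \<partial>lborel) = (\<integral>\<^sup>+x. ennreal (K (x - y)) \<partial>lborel) * ennreal (norm (f' y))"
      by (rule nn_integral_multc) measurable
    also have "(\<integral>\<^sup>+x. ennreal (K (x - y)) \<partial>lborel) = (\<integral>\<^sup>+z. ennreal (K z) \<partial>lborel)"
      using nn_integral_lborel_translate[of "\<lambda>x. ennreal (K x)" "- y"] by simp
    finally show "(\<integral>\<^sup>+x. ennreal (K (x - y)) * ennreal (norm (f' y)) \<partial>lborel) = (\<integral>\<^sup>+z. ennreal (K z) \<partial>lborel) * ennreal (norm (f' y))" .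
  qed
  also have "\<dots> = (\<integral>\<^sup>+z. ennreal (K z) \<partial>lborel) * (\<integral>\<^sup>+y. ennreal (norm (f' y)) \<partial>lborel)"
    by (rule nn_integral_cmult) measurable
  also have "(\<integral>\<^sup>+y. ennreal (norm (f' y)) \<partial>lborel) = L1_norm f"
    unfolding L1_norm_lborel using ae by (intro nn_integral_cong_AE) (auto elim!: eventually_mono)
  finally show "(\<integral>\<^sup>+x. \<integral>\<^sup>+y. ennreal (K (x - y)) * ennreal (norm (f y)) \<partial>lebesgue \<partial>lebesgue) = (\<integral>\<^sup>+z. ennreal (K z) \<partial>lborel) * L1_norm f" .
qed

text \<open>The factor |v| stays under the integral, next to the maximal function, instead of being
  replaced by its supremum: for cutoffs it is bounded but tends to 0 only pointwise, and dominated
  convergence is later applied to this integral.\<close>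

lemma H1_norm_mult:
  obtains \<kappa> where "\<kappa> > 0"
    and "\<And>(v :: real^'n \<Rightarrow> real) A \<Lambda> (f :: real^'n \<Rightarrow> 'k::{real_normed_field,euclidean_space}).
     v \<in> borel_measurable borel \<Longrightarrow> (\<And>x. \<bar>v x\<bar> \<le> A) \<Longrightarrow> (\<And>x y. \<bar>v x - v y\<bar> \<le> \<Lambda> * norm (x - y)) \<Longrightarrow> \<Lambda> \<ge> 0 \<Longrightarrow> integrable lebesgue f \<Longrightarrow>
     H1_norm (\<lambda>y. v y *\<^sub>R f y) \<le> (\<integral>\<^sup>+x. ennreal \<bar>v x\<bar> * maximal_L f x \<partial>lebesgue) + ennreal (\<Lambda> * \<kappa>) * L1_norm f"
proof -
  obtain K :: "real^'n \<Rightarrow> real" where Km[measurable]: "K \<in> borel_measurable borel" and K0: "\<And>z. 0 \<le> K z"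
     and K: "\<And>t z. t > 0 \<Longrightarrow> norm z * L_kernel t z \<le> K z" and Ki: "integrable lborel K"
    using L_kernel_commutator_majorant[where 'n='n] by blast
  define \<kappa> where "\<kappa> = (LINT z|lborel. K z) + 1"
  have I0: "(LINT z|lborel. K z) \<ge> 0" by (intro Bochner_Integration.integral_nonneg K0)
  have \<kappa>: "\<kappa> > 0" using I0 by (simp add: \<kappa>_def)
  have main: "H1_norm (\<lambda>y. v y *\<^sub>R f y) \<le> (\<integral>\<^sup>+x. ennreal \<bar>v x\<bar> * maximal_L f x \<partial>lebesgue) + ennreal (\<Lambda> * \<kappa>) * L1_norm f"
    if v: "v \<in> borel_measurable borel" "\<And>x. \<bar>v x\<bar> \<le> A" "\<And>x y. \<bar>v x - v y\<bar> \<le> \<Lambda> * norm (x - y)" and \<Lambda>: "\<Lambda> \<ge> 0" and f: "integrable lebesgue f"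
    for v :: "real^'n \<Rightarrow> real" and A \<Lambda> and f :: "real^'n \<Rightarrow> 'k"
  proof -
    note [measurable] = v(1) maximal_L_measurable[OF f]
    let ?J = "\<lambda>x. \<integral>\<^sup>+y. ennreal (K (x - y)) * ennreal (norm (f y)) \<partial>lebesgue"
    have [measurable]: "?J \<in> borel_measurable borel" by (rule nn_integral_convolution(2)[OF Km f])
    have "H1_norm (\<lambda>y. v y *\<^sub>R f y) \<le> (\<integral>\<^sup>+x. ennreal \<bar>v x\<bar> * maximal_L f x + ennreal \<Lambda> * ?J x \<partial>lborel)"
      unfolding H1_norm_lborel by (intro nn_integral_mono maximal_L_mult[OF Km K v \<Lambda> f])
    also have "\<dots> = (\<integral>\<^sup>+x. ennreal \<bar>v x\<bar> * maximal_L f x \<partial>lborel) + ennreal \<Lambda> * (\<integral>\<^sup>+x. ?J x \<partial>lborel)"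
      by (simp add: nn_integral_add nn_integral_cmult)
    also have "(\<integral>\<^sup>+x. ?J x \<partial>lborel) = (\<integral>\<^sup>+z. ennreal (K z) \<partial>lborel) * L1_norm f"
      using nn_integral_convolution(1)[OF Km f] by (simp add: nn_integral_completion)
    also have "(\<integral>\<^sup>+z. ennreal (K z) \<partial>lborel) = ennreal (LINT z|lborel. K z)"
      using Ki K0 by (intro nn_integral_eq_integral) auto
    also have "ennreal \<Lambda> * (ennreal (LINT z|lborel. K z) * L1_norm f) = ennreal (\<Lambda> * (LINT z|lborel. K z)) * L1_norm f"
      using \<Lambda> I0 by (simp add: ennreal_mult mult.assoc)
    also have "\<dots> \<le> ennreal (\<Lambda> * \<kappa>) * L1_norm f"
      using \<Lambda> by (intro mult_right_mono ennreal_leI mult_left_mono) (auto simp: \<kappa>_def)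
    finally show ?thesis by (simp add: nn_integral_completion)
  qed
  show thesis by (rule that[OF \<kappa>]) (fact main)
qed

section \<open>Dyadic cubes\<close>

text \<open>The floor makes the cubes half open, so that those of one level partition the space and
  every point has exactly one index.\<close>

definition cube_index :: "nat \<Rightarrow> real^'n \<Rightarrow> int^'n" where
  "cube_index k x = (\<chi> i. \<lfloor>2 ^ k * x $ i\<rfloor>)"

definition cube :: "nat \<Rightarrow> int^'n \<Rightarrow> (real^'n) set" where
  "cube k z = {x. cube_index k x = z}"

definition corner :: "nat \<Rightarrow> int^'n \<Rightarrow> real^'n" where
  "corner k z = (\<chi> i. of_int (z $ i) / 2 ^ k)"

text \<open>Integer \<open>div\<close> rounds towards minus infinity, so halving an index gives the
  parent also for negative coordinates.\<close>

definition children :: "int^'n \<Rightarrow> (int^'n) set" where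
  "children z = {w. \<forall>i. w $ i div 2 = z $ i}"

definition cube_mean :: "nat \<Rightarrow> (real^'n \<Rightarrow> 'b::{banach, second_countable_topology}) \<Rightarrow> int^'n \<Rightarrow> 'b" where
  "cube_mean k f z = (2 ^ k) ^ CARD('n) *\<^sub>R (LINT y|lebesgue. indicator (cube k z) y *\<^sub>R f y)"

definition cube_avg :: "nat \<Rightarrow> (real^'n \<Rightarrow> 'b::{banach, second_countable_topology}) \<Rightarrow> real^'n \<Rightarrow> 'b" where
  "cube_avg k f x = cube_mean k f (cube_index k x)"

lemma mem_cube_index: "x \<in> cube k z \<longleftrightarrow> cube_index k x = z"
  by (simp add: cube_def)

lemma mem_cube: "x \<in> cube k z \<longleftrightarrow> (\<forall>i. of_int (z $ i) \<le> 2 ^ k * x $ i \<and> 2 ^ k * x $ i < of_int (z $ i) + 1)"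
  by (simp add: cube_def cube_index_def vec_eq_iff floor_eq_iff)

lemma cube_index_div: "cube_index k x $ i = cube_index (Suc k) x $ i div 2"
proof -
  have "2 ^ k * x $ i = (2 ^ Suc k * x $ i) / real_of_int 2" by simp
  then have "\<lfloor>2 ^ k * x $ i\<rfloor> = \<lfloor>(2 ^ Suc k * x $ i) / real_of_int 2\<rfloor>" by (rule arg_cong)
  also have "\<dots> = \<lfloor>2 ^ Suc k * x $ i\<rfloor> div 2" by (rule floor_divide_real_eq_div) simp
  finally show ?thesis by (simp add: cube_index_def)
qed

lemma cube_index_children: "cube_index (Suc k) x \<in> children z \<longleftrightarrow> cube_index k x = z"
  by (simp add: children_def cube_index_div[of k] vec_eq_iff)

lemma child_cube_subset: "w \<in> children z \<Longrightarrow> cube (Suc k) w \<subseteq> cube k z"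
  using cube_index_children[of k _ z] by (auto simp: mem_cube_index)

lemma finite_vec_bounded:
  fixes S :: "'n::finite \<Rightarrow> 'a set"
  assumes "\<And>i. finite (S i)"
  shows "finite {w::'a^'n. \<forall>i. w $ i \<in> S i}"
proof (rule finite_subset)
  show "{w::'a^'n. \<forall>i. w $ i \<in> S i} \<subseteq> vec_lambda ` (PiE UNIV S)"
  proof
    fix w :: "'a^'n" assume "w \<in> {w. \<forall>i. w $ i \<in> S i}"
    then have "vec_nth w \<in> PiE UNIV S" by auto
    moreover have "w = vec_lambda (vec_nth w)" by simp
    ultimately show "w \<in> vec_lambda ` (PiE UNIV S)" by blast
  qed
  show "finite (vec_lambda ` (PiE UNIV S) :: ('a^'n) set)"
    using assms by (intro finite_imageI finite_PiE) auto
qed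

lemma finite_children: "finite (children z)"
proof (rule finite_subset)
  show "children z \<subseteq> {w. \<forall>i. w $ i \<in> {2 * z $ i, 2 * z $ i + 1}}"
  proof
    fix w assume w: "w \<in> children z"
    have "w $ i \<in> {2 * z $ i, 2 * z $ i + 1}" for i
    proof -
      have "w $ i div 2 = z $ i" using w by (simp add: children_def)
      then show ?thesis by (simp only: insert_iff empty_iff) presburger
    qed
    then show "w \<in> {w. \<forall>i. w $ i \<in> {2 * z $ i, 2 * z $ i + 1}}" by blast
  qed
  show "finite {w. \<forall>i. w $ i \<in> {2 * z $ i, 2 * z $ i + 1}}" by (intro finite_vec_bounded) auto
qed

lemma indicator_children:
  "(\<Sum>w\<in>children z. indicator (cube (Suc k) w) x) = (indicator (cube k z) x :: real)"
proof -
  have "(\<Sum>w\<in>children z. indicator (cube (Suc k) w) x) = (\<Sum>w\<in>children z. if w = cube_index (Suc k) x then 1 else (0::real))"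
    by (intro sum.cong) (auto simp: indicator_def mem_cube_index)
  also have "\<dots> = indicator (cube k z) x"
    using finite_children[of z] by (simp add: indicator_def mem_cube_index cube_index_children[symmetric])
  finally show ?thesis .
qed

lemma cube_borel [measurable]: "cube k (z::int^'n) \<in> sets borel"
proof -
  have "cube k z = (\<Inter>i. {x. of_int (z $ i) \<le> 2 ^ k * x $ i} \<inter> {x. 2 ^ k * x $ i < of_int (z $ i) + 1})"
    by (auto simp: mem_cube)
  also have "\<dots> \<in> sets borel"
  proof (intro sets.finite_INT sets.Int)
    fix i :: 'n
    show "{x::real^'n. of_int (z $ i) \<le> 2 ^ k * x $ i} \<in> sets borel"
      by (intro borel_closed closed_Collect_le continuous_intros)
    show "{x::real^'n. 2 ^ k * x $ i < of_int (z $ i) + 1} \<in> sets borel"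
      by (intro borel_open open_Collect_less continuous_intros)
  qed auto
  finally show ?thesis .
qed

lemma cube_lebesgue [measurable]: "cube k z \<in> sets lebesgue"
  using cube_borel by auto

lemma cube_subset_cbox: "cube k z \<subseteq> cbox (corner k z) (corner k z + (\<chi> i. 1 / 2 ^ k))"
proof
  fix x assume "x \<in> cube k z"
  then have "of_int (z $ i) \<le> 2 ^ k * x $ i" "2 ^ k * x $ i \<le> of_int (z $ i) + 1" for i
    unfolding mem_cube by (simp_all add: less_imp_le)
  then show "x \<in> cbox (corner k z) (corner k z + (\<chi> i. 1 / 2 ^ k))"
    by (simp add: mem_box_cart corner_def field_simps)
qed

lemma box_subset_cube: "box (corner k z) (corner k z + (\<chi> i. 1 / 2 ^ k)) \<subseteq> cube k z"
proof
  fix x assume "x \<in> box (corner k z) (corner k z + (\<chi> i. 1 / 2 ^ k))"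
  then have "\<forall>i. of_int (z $ i) < 2 ^ k * x $ i \<and> 2 ^ k * x $ i < of_int (z $ i) + 1"
    by (auto simp: mem_box_cart corner_def field_simps)
  then show "x \<in> cube k z" by (auto simp: mem_cube less_imp_le)
qed

lemma emeasure_cube: "emeasure lborel (cube k (z::int^'n)) = ennreal ((1 / 2 ^ k) ^ CARD('n))"
proof (rule antisym)
  let ?b = "corner k z + (\<chi> i. 1 / 2 ^ k) :: real^'n"
  have p: "prod ((\<bullet>) (\<chi> i. (1 / 2 ^ k :: real))) (Basis :: (real^'n) set) = (1 / 2 ^ k) ^ CARD('n)"
  proof -
    have "(\<chi> i. (1 / 2 ^ k :: real)) \<bullet> b = 1 / 2 ^ k" if "b \<in> Basis" for b :: "real^'n"
      using that by (auto simp: Basis_vec_def inner_axis)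
    then show ?thesis by simp
  qed
  have le: "\<And>b. b \<in> Basis \<Longrightarrow> corner k z \<bullet> b \<le> ?b \<bullet> b" by (auto simp: Basis_vec_def inner_axis)
  have "emeasure lborel (cube k z) \<le> emeasure lborel (cbox (corner k z) ?b)"
    by (rule emeasure_mono[OF cube_subset_cbox]) simp
  then show "emeasure lborel (cube k z) \<le> ennreal ((1 / 2 ^ k) ^ CARD('n))"
    using le by (simp add: emeasure_lborel_cbox_eq p)
  have "emeasure lborel (box (corner k z) ?b) \<le> emeasure lborel (cube k z)"
    by (rule emeasure_mono[OF box_subset_cube]) simp
  then show "ennreal ((1 / 2 ^ k) ^ CARD('n)) \<le> emeasure lborel (cube k z)"
    using le by (simp add: emeasure_lborel_box_eq p)
qed

lemma measure_cube: "measure lebesgue (cube k (z::int^'n)) = (1 / 2 ^ k) ^ CARD('n)"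
  by (simp add: measure_def emeasure_cube)

lemma dist_corner:
  assumes "x \<in> cube k (z::int^'n)"
  shows "dist (corner k z) x < real CARD('n) / 2 ^ k"
proof -
  have "dist (corner k z) x \<le> (\<Sum>i\<in>UNIV. \<bar>(corner k z - x) $ i\<bar>)"
    unfolding dist_norm by (rule norm_le_l1_cart)
  also have "\<dots> < (\<Sum>i\<in>(UNIV::'n set). 1 / 2 ^ k)"
  proof (rule sum_strict_mono)
    fix i
    have "(corner k z - x) $ i = (of_int (z $ i) - 2 ^ k * x $ i) / 2 ^ k" by (simp add: corner_def diff_divide_distrib)
    moreover have "\<bar>of_int (z $ i) - 2 ^ k * x $ i\<bar> < 1"
      using assms[unfolded mem_cube, rule_format, of i] by linarith
    ultimately show "\<bar>(corner k z - x) $ i\<bar> < 1 / 2 ^ k"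
      by (simp add: divide_strict_right_mono)
  qed auto
  finally show ?thesis by simp
qed

section \<open>Means over cubes\<close>

definition cube_integrable :: "(real^'n \<Rightarrow> 'b::{banach, second_countable_topology}) \<Rightarrow> bool" where
  "cube_integrable f \<longleftrightarrow> (\<forall>k z. integrable lebesgue (\<lambda>y. indicator (cube k z) y *\<^sub>R f y))"

lemma cube_integrableD: "cube_integrable f \<Longrightarrow> integrable lebesgue (\<lambda>y. indicator (cube k z) y *\<^sub>R f y)"
  by (simp add: cube_integrable_def)

lemma integrable_indicator_cube: "integrable lebesgue (indicator (cube k (z::int^'n)) :: real^'n \<Rightarrow> real)"
  by (rule integrable_real_indicator) (auto simp: emeasure_cube)

lemma cube_integrable_const: "cube_integrable (\<lambda>x::real^'n. c)"
  unfolding cube_integrable_def using integrable_indicator_cube by (auto intro!: integrable_scaleR_left)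

lemma cube_integrable_diff: "cube_integrable f \<Longrightarrow> cube_integrable g \<Longrightarrow> cube_integrable (\<lambda>x. f x - g x)"
  unfolding cube_integrable_def scaleR_diff_right by auto

lemma cube_integrable_norm: "cube_integrable f \<Longrightarrow> cube_integrable (\<lambda>x. norm (f x))"
  unfolding cube_integrable_def
proof (intro allI)
  fix k z assume "\<forall>k z. integrable lebesgue (\<lambda>y. indicator (cube k z) y *\<^sub>R f y)"
  then have "integrable lebesgue (\<lambda>y. norm (indicator (cube k z) y *\<^sub>R f y))" by (intro integrable_norm) blast
  then show "integrable lebesgue (\<lambda>y. indicator (cube k z) y *\<^sub>R norm (f y))" by simp
qed

lemma cube_integrable_osc: "cube_integrable f \<Longrightarrow> cube_integrable (\<lambda>x. norm (f x - c))"
  by (intro cube_integrable_norm cube_integrable_diff cube_integrable_const)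

lemma loc_integrable_cube:
  fixes f :: "real^'n \<Rightarrow> 'k::{real_normed_field,euclidean_space}"
  assumes "loc_integrable f"
  shows "cube_integrable f"
  unfolding cube_integrable_def
proof (intro allI)
  fix k and z :: "int^'n"
  let ?K = "cbox (corner k z) (corner k z + (\<chi> i. 1 / 2 ^ k))"
  have "integrable lebesgue (\<lambda>y. indicator ?K y *\<^sub>R f y)"
    using assms by (auto simp: loc_integrable_def set_integrable_def)
  then have "integrable lebesgue (\<lambda>y. indicator (cube k z) y *\<^sub>R (indicator ?K y *\<^sub>R f y))"
    by (rule integrable_mult_indicator[rotated]) simp
  moreover have "(\<lambda>y. indicator (cube k z) y *\<^sub>R (indicator ?K y *\<^sub>R f y)) = (\<lambda>y. indicator (cube k z) y *\<^sub>R f y)"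
    using cube_subset_cbox[of k z] by (auto simp: fun_eq_iff indicator_def)
  ultimately show "integrable lebesgue (\<lambda>y. indicator (cube k z) y *\<^sub>R f y)" by simp
qed

lemma integrable_cube_integrable:
  fixes f :: "real^'n \<Rightarrow> 'b::{banach, second_countable_topology}"
  assumes "integrable lebesgue f" shows "cube_integrable f"
  unfolding cube_integrable_def using assms by (auto intro!: integrable_mult_indicator)

lemma cube_integral: "(LINT y|lebesgue. indicator (cube k z) y *\<^sub>R f y) = (1 / 2 ^ k) ^ CARD('n) *\<^sub>R cube_mean k f (z::int^'n)"
  by (simp add: cube_mean_def power_one_over)

lemma cube_mean_const: "cube_mean k (\<lambda>x. c) (z::int^'n) = c"
proof -
  have "(LINT y|lebesgue. indicator (cube k z) y *\<^sub>R c) = (1 / 2 ^ k) ^ CARD('n) *\<^sub>R c"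
    using integrable_indicator_cube[of k z] by (simp add: measure_cube)
  then show ?thesis by (simp add: cube_mean_def power_one_over)
qed

lemma cube_mean_diff:
  "cube_integrable f \<Longrightarrow> cube_integrable g \<Longrightarrow> cube_mean k (\<lambda>x. f x - g x) z = cube_mean k f z - cube_mean k g z"
  unfolding cube_mean_def scaleR_diff_right[of "indicator _ _"]
  by (subst Bochner_Integration.integral_diff) (auto intro: cube_integrableD simp: scaleR_diff_right)

lemma cube_mean_nonneg: "(\<And>x. f x \<ge> (0::real)) \<Longrightarrow> cube_mean k f z \<ge> 0"
  unfolding cube_mean_def by (auto intro!: mult_nonneg_nonneg Bochner_Integration.integral_nonneg)

lemma cube_mean_mono:
  fixes f g :: "real^'n \<Rightarrow> real"
  shows "cube_integrable f \<Longrightarrow> cube_integrable g \<Longrightarrow> (\<And>x. f x \<le> g x) \<Longrightarrow> cube_mean k f z \<le> cube_mean k g z"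
  unfolding cube_mean_def real_scaleR_def
  by (intro mult_left_mono integral_mono) (auto dest: cube_integrableD intro!: mult_left_mono)

lemma norm_cube_mean: "norm (cube_mean k f z) \<le> cube_mean k (\<lambda>x. norm (f x)) z"
proof -
  have "norm (LINT y|lebesgue. indicator (cube k z) y *\<^sub>R f y) \<le> (LINT y|lebesgue. norm (indicator (cube k z) y *\<^sub>R f y))"
    by (rule integral_norm_bound)
  then show ?thesis by (simp add: cube_mean_def mult_left_mono)
qed

lemma norm_cube_mean_diff:
  assumes "cube_integrable f"
  shows "norm (cube_mean k f z - c) \<le> cube_mean k (\<lambda>x. norm (f x - c)) z"
proof -
  have "cube_mean k f z - c = cube_mean k (\<lambda>x. f x - c) z"
    by (simp add: cube_mean_diff[OF assms cube_integrable_const] cube_mean_const)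
  then show ?thesis by (simp add: norm_cube_mean)
qed

lemma cube_integral_children:
  assumes "cube_integrable f"
  shows "(LINT y|lebesgue. indicator (cube k z) y *\<^sub>R f y) = (\<Sum>w\<in>children z. LINT y|lebesgue. indicator (cube (Suc k) w) y *\<^sub>R f y)"
proof -
  have "(LINT y|lebesgue. indicator (cube k z) y *\<^sub>R f y) = (LINT y|lebesgue. (\<Sum>w\<in>children z. indicator (cube (Suc k) w) y *\<^sub>R f y))"
    by (simp flip: scaleR_sum_left add: indicator_children)
  also have "\<dots> = (\<Sum>w\<in>children z. LINT y|lebesgue. indicator (cube (Suc k) w) y *\<^sub>R f y)"
    using assms by (intro Bochner_Integration.integral_sum) (auto dest: cube_integrableD)
  finally show ?thesis .
qed

text \<open>A child has 2^(-d) of the volume of its parent. This is the source of the factors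
  \<open>2 ^ CARD('n)\<close> in the stopping argument and in \<open>haar_size\<close>.\<close>

lemma cube_mean_child_le:
  fixes f :: "real^'n \<Rightarrow> real"
  assumes f: "cube_integrable f" and pos: "\<And>x. f x \<ge> 0" and w: "w \<in> children z"
  shows "cube_mean (Suc k) f w \<le> 2 ^ CARD('n) * cube_mean k f z"
proof -
  have "(LINT y|lebesgue. indicator (cube (Suc k) w) y *\<^sub>R f y) \<le> (LINT y|lebesgue. indicator (cube k z) y *\<^sub>R f y)"
    using child_cube_subset[OF w, of k] pos by (intro integral_mono cube_integrableD[OF f]) (auto simp: indicator_def)
  then have "(2 ^ Suc k) ^ CARD('n) * (LINT y|lebesgue. indicator (cube (Suc k) w) y *\<^sub>R f y) \<le> (2 ^ Suc k) ^ CARD('n) * (LINT y|lebesgue. indicator (cube k z) y *\<^sub>R f y)"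
    by (rule mult_left_mono) simp
  then show ?thesis by (simp add: cube_mean_def power_mult_distrib)
qed

section \<open>Dyadic averages converge in \<open>L\<^sup>1\<close>\<close>

lemma cube_mean_rep:
  fixes f f' :: "real^'n \<Rightarrow> 'b::{banach, second_countable_topology}"
  assumes [measurable]: "f \<in> borel_measurable lebesgue" "f' \<in> borel_measurable borel" and ae: "AE x in lborel. f x = f' x"
  shows "cube_mean k f z = (2 ^ k) ^ CARD('n) *\<^sub>R (LINT y|lborel. indicator (cube k z) y *\<^sub>R f' y)"
proof -
  have "(LINT y|lebesgue. indicator (cube k z) y *\<^sub>R f y) = (LINT y|lborel. indicator (cube k z) y *\<^sub>R f' y)"
    by (rule integral_lebesgue_rep) (use ae in \<open>auto elim!: eventually_mono\<close>)
  then show ?thesis by (simp add: cube_mean_def)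
qed

text \<open>The error at x is the average of f(x + h) - f(x) over the h that carry x into its own
  cube. All such h lie in the box W, given by |h_j| \<le> 2^(-k). Enlarging the domain to W makes it
  independent of x, and the volume of W, which is 2^d times that of a cube, yields the factor
  2^d.\<close>

lemma L1_norm_cube_avg:
  fixes f f' :: "real^'n \<Rightarrow> 'k::{real_normed_field,euclidean_space}"
  assumes f: "integrable lebesgue f" and f': "integrable lborel f'" and ae: "AE x in lborel. f x = f' x"
    and S: "\<And>h. (\<And>j. \<bar>h $ j\<bar> \<le> 1 / 2 ^ k) \<Longrightarrow> shift_norm f' h \<le> S"
  shows "L1_norm (\<lambda>x. f x - cube_avg k f x) \<le> 2 ^ CARD('n) * S"
proof -
  have [measurable]: "f' \<in> borel_measurable borel" "f \<in> borel_measurable lebesgue" using f f' by auto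
  define W :: "(real^'n) set" where "W = cbox (\<chi> i. - 1 / 2 ^ k) (\<chi> i. 1 / 2 ^ k)"
  let ?c = "(2 ^ k) ^ CARD('n) :: real"
  have W: "h \<in> W \<longleftrightarrow> (\<forall>j. \<bar>h $ j\<bar> \<le> 1 / 2 ^ k)" for h
  proof -
    have "(- 1 / 2 ^ k \<le> a \<and> a \<le> 1 / 2 ^ k) \<longleftrightarrow> \<bar>a\<bar> \<le> 1 / 2 ^ k" for a :: real
      by (simp add: abs_le_iff minus_le_iff conj_commute)
    then show ?thesis unfolding W_def mem_box_cart vec_lambda_beta by blast
  qed
  have Wm[measurable]: "W \<in> sets borel" by (simp add: W_def)
  have eW: "emeasure lborel W = ennreal ((2 / 2 ^ k) ^ CARD('n))"
  proof -
    have "(((\<chi> i. 1 / 2 ^ k) - (\<chi> i. - 1 / 2 ^ k)) :: real^'n) \<bullet> b = 2 / 2 ^ k" if "b \<in> Basis" for b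
      using that by (auto simp: Basis_vec_def inner_axis)
    moreover have "((\<chi> i. - 1 / 2 ^ k) :: real^'n) \<bullet> b \<le> (\<chi> i. 1 / 2 ^ k) \<bullet> b" if "b \<in> Basis" for b
      using that by (auto simp: Basis_vec_def inner_axis)
    ultimately show ?thesis by (simp add: W_def emeasure_lborel_cbox_eq)
  qed
  have Q: "h \<in> W" if "x + h \<in> cube k (cube_index k x)" for x h
  proof -
    have "x \<in> cube k (cube_index k x)" by (simp add: mem_cube_index)
    then have "\<bar>h $ j\<bar> \<le> 1 / 2 ^ k" for j
      using that[unfolded mem_cube, rule_format, of j] unfolding mem_cube
      by (auto simp: abs_le_iff field_simps dest!: spec[of _ j])
    then show ?thesis by (simp add: W)
  qed
  have pw: "ennreal (norm (f' x - cube_avg k f x)) \<le> ennreal ?c * (\<integral>\<^sup>+h. indicator W h * ennreal (norm (f' (x + h) - f' x)) \<partial>lborel)" for x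
  proof -
    let ?z = "cube_index k x"
    have i1: "integrable lborel (\<lambda>y. indicator (cube k ?z) y *\<^sub>R f' y)" using f' by (intro integrable_mult_indicator) auto
    have i2: "integrable lborel (\<lambda>y. indicator (cube k ?z) y *\<^sub>R f' x)"
      by (intro integrable_scaleR_left integrable_real_indicator) (auto simp: emeasure_cube)
    have "?c *\<^sub>R (LINT y|lborel. indicator (cube k ?z) y *\<^sub>R f' x) = f' x"
      by (simp add: measure_def emeasure_cube power_one_over)
    then have "cube_avg k f x - f' x = ?c *\<^sub>R ((LINT y|lborel. indicator (cube k ?z) y *\<^sub>R f' y) - (LINT y|lborel. indicator (cube k ?z) y *\<^sub>R f' x))"
      unfolding cube_avg_def by (subst cube_mean_rep[of f f', OF _ _ ae]) (auto simp: scaleR_diff_right)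
    also have "\<dots> = ?c *\<^sub>R (LINT y|lborel. indicator (cube k ?z) y *\<^sub>R (f' y - f' x))"
      using i1 i2 by (simp add: scaleR_diff_right)
    finally have eq: "cube_avg k f x - f' x = ?c *\<^sub>R (LINT y|lborel. indicator (cube k ?z) y *\<^sub>R (f' y - f' x))" .
    have "norm (f' x - cube_avg k f x) = ?c * norm (LINT y|lborel. indicator (cube k ?z) y *\<^sub>R (f' y - f' x))"
      unfolding norm_minus_commute[of "f' x"] eq norm_scaleR by simp
    then have "ennreal (norm (f' x - cube_avg k f x)) = ennreal ?c * ennreal (norm (LINT y|lborel. indicator (cube k ?z) y *\<^sub>R (f' y - f' x)))"
      by (simp add: ennreal_mult)
    also have "\<dots> \<le> ennreal ?c * (\<integral>\<^sup>+y. ennreal (norm (indicator (cube k ?z) y *\<^sub>R (f' y - f' x))) \<partial>lborel)"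
      using i1 i2 by (intro mult_left_mono integral_norm_bound_ennreal) (auto simp: scaleR_diff_right)
    also have "(\<integral>\<^sup>+y. ennreal (norm (indicator (cube k ?z) y *\<^sub>R (f' y - f' x))) \<partial>lborel)
       = (\<integral>\<^sup>+h. ennreal (norm (indicator (cube k ?z) (x + h) *\<^sub>R (f' (x + h) - f' x))) \<partial>lborel)"
      by (rule nn_integral_lborel_translate[symmetric]) measurable
    also have "\<dots> \<le> (\<integral>\<^sup>+h. indicator W h * ennreal (norm (f' (x + h) - f' x)) \<partial>lborel)"
      by (intro nn_integral_mono) (auto simp: indicator_def dest: Q)
    finally show ?thesis by (simp add: mult_left_mono)
  qed
  have "L1_norm (\<lambda>x. f x - cube_avg k f x) = (\<integral>\<^sup>+x. ennreal (norm (f' x - cube_avg k f x)) \<partial>lborel)"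
    unfolding L1_norm_lborel using ae by (intro nn_integral_cong_AE) (auto elim!: eventually_mono)
  also have "\<dots> \<le> (\<integral>\<^sup>+x. ennreal ?c * (\<integral>\<^sup>+h. indicator W h * ennreal (norm (f' (x + h) - f' x)) \<partial>lborel) \<partial>lborel)"
    by (rule nn_integral_mono) (rule pw)
  also have "\<dots> = ennreal ?c * (\<integral>\<^sup>+x. (\<integral>\<^sup>+h. indicator W h * ennreal (norm (f' (x + h) - f' x)) \<partial>lborel) \<partial>lborel)"
    by (rule nn_integral_cmult) measurable
  also have "(\<integral>\<^sup>+x. (\<integral>\<^sup>+h. indicator W h * ennreal (norm (f' (x + h) - f' x)) \<partial>lborel) \<partial>lborel)
     = (\<integral>\<^sup>+h. (\<integral>\<^sup>+x. indicator W h * ennreal (norm (f' (x + h) - f' x)) \<partial>lborel) \<partial>lborel)"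
    by (rule lborel_pair.Fubini') measurable
  also have "\<dots> \<le> (\<integral>\<^sup>+h. S * indicator W h \<partial>lborel)"
  proof (rule nn_integral_mono)
    fix h
    have "(\<integral>\<^sup>+x. indicator W h * ennreal (norm (f' (x + h) - f' x)) \<partial>lborel) = indicator W h * shift_norm f' h"
      unfolding shift_norm_def by (rule nn_integral_cmult) measurable
    also have "\<dots> \<le> S * indicator W h" using S[of h] by (auto simp: indicator_def W)
    finally show "(\<integral>\<^sup>+x. indicator W h * ennreal (norm (f' (x + h) - f' x)) \<partial>lborel) \<le> S * indicator W h" .
  qed
  also have "\<dots> = S * ennreal ((2 / 2 ^ k) ^ CARD('n))" by (simp add: nn_integral_cmult_indicator eW)
  also have "ennreal ?c * (S * ennreal ((2 / 2 ^ k) ^ CARD('n))) = (ennreal ?c * ennreal ((2 / 2 ^ k) ^ CARD('n))) * S"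
    by (simp only: mult_ac)
  also have "ennreal ?c * ennreal ((2 / 2 ^ k) ^ CARD('n)) = ennreal (2 ^ CARD('n))"
    by (simp add: power_divide flip: ennreal_mult)
  finally show ?thesis by (simp add: mult_left_mono mult_right_mono ennreal_power[symmetric])
qed

text \<open>For merely integrable f, continuity of translations in \<open>L1\<close> takes the place
  of a gradient bound.\<close>

lemma cube_avg_tendsto:
  fixes f :: "real^'n \<Rightarrow> 'k::{real_normed_field,euclidean_space}"
  assumes f: "integrable lebesgue f"
  shows "(\<lambda>k. L1_norm (\<lambda>x. f x - cube_avg k f x)) \<longlonglongrightarrow> 0"
proof (rule ennreal_tendsto_0I)
  fix e :: real assume e: "e > 0"
  obtain f' where f': "integrable lborel f'" and ae: "AE x in lborel. f x = f' x"
    using integrable_borel_representative[OF f] by blast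
  define e' where "e' = e / (2 * 2 ^ CARD('n))"
  have "e' > 0" using e by (simp add: e'_def)
  then obtain \<delta> where \<delta>: "\<delta> > 0" "\<And>h. norm h < \<delta> \<Longrightarrow> shift_norm f' h < ennreal e'"
    using shift_norm_small[OF f'] by metis
  have "(\<lambda>k. real CARD('n) * (1/2) ^ k) \<longlonglongrightarrow> real CARD('n) * 0" by (intro tendsto_intros LIMSEQ_power_zero) auto
  then have "eventually (\<lambda>k. real CARD('n) * (1/2) ^ k < \<delta>) sequentially" using \<delta>(1) by (intro order_tendstoD) auto
  then show "\<forall>\<^sub>F k in sequentially. L1_norm (\<lambda>x. f x - cube_avg k f x) < ennreal e"
  proof eventually_elim
    case (elim k)
    have "L1_norm (\<lambda>x. f x - cube_avg k f x) \<le> 2 ^ CARD('n) * ennreal e'"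
    proof (rule L1_norm_cube_avg[OF f f' ae])
      fix h :: "real^'n" assume h: "\<And>j. \<bar>h $ j\<bar> \<le> 1 / 2 ^ k"
      have "norm h \<le> (\<Sum>i\<in>UNIV. \<bar>h $ i\<bar>)" by (rule norm_le_l1_cart)
      also have "\<dots> \<le> (\<Sum>i\<in>(UNIV::'n set). 1 / 2 ^ k)" by (intro sum_mono h)
      also have "\<dots> < \<delta>" using elim by (simp add: power_one_over)
      finally show "shift_norm f' h \<le> ennreal e'" using \<delta>(2) by (auto intro: less_imp_le)
    qed
    also have "\<dots> = ennreal (2 ^ CARD('n) * e')" using \<open>e' > 0\<close> by (simp add: ennreal_mult flip: ennreal_power)
    also have "\<dots> < ennreal e" using e by (intro ennreal_lessI) (auto simp: e'_def)
    finally show ?case .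
  qed
qed

section \<open>Mean oscillation\<close>

lemma cube_avg_indicator: "indicator (cube k z) y *\<^sub>R cube_avg k f y = indicator (cube k z) y *\<^sub>R cube_mean k f z"
  by (auto simp: indicator_def cube_avg_def mem_cube_index)

lemma indicator_children_scaleR:
  "indicator (cube k z) y *\<^sub>R (v::'b::real_vector) = (\<Sum>w\<in>children z. indicator (cube (Suc k) w) y *\<^sub>R v)"
  by (simp flip: scaleR_sum_left add: indicator_children)

lemma sum_children_disjoint:
  assumes "\<And>w y. w \<in> children z \<Longrightarrow> y \<notin> cube (Suc k) w \<Longrightarrow> g w y = (0::'b::comm_monoid_add)"
  shows "y \<in> cube k z \<Longrightarrow> (\<Sum>w\<in>children z. g w y) = g (cube_index (Suc k) y) y"
    and "y \<notin> cube k z \<Longrightarrow> (\<Sum>w\<in>children z. g w y) = 0"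
proof -
  assume y: "y \<in> cube k z"
  then have m: "cube_index (Suc k) y \<in> children z" by (simp add: cube_index_children mem_cube_index)
  have "(\<Sum>w\<in>children z. g w y) = (\<Sum>w\<in>children z. if w = cube_index (Suc k) y then g w y else 0)"
    by (intro sum.cong refl) (auto simp: mem_cube_index intro!: assms)
  then show "(\<Sum>w\<in>children z. g w y) = g (cube_index (Suc k) y) y" using m finite_children[of z] by simp
next
  assume y: "y \<notin> cube k z"
  then show "(\<Sum>w\<in>children z. g w y) = 0"
    using child_cube_subset[of _ z k] by (intro sum.neutral ballI assms) auto
qed

text \<open>The good part g is bounded, lives on the cube and carries the whole integral of b - c,
  so that it has integral zero when c is the mean. The remainder h has \<open>H1\<close> norm
  controlled by the oscillation integral. What is split is b - c with b replaced by its averages j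
  generations below the cube, so that an induction on j reaches finitely many cubes.\<close>

definition H1_split ::
  "(real^'n \<Rightarrow> 'k::{real_normed_field,euclidean_space}) \<Rightarrow> real \<Rightarrow> real \<Rightarrow> nat \<Rightarrow> int^'n \<Rightarrow> 'k \<Rightarrow> nat \<Rightarrow>
    (real^'n \<Rightarrow> 'k) \<Rightarrow> (real^'n \<Rightarrow> 'k) \<Rightarrow> bool" where
  "H1_split b N D k z c j g h \<longleftrightarrow>
      (\<forall>y. indicator (cube k z) y *\<^sub>R (cube_avg (k + j) b y - c) = g y + h y) \<and>
      integrable lebesgue g \<and> integrable lebesgue h \<and>
      (\<forall>y. norm (g y) \<le> N) \<and> (\<forall>y. y \<notin> cube k z \<longrightarrow> g y = 0) \<and>
      (LINT y|lebesgue. g y) = (LINT y|lebesgue. indicator (cube k z) y *\<^sub>R (b y - c)) \<and>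
      H1_norm h \<le> ennreal (D * (LINT y|lebesgue. indicator (cube k z) y *\<^sub>R norm (b y - c)))"

context
  fixes b :: "real^'n \<Rightarrow> 'k::{real_normed_field,euclidean_space}" and \<beta> C :: real
  assumes b: "cube_integrable b" and \<beta>: "\<beta> > 0"
    and osc: "\<And>k z. cube_mean k (\<lambda>y. norm (b y - cube_mean k b z)) z \<le> \<beta>"
    and C: "C > 0"
    and atom: "\<And>(h :: real^'n \<Rightarrow> 'k) k z M. integrable lebesgue h \<Longrightarrow> (\<And>y. norm (h y) \<le> M) \<Longrightarrow>
       (\<And>y. y \<notin> cube k z \<Longrightarrow> h y = 0) \<Longrightarrow> (LINT y|lebesgue. h y) = 0 \<Longrightarrow> H1_norm h \<le> ennreal (C * M * (1 / 2 ^ k) ^ CARD('n))"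
begin

text \<open>The John--Nirenberg stopping argument, run directly at the level of the Hardy space: stopping
  cubes, on which the oscillation around \<open>c\<close> exceeds \<open>2\<beta>\<close>, occupy at most half of the cube, and on
  each of them the reference constant is replaced by the mean.\<close>

lemma stopping_decomposition:
  "cube_mean k (\<lambda>y. norm (b y - c)) z \<le> 2 * \<beta> \<Longrightarrow>
    \<exists>g h. H1_split b (2 ^ CARD('n) * (2 * \<beta>)) (2 * C * 2 ^ CARD('n)) k z c j g h"
proof (induction j arbitrary: k z c)
  case 0
  let ?g = "\<lambda>y. indicator (cube k z) y *\<^sub>R (cube_mean k b z - c)"
  have "norm (cube_mean k b z - c) \<le> 1 * (2 * \<beta>)"
    using norm_cube_mean_diff[OF b, of k z c] 0 by simp
  also have "\<dots> \<le> 2 ^ CARD('n) * (2 * \<beta>)" using \<beta> by (intro mult_right_mono) auto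
  finally have le: "norm (cube_mean k b z - c) \<le> 2 ^ CARD('n) * (2 * \<beta>)" .
  have gi: "integrable lebesgue ?g" by (intro integrable_scaleR_left integrable_indicator_cube)
  have gI: "(LINT y|lebesgue. ?g y) = (LINT y|lebesgue. indicator (cube k z) y *\<^sub>R (b y - c))"
    unfolding cube_integral cube_mean_const cube_mean_diff[OF b cube_integrable_const] ..
  show ?case
  proof (rule exI[of _ ?g], rule exI[of _ "\<lambda>y. 0"], unfold H1_split_def, intro conjI allI impI)
    show "indicator (cube k z) y *\<^sub>R (cube_avg (k + 0) b y - c) = ?g y + 0" for y
      using cube_avg_indicator[of k z y b] by (simp add: scaleR_diff_right)
    show "norm (?g y) \<le> 2 ^ CARD('n) * (2 * \<beta>)" for y
      using le \<beta> by (auto simp: indicator_def)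
    show "?g y = 0" if "y \<notin> cube k z" for y using that by simp
    show "integrable lebesgue ?g" by (rule gi)
    show "(LINT y|lebesgue. ?g y) = (LINT y|lebesgue. indicator (cube k z) y *\<^sub>R (b y - c))" by (rule gI)
    show "integrable lebesgue (\<lambda>y::real^'n. 0 :: 'k)" by simp
    show "H1_norm (\<lambda>y::real^'n. 0 :: 'k) \<le> ennreal (2 * C * 2 ^ CARD('n) * (LINT y|lebesgue. indicator (cube k z) y *\<^sub>R norm (b y - c)))"
      by (simp add: H1_zero)
  qed
next
  case (Suc j)
  let ?N = "2 ^ CARD('n) * (2 * \<beta>)"
  let ?I = "\<lambda>w c. LINT y|lebesgue. indicator (cube (Suc k) w) y *\<^sub>R norm (b y - c)"
  have "\<exists>g h. H1_split b ?N (2 * C * 2 ^ CARD('n)) (Suc k) w c j g h" if w: "w \<in> children z" for w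
  proof (cases "cube_mean (Suc k) (\<lambda>y. norm (b y - c)) w \<le> 2 * \<beta>")
    case True
    then show ?thesis by (rule Suc.IH)
  next
    case False
    let ?m = "cube_mean (Suc k) b w"
    let ?v = "(1 / 2 ^ Suc k) ^ CARD('n) :: real"
    have "cube_mean (Suc k) (\<lambda>y. norm (b y - ?m)) w \<le> 2 * \<beta>"
      using osc[of "Suc k" w] \<beta> by simp
    from Suc.IH[OF this] obtain g h where
      eq: "\<And>y. indicator (cube (Suc k) w) y *\<^sub>R (cube_avg (Suc k + j) b y - ?m) = g y + h y" and
      gi: "integrable lebesgue g" and hi: "integrable lebesgue h" and
      gN: "\<And>y. norm (g y) \<le> ?N" and g0: "\<And>y. y \<notin> cube (Suc k) w \<Longrightarrow> g y = 0" and
      gI: "(LINT y|lebesgue. g y) = (LINT y|lebesgue. indicator (cube (Suc k) w) y *\<^sub>R (b y - ?m))" and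
      hH: "H1_norm h \<le> ennreal (2 * C * 2 ^ CARD('n) * ?I w ?m)" unfolding H1_split_def by blast
    \<comment> \<open>With the mean as reference constant the good part has integral zero, so it can
      join the remainder at the cost given by \<open>atom\<close>.\<close>
    have "(LINT y|lebesgue. g y) = 0"
      unfolding gI cube_integral cube_mean_diff[OF b cube_integrable_const] cube_mean_const by simp
    then have gH: "H1_norm g \<le> ennreal (C * ?N * ?v)" by (intro atom gi gN g0)
    let ?g = "\<lambda>y. indicator (cube (Suc k) w) y *\<^sub>R (?m - c)"
    let ?h = "\<lambda>y. g y + h y"
    \<comment> \<open>The parent has oscillation at most 2\<beta> around c, so the jump from c to
      the new constant is at most 2^d times 2\<beta>. This explains the bound
      \<open>?N\<close>.\<close>
    have "norm (?m - c) \<le> cube_mean (Suc k) (\<lambda>y. norm (b y - c)) w" by (rule norm_cube_mean_diff[OF b])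
    also have "\<dots> \<le> 2 ^ CARD('n) * cube_mean k (\<lambda>y. norm (b y - c)) z"
      by (rule cube_mean_child_le[OF cube_integrable_osc[OF b] _ w]) simp
    also have "\<dots> \<le> ?N" using Suc.prems by (intro mult_left_mono) auto
    finally have le: "norm (?m - c) \<le> ?N" .
    \<comment> \<open>Both contributions are at most 2 C 2^d \<beta> times the volume of the child.
      On a stopping cube the oscillation integral around c exceeds 2\<beta> times this volume, so it
      absorbs their sum, and the constant 2 C 2^d reproduces itself at every generation.\<close>
    have "H1_norm ?h \<le> ennreal (C * ?N * ?v) + ennreal (2 * C * 2 ^ CARD('n) * ?I w ?m)"
      using H1_norm_add[OF gi hi] gH hH by (meson add_mono order_trans)
    also have "\<dots> \<le> ennreal (C * ?N * ?v) + ennreal (2 * C * 2 ^ CARD('n) * (?v * \<beta>))"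
      unfolding cube_integral unfolding real_scaleR_def using C osc[of "Suc k" w]
      by (intro add_left_mono ennreal_leI mult_left_mono) auto
    also have "\<dots> = ennreal (2 * C * 2 ^ CARD('n) * (?v * (2 * \<beta>)))"
      using C \<beta> by (subst ennreal_plus[symmetric]) (auto simp: algebra_simps)
    also have "\<dots> \<le> ennreal (2 * C * 2 ^ CARD('n) * ?I w c)"
      unfolding cube_integral unfolding real_scaleR_def using C False
      by (intro ennreal_leI mult_left_mono) auto
    finally have H: "H1_norm ?h \<le> ennreal (2 * C * 2 ^ CARD('n) * ?I w c)" .
    have gI': "(LINT y|lebesgue. ?g y) = (LINT y|lebesgue. indicator (cube (Suc k) w) y *\<^sub>R (b y - c))"
      unfolding cube_integral cube_mean_const cube_mean_diff[OF b cube_integrable_const] ..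
    show ?thesis
    proof (rule exI[of _ ?g], rule exI[of _ ?h], unfold H1_split_def, intro conjI allI impI)
      show "indicator (cube (Suc k) w) y *\<^sub>R (cube_avg (Suc k + j) b y - c) = ?g y + ?h y" for y
        unfolding eq[symmetric] by (simp add: algebra_simps)
      show "integrable lebesgue ?g" by (intro integrable_scaleR_left integrable_indicator_cube)
      show "norm (?g y) \<le> ?N" for y using le \<beta> by (auto simp: indicator_def)
      show "?g y = 0" if "y \<notin> cube (Suc k) w" for y using that by simp
      show "integrable lebesgue ?h" using gi hi by (rule Bochner_Integration.integrable_add)
      show "(LINT y|lebesgue. ?g y) = (LINT y|lebesgue. indicator (cube (Suc k) w) y *\<^sub>R (b y - c))" by (rule gI')
      show "H1_norm ?h \<le> ennreal (2 * C * 2 ^ CARD('n) * ?I w c)" by (rule H)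
    qed
  qed
  then obtain g h where gh: "\<And>w. w \<in> children z \<Longrightarrow> H1_split b ?N (2 * C * 2 ^ CARD('n)) (Suc k) w c j (g w) (h w)"
    by metis
  then have
    eq: "\<And>w y. w \<in> children z \<Longrightarrow> indicator (cube (Suc k) w) y *\<^sub>R (cube_avg (Suc k + j) b y - c) = g w y + h w y" and
    gi: "\<And>w. w \<in> children z \<Longrightarrow> integrable lebesgue (g w)" and hi: "\<And>w. w \<in> children z \<Longrightarrow> integrable lebesgue (h w)" and
    gN: "\<And>w y. w \<in> children z \<Longrightarrow> norm (g w y) \<le> ?N" and g0: "\<And>w y. w \<in> children z \<Longrightarrow> y \<notin> cube (Suc k) w \<Longrightarrow> g w y = 0" and
    gI: "\<And>w. w \<in> children z \<Longrightarrow> (LINT y|lebesgue. g w y) = (LINT y|lebesgue. indicator (cube (Suc k) w) y *\<^sub>R (b y - c))" and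
    hH: "\<And>w. w \<in> children z \<Longrightarrow> H1_norm (h w) \<le> ennreal (2 * C * 2 ^ CARD('n) * ?I w c)"
    unfolding H1_split_def by blast+
  let ?g = "\<lambda>y. \<Sum>w\<in>children z. g w y"
  let ?h = "\<lambda>y. \<Sum>w\<in>children z. h w y"
  have I0: "?I w c \<ge> 0" for w by (intro Bochner_Integration.integral_nonneg) auto
  show ?case
  proof (rule exI[of _ ?g], rule exI[of _ ?h], unfold H1_split_def, intro conjI allI impI)
    fix y
    have "indicator (cube k z) y *\<^sub>R (cube_avg (k + Suc j) b y - c) = (\<Sum>w\<in>children z. indicator (cube (Suc k) w) y *\<^sub>R (cube_avg (Suc k + j) b y - c))"
      unfolding add_Suc_right add_Suc by (rule indicator_children_scaleR)
    also have "\<dots> = (\<Sum>w\<in>children z. g w y + h w y)" by (intro sum.cong eq) auto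
    finally show "indicator (cube k z) y *\<^sub>R (cube_avg (k + Suc j) b y - c) = ?g y + ?h y" by (simp add: sum.distrib)
    show "norm (?g y) \<le> ?N"
    proof (cases "y \<in> cube k z")
      case True
      then have "cube_index (Suc k) y \<in> children z" by (simp add: cube_index_children mem_cube_index)
      moreover have "?g y = g (cube_index (Suc k) y) y" using g0 True by (intro sum_children_disjoint(1)) auto
      ultimately show ?thesis using gN by simp
    next
      case False
      then have "?g y = 0" using g0 by (intro sum_children_disjoint(2)) auto
      then show ?thesis using \<beta> by simp
    qed
    show "?g y = 0" if "y \<notin> cube k z" using g0 that by (intro sum_children_disjoint(2)) auto
  next
    show "integrable lebesgue ?g" "integrable lebesgue ?h" using gi hi by auto
    have "(LINT y|lebesgue. ?g y) = (\<Sum>w\<in>children z. LINT y|lebesgue. g w y)"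
      using gi by (intro Bochner_Integration.integral_sum) auto
    also have "\<dots> = (\<Sum>w\<in>children z. LINT y|lebesgue. indicator (cube (Suc k) w) y *\<^sub>R (b y - c))"
      by (intro sum.cong gI) auto
    also have "\<dots> = (LINT y|lebesgue. indicator (cube k z) y *\<^sub>R (b y - c))"
      by (rule cube_integral_children[symmetric]) (intro cube_integrable_diff b cube_integrable_const)
    finally show "(LINT y|lebesgue. ?g y) = (LINT y|lebesgue. indicator (cube k z) y *\<^sub>R (b y - c))" .
    have "H1_norm ?h \<le> (\<Sum>w\<in>children z. H1_norm (h w))" by (rule H1_norm_sum[OF hi])
    also have "\<dots> \<le> (\<Sum>w\<in>children z. ennreal (2 * C * 2 ^ CARD('n) * ?I w c))" by (intro sum_mono hH)
    also have "\<dots> = ennreal (\<Sum>w\<in>children z. 2 * C * 2 ^ CARD('n) * ?I w c)"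
      using C I0 by (intro sum_ennreal) auto
    also have "(\<Sum>w\<in>children z. 2 * C * 2 ^ CARD('n) * ?I w c) = 2 * C * 2 ^ CARD('n) * (LINT y|lebesgue. indicator (cube k z) y *\<^sub>R norm (b y - c))"
      unfolding cube_integral_children[OF cube_integrable_osc[OF b], of k z] by (rule sum_distrib_left[symmetric])
    finally show "H1_norm ?h \<le> ennreal (2 * C * 2 ^ CARD('n) * (LINT y|lebesgue. indicator (cube k z) y *\<^sub>R norm (b y - c)))" .
  qed
qed

text \<open>With c the mean the good part has integral zero too, so averages of b at all finer
  levels satisfy one bound, and lower semicontinuity of \<open>H1_norm\<close> removes the
  averaging. The good part and the remainder each contribute 2 C 2^d \<beta> times the
  volume.\<close>

lemma H1_norm_BMO_cube:
  "H1_norm (\<lambda>y. indicator (cube k z) y *\<^sub>R (b y - cube_mean k b z)) \<le> ennreal (4 * C * 2 ^ CARD('n) * \<beta> * (1 / 2 ^ k) ^ CARD('n))"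
proof -
  let ?m = "cube_mean k b z"
  let ?v = "(1 / 2 ^ k) ^ CARD('n) :: real"
  let ?f = "\<lambda>y. indicator (cube k z) y *\<^sub>R (b y - ?m)"
  let ?u = "\<lambda>j y. indicator (cube k z) y *\<^sub>R (cube_avg (k + j) b y - ?m)"
  have f: "integrable lebesgue ?f" by (intro cube_integrableD cube_integrable_diff b cube_integrable_const)
  have u: "integrable lebesgue (?u j) \<and> H1_norm (?u j) \<le> ennreal (4 * C * 2 ^ CARD('n) * \<beta> * ?v)" for j
  proof -
    have "cube_mean k (\<lambda>y. norm (b y - ?m)) z \<le> 2 * \<beta>" using osc[of k z] \<beta> by simp
    from stopping_decomposition[OF this, where j = j] obtain g h where
      eq: "\<And>y. ?u j y = g y + h y" and gi: "integrable lebesgue g" and hi: "integrable lebesgue h" and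
      gN: "\<And>y. norm (g y) \<le> 2 ^ CARD('n) * (2 * \<beta>)" and g0: "\<And>y. y \<notin> cube k z \<Longrightarrow> g y = 0" and
      gI: "(LINT y|lebesgue. g y) = (LINT y|lebesgue. indicator (cube k z) y *\<^sub>R (b y - ?m))" and
      hH: "H1_norm h \<le> ennreal (2 * C * 2 ^ CARD('n) * (LINT y|lebesgue. indicator (cube k z) y *\<^sub>R norm (b y - ?m)))" unfolding H1_split_def by blast
    have "(LINT y|lebesgue. g y) = 0"
      unfolding gI cube_integral cube_mean_diff[OF b cube_integrable_const] cube_mean_const by simp
    then have gH: "H1_norm g \<le> ennreal (C * (2 ^ CARD('n) * (2 * \<beta>)) * ?v)" by (intro atom gi gN g0)
    have "H1_norm (?u j) \<le> ennreal (C * (2 ^ CARD('n) * (2 * \<beta>)) * ?v) + ennreal (2 * C * 2 ^ CARD('n) * (LINT y|lebesgue. indicator (cube k z) y *\<^sub>R norm (b y - ?m)))"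
      unfolding eq using H1_norm_add[OF gi hi] gH hH by (meson add_mono order_trans)
    also have "\<dots> \<le> ennreal (C * (2 ^ CARD('n) * (2 * \<beta>)) * ?v) + ennreal (2 * C * 2 ^ CARD('n) * (?v * \<beta>))"
      unfolding cube_integral unfolding real_scaleR_def using C osc[of k z]
      by (intro add_left_mono ennreal_leI mult_left_mono) auto
    also have "\<dots> = ennreal (4 * C * 2 ^ CARD('n) * \<beta> * ?v)"
      using C \<beta> by (subst ennreal_plus[symmetric]) (auto simp: algebra_simps)
    finally show ?thesis unfolding eq using gi hi by auto
  qed
  have "H1_norm ?f \<le> liminf (\<lambda>j. H1_norm (?u j))"
  proof (rule H1_norm_le_liminf)
    show "integrable lebesgue (?u j)" for j using u by blast
    show "integrable lebesgue ?f" by (rule f)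
    let ?F = "\<lambda>y. indicator (cube k z) y *\<^sub>R b y"
    have F: "integrable lebesgue ?F" by (rule cube_integrableD[OF b])
    \<comment> \<open>By nesting, restriction to the cube of level k commutes with averaging at a
      finer level; this reduces the limit to \<open>cube_avg_tendsto\<close> for an integrable
      function.\<close>
    have child: "y \<in> cube (k + j) w \<Longrightarrow> x \<in> cube (k + j) w \<Longrightarrow> y \<in> cube k z \<longleftrightarrow> x \<in> cube k z" for x y j w
    proof (induction j arbitrary: w)
      case (Suc j)
      have "cube_index (k + j) y = cube_index (k + j) x"
        using Suc.prems by (simp add: vec_eq_iff cube_index_div[of "k + j"] mem_cube_index)
      then show ?case using Suc.IH[of "cube_index (k + j) x"] by (simp add: mem_cube_index)
    qed (auto simp: mem_cube_index)
    have loc: "indicator (cube k z) y *\<^sub>R cube_avg (k + j) b y = cube_avg (k + j) ?F y" for y j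
    proof -
      let ?w = "cube_index (k + j) y"
      have "indicator (cube (k + j) ?w) x *\<^sub>R ?F x = indicator (cube k z) y *\<^sub>R (indicator (cube (k + j) ?w) x *\<^sub>R b x)" for x
        using child[of y j ?w x] by (auto simp: indicator_def mem_cube_index)
      note * = this
      show ?thesis unfolding cube_avg_def cube_mean_def * integral_scaleR_right by (simp add: scaleR_left_commute)
    qed
    have "L1_norm (\<lambda>y. ?u j y - ?f y) = L1_norm (\<lambda>y. ?F y - cube_avg (k + j) ?F y)" for j
    proof -
      have "?u j y - ?f y = - (?F y - cube_avg (k + j) ?F y)" for y
        unfolding loc[symmetric] by (simp add: algebra_simps)
      note * = this
      have "norm (?u j y - ?f y) = norm (?F y - cube_avg (k + j) ?F y)" for y
        by (simp only: * norm_minus_cancel)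
      then show ?thesis by (simp only: L1_norm_def)
    qed
    moreover have "(\<lambda>j. L1_norm (\<lambda>y. ?F y - cube_avg (k + j) ?F y)) \<longlonglongrightarrow> 0"
      using LIMSEQ_ignore_initial_segment[OF cube_avg_tendsto[OF F], of k] by (simp add: add.commute)
    ultimately show "(\<lambda>j. L1_norm (\<lambda>y. ?u j y - ?f y)) \<longlonglongrightarrow> 0" by simp
  qed
  also have "\<dots> \<le> ennreal (4 * C * 2 ^ CARD('n) * \<beta> * ?v)"
    by (rule Liminf_le) (use u in \<open>auto intro!: always_eventually\<close>)
  finally show ?thesis .
qed

end

section \<open>Atoms and bounded functions on cubes\<close>

text \<open>For V = 1 the defining quantity is \<omega> r^2, with \<omega> the volume of the unit
  ball; the truncated subtraction in the exponent d - 2 is exact since d \<ge> 3.\<close>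

lemma critical_radius_one:
  assumes d: "3 \<le> CARD('n)"
  shows "critical_radius (\<lambda>_. 1) (x::real^'n) = 1 / sqrt (unit_ball_vol (real CARD('n)))"
proof -
  define \<omega> where "\<omega> = unit_ball_vol (real CARD('n))"
  have \<omega>: "\<omega> > 0" unfolding \<omega>_def by (intro unit_ball_vol_pos) simp
  have eq: "1 / r ^ (CARD('n) - 2) * (LINT y:ball x r|lebesgue. 1) = \<omega> * r\<^sup>2" if r: "r > 0" for r
  proof -
    have "(LINT y:ball x r|lebesgue. (1::real)) = \<omega> * r ^ CARD('n)"
      using r \<omega> by (simp add: set_lebesgue_integral_def measure_def emeasure_ball \<omega>_def[symmetric])
    moreover have "r ^ CARD('n) = r ^ (CARD('n) - 2) * r\<^sup>2"
    proof -
      have "CARD('n) - 2 + 2 = CARD('n)" using d by simp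
      then show ?thesis by (metis power_add)
    qed
    ultimately show ?thesis using r by simp
  qed
  have "{r. 0 < r \<and> 1 / r ^ (CARD('n) - 2) * (LINT y:ball x r|lebesgue. 1) \<le> 1} = {r. 0 < r \<and> \<omega> * r\<^sup>2 \<le> 1}"
    using eq by auto
  also have "Sup \<dots> = 1 / sqrt \<omega>"
  proof (rule cSup_eq_maximum)
    show "1 / sqrt \<omega> \<in> {r. 0 < r \<and> \<omega> * r\<^sup>2 \<le> 1}" using \<omega> by (simp add: power_divide)
    fix r assume "r \<in> {r. 0 < r \<and> \<omega> * r\<^sup>2 \<le> 1}"
    then have "r\<^sup>2 \<le> (1 / sqrt \<omega>)\<^sup>2" using \<omega> by (simp add: power_divide field_simps)
    then show "r \<le> 1 / sqrt \<omega>" by (rule power2_le_imp_le) (use \<omega> in simp)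
  qed
  finally show ?thesis by (simp add: critical_radius_def \<omega>_def)
qed

lemma measure_ball_pos: "r > 0 \<Longrightarrow> measure lebesgue (ball (x::real^'n) r) > 0"
  using unit_ball_vol_pos[of "real CARD('n)"] by (simp add: measure_def emeasure_ball)

text \<open>A function bounded by M on a ball, divided by M times the volume, satisfies the size
  condition for all q at once, including q = \<infinity>. Its mean has modulus at most 1, hence at
  most (r/\<rho>)^\<epsilon> once r is at least the critical radius; for smaller balls mean zero
  takes over.\<close>

lemma generalized_atom_scaled:
  fixes h :: "real^'n \<Rightarrow> 'k::{real_normed_field,euclidean_space}"
  assumes d: "3 \<le> CARD('n)" and q: "1 < q" and \<epsilon>: "0 < \<epsilon>"
    and h: "integrable lebesgue h" and M: "M > 0" "\<And>y. norm (h y) \<le> M"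
    and r: "r > 0" and supp: "\<And>y. y \<notin> ball x0 r \<Longrightarrow> h y = 0"
    and c: "(LINT y|lebesgue. h y) = 0 \<or> 1 / sqrt (unit_ball_vol (real CARD('n))) \<le> r"
  shows "generalized_atom q \<epsilon> x0 r (\<lambda>y. of_real (1 / (M * measure lebesgue (ball x0 r))) * h y)"
proof -
  define V where "V = measure lebesgue (ball x0 r)"
  have V: "V > 0" unfolding V_def by (rule measure_ball_pos[OF r])
  have eV: "emeasure lebesgue (ball x0 r) = ennreal V" unfolding V_def using r by (simp add: measure_def emeasure_ball)
  define a where "a = (\<lambda>y. of_real (1 / (M * V)) * h y)"
  have [measurable]: "h \<in> borel_measurable lebesgue" using h by auto
  have am[measurable]: "a \<in> borel_measurable lebesgue" unfolding a_def by measurable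
  have a_le: "norm (a y) \<le> 1 / V" for y
  proof -
    have "norm (a y) = norm (h y) / (M * V)" using M V by (simp add: a_def norm_mult norm_divide)
    also have "\<dots> \<le> M / (M * V)" using M V by (intro divide_right_mono) auto
    finally show ?thesis using M by simp
  qed
  have a0: "a y = 0" if "y \<notin> ball x0 r" for y using supp[OF that] by (simp add: a_def)
  have Vint: "integrable lebesgue (indicator (ball x0 r) :: real^'n \<Rightarrow> real)"
    using eV by (intro integrable_real_indicator) auto
  have "Lq_norm q a \<le> ereal (V powr (real_of_ereal (1 / q) - 1))"
  proof (cases q)
    case (real p)
    then have p: "p > 1" using q by simp
    let ?w = "\<lambda>y. (1 / V) powr p * indicator (ball x0 r) y"
    have le: "norm (a y) powr p \<le> ?w y" for y
      using a_le[of y] a0[of y] p by (auto simp: indicator_def intro!: powr_mono2)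
    have wi: "integrable lebesgue ?w" using Vint by simp
    have i: "integrable lebesgue (\<lambda>y. norm (a y) powr p)"
      by (rule Bochner_Integration.integrable_bound[OF wi]) (use le in \<open>auto\<close>)
    have "(LINT y|lebesgue. norm (a y) powr p) \<le> (LINT y|lebesgue. ?w y)"
      by (rule integral_mono[OF i wi]) (rule le)
    also have "\<dots> = (1 / V) powr p * V" using Vint by (simp add: V_def)
    also have "\<dots> = V powr (1 - p)" using V by (simp add: powr_diff powr_divide)
    finally have "(LINT y|lebesgue. norm (a y) powr p) powr (1 / p) \<le> (V powr (1 - p)) powr (1 / p)"
      using p by (intro powr_mono2) (auto intro!: Bochner_Integration.integral_nonneg)
    also have "\<dots> = V powr (1 / p - 1)" using p by (simp add: powr_powr diff_divide_distrib)
    finally show ?thesis using real p i by (simp add: Lq_norm_def one_ereal_def)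
  next
    case PInf
    have "esssup lebesgue (\<lambda>x. ereal (norm (a x))) \<le> ereal (1 / V)"
      by (rule esssup_I) (use a_le in auto)
    moreover have "V powr - 1 = 1 / V" using V by (simp add: powr_minus_divide)
    ultimately show ?thesis using PInf by (simp add: Lq_norm_def)
  qed (use q in auto)
  moreover have "norm (LINT y|lebesgue. a y) \<le> (r / critical_radius (\<lambda>_. 1) x0) powr \<epsilon>"
    using c
  proof
    assume "(LINT y|lebesgue. h y) = 0"
    then have "(LINT y|lebesgue. a y) = 0" unfolding a_def by simp
    then show ?thesis by simp
  next
    assume r2: "1 / sqrt (unit_ball_vol (real CARD('n))) \<le> r"
    have \<omega>: "unit_ball_vol (real CARD('n)) > 0" by (intro unit_ball_vol_pos) simp
    have ai: "integrable lebesgue a" unfolding a_def using h by simp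
    have "norm (LINT y|lebesgue. a y) \<le> (LINT y|lebesgue. norm (a y))" by (rule integral_norm_bound)
    also have "\<dots> \<le> (LINT y|lebesgue. (1 / V) * indicator (ball x0 r) y)"
    proof (rule integral_mono)
      show "integrable lebesgue (\<lambda>y. norm (a y))" using ai by simp
      show "integrable lebesgue (\<lambda>y. (1 / V) * indicator (ball x0 r) y)" using Vint by simp
      show "norm (a y) \<le> (1 / V) * indicator (ball x0 r) y" for y
        using a_le[of y] a0[of y] by (cases "y \<in> ball x0 r") auto
    qed
    also have "\<dots> = 1" using Vint V by (simp add: V_def)
    also have "1 \<le> (r / critical_radius (\<lambda>_. 1) x0) powr \<epsilon>"
      unfolding critical_radius_one[OF d] using r2 \<omega> \<epsilon> by (intro ge_one_powr_ge_zero) (auto simp: field_simps)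
    finally show ?thesis .
  qed
  ultimately show ?thesis unfolding generalized_atom_def a_def V_def
    using r am[unfolded a_def V_def] a0[unfolded a_def V_def] by blast
qed

text \<open>The cube lies in a ball of radius r = d 2^(-k), for which 1 and r^(-1/2) are both at
  most 2^(k/2); the two terms of the ball estimate merge into one.\<close>

lemma H1_norm_cube_function:
  obtains C where "C > 0"
    and "\<And>(h :: real^'n \<Rightarrow> 'k::{real_normed_field,euclidean_space}) k z M. integrable lebesgue h \<Longrightarrow> (\<And>y. norm (h y) \<le> M) \<Longrightarrow>
       (\<And>y. y \<notin> cube k z \<Longrightarrow> h y = 0) \<Longrightarrow> H1_norm h \<le> ennreal (C * M * (1 / 2 ^ k) ^ CARD('n) * sqrt 2 ^ k)"
proof -
  obtain C where C: "C > 0" and H: "\<And>(h :: real^'n \<Rightarrow> 'k) r M c. integrable lebesgue h \<Longrightarrow> r > 0 \<Longrightarrow>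
     (\<And>y. norm (h y) \<le> M) \<Longrightarrow> (\<And>y. y \<notin> ball c r \<Longrightarrow> h y = 0) \<Longrightarrow>
     H1_norm h \<le> ennreal (C * M * r ^ CARD('n) * (1 + r powr (- (1/2))))"
    by (fact H1_norm_bounded_support)
  let ?d = "real CARD('n)"
  have d1: "?d \<ge> 1" by (simp add: Suc_leI)
  have main: "H1_norm h \<le> ennreal ((2 * C * ?d ^ CARD('n)) * M * (1 / 2 ^ k) ^ CARD('n) * sqrt 2 ^ k)"
    if h: "integrable lebesgue h" and M: "\<And>y. norm (h y) \<le> M" and supp: "\<And>y. y \<notin> cube k z \<Longrightarrow> h y = 0"
    for h :: "real^'n \<Rightarrow> 'k" and k z M
  proof -
    have M0: "M \<ge> 0" using M[of 0] by (metis norm_ge_zero order_trans)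
    define r where "r = ?d / 2 ^ k"
    have r: "r > 0" using d1 by (simp add: r_def)
    have "H1_norm h \<le> ennreal (C * M * r ^ CARD('n) * (1 + r powr (- (1/2))))"
    proof (rule H[OF h r M])
      show "h y = 0" if "y \<notin> ball (corner k z) r" for y
        using that dist_corner[of y k z] by (intro supp) (auto simp: r_def)
    qed
    also have "\<dots> \<le> ennreal (C * M * r ^ CARD('n) * (2 * sqrt 2 ^ k))"
    proof (intro ennreal_leI mult_left_mono)
      have "r powr (- (1/2)) \<le> (1 / 2 ^ k) powr (- (1/2))"
        using d1 by (intro powr_mono2') (auto simp: r_def divide_right_mono)
      also have "\<dots> = (2 ^ k) powr (1/2)" by (simp add: powr_divide powr_minus_divide)
      also have "\<dots> = sqrt (2 ^ k)" by (simp add: powr_half_sqrt)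
      also have "\<dots> = sqrt 2 ^ k" by (simp add: real_sqrt_power)
      finally have "r powr (- (1/2)) \<le> sqrt 2 ^ k" .
      moreover have "1 \<le> sqrt 2 ^ k" by (simp add: one_le_power)
      ultimately show "1 + r powr (- (1/2)) \<le> 2 * sqrt 2 ^ k" by linarith
    qed (use C M0 r in auto)
    also have "C * M * r ^ CARD('n) * (2 * sqrt 2 ^ k) = (2 * C * ?d ^ CARD('n)) * M * (1 / 2 ^ k) ^ CARD('n) * sqrt 2 ^ k"
      by (simp add: r_def power_divide)
    finally show ?thesis .
  qed
  have "2 * C * ?d ^ CARD('n) > 0" using C d1 by simp
  then show thesis by (rule that) (fact main)
qed

lemma H1_norm_cube_mean_zero:
  obtains C where "C > 0"
    and "\<And>(h :: real^'n \<Rightarrow> 'k::{real_normed_field,euclidean_space}) k z M. integrable lebesgue h \<Longrightarrow> (\<And>y. norm (h y) \<le> M) \<Longrightarrow>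
       (\<And>y. y \<notin> cube k z \<Longrightarrow> h y = 0) \<Longrightarrow> (LINT y|lebesgue. h y) = 0 \<Longrightarrow> H1_norm h \<le> ennreal (C * M * (1 / 2 ^ k) ^ CARD('n))"
proof -
  obtain C where C: "C > 0" and H: "\<And>(h :: real^'n \<Rightarrow> 'k) r M c. integrable lebesgue h \<Longrightarrow> r > 0 \<Longrightarrow>
     (\<And>y. norm (h y) \<le> M) \<Longrightarrow> (\<And>y. y \<notin> ball c r \<Longrightarrow> h y = 0) \<Longrightarrow> (LINT y|lebesgue. h y) = 0 \<Longrightarrow>
     H1_norm h \<le> ennreal (C * M * r ^ CARD('n))"
    by (fact H1_norm_mean_zero)
  let ?d = "real CARD('n)"
  have d1: "?d \<ge> 1" by (simp add: Suc_leI)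
  have main: "H1_norm h \<le> ennreal ((C * ?d ^ CARD('n)) * M * (1 / 2 ^ k) ^ CARD('n))"
    if h: "integrable lebesgue h" and M: "\<And>y. norm (h y) \<le> M" and supp: "\<And>y. y \<notin> cube k z \<Longrightarrow> h y = 0"
      and zero: "(LINT y|lebesgue. h y) = 0"
    for h :: "real^'n \<Rightarrow> 'k" and k z M
  proof -
    define r where "r = ?d / 2 ^ k"
    have r: "r > 0" using d1 by (simp add: r_def)
    have "H1_norm h \<le> ennreal (C * M * r ^ CARD('n))"
    proof (rule H[OF h r M _ zero])
      show "h y = 0" if "y \<notin> ball (corner k z) r" for y
        using that dist_corner[of y k z] by (intro supp) (auto simp: r_def)
    qed
    also have "C * M * r ^ CARD('n) = (C * ?d ^ CARD('n)) * M * (1 / 2 ^ k) ^ CARD('n)"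
      by (simp add: r_def power_divide)
    finally show ?thesis .
  qed
  have "C * ?d ^ CARD('n) > 0" using C d1 by simp
  then show thesis by (rule that) (fact main)
qed

lemma sum_children_volume: "(\<Sum>w\<in>children (z::int^'n). (1 / 2 ^ Suc k) ^ CARD('n)) = (1 / 2 ^ k :: real) ^ CARD('n)"
proof -
  have "(LINT y|lebesgue. indicator (cube k z) y *\<^sub>R (1::real)) = (\<Sum>w\<in>children z. LINT y|lebesgue. indicator (cube (Suc k) w) y *\<^sub>R (1::real))"
    by (rule cube_integral_children) (rule cube_integrable_const)
  then show ?thesis unfolding cube_integral cube_mean_const by simp
qed

section \<open>BMO on cubes\<close>

text \<open>The term d makes the ball contain the cube. The other term is the critical radius, so
  that at level 0 the ball admits atoms without cancellation. Scaling by 2^(-k) keeps the volume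
  comparable to that of the cube.\<close>

definition ball_rad :: "nat \<Rightarrow> nat \<Rightarrow> real" where
  "ball_rad d k = max (real d) (1 / sqrt (unit_ball_vol (real d))) / 2 ^ k"

text \<open>The constant b_Q. Averaging over the ball rather than the cube is dictated by the atom
  condition in \<open>class_K\<close>.\<close>

definition cube_ball_mean :: "(real^'n \<Rightarrow> 'k::{real_normed_field,euclidean_space}) \<Rightarrow> nat \<Rightarrow> int^'n \<Rightarrow> 'k" where
  "cube_ball_mean b k z = ball_mean b (corner k z) (ball_rad CARD('n) k)"

lemma ball_rad_pos: "d > 0 \<Longrightarrow> ball_rad d k > 0"
  by (simp add: ball_rad_def less_max_iff_disj)

lemma cube_subset_ball: "cube k (z::int^'n) \<subseteq> ball (corner k z) (ball_rad CARD('n) k)"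
proof
  fix x assume "x \<in> cube k z"
  then have "dist (corner k z) x < real CARD('n) / 2 ^ k" by (rule dist_corner)
  also have "\<dots> \<le> ball_rad CARD('n) k" unfolding ball_rad_def by (intro divide_right_mono) auto
  finally show "x \<in> ball (corner k z) (ball_rad CARD('n) k)" by simp
qed

text \<open>The oscillation around the ball mean is at most the ratio of the volumes times the BMO
  norm, and passing to the cube mean at most doubles it. The second bound compares the two reference
  constants in play: the cube mean of the stopping argument and the ball mean of the atom
  condition.\<close>

lemma BMO_cubes:
  fixes b :: "real^'n \<Rightarrow> 'k::{real_normed_field,euclidean_space}"
  assumes b: "b \<in> BMO"
  obtains \<beta> where "\<beta> > 0" and "\<And>k z. cube_mean k (\<lambda>y. norm (b y - cube_mean k b z)) z \<le> \<beta>"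
    and "\<And>k z. norm (cube_mean k b z - cube_ball_mean b k z) \<le> \<beta>"
proof -
  have bc: "cube_integrable b" using b by (intro loc_integrable_cube) (simp add: BMO_def)
  obtain N where N: "N \<ge> 0" "BMO_norm b = ennreal N"
    using b by (cases "BMO_norm b") (auto simp: BMO_def)
  define \<omega> where "\<omega> = unit_ball_vol (real CARD('n))"
  have \<omega>: "\<omega> > 0" unfolding \<omega>_def by (intro unit_ball_vol_pos) simp
  define r0 where "r0 = max (real CARD('n)) (1 / sqrt (unit_ball_vol (real CARD('n))))"
  have r0: "r0 > 0" by (simp add: r0_def less_max_iff_disj)
  define \<beta> where "\<beta> = N * \<omega> * r0 ^ CARD('n)"
  have \<beta>: "\<beta> \<ge> 0" using N \<omega> r0 by (simp add: \<beta>_def)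
  have 1: "cube_mean k (\<lambda>y. norm (b y - cube_ball_mean b k z)) z \<le> \<beta>" for k z
  proof -
    let ?r = "ball_rad CARD('n) k" and ?x = "corner k z"
    have r: "?r > 0" by (rule ball_rad_pos) simp
    have e: "emeasure lebesgue (ball ?x ?r) = ennreal (\<omega> * ?r ^ CARD('n))"
      using r by (simp add: emeasure_ball \<omega>_def)
    have "(\<integral>\<^sup>+y\<in>ball ?x ?r. ennreal (norm (b y - ball_mean b ?x ?r)) \<partial>lebesgue) / emeasure lebesgue (ball ?x ?r) \<le> BMO_norm b"
      unfolding BMO_norm_def using r by (intro SUP_upper2[of "(?x, ?r)"]) auto
    then have "(\<integral>\<^sup>+y\<in>ball ?x ?r. ennreal (norm (b y - ball_mean b ?x ?r)) \<partial>lebesgue) \<le> ennreal N * ennreal (\<omega> * ?r ^ CARD('n))"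
    proof -
      let ?a = "\<integral>\<^sup>+y\<in>ball ?x ?r. ennreal (norm (b y - ball_mean b ?x ?r)) \<partial>lebesgue"
      let ?e = "ennreal (\<omega> * ?r ^ CARD('n))"
      assume "?a / emeasure lebesgue (ball ?x ?r) \<le> BMO_norm b"
      then have "?a / ?e * ?e \<le> ennreal N * ?e" unfolding N e by (rule mult_right_mono) simp
      moreover have "?a / ?e * ?e = ?a" using \<omega> r by (simp add: ennreal_divide_times)
      ultimately show ?thesis by simp
    qed
    moreover have "ennreal (LINT y|lebesgue. indicator (cube k z) y *\<^sub>R norm (b y - cube_ball_mean b k z)) = (\<integral>\<^sup>+y. ennreal (indicator (cube k z) y *\<^sub>R norm (b y - cube_ball_mean b k z)) \<partial>lebesgue)"
      by (rule nn_integral_eq_integral[symmetric, OF cube_integrableD[OF cube_integrable_osc[OF bc]]]) simp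
    moreover have "\<dots> \<le> (\<integral>\<^sup>+y\<in>ball ?x ?r. ennreal (norm (b y - ball_mean b ?x ?r)) \<partial>lebesgue)"
      using cube_subset_ball[of k z] by (intro nn_integral_mono) (auto simp: indicator_def cube_ball_mean_def)
    ultimately have "ennreal (LINT y|lebesgue. indicator (cube k z) y *\<^sub>R norm (b y - cube_ball_mean b k z)) \<le> ennreal (N * (\<omega> * ?r ^ CARD('n)))"
      using N \<omega> r by (simp add: ennreal_mult)
    then have "(LINT y|lebesgue. indicator (cube k z) y *\<^sub>R norm (b y - cube_ball_mean b k z)) \<le> N * (\<omega> * ?r ^ CARD('n))"
      using N \<omega> r by (subst (asm) ennreal_le_iff) auto
    then have "(2 ^ k) ^ CARD('n) * (LINT y|lebesgue. indicator (cube k z) y *\<^sub>R norm (b y - cube_ball_mean b k z)) \<le> (2 ^ k) ^ CARD('n) * (N * (\<omega> * ?r ^ CARD('n)))"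
      by (intro mult_left_mono) auto
    also have "\<dots> = \<beta>" by (simp add: \<beta>_def ball_rad_def r0_def[symmetric] power_divide)
    finally show ?thesis by (simp add: cube_mean_def)
  qed
  have 2: "norm (cube_mean k b z - cube_ball_mean b k z) \<le> \<beta>" for k z
    using norm_cube_mean_diff[OF bc, of k z "cube_ball_mean b k z"] 1[of k z] by simp
  have 3: "cube_mean k (\<lambda>y. norm (b y - cube_mean k b z)) z \<le> 2 * \<beta> + 1" for k z
  proof -
    let ?c = "norm (cube_mean k b z - cube_ball_mean b k z)"
    have i: "cube_integrable (\<lambda>y. norm (b y - cube_ball_mean b k z))" by (rule cube_integrable_osc[OF bc])
    have "cube_mean k (\<lambda>y. norm (b y - cube_mean k b z)) z \<le> cube_mean k (\<lambda>y. norm (b y - cube_ball_mean b k z) - (- ?c)) z"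
    proof (rule cube_mean_mono)
      show "norm (b x - cube_mean k b z) \<le> norm (b x - cube_ball_mean b k z) - (- ?c)" for x
        using norm_triangle_ineq4[of "b x - cube_ball_mean b k z" "cube_mean k b z - cube_ball_mean b k z"] by simp
    qed (intro cube_integrable_osc cube_integrable_diff cube_integrable_const bc)+
    also have "\<dots> = cube_mean k (\<lambda>y. norm (b y - cube_ball_mean b k z)) z - (- ?c)"
      by (simp only: cube_mean_diff[OF i cube_integrable_const] cube_mean_const)
    finally show ?thesis using 1[of k z] 2[of k z] by simp
  qed
  show thesis
  \<comment> \<open>The summand 1 keeps the constant positive when the BMO norm vanishes.\<close>
  proof (rule that[of "2 * \<beta> + 1"])
    show "norm (cube_mean k b z - cube_ball_mean b k z) \<le> 2 * \<beta> + 1" for k z using 2[of k z] \<beta> by simp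
  qed (use \<beta> 3 in auto)
qed

section \<open>The commutator on simple pieces\<close>

text \<open>The common shape of the Haar pieces. The values \<open>c\<close> are arbitrary, and
  cancellation is imposed separately where an estimate relies on it.\<close>

definition cube_step :: "nat \<Rightarrow> int^'n \<Rightarrow> (int^'n \<Rightarrow> 'k::real_normed_vector) \<Rightarrow> real^'n \<Rightarrow> 'k" where
  "cube_step k z c y = (\<Sum>w\<in>children z. indicator (cube (Suc k) w) y *\<^sub>R c w)"

lemma cube_step_at: "y \<in> cube k z \<Longrightarrow> cube_step k z c y = c (cube_index (Suc k) y)"
  unfolding cube_step_def
  by (subst sum_children_disjoint(1)[of z k "\<lambda>w y. indicator (cube (Suc k) w) y *\<^sub>R c w"]) (auto simp: mem_cube_index)

lemma cube_step_outside: "y \<notin> cube k z \<Longrightarrow> cube_step k z c y = 0"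
  unfolding cube_step_def
  by (subst sum_children_disjoint(2)[of z k "\<lambda>w y. indicator (cube (Suc k) w) y *\<^sub>R c w"]) auto

lemma cube_step_integrable:
  fixes c :: "int^'n \<Rightarrow> 'k::{banach, second_countable_topology}"
  shows "integrable lebesgue (cube_step k z c)"
  unfolding cube_step_def[abs_def]
  by (intro Bochner_Integration.integrable_sum integrable_scaleR_left integrable_indicator_cube)

lemma cube_step_norm_le:
  assumes "\<And>w. w \<in> children z \<Longrightarrow> norm (c w) \<le> M" "M \<ge> 0"
  shows "norm (cube_step k z c y) \<le> M"
proof (cases "y \<in> cube k z")
  case True
  then have "cube_index (Suc k) y \<in> children z" by (simp add: cube_index_children mem_cube_index)
  then show ?thesis using True assms by (simp add: cube_step_at)
qed (use assms in \<open>simp add: cube_step_outside\<close>)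

locale KL_commutator =
  fixes T :: "(real^'n \<Rightarrow> 'k::{real_normed_field,euclidean_space}) \<Rightarrow> real^'n \<Rightarrow> 'k"
    and b :: "real^'n \<Rightarrow> 'k"
  assumes d: "3 \<le> CARD('n)" and T: "T \<in> class_K" and b: "b \<in> BMO"
begin

lemma T_sublinear:
  "f \<in> H1 \<Longrightarrow> g \<in> H1 \<Longrightarrow> norm (T (\<lambda>y. \<alpha> * f y + \<beta> * g y) x) \<le> norm \<alpha> * norm (T f x) + norm \<beta> * norm (T g x)"
  using T by (auto simp: class_K_def sublinear_on_H1_def)

lemma T_add: "f \<in> H1 \<Longrightarrow> g \<in> H1 \<Longrightarrow> norm (T (\<lambda>y. f y + g y) x) \<le> norm (T f x) + norm (T g x)"
  using T_sublinear[of f g 1 1 x] by simp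

lemma T_cmult: "f \<in> H1 \<Longrightarrow> norm (T (\<lambda>y. \<alpha> * f y) x) \<le> norm \<alpha> * norm (T f x)"
  using T_sublinear[of f f \<alpha> 0 x] by simp

lemma T_zero: "T (\<lambda>y. 0) x = 0"
  using T_sublinear[OF H1_zero(1) H1_zero(1), of 0 0 x] by simp

lemma T_sum: "(\<And>i. i \<in> I \<Longrightarrow> f i \<in> H1) \<Longrightarrow> norm (T (\<lambda>y. \<Sum>i\<in>I. f i y) x) \<le> (\<Sum>i\<in>I. norm (T (f i) x))"
proof (induction I rule: infinite_finite_induct)
  case (insert i I)
  then have "norm (T (\<lambda>y. f i y + (\<Sum>i\<in>I. f i y)) x) \<le> norm (T (f i) x) + norm (T (\<lambda>y. \<Sum>i\<in>I. f i y) x)"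
    by (intro T_add H1_sum) auto
  also have "\<dots> \<le> norm (T (f i) x) + (\<Sum>i\<in>I. norm (T (f i) x))" using insert by (intro add_left_mono) auto
  finally show ?case using insert by simp
qed (simp_all add: T_zero)

lemma T_bounded:
  obtains C where "C > 0" "\<And>f. f \<in> H1 \<Longrightarrow> L1_norm (T f) \<le> ennreal C * H1_norm f"
proof -
  obtain C where C: "\<And>f. f \<in> H1 \<Longrightarrow> L1_norm (T f) \<le> ennreal C * H1_norm f"
    using T by (auto simp: class_K_def bounded_H1_L1_def)
  show thesis
  proof (rule that[of "max C 1"])
    fix f :: "real^'n \<Rightarrow> 'k" assume "f \<in> H1"
    then have "L1_norm (T f) \<le> ennreal C * H1_norm f" by (rule C)
    also have "\<dots> \<le> ennreal (max C 1) * H1_norm f" by (intro mult_right_mono ennreal_leI) auto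
    finally show "L1_norm (T f) \<le> ennreal (max C 1) * H1_norm f" .
  qed simp
qed

lemma T_measurable: "f \<in> H1 \<Longrightarrow> T f \<in> borel_measurable lebesgue"
  using T by (auto simp: class_K_def bounded_H1_L1_def)

lemma b_measurable: "b \<in> borel_measurable lebesgue"
  using b by (intro loc_integrable_measurable) (simp add: BMO_def)

lemma b_cube_integrable: "cube_integrable b"
  using b by (intro loc_integrable_cube) (simp add: BMO_def)

text \<open>The atom condition is applied to h divided by M times the volume of the ball. The
  inequality |T(\<alpha> f)| \<le> |\<alpha>| |T f| scales the estimate back, and the volume is a
  fixed multiple of 2^(-kd). At level 0 the ball has at least the critical radius, which replaces
  cancellation.\<close>

lemma T_atom:
  obtains C where "C > 0" and "\<And>h k z M. integrable lebesgue h \<Longrightarrow> h \<in> H1 \<Longrightarrow> (\<And>y. norm (h y) \<le> M) \<Longrightarrow>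
       (\<And>y. y \<notin> cube k z \<Longrightarrow> h y = 0) \<Longrightarrow> k = 0 \<or> (LINT y|lebesgue. h y) = 0 \<Longrightarrow>
       L1_norm (\<lambda>x. (b x - cube_ball_mean b k z) * T h x) \<le> ennreal (C * M * (1 / 2 ^ k) ^ CARD('n))"
proof -
  obtain q \<epsilon> CK where q: "1 < q" and \<epsilon>: "0 < \<epsilon>" and CK: "CK > (0::real)" and
    K: "\<And>x0 r a. generalized_atom q \<epsilon> x0 r a \<Longrightarrow> L1_norm (\<lambda>x. (b x - ball_mean b x0 r) * T a x) \<le> ennreal CK * BMO_norm b"
    using T b unfolding class_K_def by blast
  obtain N where N: "N \<ge> 0" "BMO_norm b = ennreal N"
    using b by (cases "BMO_norm b") (auto simp: BMO_def)
  define \<omega> where "\<omega> = unit_ball_vol (real CARD('n))"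
  have \<omega>: "\<omega> > 0" unfolding \<omega>_def by (intro unit_ball_vol_pos) simp
  define r0 where "r0 = max (real CARD('n)) (1 / sqrt (unit_ball_vol (real CARD('n))))"
  have r0: "r0 > 0" by (simp add: r0_def less_max_iff_disj)
  define C where "C = \<omega> * r0 ^ CARD('n) * CK * N + 1"
  have C: "C > 0" using \<omega> r0 CK N by (simp add: C_def add_nonneg_pos)
  have main: "L1_norm (\<lambda>x. (b x - cube_ball_mean b k z) * T h x) \<le> ennreal (C * M * (1 / 2 ^ k) ^ CARD('n))"
    if h: "integrable lebesgue h" and hH: "h \<in> H1" and M: "\<And>y. norm (h y) \<le> M" and supp: "\<And>y. y \<notin> cube k z \<Longrightarrow> h y = 0"
      and c: "k = 0 \<or> (LINT y|lebesgue. h y) = 0" for h k z M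
  proof (cases "M > 0")
    \<comment> \<open>Here M \<le> 0 forces h = 0, and the normalisation by M would break
      down.\<close>
    case False
    have "h y = 0" for y using M[of y] False by (metis norm_le_zero_iff not_less order_trans)
    then have "h = (\<lambda>y. 0)" by (simp add: fun_eq_iff)
    then have "T h x = 0" for x using T_zero[of x] by simp
    then show ?thesis by (simp add: L1_norm_def)
  next
    case True
    let ?r = "ball_rad CARD('n) k" and ?x = "corner k z"
    have r: "?r > 0" by (rule ball_rad_pos) simp
    define V where "V = measure lebesgue (ball ?x ?r)"
    have V: "V = \<omega> * r0 ^ CARD('n) * (1 / 2 ^ k) ^ CARD('n)"
      unfolding V_def using r \<omega> by (simp add: measure_def emeasure_ball \<omega>_def[symmetric]) (simp add: ball_rad_def r0_def power_divide)
    have V0: "V > 0" using \<omega> r0 by (simp add: V)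
    define a where "a = (\<lambda>y. of_real (1 / (M * V)) * h y)"
    have "generalized_atom q \<epsilon> ?x ?r a"
      unfolding a_def V_def
    proof (rule generalized_atom_scaled[OF d q \<epsilon> h True M r])
      show "h y = 0" if "y \<notin> ball ?x ?r" for y using that cube_subset_ball[of k z] by (intro supp) auto
      show "(LINT y|lebesgue. h y) = 0 \<or> 1 / sqrt (unit_ball_vol (real CARD('n))) \<le> ?r"
        using c by (auto simp: ball_rad_def)
    qed
    then have Ka: "L1_norm (\<lambda>x. (b x - ball_mean b ?x ?r) * T a x) \<le> ennreal CK * ennreal N"
      using K N by metis
    have aH: "a \<in> H1" unfolding a_def by (rule H1_cmult[OF hH])
    have [measurable]: "T a \<in> borel_measurable lebesgue" "b \<in> borel_measurable lebesgue"
      using T_measurable[OF aH] b_measurable by auto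
    have ha: "h = (\<lambda>y. of_real (M * V) * a y)" using True V0 by (simp add: a_def fun_eq_iff flip: mult.assoc of_real_mult)
    have "norm (T h x) \<le> M * V * norm (T a x)" for x
      using T_cmult[OF aH, of "of_real (M * V)" x] True V0 unfolding ha[symmetric] by (simp add: norm_mult)
    then have le: "norm ((b x - cube_ball_mean b k z) * T h x) \<le> M * V * norm ((b x - ball_mean b ?x ?r) * T a x)" for x
      unfolding norm_mult cube_ball_mean_def
      using mult_left_mono[of "norm (T h x)" "M * V * norm (T a x)" "norm (b x - ball_mean b ?x ?r)"] by (simp add: mult_ac)
    have "L1_norm (\<lambda>x. (b x - cube_ball_mean b k z) * T h x) \<le> (\<integral>\<^sup>+x. ennreal (M * V) * ennreal (norm ((b x - ball_mean b ?x ?r) * T a x)) \<partial>lebesgue)"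
      unfolding L1_norm_def using True V0
      by (intro nn_integral_mono order_trans[OF ennreal_leI[OF le]]) (simp add: ennreal_mult)
    also have "\<dots> = ennreal (M * V) * L1_norm (\<lambda>x. (b x - ball_mean b ?x ?r) * T a x)"
      unfolding L1_norm_def by (rule nn_integral_cmult) measurable
    also have "\<dots> \<le> ennreal (M * V) * (ennreal CK * ennreal N)" by (intro mult_left_mono Ka) simp
    also have "\<dots> = ennreal (M * V * (CK * N))" using True V0 CK N by (simp add: ennreal_mult)
    also have "M * V * (CK * N) = (\<omega> * r0 ^ CARD('n) * CK * N) * (M * (1 / 2 ^ k) ^ CARD('n))" by (simp add: V)
    also have "\<dots> \<le> C * (M * (1 / 2 ^ k) ^ CARD('n))" using True by (intro mult_right_mono) (auto simp: C_def)
    finally show ?thesis by (simp add: ennreal_leI mult.assoc)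
  qed
  show thesis by (rule that[OF C]) (fact main)
qed

text \<open>On each child w the factor b - b_Q is split at the mean m_w of b over w. The part b -
  m_w has mean zero there and is covered by the John-Nirenberg estimate. The constant m_w - b_Q is
  at most (2^d + 1) \<beta> in modulus, but it multiplies a function without cancellation, and this
  alone causes the loss 2^(k/2).\<close>

lemma cube_step_H1_BMO:
  obtains C where "C > 0" and "\<And>k z c M. (\<And>w. w \<in> children z \<Longrightarrow> norm (c w) \<le> M) \<Longrightarrow> M \<ge> 0 \<Longrightarrow>
     (\<lambda>y. (b y - cube_ball_mean b k z) * cube_step k z c y) \<in> H1 \<and>
     H1_norm (\<lambda>y. (b y - cube_ball_mean b k z) * cube_step k z c y) \<le> ennreal (C * M * (1 / 2 ^ k) ^ CARD('n) * sqrt 2 ^ k)"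
proof -
  obtain \<beta> where \<beta>: "\<beta> > 0" and osc: "\<And>k z. cube_mean k (\<lambda>y. norm (b y - cube_mean k b z)) z \<le> \<beta>"
    and bm: "\<And>k z. norm (cube_mean k b z - cube_ball_mean b k z) \<le> \<beta>"
    using BMO_cubes[OF b] by metis
  obtain C1 where C1: "C1 > 0" and E1: "\<And>(h :: real^'n \<Rightarrow> 'k) k z M. integrable lebesgue h \<Longrightarrow> (\<And>y. norm (h y) \<le> M) \<Longrightarrow>
       (\<And>y. y \<notin> cube k z \<Longrightarrow> h y = 0) \<Longrightarrow> H1_norm h \<le> ennreal (C1 * M * (1 / 2 ^ k) ^ CARD('n) * sqrt 2 ^ k)"
    by (fact H1_norm_cube_function)
  obtain C2 where C2: "C2 > 0" and E2: "\<And>(h :: real^'n \<Rightarrow> 'k) k z M. integrable lebesgue h \<Longrightarrow> (\<And>y. norm (h y) \<le> M) \<Longrightarrow>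
       (\<And>y. y \<notin> cube k z \<Longrightarrow> h y = 0) \<Longrightarrow> (LINT y|lebesgue. h y) = 0 \<Longrightarrow> H1_norm h \<le> ennreal (C2 * M * (1 / 2 ^ k) ^ CARD('n))"
    by (fact H1_norm_cube_mean_zero)
  have JN: "H1_norm (\<lambda>y. indicator (cube k z) y *\<^sub>R (b y - cube_mean k b z)) \<le> ennreal (4 * C2 * 2 ^ CARD('n) * \<beta> * (1 / 2 ^ k) ^ CARD('n))" for k z
    by (rule H1_norm_BMO_cube[OF b_cube_integrable \<beta> osc C2]) (fact E2)
  let ?D = "2 ^ CARD('n) * \<beta> + \<beta>"
  \<comment> \<open>The final factor 2 majorises the sqrt 2 that is lost because the children live
    at level k + 1.\<close>
  define C where "C = 4 * C2 * 2 ^ CARD('n) * \<beta> + C1 * ?D * 2"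
  have D: "?D > 0" using \<beta> by (simp add: add_pos_pos)
  have C: "C > 0" unfolding C_def using C1 C2 \<beta> D by (intro add_pos_pos mult_pos_pos) auto
  have main: "(\<lambda>y. (b y - cube_ball_mean b k z) * cube_step k z c y) \<in> H1 \<and>
     H1_norm (\<lambda>y. (b y - cube_ball_mean b k z) * cube_step k z c y) \<le> ennreal (C * M * (1 / 2 ^ k) ^ CARD('n) * sqrt 2 ^ k)"
    if cM: "\<And>w. w \<in> children z \<Longrightarrow> norm (c w) \<le> M" and M: "M \<ge> 0" for k z c M
  proof -
    let ?B = "cube_ball_mean b k z" and ?m = "\<lambda>w. cube_mean (Suc k) b w"
    let ?v = "(1 / 2 ^ Suc k) ^ CARD('n) :: real"
    let ?p = "\<lambda>w y. c w * (indicator (cube (Suc k) w) y *\<^sub>R (b y - ?m w))"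
    let ?q = "\<lambda>w y. c w * (indicator (cube (Suc k) w) y *\<^sub>R (?m w - ?B))"
    have eq: "(\<lambda>y. (b y - ?B) * cube_step k z c y) = (\<lambda>y. \<Sum>w\<in>children z. ?p w y + ?q w y)"
      unfolding cube_step_def by (simp add: fun_eq_iff sum_distrib_left algebra_simps)
    have pi: "integrable lebesgue (\<lambda>y. indicator (cube (Suc k) w) y *\<^sub>R (b y - ?m w))" for w
      by (intro cube_integrableD cube_integrable_diff b_cube_integrable cube_integrable_const)
    have qi: "integrable lebesgue (\<lambda>y. indicator (cube (Suc k) w) y *\<^sub>R (?m w - ?B))" for w
      by (intro integrable_scaleR_left integrable_indicator_cube)
    have pqi: "integrable lebesgue (\<lambda>y. ?p w y + ?q w y)" for w
      by (intro Bochner_Integration.integrable_add integrable_mult_right pi qi)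
    have s1: "1 \<le> sqrt 2 ^ k" by (simp add: one_le_power)
    have pq: "H1_norm (\<lambda>y. ?p w y + ?q w y) \<le> ennreal (C * M * sqrt 2 ^ k * ?v)" if w: "w \<in> children z" for w
    proof -
      have "norm (?m w - cube_mean k b z) \<le> cube_mean (Suc k) (\<lambda>y. norm (b y - cube_mean k b z)) w"
        by (rule norm_cube_mean_diff[OF b_cube_integrable])
      also have "\<dots> \<le> 2 ^ CARD('n) * cube_mean k (\<lambda>y. norm (b y - cube_mean k b z)) z"
        by (rule cube_mean_child_le[OF cube_integrable_osc[OF b_cube_integrable] _ w]) simp
      also have "\<dots> \<le> 2 ^ CARD('n) * \<beta>" by (intro mult_left_mono osc) simp
      finally have "norm (?m w - ?B) \<le> ?D"
        using bm[of k z] norm_triangle_ineq[of "?m w - cube_mean k b z" "cube_mean k b z - ?B"] by simp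
      then have "H1_norm (\<lambda>y. indicator (cube (Suc k) w) y *\<^sub>R (?m w - ?B)) \<le> ennreal (C1 * ?D * ?v * sqrt 2 ^ Suc k)"
        using D by (intro E1[OF qi]) (auto simp: indicator_def)
      also have "\<dots> \<le> ennreal ((C1 * ?D * 2) * sqrt 2 ^ k * ?v)"
      proof (rule ennreal_leI)
        have "sqrt 2 \<le> (2::real)" by (simp add: real_le_lsqrt)
        then have "sqrt 2 * (C1 * ?D * ?v * sqrt 2 ^ k) \<le> 2 * (C1 * ?D * ?v * sqrt 2 ^ k)"
          using C1 D by (intro mult_right_mono) auto
        then show "C1 * ?D * ?v * sqrt 2 ^ Suc k \<le> (C1 * ?D * 2) * sqrt 2 ^ k * ?v" by (simp only: power_Suc mult_ac)
      qed
      finally have q: "H1_norm (\<lambda>y. indicator (cube (Suc k) w) y *\<^sub>R (?m w - ?B)) \<le> ennreal ((C1 * ?D * 2) * sqrt 2 ^ k * ?v)" .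
      have p: "H1_norm (\<lambda>y. indicator (cube (Suc k) w) y *\<^sub>R (b y - ?m w)) \<le> ennreal ((4 * C2 * 2 ^ CARD('n) * \<beta>) * sqrt 2 ^ k * ?v)"
      proof (rule order_trans[OF JN], rule ennreal_leI)
        have "(4 * C2 * 2 ^ CARD('n) * \<beta> * ?v) * 1 \<le> (4 * C2 * 2 ^ CARD('n) * \<beta> * ?v) * sqrt 2 ^ k"
          using C2 \<beta> s1 by (intro mult_left_mono) auto
        then show "4 * C2 * 2 ^ CARD('n) * \<beta> * ?v \<le> (4 * C2 * 2 ^ CARD('n) * \<beta>) * sqrt 2 ^ k * ?v" by (simp add: mult_ac)
      qed
      have cw: "ennreal (norm (c w)) \<le> ennreal M" using cM[OF w] by (rule ennreal_leI)
      have "H1_norm (\<lambda>y. ?p w y + ?q w y) \<le> H1_norm (?p w) + H1_norm (?q w)"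
        by (intro H1_norm_add integrable_mult_right pi qi)
      also have "\<dots> \<le> ennreal (norm (c w)) * H1_norm (\<lambda>y. indicator (cube (Suc k) w) y *\<^sub>R (b y - ?m w))
          + ennreal (norm (c w)) * H1_norm (\<lambda>y. indicator (cube (Suc k) w) y *\<^sub>R (?m w - ?B))"
        by (intro add_mono H1_norm_cmult pi qi)
      also have "\<dots> \<le> ennreal M * ennreal ((4 * C2 * 2 ^ CARD('n) * \<beta>) * sqrt 2 ^ k * ?v) + ennreal M * ennreal ((C1 * ?D * 2) * sqrt 2 ^ k * ?v)"
        by (intro add_mono mult_mono cw p q) auto
      also have "\<dots> = ennreal (M * (((4 * C2 * 2 ^ CARD('n) * \<beta>) * sqrt 2 ^ k * ?v) + ((C1 * ?D * 2) * sqrt 2 ^ k * ?v)))"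
        using M C1 C2 \<beta> D by (simp add: ennreal_mult[symmetric] ennreal_plus[symmetric] distrib_left del: ennreal_plus)
      also have "M * (((4 * C2 * 2 ^ CARD('n) * \<beta>) * sqrt 2 ^ k * ?v) + ((C1 * ?D * 2) * sqrt 2 ^ k * ?v)) = C * M * sqrt 2 ^ k * ?v"
        by (simp only: C_def) (simp only: algebra_simps)
      finally show ?thesis .
    qed
    have "H1_norm (\<lambda>y. (b y - ?B) * cube_step k z c y) \<le> (\<Sum>w\<in>children z. H1_norm (\<lambda>y. ?p w y + ?q w y))"
      unfolding eq by (rule H1_norm_sum[OF pqi])
    also have "\<dots> \<le> (\<Sum>w\<in>children z. ennreal (C * M * sqrt 2 ^ k * ?v))" by (intro sum_mono pq)
    also have "\<dots> = ennreal (\<Sum>w\<in>children z. C * M * sqrt 2 ^ k * ?v)" using C M by (intro sum_ennreal) auto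
    also have "(\<Sum>w\<in>children z. C * M * sqrt 2 ^ k * ?v) = C * M * sqrt 2 ^ k * (1 / 2 ^ k) ^ CARD('n)"
      by (simp only: sum_distrib_left[symmetric] sum_children_volume)
    finally have H: "H1_norm (\<lambda>y. (b y - ?B) * cube_step k z c y) \<le> ennreal (C * M * (1 / 2 ^ k) ^ CARD('n) * sqrt 2 ^ k)"
      by (simp only: mult_ac)
    moreover have "integrable lebesgue (\<lambda>y. (b y - ?B) * cube_step k z c y)"
      unfolding eq by (intro Bochner_Integration.integrable_sum pqi)
    ultimately show ?thesis by (auto simp: H1_def intro: le_less_trans)
  qed
  show thesis by (rule that[OF C]) (fact main)
qed

text \<open>Either there is cancellation, or k = 0 and the loss 2^(k/2) equals 1; in both cases only
  the volume of the cube remains.\<close>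

lemma cube_step_H1:
  obtains C where "C > 0" and "\<And>k z c M. (\<And>w. w \<in> children z \<Longrightarrow> norm (c w :: 'k) \<le> M) \<Longrightarrow> M \<ge> 0 \<Longrightarrow>
     k = 0 \<or> (LINT y|lebesgue. cube_step k (z::int^'n) c y) = 0 \<Longrightarrow>
     cube_step k z c \<in> H1 \<and> H1_norm (cube_step k z c) \<le> ennreal (C * M * (1 / 2 ^ k) ^ CARD('n))"
proof -
  obtain C1 where C1: "C1 > 0" and E1: "\<And>(h :: real^'n \<Rightarrow> 'k) k z M. integrable lebesgue h \<Longrightarrow> (\<And>y. norm (h y) \<le> M) \<Longrightarrow>
       (\<And>y. y \<notin> cube k z \<Longrightarrow> h y = 0) \<Longrightarrow> H1_norm h \<le> ennreal (C1 * M * (1 / 2 ^ k) ^ CARD('n) * sqrt 2 ^ k)"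
    by (fact H1_norm_cube_function)
  obtain C2 where C2: "C2 > 0" and E2: "\<And>(h :: real^'n \<Rightarrow> 'k) k z M. integrable lebesgue h \<Longrightarrow> (\<And>y. norm (h y) \<le> M) \<Longrightarrow>
       (\<And>y. y \<notin> cube k z \<Longrightarrow> h y = 0) \<Longrightarrow> (LINT y|lebesgue. h y) = 0 \<Longrightarrow> H1_norm h \<le> ennreal (C2 * M * (1 / 2 ^ k) ^ CARD('n))"
    by (fact H1_norm_cube_mean_zero)
  have main: "cube_step k z c \<in> H1 \<and> H1_norm (cube_step k z c) \<le> ennreal ((C1 + C2) * M * (1 / 2 ^ k) ^ CARD('n))"
    if cM: "\<And>w. w \<in> children z \<Longrightarrow> norm (c w) \<le> M" and M: "M \<ge> 0" and
       zero: "k = 0 \<or> (LINT y|lebesgue. cube_step k z c y) = 0" for k and z :: "int^'n" and c :: "int^'n \<Rightarrow> 'k" and M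
  proof -
    have n: "norm (cube_step k z c y) \<le> M" for y by (intro cube_step_norm_le cM M)
    let ?v = "(1 / 2 ^ k) ^ CARD('n) :: real"
    have "H1_norm (cube_step k z c) \<le> ennreal ((C1 + C2) * M * ?v)"
      using zero
    proof
      assume k: "k = 0"
      have "H1_norm (cube_step k z c) \<le> ennreal (C1 * M * ?v * sqrt 2 ^ k)"
        by (intro E1 cube_step_integrable n cube_step_outside)
      also have "\<dots> \<le> ennreal ((C1 + C2) * M * ?v)"
        using k M C1 C2 by (intro ennreal_leI) (auto intro!: mult_right_mono)
      finally show ?thesis .
    next
      assume z: "(LINT y|lebesgue. cube_step k z c y) = 0"
      have "H1_norm (cube_step k z c) \<le> ennreal (C2 * M * ?v)"
        by (intro E2 cube_step_integrable n cube_step_outside z)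
      also have "\<dots> \<le> ennreal ((C1 + C2) * M * ?v)"
        using M C1 C2 by (intro ennreal_leI mult_right_mono) auto
      finally show ?thesis .
    qed
    then show ?thesis using cube_step_integrable[of k z c] by (auto simp: H1_def intro: le_less_trans)
  qed
  have "C1 + C2 > 0" using C1 C2 by simp
  then show thesis by (rule that) (fact main)
qed

text \<open>A pointwise bound for |[b,T] h|. In each term \<open>T\<close> is applied to a function
  that does not depend on x, so measurability is immediate, and the integral splits into the atom
  condition and the bound from \<open>H1\<close> to \<open>L1\<close>.\<close>

definition comm_majorant :: "nat \<Rightarrow> int^'n \<Rightarrow> (real^'n \<Rightarrow> 'k) \<Rightarrow> real^'n \<Rightarrow> real" where
  "comm_majorant k z h x = norm (b x - cube_ball_mean b k z) * norm (T h x)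
     + norm (T (\<lambda>y. (b y - cube_ball_mean b k z) * h y) x)"

end

section \<open>Haar expansion of a compactly supported Sobolev function\<close>

text \<open>Indices of the cubes of level k that tile the box [-N, N)^d.\<close>

definition box_index :: "nat \<Rightarrow> nat \<Rightarrow> (int^'n) set" where
  "box_index N k = {z. \<forall>i. z $ i \<in> {- (int N * 2 ^ k)..<int N * 2 ^ k}}"

lemma finite_box_index: "finite (box_index N k)"
  unfolding box_index_def by (rule finite_vec_bounded) simp

lemma cube_index_in_box:
  "cube_index k y \<in> box_index N k \<longleftrightarrow> (\<forall>i. - real N \<le> y $ i \<and> y $ i < real N)"
proof -
  have 1: "(- (int N * 2 ^ k) \<le> \<lfloor>2 ^ k * t\<rfloor>) \<longleftrightarrow> - real N \<le> t" for t :: real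
  proof -
    have "(- (int N * 2 ^ k) \<le> \<lfloor>2 ^ k * t\<rfloor>) \<longleftrightarrow> 2 ^ k * (- real N) \<le> 2 ^ k * t" by (simp add: le_floor_iff mult.commute)
    also have "\<dots> \<longleftrightarrow> - real N \<le> t" by (rule mult_le_cancel_left_pos) simp
    finally show ?thesis .
  qed
  have 2: "(\<lfloor>2 ^ k * t\<rfloor> < int N * 2 ^ k) \<longleftrightarrow> t < real N" for t :: real
  proof -
    have "(\<lfloor>2 ^ k * t\<rfloor> < int N * 2 ^ k) \<longleftrightarrow> 2 ^ k * t < 2 ^ k * real N" by (simp add: floor_less_iff mult.commute)
    also have "\<dots> \<longleftrightarrow> t < real N" by (rule mult_less_cancel_left_pos) simp
    finally show ?thesis .
  qed
  show ?thesis unfolding box_index_def by (simp add: cube_index_def 1 2)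
qed

text \<open>Index \<open>0\<close> is the unit scale, where no cancellation is needed; index \<open>Suc k\<close> carries the
  difference between the averages at levels \<open>Suc k\<close> and \<open>k\<close>.\<close>

definition haar_coeff :: "(real^'n \<Rightarrow> 'b::{banach, second_countable_topology}) \<Rightarrow> nat \<Rightarrow> int^'n \<Rightarrow> int^'n \<Rightarrow> 'b" where
  "haar_coeff f n z w = (case n of 0 \<Rightarrow> cube_mean 0 f z | Suc k \<Rightarrow> cube_mean (Suc k) f w - cube_mean k f z)"

text \<open>By truncated subtraction n = 0 and n = 1 both live on unit cubes: the first carries the
  averages, the second the first differences.\<close>

definition haar :: "(real^'n \<Rightarrow> 'b::{banach, second_countable_topology}) \<Rightarrow> nat \<Rightarrow> int^'n \<Rightarrow> real^'n \<Rightarrow> 'b" where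
  "haar f n z = cube_step (n - 1) z (haar_coeff f n z)"

text \<open>An integral expression instead of a maximum of coefficients, because it sums over cubes
  to an \<open>L1\<close> norm. The factor 2^d passes from a child to its parent.\<close>

definition haar_size :: "(real^'n \<Rightarrow> 'b::{banach, second_countable_topology}) \<Rightarrow> nat \<Rightarrow> int^'n \<Rightarrow> real" where
  "haar_size f n z = (case n of 0 \<Rightarrow> norm (cube_mean 0 f z)
     | Suc k \<Rightarrow> 2 ^ CARD('n) * cube_mean k (\<lambda>y. norm (f y - cube_mean k f z)) z)"

lemma haar_size_nonneg: "haar_size f n z \<ge> 0"
  by (auto simp: haar_size_def split: nat.split intro!: mult_nonneg_nonneg cube_mean_nonneg)

lemma haar_coeff_le:
  assumes f: "cube_integrable f" and w: "w \<in> children z"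
  shows "norm (haar_coeff f n z w) \<le> haar_size f n z"
proof (cases n)
  case (Suc k)
  have "norm (cube_mean (Suc k) f w - cube_mean k f z) \<le> cube_mean (Suc k) (\<lambda>y. norm (f y - cube_mean k f z)) w"
    by (rule norm_cube_mean_diff[OF f])
  also have "\<dots> \<le> 2 ^ CARD('a) * cube_mean k (\<lambda>y. norm (f y - cube_mean k f z)) z"
    by (rule cube_mean_child_le[OF cube_integrable_osc[OF f] _ w]) simp
  finally show ?thesis by (simp add: Suc haar_coeff_def haar_size_def)
qed (simp add: haar_coeff_def haar_size_def)

lemma cube_step_integral:
  fixes c :: "int^'n \<Rightarrow> 'b::{banach, second_countable_topology}"
  shows "(LINT y|lebesgue. cube_step k z c y) = (\<Sum>w\<in>children z. (1 / 2 ^ Suc k) ^ CARD('n) *\<^sub>R c w)"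
proof -
  have "(LINT y|lebesgue. cube_step k z c y) = (\<Sum>w\<in>children z. LINT y|lebesgue. indicator (cube (Suc k) w) y *\<^sub>R c w)"
    unfolding cube_step_def
    by (intro Bochner_Integration.integral_sum integrable_scaleR_left integrable_indicator_cube)
  then show ?thesis unfolding cube_integral cube_mean_const .
qed

text \<open>The means over the children average to the mean over the parent. Index 0 has no
  cancellation and falls under the first alternative.\<close>

lemma haar_mean_zero:
  fixes f :: "real^'n \<Rightarrow> 'b::{banach, second_countable_topology}"
  assumes f: "cube_integrable f"
  shows "n - 1 = 0 \<or> (LINT y|lebesgue. cube_step (n - 1) z (haar_coeff f n z) y) = 0"
proof (cases n)
  case (Suc k)
  have "(LINT y|lebesgue. cube_step k z (haar_coeff f (Suc k) z) y)
     = (\<Sum>w\<in>children z. (1 / 2 ^ Suc k) ^ CARD('n) *\<^sub>R cube_mean (Suc k) f w) - (\<Sum>w\<in>children z. (1 / 2 ^ Suc k) ^ CARD('n) *\<^sub>R cube_mean k f z)"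
    unfolding cube_step_integral haar_coeff_def nat.case scaleR_diff_right sum_subtractf ..
  also have "(\<Sum>w\<in>children z. (1 / 2 ^ Suc k) ^ CARD('n) *\<^sub>R cube_mean (Suc k) f w) = (1 / 2 ^ k) ^ CARD('n) *\<^sub>R cube_mean k f z"
    using cube_integral_children[OF f, of k z] unfolding cube_integral by simp
  also have "(\<Sum>w\<in>children z. (1 / 2 ^ Suc k) ^ CARD('n) *\<^sub>R cube_mean k f z) = (1 / 2 ^ k) ^ CARD('n) *\<^sub>R cube_mean k f z"
    unfolding scaleR_sum_left[symmetric] sum_children_volume ..
  finally show ?thesis by (simp add: Suc)
qed simp

lemma sum_haar_level:
  fixes f :: "real^'n \<Rightarrow> 'b::{banach, second_countable_topology}"
  assumes y: "cube_index (n - 1) y \<in> box_index N (n - 1)"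
  shows "(\<Sum>z\<in>box_index N (n - 1). haar f n z y) = haar_coeff f n (cube_index (n - 1) y) (cube_index (Suc (n - 1)) y)"
proof -
  have "(\<Sum>z\<in>box_index N (n - 1). haar f n z y) = (\<Sum>z\<in>box_index N (n - 1). if z = cube_index (n - 1) y then haar f n z y else 0)"
    by (intro sum.cong refl) (auto simp: haar_def mem_cube_index intro!: cube_step_outside)
  also have "\<dots> = haar f n (cube_index (n - 1) y) y" using y by (simp only: sum.delta[OF finite_box_index] if_True)
  finally show ?thesis by (simp add: haar_def cube_step_at mem_cube_index)
qed

text \<open>Inside the box the sum telescopes. The box is a union of cubes at every level, so for y
  outside it the cube of y misses the support and both sides vanish.\<close>

lemma haar_expansion:
  fixes f :: "real^'n \<Rightarrow> 'b::{banach, second_countable_topology}"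
  assumes supp: "\<And>y. f y \<noteq> 0 \<Longrightarrow> \<forall>i. - real N \<le> y $ i \<and> y $ i < real N"
  shows "(\<Sum>n\<le>K. \<Sum>z\<in>box_index N (n - 1). haar f n z y) = cube_avg K f y"
proof (cases "\<forall>i. - real N \<le> y $ i \<and> y $ i < real N")
  case True
  then have m: "cube_index k y \<in> box_index N k" for k by (simp add: cube_index_in_box)
  show ?thesis
  proof (induction K)
    case 0
    show ?case using sum_haar_level[of 0 y N f] m[of 0] by (simp add: haar_coeff_def cube_avg_def)
  next
    case (Suc K)
    have "(\<Sum>z\<in>box_index N K. haar f (Suc K) z y) = cube_avg (Suc K) f y - cube_avg K f y"
      using sum_haar_level[of "Suc K" y N f] m[of K] by (simp add: haar_coeff_def cube_avg_def)
    then show ?case using Suc by simp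
  qed
next
  case False
  then have m: "cube_index k y \<notin> box_index N k" for k by (simp add: cube_index_in_box)
  have "indicator (cube K (cube_index K y)) x *\<^sub>R f x = 0" for x
  proof (cases "x \<in> cube K (cube_index K y)")
    case True
    then have "cube_index K x \<notin> box_index N K" using m[of K] by (simp add: mem_cube_index)
    then have "f x = 0" using supp[of x] by (auto simp: cube_index_in_box)
    then show ?thesis by simp
  qed simp
  then have "cube_avg K f y = 0" unfolding cube_avg_def cube_mean_def by (simp only: integral_zero scaleR_zero_right)
  moreover have "(\<Sum>n\<le>K. \<Sum>z\<in>box_index N (n - 1). haar f n z y) = 0"
  proof (intro sum.neutral ballI)
    fix n and z :: "int^'n" assume "z \<in> box_index N (n - 1)"
    then have "y \<notin> cube (n - 1) z" using m[of "n - 1"] by (auto simp: mem_cube_index)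
    then show "haar f n z y = 0" by (simp add: haar_def cube_step_outside)
  qed
  ultimately show ?thesis by simp
qed

text \<open>The integrand may depend on the cube, as it does for the oscillation around the mean of
  that cube; since cubes of one level are disjoint, the sum is a single integral.\<close>

lemma sum_cube_integrals_le:
  fixes u :: "int^'n \<Rightarrow> real^'n \<Rightarrow> real"
  assumes Z: "finite Z" and u: "\<And>z. z \<in> Z \<Longrightarrow> cube_integrable (u z)" and pos: "\<And>z y. u z y \<ge> 0"
    and le: "\<And>z y. y \<in> cube k z \<Longrightarrow> ennreal (u z y) \<le> v y"
  shows "ennreal (\<Sum>z\<in>Z. (1 / 2 ^ k) ^ CARD('n) * cube_mean k (u z) z) \<le> (\<integral>\<^sup>+y. v y \<partial>lebesgue)"
proof -
  have i: "integrable lebesgue (\<lambda>y. indicator (cube k z) y *\<^sub>R u z y)" if "z \<in> Z" for z by (rule cube_integrableD[OF u[OF that]])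
  have "ennreal (\<Sum>z\<in>Z. (1 / 2 ^ k) ^ CARD('n) * cube_mean k (u z) z) = (\<Sum>z\<in>Z. ennreal ((1 / 2 ^ k) ^ CARD('n) * cube_mean k (u z) z))"
    using pos by (intro sum_ennreal[symmetric] mult_nonneg_nonneg cube_mean_nonneg) auto
  also have "\<dots> = (\<Sum>z\<in>Z. \<integral>\<^sup>+y. ennreal (indicator (cube k z) y *\<^sub>R u z y) \<partial>lebesgue)"
  proof (rule sum.cong[OF refl])
    fix z assume z: "z \<in> Z"
    have "(\<integral>\<^sup>+y. ennreal (indicator (cube k z) y *\<^sub>R u z y) \<partial>lebesgue) = ennreal (LINT y|lebesgue. indicator (cube k z) y *\<^sub>R u z y)"
      using pos by (intro nn_integral_eq_integral i z) auto
    then show "ennreal ((1 / 2 ^ k) ^ CARD('n) * cube_mean k (u z) z) = (\<integral>\<^sup>+y. ennreal (indicator (cube k z) y *\<^sub>R u z y) \<partial>lebesgue)"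
      unfolding cube_integral by simp
  qed
  also have "\<dots> = (\<integral>\<^sup>+y. (\<Sum>z\<in>Z. ennreal (indicator (cube k z) y *\<^sub>R u z y)) \<partial>lebesgue)"
    using i by (intro nn_integral_sum[symmetric]) auto
  also have "\<dots> \<le> (\<integral>\<^sup>+y. v y \<partial>lebesgue)"
  proof (rule nn_integral_mono)
    fix y
    have "(\<Sum>z\<in>Z. ennreal (indicator (cube k z) y *\<^sub>R u z y)) \<le> (\<Sum>z\<in>Z. if z = cube_index k y then v y else 0)"
      using le by (intro sum_mono) (auto simp: indicator_def mem_cube_index)
    also have "\<dots> \<le> v y" using Z by simp
    finally show "(\<Sum>z\<in>Z. ennreal (indicator (cube k z) y *\<^sub>R u z y)) \<le> v y" .
  qed
  finally show ?thesis .
qed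

text \<open>Total \<open>L1\<close> size of the pieces of index n, multiplied by the loss 2^(k/2) at
  their level k = n - 1.\<close>

definition haar_weight :: "nat \<Rightarrow> (real^'n \<Rightarrow> 'b::{banach, second_countable_topology}) \<Rightarrow> nat \<Rightarrow> real" where
  "haar_weight N f n = (\<Sum>z\<in>box_index N (n - 1). haar_size f n z * (1 / 2 ^ (n - 1)) ^ CARD('n) * sqrt 2 ^ (n - 1))"

lemma haar_weight_nonneg: "haar_weight N f n \<ge> 0"
  unfolding haar_weight_def by (intro sum_nonneg mult_nonneg_nonneg haar_size_nonneg) auto

lemma haar_weight_0:
  fixes f :: "real^'n \<Rightarrow> 'k::{real_normed_field,euclidean_space}"
  assumes f: "integrable lebesgue f"
  shows "ennreal (haar_weight N f 0) \<le> L1_norm f"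
proof -
  have fc: "cube_integrable f" by (rule integrable_cube_integrable[OF f])
  have "haar_weight N f 0 \<le> (\<Sum>z\<in>box_index N 0. (1 / 2 ^ 0) ^ CARD('n) * cube_mean 0 (\<lambda>y. norm (f y)) z)"
    unfolding haar_weight_def using norm_cube_mean[of 0 f] by (auto intro!: sum_mono simp: haar_size_def)
  then have "ennreal (haar_weight N f 0) \<le> ennreal (\<Sum>z\<in>box_index N 0. (1 / 2 ^ 0) ^ CARD('n) * cube_mean 0 (\<lambda>y. norm (f y)) z)"
    by (rule ennreal_leI)
  also have "\<dots> \<le> (\<integral>\<^sup>+y. ennreal (norm (f y)) \<partial>lebesgue)"
    by (rule sum_cube_integrals_le) (auto intro: finite_box_index cube_integrable_norm fc)
  finally show ?thesis by (simp add: L1_norm_def)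
qed

text \<open>The oscillations over cubes of level k add up to the \<open>L1\<close> distance of f
  from its averages, which the gradient bounds by 2^d 2^(-k). With the loss 2^(k/2) this leaves
  (sqrt 2 / 2)^k. One factor 2^d of 4^d comes from \<open>haar_size\<close>, the other from the
  averaging estimate.\<close>

lemma haar_weight_Suc:
  fixes f :: "real^'n \<Rightarrow> 'k::{real_normed_field,euclidean_space}"
  assumes f: "integrable lebesgue f" and g: "\<And>j. integrable lebesgue (g j)" and w: "\<And>j. has_weak_partial j f (g j)"
  shows "ennreal (haar_weight N f (Suc k)) \<le> ennreal (4 ^ CARD('n) * (sqrt 2 / 2) ^ k) * (\<Sum>j\<in>UNIV. L1_norm (g j))"
proof -
  have fc: "cube_integrable f" by (rule integrable_cube_integrable[OF f])
  obtain f' where f': "integrable lborel f'" "AE x in lborel. f x = f' x"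
    using integrable_borel_representative[OF f] by blast
  have "\<forall>j. \<exists>g'. integrable lborel g' \<and> (AE x in lborel. g j x = g' x)"
    using integrable_borel_representative[OF g] by blast
  then obtain g' where g': "\<And>j. integrable lborel (g' j)" "\<And>j. AE x in lborel. g j x = g' j x" by metis
  let ?S = "\<Sum>j\<in>UNIV. L1_norm (g j)"
  have S: "(\<Sum>j\<in>UNIV. \<integral>\<^sup>+x. ennreal (norm (g' j x)) \<partial>lborel) = ?S"
  proof (rule sum.cong[OF refl])
    fix j
    show "(\<integral>\<^sup>+x. ennreal (norm (g' j x)) \<partial>lborel) = L1_norm (g j)"
      unfolding L1_norm_lborel using g'(2)[of j] by (intro nn_integral_cong_AE) (auto elim!: eventually_mono)
  qed
  have "L1_norm (\<lambda>x. f x - cube_avg k f x) \<le> 2 ^ CARD('n) * (ennreal (1 / 2 ^ k) * ?S)"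
  proof (rule L1_norm_cube_avg[OF f f'])
    fix h :: "real^'n" assume h: "\<And>j. \<bar>h $ j\<bar> \<le> 1 / 2 ^ k"
    have "shift_norm f' h \<le> ennreal (1 / 2 ^ k) * (\<Sum>j\<in>UNIV. \<integral>\<^sup>+x. ennreal (norm (g' j x)) \<partial>lborel)"
      by (rule shift_norm_gradient[OF f'(1) g'(1) _ h]) (rule has_weak_partial_rep[OF w f' g'(1) g'(2)])
    then show "shift_norm f' h \<le> ennreal (1 / 2 ^ k) * ?S" unfolding S .
  qed
  moreover have "ennreal (\<Sum>z\<in>box_index N k. (1 / 2 ^ k) ^ CARD('n) * cube_mean k (\<lambda>y. norm (f y - cube_mean k f z)) z) \<le> (\<integral>\<^sup>+y. ennreal (norm (f y - cube_avg k f y)) \<partial>lebesgue)"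
    by (rule sum_cube_integrals_le)
       (auto intro: finite_box_index cube_integrable_osc fc simp: mem_cube_index cube_avg_def)
  ultimately have le: "ennreal (\<Sum>z\<in>box_index N k. (1 / 2 ^ k) ^ CARD('n) * cube_mean k (\<lambda>y. norm (f y - cube_mean k f z)) z) \<le> 2 ^ CARD('n) * (ennreal (1 / 2 ^ k) * ?S)"
    unfolding L1_norm_def by (rule order_trans[rotated])
  let ?a = "2 ^ CARD('n) * sqrt 2 ^ k"
  have "haar_weight N f (Suc k) = ?a * (\<Sum>z\<in>box_index N k. (1 / 2 ^ k) ^ CARD('n) * cube_mean k (\<lambda>y. norm (f y - cube_mean k f z)) z)"
    unfolding haar_weight_def sum_distrib_left by (intro sum.cong) (auto simp: haar_size_def)
  then have "ennreal (haar_weight N f (Suc k)) = ennreal ?a * ennreal (\<Sum>z\<in>box_index N k. (1 / 2 ^ k) ^ CARD('n) * cube_mean k (\<lambda>y. norm (f y - cube_mean k f z)) z)"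
    by (simp add: ennreal_mult' )
  also have "\<dots> \<le> ennreal ?a * (2 ^ CARD('n) * (ennreal (1 / 2 ^ k) * ?S))" by (intro mult_left_mono le) simp
  also have "(2 :: ennreal) ^ CARD('n) = ennreal (2 ^ CARD('n))" by (simp flip: ennreal_power)
  also have "ennreal ?a * (ennreal (2 ^ CARD('n)) * (ennreal (1 / 2 ^ k) * ?S)) = (ennreal ?a * ennreal (2 ^ CARD('n)) * ennreal (1 / 2 ^ k)) * ?S"
    by (simp only: mult.assoc)
  also have "ennreal ?a * ennreal (2 ^ CARD('n)) * ennreal (1 / 2 ^ k) = ennreal (?a * 2 ^ CARD('n) * (1 / 2 ^ k))"
    by (simp only: ennreal_mult[symmetric] mult_nonneg_nonneg zero_le_power zero_le_numeral real_sqrt_ge_zero zero_le_divide_1_iff)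
  also have "?a * 2 ^ CARD('n) * (1 / 2 ^ k) = (2 ^ CARD('n) * 2 ^ CARD('n)) * (sqrt 2 / 2) ^ k" by (simp add: power_divide)
  also have "(2::real) ^ CARD('n) * 2 ^ CARD('n) = 4 ^ CARD('n)" by (simp flip: power_mult_distrib)
  finally show ?thesis .
qed

lemma haar_weight_summable:
  fixes f :: "real^'n \<Rightarrow> 'k::{real_normed_field,euclidean_space}"
  assumes f: "integrable lebesgue f" and g: "\<And>j. integrable lebesgue (g j)" and w: "\<And>j. has_weak_partial j f (g j)"
  shows "summable (haar_weight N f)"
    and "ennreal (\<Sum>n. haar_weight N f n) \<le> ennreal (1 + 4 ^ CARD('n) / (1 - sqrt 2 / 2)) * (L1_norm f + (\<Sum>j\<in>UNIV. L1_norm (g j)))"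
proof -
  let ?S = "\<Sum>j\<in>UNIV. L1_norm (g j)"
  let ?q = "sqrt 2 / 2"
  have "?S < \<infinity>" using integrable_L1_norm[OF g] by (simp add: less_top)
  then obtain s where s: "?S = ennreal s" "s \<ge> 0" by (cases ?S) auto
  obtain l where l: "L1_norm f = ennreal l" "l \<ge> 0" using integrable_L1_norm[OF f] by (cases "L1_norm f") auto
  have q: "0 \<le> ?q" "?q < 1" using real_sqrt_less_mono[of 2 4] by auto
  have W0: "haar_weight N f 0 \<le> l" using haar_weight_0[OF f, of N] l by simp
  have WS: "haar_weight N f (Suc k) \<le> 4 ^ CARD('n) * ?q ^ k * s" for k
    using haar_weight_Suc[OF f g w, of N k] s by (simp flip: ennreal_mult)
  have sg: "summable (\<lambda>k. 4 ^ CARD('n) * ?q ^ k * s)"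
    using q by (intro summable_mult summable_mult2 summable_geometric) auto
  have sS: "summable (\<lambda>k. haar_weight N f (Suc k))"
    by (rule summable_comparison_test'[OF sg, of 0]) (simp only: real_norm_def abs_of_nonneg[OF haar_weight_nonneg] WS)
  then show sum: "summable (haar_weight N f)" by (simp add: summable_Suc_iff)
  have "(\<Sum>n. haar_weight N f n) = haar_weight N f 0 + (\<Sum>k. haar_weight N f (Suc k))"
    using suminf_split_head[OF sum] by simp
  also have "\<dots> \<le> l + (\<Sum>k. 4 ^ CARD('n) * ?q ^ k * s)" by (intro add_mono W0 suminf_le WS sS sg)
  also have "(\<Sum>k. 4 ^ CARD('n) * ?q ^ k * s) = 4 ^ CARD('n) / (1 - ?q) * s"
  proof -
    have "(\<Sum>k. 4 ^ CARD('n) * ?q ^ k * s) = (\<Sum>k. ?q ^ k * (4 ^ CARD('n) * s))" by (simp only: mult_ac)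
    also have "\<dots> = (\<Sum>k. ?q ^ k) * (4 ^ CARD('n) * s)" using q by (intro suminf_mult2[symmetric] summable_geometric) auto
    finally show ?thesis using q by (simp add: suminf_geometric)
  qed
  also have "l + 4 ^ CARD('n) / (1 - ?q) * s \<le> (1 + 4 ^ CARD('n) / (1 - ?q)) * (l + s)"
    using l s q by (simp add: distrib_right distrib_left)
  finally have "ennreal (\<Sum>n. haar_weight N f n) \<le> ennreal ((1 + 4 ^ CARD('n) / (1 - ?q)) * (l + s))" by (rule ennreal_leI)
  then show "ennreal (\<Sum>n. haar_weight N f n) \<le> ennreal (1 + 4 ^ CARD('n) / (1 - sqrt 2 / 2)) * (L1_norm f + ?S)"
    unfolding l s using l s q by (simp add: ennreal_mult flip: ennreal_plus)
qed

text \<open>The partial sums are Cauchy, with the tails of the summable weights as rate; the sum is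
  the prescribed v because v is reached almost everywhere along a subsequence.\<close>

lemma H1_series:
  fixes p :: "nat \<Rightarrow> real^'n \<Rightarrow> 'k::{real_normed_field,euclidean_space}"
  assumes p: "\<And>n. p n \<in> H1" and w: "\<And>n. H1_norm (p n) \<le> ennreal (w n)" "\<And>n. w n \<ge> 0" "summable w"
    and v: "v \<in> borel_measurable lebesgue"
    and r: "strict_mono (r :: nat \<Rightarrow> nat)" and ae: "AE x in lebesgue. (\<lambda>j. \<Sum>n\<le>r j. p n x) \<longlonglongrightarrow> v x"
  shows "v \<in> H1" and "(\<lambda>K. H1_norm (\<lambda>x. v x - (\<Sum>n\<le>K. p n x))) \<longlonglongrightarrow> 0"
proof -
  define \<epsilon> where "\<epsilon> = (\<lambda>K. ennreal (suminf w - (\<Sum>n\<le>K. w n)))"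
  have "(\<lambda>K. suminf w - (\<Sum>n\<le>K. w n)) \<longlonglongrightarrow> suminf w - suminf w"
    using summable_LIMSEQ'[OF w(3)] by (intro tendsto_intros)
  then have \<epsilon>: "\<epsilon> \<longlonglongrightarrow> 0" unfolding \<epsilon>_def using tendsto_ennrealI by fastforce
  have lim: "v \<in> H1 \<and> (\<forall>K. H1_norm (\<lambda>x. v x - (\<Sum>n\<le>K. p n x)) \<le> \<epsilon> K)"
  proof (rule H1_limit[OF _ v r ae _ \<epsilon>])
    show "(\<lambda>x. \<Sum>n\<le>K. p n x) \<in> H1" for K by (intro H1_sum p)
    fix n m :: nat assume nm: "n \<le> m"
    have fin: "{..m} = {..n} \<union> {n<..m}" "{..n} \<inter> {n<..m} = {}" using nm by auto
    have split: "(\<Sum>i\<le>m. h i) = (\<Sum>i\<le>n. h i) + (\<Sum>i\<in>{n<..m}. h i)" for h :: "nat \<Rightarrow> 'c::comm_monoid_add"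
      unfolding fin(1) by (rule sum.union_disjoint) (use fin(2) in auto)
    have "H1_norm (\<lambda>x. (\<Sum>i\<le>m. p i x) - (\<Sum>i\<le>n. p i x)) = H1_norm (\<lambda>x. \<Sum>i\<in>{n<..m}. p i x)"
      unfolding split by simp
    also have "\<dots> \<le> (\<Sum>i\<in>{n<..m}. H1_norm (p i))" by (intro H1_norm_sum H1_D p)
    also have "\<dots> \<le> (\<Sum>i\<in>{n<..m}. ennreal (w i))" by (intro sum_mono w)
    also have "\<dots> = ennreal (\<Sum>i\<in>{n<..m}. w i)" using w by (intro sum_ennreal) auto
    also have "\<dots> \<le> \<epsilon> n"
    proof -
      have "(\<Sum>i\<le>m. w i) \<le> suminf w" using w by (intro sum_le_suminf) auto
      then show ?thesis unfolding \<epsilon>_def split[of w] by (intro ennreal_leI) simp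
    qed
    finally show "H1_norm (\<lambda>x. (\<Sum>i\<le>m. p i x) - (\<Sum>i\<le>n. p i x)) \<le> \<epsilon> n" .
  qed
  then show "v \<in> H1" by simp
  show "(\<lambda>K. H1_norm (\<lambda>x. v x - (\<Sum>n\<le>K. p n x))) \<longlonglongrightarrow> 0"
    by (rule tendsto_sandwich[OF _ _ tendsto_const \<epsilon>]) (use lim in \<open>auto intro!: always_eventually\<close>)
qed

section \<open>Commutator estimate for compactly supported functions\<close>

context KL_commutator
begin

lemma T_integrable: "f \<in> H1 \<Longrightarrow> integrable lebesgue (T f)"
  using T by (auto simp: class_K_def bounded_H1_L1_def)

text \<open>From one generation to the next the mean over a cube changes by at most 2^d \<beta>, so
  it grows at most linearly in k; a geometric majorant is what the Haar weights accommodate. The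
  second summand of \<open>B\<close> makes B (sqrt 2 - 1) at least 2^d \<beta>, which closes the
  induction; the first one, over the finitely many unit cubes of the box, starts it and depends on
  N.\<close>

lemma cube_ball_mean_growth:
  obtains B where "B > 0" and "\<And>k z. z \<in> box_index N k \<Longrightarrow> norm (cube_ball_mean b k z) \<le> B * sqrt 2 ^ k"
proof -
  obtain \<beta> where \<beta>: "\<beta> > 0" and osc: "\<And>k z. cube_mean k (\<lambda>y. norm (b y - cube_mean k b z)) z \<le> \<beta>"
    and bm: "\<And>k z. norm (cube_mean k b z - cube_ball_mean b k z) \<le> \<beta>"
    using BMO_cubes[OF b] by metis
  have s2: "sqrt 2 > 1" by simp
  define B where "B = (\<Sum>z\<in>(box_index N 0 :: (int^'n) set). norm (cube_mean 0 b z)) + 2 ^ CARD('n) * \<beta> / (sqrt 2 - 1)"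
  have B: "B \<ge> 0" unfolding B_def using \<beta> by (intro add_nonneg_nonneg sum_nonneg) auto
  have "norm (cube_mean k b z) \<le> B * sqrt 2 ^ k" if "z \<in> box_index N k" for k and z :: "int^'n"
    using that
  proof (induction k arbitrary: z)
    case 0
    have "norm (cube_mean 0 b z) \<le> (\<Sum>z\<in>box_index N 0. norm (cube_mean 0 b z))"
      by (rule member_le_sum[OF 0]) (auto intro: finite_box_index)
    then show ?case using \<beta> by (simp add: B_def add_increasing2)
  next
    case (Suc k)
    define z' where "z' = (\<chi> i. z $ i div 2)"
    have w: "z \<in> children z'" by (simp add: children_def z'_def)
    have "z' \<in> box_index N k"
    proof -
      have "- P \<le> a div 2 \<and> a div 2 < P" if "- (2 * P) \<le> a" "a < 2 * P" for a P :: int using that by presburger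
      from this[of "int N * 2 ^ k"] show ?thesis using Suc.prems by (simp add: box_index_def z'_def mult.left_commute)
    qed
    then have IH: "norm (cube_mean k b z') \<le> B * sqrt 2 ^ k" by (rule Suc.IH)
    have "norm (cube_mean (Suc k) b z - cube_mean k b z') \<le> cube_mean (Suc k) (\<lambda>y. norm (b y - cube_mean k b z')) z"
      by (rule norm_cube_mean_diff[OF b_cube_integrable])
    also have "\<dots> \<le> 2 ^ CARD('n) * cube_mean k (\<lambda>y. norm (b y - cube_mean k b z')) z'"
      by (rule cube_mean_child_le[OF cube_integrable_osc[OF b_cube_integrable] _ w]) simp
    also have "\<dots> \<le> 2 ^ CARD('n) * \<beta>" by (intro mult_left_mono osc) simp
    also have "\<dots> \<le> B * (sqrt 2 - 1)"
    proof -
      have "2 ^ CARD('n) * \<beta> / (sqrt 2 - 1) \<le> B" unfolding B_def by (simp add: sum_nonneg)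
      then show ?thesis by (simp add: pos_divide_le_eq)
    qed
    also have "\<dots> \<le> B * (sqrt 2 - 1) * sqrt 2 ^ k"
      using B mult_left_mono[OF one_le_power[of "sqrt 2" k], of "B * (sqrt 2 - 1)"] by simp
    finally have "norm (cube_mean (Suc k) b z - cube_mean k b z') \<le> B * (sqrt 2 - 1) * sqrt 2 ^ k" .
    then have "norm (cube_mean (Suc k) b z) \<le> B * sqrt 2 ^ k + B * (sqrt 2 - 1) * sqrt 2 ^ k"
      using IH norm_triangle_ineq[of "cube_mean k b z'" "cube_mean (Suc k) b z - cube_mean k b z'"] by simp
    also have "\<dots> = B * sqrt 2 ^ Suc k" by (simp add: algebra_simps)
    finally show ?case .
  qed
  note m = this
  show thesis
  proof (rule that[of "B + \<beta>"])
    show "B + \<beta> > 0" using B \<beta> by simp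
    fix k and z :: "int^'n" assume z: "z \<in> box_index N k"
    have "norm (cube_ball_mean b k z) \<le> norm (cube_mean k b z) + \<beta>"
      using bm[of k z] norm_triangle_ineq4[of "cube_mean k b z" "cube_mean k b z - cube_ball_mean b k z"] by simp
    also have "\<dots> \<le> B * sqrt 2 ^ k + \<beta> * sqrt 2 ^ k"
    proof -
      have "\<beta> * 1 \<le> \<beta> * sqrt 2 ^ k" using \<beta> by (intro mult_left_mono one_le_power) auto
      then show ?thesis using m[OF z] by simp
    qed
    finally show "norm (cube_ball_mean b k z) \<le> (B + \<beta>) * sqrt 2 ^ k" by (simp add: distrib_right)
  qed
qed

text \<open>Add and subtract b_Q: at the fixed point x the factor b(x) - b_Q is a scalar and comes
  out of \<open>T\<close>.\<close>

lemma commutator_le_majorant: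
  assumes h: "h \<in> H1" and bh: "(\<lambda>y. (b y - cube_ball_mean b k z) * h y) \<in> H1"
  shows "norm (T (\<lambda>y. (b x - b y) * h y) x) \<le> comm_majorant k z h x"
proof -
  have "(\<lambda>y. (b x - b y) * h y) = (\<lambda>y. (b x - cube_ball_mean b k z) * h y + (-1) * ((b y - cube_ball_mean b k z) * h y))"
    by (simp add: fun_eq_iff algebra_simps)
  then show ?thesis using T_sublinear[OF h bh, of "b x - cube_ball_mean b k z" "-1" x]
    by (simp add: comm_majorant_def)
qed

text \<open>One subsequence has to serve both sequences, because the two limits are combined at the
  same point x; the two moduli are added before a subsequence is extracted.\<close>

lemma T_tendsto_subseq:
  assumes u: "\<And>n. u n \<in> H1" and v: "\<And>n. v n \<in> H1"
    and ul: "(\<lambda>n. H1_norm (u n)) \<longlonglongrightarrow> 0" and vl: "(\<lambda>n. H1_norm (v n)) \<longlonglongrightarrow> 0"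
  shows "\<exists>r::nat\<Rightarrow>nat. strict_mono r \<and> (AE x in lebesgue. (\<lambda>n. T (u (r n)) x) \<longlonglongrightarrow> 0 \<and> (\<lambda>n. T (v (r n)) x) \<longlonglongrightarrow> 0)"
proof -
  obtain C where C: "C > 0" "\<And>f. f \<in> H1 \<Longrightarrow> L1_norm (T f) \<le> ennreal C * H1_norm f" by (fact T_bounded)
  let ?e = "\<lambda>n x. norm (T (u n) x) + norm (T (v n) x)"
  have ei: "integrable lebesgue (?e n)" for n using T_integrable[OF u] T_integrable[OF v] by simp
  have "(\<lambda>n. ennreal C * (H1_norm (u n) + H1_norm (v n))) \<longlonglongrightarrow> ennreal C * (0 + 0)"
    by (intro ennreal_tendsto_cmult tendsto_add ul vl) simp
  then have l: "(\<lambda>n. ennreal C * (H1_norm (u n) + H1_norm (v n))) \<longlonglongrightarrow> 0" by simp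
  have "(\<lambda>n. ennreal (LINT x|lebesgue. norm (?e n x))) \<longlonglongrightarrow> 0"
  proof (rule tendsto_sandwich[OF _ _ tendsto_const l])
    show "\<forall>\<^sub>F n in sequentially. ennreal (LINT x|lebesgue. norm (?e n x)) \<le> ennreal C * (H1_norm (u n) + H1_norm (v n))"
    proof (rule always_eventually, rule allI)
      fix n
      have "ennreal (LINT x|lebesgue. norm (?e n x)) = (\<integral>\<^sup>+x. ennreal (norm (?e n x)) \<partial>lebesgue)"
        using ei[of n] by (intro nn_integral_eq_integral[symmetric]) auto
      also have "\<dots> = L1_norm (T (u n)) + L1_norm (T (v n))"
        unfolding L1_norm_def using T_measurable[OF u] T_measurable[OF v]
        by (subst nn_integral_add[symmetric]) auto
      also have "\<dots> \<le> ennreal C * H1_norm (u n) + ennreal C * H1_norm (v n)" by (intro add_mono C u v)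
      finally show "ennreal (LINT x|lebesgue. norm (?e n x)) \<le> ennreal C * (H1_norm (u n) + H1_norm (v n))"
        by (simp add: distrib_left)
    qed
  qed simp
  then have "(\<lambda>n. LINT x|lebesgue. norm (?e n x)) \<longlonglongrightarrow> 0"
    by (simp add: tendsto_ennreal_iff[of _ _ 0, simplified] ennreal_0[symmetric] Bochner_Integration.integral_nonneg del: ennreal_0)
  from tendsto_L1_AE_subseq[OF ei this] obtain r :: "nat \<Rightarrow> nat" where r: "strict_mono r"
    and ae: "AE x in lebesgue. (\<lambda>n. ?e (r n) x) \<longlonglongrightarrow> 0" by blast
  have "AE x in lebesgue. (\<lambda>n. T (u (r n)) x) \<longlonglongrightarrow> 0 \<and> (\<lambda>n. T (v (r n)) x) \<longlonglongrightarrow> 0"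
    using ae
  proof eventually_elim
    case (elim x)
    show ?case by (intro conjI; rule Lim_null_comparison[OF _ elim]) auto
  qed
  then show ?thesis using r by blast
qed

text \<open>Partial sums u of the Haar expansion obey a pointwise bound by the sum G of the
  majorants of all pieces, and the Haar weights control the integral of G. The bound passes to f
  almost everywhere, because for fixed x the error involves only \<open>T\<close> of f - u and of b
  (f - u). The constant does not depend on the box.\<close>

lemma compact_support_bound:
  obtains C where "C > 0" and "\<And>f g N. integrable lebesgue f \<Longrightarrow> (\<And>j. integrable lebesgue (g j)) \<Longrightarrow> (\<And>j. has_weak_partial j f (g j)) \<Longrightarrow>
     (\<And>y. f y \<noteq> 0 \<Longrightarrow> \<forall>i. - real N \<le> y $ i \<and> y $ i < real N) \<Longrightarrow>
     (\<lambda>y. b y * f y) \<in> H1 \<and>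
     (\<integral>\<^sup>+x. ennreal (norm (commutator b T f x)) \<partial>lebesgue) \<le> ennreal C * (L1_norm f + (\<Sum>j\<in>UNIV. L1_norm (g j)))"
proof -
  obtain C1 where C1: "C1 > 0" and E1: "\<And>k z c M. (\<And>w. w \<in> children z \<Longrightarrow> norm (c w :: 'k) \<le> M) \<Longrightarrow> M \<ge> 0 \<Longrightarrow>
     k = 0 \<or> (LINT y|lebesgue. cube_step k (z::int^'n) c y) = 0 \<Longrightarrow>
     cube_step k z c \<in> H1 \<and> H1_norm (cube_step k z c) \<le> ennreal (C1 * M * (1 / 2 ^ k) ^ CARD('n))"
    by (fact cube_step_H1)
  obtain C2 where C2: "C2 > 0" and E2: "\<And>k z c M. (\<And>w. w \<in> children z \<Longrightarrow> norm (c w) \<le> M) \<Longrightarrow> M \<ge> 0 \<Longrightarrow>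
     (\<lambda>y. (b y - cube_ball_mean b k z) * cube_step k z c y) \<in> H1 \<and>
     H1_norm (\<lambda>y. (b y - cube_ball_mean b k z) * cube_step k z c y) \<le> ennreal (C2 * M * (1 / 2 ^ k) ^ CARD('n) * sqrt 2 ^ k)"
    by (fact cube_step_H1_BMO)
  obtain C3 where C3: "C3 > 0" and E3: "\<And>h k z M. integrable lebesgue h \<Longrightarrow> h \<in> H1 \<Longrightarrow> (\<And>y. norm (h y) \<le> M) \<Longrightarrow>
       (\<And>y. y \<notin> cube k z \<Longrightarrow> h y = 0) \<Longrightarrow> k = 0 \<or> (LINT y|lebesgue. h y) = 0 \<Longrightarrow>
       L1_norm (\<lambda>x. (b x - cube_ball_mean b k z) * T h x) \<le> ennreal (C3 * M * (1 / 2 ^ k) ^ CARD('n))"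
    by (fact T_atom)
  obtain C4 where C4: "C4 > 0" and E4: "\<And>f. f \<in> H1 \<Longrightarrow> L1_norm (T f) \<le> ennreal C4 * H1_norm f" by (fact T_bounded)
  let ?C0 = "1 + 4 ^ CARD('n) / (1 - sqrt 2 / 2)"
  have q: "sqrt 2 / 2 < (1::real)" using real_sqrt_less_mono[of 2 4] by auto
  have C0: "?C0 > 0" using q by (intro add_pos_pos divide_pos_pos) auto
  define C5 where "C5 = C3 + C4 * C2"
  have C5: "C5 > 0" using C2 C3 C4 by (simp add: C5_def add_pos_pos)
  have main: "(\<lambda>y. b y * f y) \<in> H1 \<and>
     (\<integral>\<^sup>+x. ennreal (norm (commutator b T f x)) \<partial>lebesgue) \<le> ennreal (C5 * ?C0) * (L1_norm f + (\<Sum>j\<in>UNIV. L1_norm (g j)))"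
    if f: "integrable lebesgue f" and g: "\<And>j. integrable lebesgue (g j)" and wp: "\<And>j. has_weak_partial j f (g j)"
      and supp: "\<And>y. f y \<noteq> 0 \<Longrightarrow> \<forall>i. - real N \<le> y $ i \<and> y $ i < real N" for f g N
  proof -
    have fc: "cube_integrable f" by (rule integrable_cube_integrable[OF f])
    have [measurable]: "f \<in> borel_measurable lebesgue" "b \<in> borel_measurable lebesgue" using f b_measurable by auto
    let ?Z = "\<lambda>n. box_index N (n - 1) :: (int^'n) set"
    let ?H = "haar f"
    let ?v = "\<lambda>n. (1 / 2 ^ (n - 1)) ^ CARD('n) :: real"
    let ?W = "haar_weight N f"
    let ?B = "\<lambda>n z. cube_ball_mean b (n - 1) z"
    note W = haar_weight_summable[OF f g wp, of N]
    have s1: "1 \<le> sqrt 2 ^ k" for k by (simp add: one_le_power)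
    have H1: "?H n z \<in> H1" and Hn: "H1_norm (?H n z) \<le> ennreal (C1 * haar_size f n z * ?v n)" for n z
      using E1[of z "haar_coeff f n z" "haar_size f n z" "n - 1", OF haar_coeff_le[OF fc] haar_size_nonneg haar_mean_zero[OF fc]]
      by (auto simp: haar_def)
    have bH: "(\<lambda>y. (b y - ?B n z) * ?H n z y) \<in> H1" and
      bHn: "H1_norm (\<lambda>y. (b y - ?B n z) * ?H n z y) \<le> ennreal (C2 * haar_size f n z * ?v n * sqrt 2 ^ (n - 1))" for n z
      using E2[of z "haar_coeff f n z" "haar_size f n z" "n - 1", OF haar_coeff_le[OF fc] haar_size_nonneg]
      by (auto simp: haar_def)
    let ?p = "\<lambda>n y. \<Sum>z\<in>?Z n. ?H n z y"
    have exp: "(\<Sum>n\<le>K. ?p n y) = cube_avg K f y" for K y by (rule haar_expansion[OF supp])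
    \<comment> \<open>Almost everywhere convergence, extracted from convergence in
      \<open>L1\<close>, identifies f and b f as the sums of their series.\<close>
    obtain r where r: "strict_mono (r :: nat \<Rightarrow> nat)" and ae: "AE x in lebesgue. (\<lambda>j. cube_avg (r j) f x) \<longlonglongrightarrow> f x"
    proof -
      have i: "integrable lebesgue (\<lambda>x. f x - cube_avg K f x)" for K
      proof -
        have "integrable lebesgue (\<lambda>x. \<Sum>n\<le>K. ?p n x)" by (intro Bochner_Integration.integrable_sum H1_D(1) H1)
        then show ?thesis using f unfolding exp by simp
      qed
      have "(\<lambda>K. ennreal (LINT x|lebesgue. norm (f x - cube_avg K f x))) \<longlonglongrightarrow> 0"
      proof -
        have "ennreal (LINT x|lebesgue. norm (f x - cube_avg K f x)) = L1_norm (\<lambda>x. f x - cube_avg K f x)" for K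
          unfolding L1_norm_def using i[of K] by (intro nn_integral_eq_integral[symmetric]) auto
        then show ?thesis using cube_avg_tendsto[OF f] by simp
      qed
      then have "(\<lambda>K. LINT x|lebesgue. norm (f x - cube_avg K f x)) \<longlonglongrightarrow> 0"
        by (simp add: tendsto_ennreal_iff[of _ _ 0, simplified] ennreal_0[symmetric] Bochner_Integration.integral_nonneg del: ennreal_0)
      from tendsto_L1_AE_subseq[OF i this] obtain r :: "nat \<Rightarrow> nat" where r: "strict_mono r"
        and ae: "AE x in lebesgue. (\<lambda>n. f x - cube_avg (r n) f x) \<longlonglongrightarrow> 0" by blast
      from ae have "AE x in lebesgue. (\<lambda>j. cube_avg (r j) f x) \<longlonglongrightarrow> f x"
      proof eventually_elim
        case (elim x)
        have "(\<lambda>n. f x - (f x - cube_avg (r n) f x)) \<longlonglongrightarrow> f x - 0" by (intro tendsto_intros elim)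
        then show ?case by simp
      qed
      then show ?thesis using r that by blast
    qed
    have sumW: "(\<Sum>z\<in>?Z n. ennreal (c * haar_size f n z * ?v n * sqrt 2 ^ (n - 1))) = ennreal (c * ?W n)" if "c \<ge> 0" for c n
    proof -
      have "(\<Sum>z\<in>?Z n. ennreal (c * haar_size f n z * ?v n * sqrt 2 ^ (n - 1))) = ennreal (\<Sum>z\<in>?Z n. c * haar_size f n z * ?v n * sqrt 2 ^ (n - 1))"
        using that haar_size_nonneg[of f n] by (intro sum_ennreal mult_nonneg_nonneg) auto
      also have "(\<Sum>z\<in>?Z n. c * haar_size f n z * ?v n * sqrt 2 ^ (n - 1)) = c * ?W n"
        unfolding haar_weight_def sum_distrib_left by (simp only: mult.assoc)
      finally show ?thesis .
    qed
    have le_s: "c * haar_size f n z * ?v n \<le> c * haar_size f n z * ?v n * sqrt 2 ^ (n - 1)" if "c \<ge> 0" for c n z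
      using mult_left_mono[OF s1[of "n - 1"], of "c * haar_size f n z * ?v n"] that haar_size_nonneg[of f n z] by simp
    have pH: "?p n \<in> H1" for n by (intro H1_sum H1)
    have pn: "H1_norm (?p n) \<le> ennreal (C1 * ?W n)" for n
    proof -
      have "H1_norm (?p n) \<le> (\<Sum>z\<in>?Z n. H1_norm (?H n z))" by (intro H1_norm_sum H1_D(1) H1)
      also have "\<dots> \<le> (\<Sum>z\<in>?Z n. ennreal (C1 * haar_size f n z * ?v n * sqrt 2 ^ (n - 1)))"
        using C1 by (intro sum_mono order_trans[OF Hn] ennreal_leI le_s) simp
      finally show ?thesis using sumW[of C1 n] C1 by simp
    qed
    obtain B0 where B0: "B0 > 0" and growth: "\<And>k z. z \<in> box_index N k \<Longrightarrow> norm (cube_ball_mean b k z) \<le> B0 * sqrt 2 ^ k"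
      by (fact cube_ball_mean_growth)
    \<comment> \<open>Here the term b_Q h_Q is included. The growth of b_Q costs 2^(k/2), but
      against the \<open>H1\<close> norm of h_Q, which carries no loss, so the same weights
      suffice.\<close>
    have bp: "(\<lambda>y. b y * ?p n y) \<in> H1 \<and> H1_norm (\<lambda>y. b y * ?p n y) \<le> ennreal ((C2 + B0 * C1) * ?W n)" for n
    proof -
      have eq: "(\<lambda>y. b y * ?p n y) = (\<lambda>y. \<Sum>z\<in>?Z n. (b y - ?B n z) * ?H n z y + ?B n z * ?H n z y)"
        by (simp add: fun_eq_iff sum_distrib_left algebra_simps)
      have t: "H1_norm (\<lambda>y. (b y - ?B n z) * ?H n z y + ?B n z * ?H n z y) \<le> ennreal ((C2 + B0 * C1) * haar_size f n z * ?v n * sqrt 2 ^ (n - 1))"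
        if z: "z \<in> ?Z n" for z
      proof -
        have "H1_norm (\<lambda>y. (b y - ?B n z) * ?H n z y + ?B n z * ?H n z y) \<le> H1_norm (\<lambda>y. (b y - ?B n z) * ?H n z y) + H1_norm (\<lambda>y. ?B n z * ?H n z y)"
          by (intro H1_norm_add H1_D(1) bH H1_cmult H1)
        also have "\<dots> \<le> ennreal (C2 * haar_size f n z * ?v n * sqrt 2 ^ (n - 1)) + ennreal (B0 * sqrt 2 ^ (n - 1)) * ennreal (C1 * haar_size f n z * ?v n)"
          by (intro add_mono bHn order_trans[OF H1_norm_cmult[OF H1_D(1)[OF H1]]] mult_mono Hn ennreal_leI growth z) auto
        also have "\<dots> = ennreal (C2 * haar_size f n z * ?v n * sqrt 2 ^ (n - 1) + B0 * sqrt 2 ^ (n - 1) * (C1 * haar_size f n z * ?v n))"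
          using C1 C2 B0 haar_size_nonneg[of f n z] by (simp add: ennreal_mult)
        also have "C2 * haar_size f n z * ?v n * sqrt 2 ^ (n - 1) + B0 * sqrt 2 ^ (n - 1) * (C1 * haar_size f n z * ?v n) = (C2 + B0 * C1) * haar_size f n z * ?v n * sqrt 2 ^ (n - 1)"
          by (simp add: algebra_simps)
        finally show ?thesis .
      qed
      have "H1_norm (\<lambda>y. b y * ?p n y) \<le> (\<Sum>z\<in>?Z n. H1_norm (\<lambda>y. (b y - ?B n z) * ?H n z y + ?B n z * ?H n z y))"
        unfolding eq by (intro H1_norm_sum H1_D(1) H1_add bH H1_cmult H1)
      also have "\<dots> \<le> (\<Sum>z\<in>?Z n. ennreal ((C2 + B0 * C1) * haar_size f n z * ?v n * sqrt 2 ^ (n - 1)))" by (intro sum_mono t)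
      finally have "H1_norm (\<lambda>y. b y * ?p n y) \<le> ennreal ((C2 + B0 * C1) * ?W n)" using sumW[of "C2 + B0 * C1" n] C1 C2 B0 by simp
      moreover have "(\<lambda>y. b y * ?p n y) \<in> H1" unfolding eq by (intro H1_sum H1_add bH H1_cmult H1)
      ultimately show ?thesis by blast
    qed
    have fl: "f \<in> H1" "(\<lambda>K. H1_norm (\<lambda>x. f x - (\<Sum>n\<le>K. ?p n x))) \<longlonglongrightarrow> 0"
    proof -
      have ae': "AE x in lebesgue. (\<lambda>j. \<Sum>n\<le>r j. ?p n x) \<longlonglongrightarrow> f x" unfolding exp by (fact ae)
      note * = H1_series[of ?p "\<lambda>n. C1 * ?W n", OF pH pn _ _ _ r ae']
      have 1: "0 \<le> C1 * ?W n" for n using C1 haar_weight_nonneg[of N f n] by simp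
      have 2: "summable (\<lambda>n. C1 * ?W n)" by (intro summable_mult W)
      have 3: "f \<in> borel_measurable lebesgue" by measurable
      show "f \<in> H1" "(\<lambda>K. H1_norm (\<lambda>x. f x - (\<Sum>n\<le>K. ?p n x))) \<longlonglongrightarrow> 0"
        using *[OF 1 2 3] by auto
    qed
    have bfl: "(\<lambda>y. b y * f y) \<in> H1" "(\<lambda>K. H1_norm (\<lambda>x. b x * f x - (\<Sum>n\<le>K. b x * ?p n x))) \<longlonglongrightarrow> 0"
    proof -
      have ae': "AE x in lebesgue. (\<lambda>j. \<Sum>n\<le>r j. b x * ?p n x) \<longlonglongrightarrow> b x * f x"
        using ae
      proof eventually_elim
        case (elim x)
        have "(\<lambda>j. b x * (\<Sum>n\<le>r j. ?p n x)) \<longlonglongrightarrow> b x * f x" unfolding exp by (intro tendsto_intros elim)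
        then show ?case by (simp add: sum_distrib_left)
      qed
      note * = H1_series[of "\<lambda>n y. b y * ?p n y" "\<lambda>n. (C2 + B0 * C1) * ?W n", OF bp[THEN conjunct1] bp[THEN conjunct2] _ _ _ r ae']
      have 1: "0 \<le> (C2 + B0 * C1) * ?W n" for n using C1 C2 B0 haar_weight_nonneg[of N f n] by simp
      have 2: "summable (\<lambda>n. (C2 + B0 * C1) * ?W n)" by (intro summable_mult W)
      have 3: "(\<lambda>y. b y * f y) \<in> borel_measurable lebesgue" by measurable
      show "(\<lambda>y. b y * f y) \<in> H1" "(\<lambda>K. H1_norm (\<lambda>x. b x * f x - (\<Sum>n\<le>K. b x * ?p n x))) \<longlonglongrightarrow> 0"
        using *[OF 1 2 3] by auto
    qed
    let ?u = "\<lambda>K x. \<Sum>n\<le>K. ?p n x"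
    have uH: "?u K \<in> H1" for K by (intro H1_sum pH)
    have buH: "(\<lambda>y. b y * ?u K y) \<in> H1" for K
      using H1_sum[of "{..K}" "\<lambda>n y. b y * ?p n y"] bp by (simp add: sum_distrib_left)
    let ?\<Theta> = "\<lambda>n z. comm_majorant (n - 1) z (?H n z)"
    \<comment> \<open>Summed in \<open>ennreal\<close>, the majorants need no discussion of
      convergence, and the integral of G is computed termwise.\<close>
    define G where "G = (\<lambda>x. \<Sum>n. \<Sum>z\<in>?Z n. ennreal (?\<Theta> n z x))"
    have \<Theta>0: "?\<Theta> n z x \<ge> 0" for n z x by (simp add: comm_majorant_def)
    have \<Theta>m[measurable]: "?\<Theta> n z \<in> borel_measurable lebesgue" for n z
      unfolding comm_majorant_def[abs_def] using T_measurable[OF H1[of n z]] T_measurable[OF bH[of n z]] by measurable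
    have \<Theta>: "(\<integral>\<^sup>+x. ennreal (?\<Theta> n z x) \<partial>lebesgue) \<le> ennreal (C5 * haar_size f n z * ?v n * sqrt 2 ^ (n - 1))" for n z
    proof -
      let ?a = "haar_size f n z * ?v n * sqrt 2 ^ (n - 1)"
      have a0: "?a \<ge> 0" using haar_size_nonneg[of f n z] by simp
      have "(\<integral>\<^sup>+x. ennreal (?\<Theta> n z x) \<partial>lebesgue) = (\<integral>\<^sup>+x. ennreal (norm ((b x - ?B n z) * T (?H n z) x)) + ennreal (norm (T (\<lambda>y. (b y - ?B n z) * ?H n z y) x)) \<partial>lebesgue)"
        by (simp add: comm_majorant_def norm_mult)
      also have "\<dots> = L1_norm (\<lambda>x. (b x - ?B n z) * T (?H n z) x) + L1_norm (T (\<lambda>y. (b y - ?B n z) * ?H n z y))"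
        unfolding L1_norm_def using T_measurable[OF H1[of n z]] T_measurable[OF bH[of n z]] by (intro nn_integral_add) auto
      also have "\<dots> \<le> ennreal (C3 * haar_size f n z * ?v n * sqrt 2 ^ (n - 1)) + ennreal C4 * ennreal (C2 * haar_size f n z * ?v n * sqrt 2 ^ (n - 1))"
      proof (rule add_mono)
        have "L1_norm (\<lambda>x. (b x - ?B n z) * T (?H n z) x) \<le> ennreal (C3 * haar_size f n z * ?v n)"
        proof (rule E3[OF H1_D(1)[OF H1] H1])
          show "norm (?H n z y) \<le> haar_size f n z" for y
            unfolding haar_def by (rule cube_step_norm_le) (simp_all add: haar_coeff_le[OF fc] haar_size_nonneg)
          show "?H n z y = 0" if "y \<notin> cube (n - 1) z" for y
            using that unfolding haar_def by (rule cube_step_outside)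
          show "n - 1 = 0 \<or> (LINT y|lebesgue. ?H n z y) = 0"
            unfolding haar_def by (rule haar_mean_zero[OF fc])
        qed
        also have "\<dots> \<le> ennreal (C3 * haar_size f n z * ?v n * sqrt 2 ^ (n - 1))" using C3 by (intro ennreal_leI le_s) simp
        finally show "L1_norm (\<lambda>x. (b x - ?B n z) * T (?H n z) x) \<le> ennreal (C3 * haar_size f n z * ?v n * sqrt 2 ^ (n - 1))" .
        show "L1_norm (T (\<lambda>y. (b y - ?B n z) * ?H n z y)) \<le> ennreal C4 * ennreal (C2 * haar_size f n z * ?v n * sqrt 2 ^ (n - 1))"
          by (rule order_trans[OF E4[OF bH]]) (intro mult_left_mono bHn, simp)
      qed
      also have "\<dots> = ennreal (C3 * haar_size f n z * ?v n * sqrt 2 ^ (n - 1) + C4 * (C2 * haar_size f n z * ?v n * sqrt 2 ^ (n - 1)))"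
        using C2 C3 C4 haar_size_nonneg[of f n z] by (simp add: ennreal_mult)
      also have "C3 * haar_size f n z * ?v n * sqrt 2 ^ (n - 1) + C4 * (C2 * haar_size f n z * ?v n * sqrt 2 ^ (n - 1)) = C5 * haar_size f n z * ?v n * sqrt 2 ^ (n - 1)"
        by (simp only: C5_def distrib_right mult.assoc)
      finally show ?thesis .
    qed
    have "(\<integral>\<^sup>+x. G x \<partial>lebesgue) = (\<Sum>n. \<integral>\<^sup>+x. (\<Sum>z\<in>?Z n. ennreal (?\<Theta> n z x)) \<partial>lebesgue)"
      unfolding G_def by (rule nn_integral_suminf) measurable
    also have "\<dots> = (\<Sum>n. \<Sum>z\<in>?Z n. \<integral>\<^sup>+x. ennreal (?\<Theta> n z x) \<partial>lebesgue)"
      by (intro suminf_cong nn_integral_sum) measurable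
    also have "\<dots> \<le> (\<Sum>n. ennreal (C5 * ?W n))"
    proof (rule suminf_le)
      fix n
      have "(\<Sum>z\<in>?Z n. \<integral>\<^sup>+x. ennreal (?\<Theta> n z x) \<partial>lebesgue) \<le> (\<Sum>z\<in>?Z n. ennreal (C5 * haar_size f n z * ?v n * sqrt 2 ^ (n - 1)))"
        by (intro sum_mono \<Theta>)
      then show "(\<Sum>z\<in>?Z n. \<integral>\<^sup>+x. ennreal (?\<Theta> n z x) \<partial>lebesgue) \<le> ennreal (C5 * ?W n)" using sumW[of C5 n] C5 by simp
    qed auto
    also have "\<dots> = ennreal (\<Sum>n. C5 * ?W n)"
      using C5 W(1) haar_weight_nonneg[of N f] by (intro suminf_ennreal2 summable_mult) auto
    also have "(\<Sum>n. C5 * ?W n) = C5 * (\<Sum>n. ?W n)" using W(1) by (rule suminf_mult)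
    also have "ennreal (C5 * (\<Sum>n. ?W n)) = ennreal C5 * ennreal (\<Sum>n. ?W n)"
      using C5 W(1) haar_weight_nonneg[of N f] by (intro ennreal_mult suminf_nonneg) auto
    also have "\<dots> \<le> ennreal C5 * (ennreal ?C0 * (L1_norm f + (\<Sum>j\<in>UNIV. L1_norm (g j))))"
      by (intro mult_left_mono W(2)) simp
    also have "\<dots> = ennreal (C5 * ?C0) * (L1_norm f + (\<Sum>j\<in>UNIV. L1_norm (g j)))"
      using C5 C0 by (simp only: ennreal_mult[OF less_imp_le[OF C5] less_imp_le[OF C0]] mult.assoc)
    finally have GI: "(\<integral>\<^sup>+x. G x \<partial>lebesgue) \<le> ennreal (C5 * ?C0) * (L1_norm f + (\<Sum>j\<in>UNIV. L1_norm (g j)))" .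
    have uG: "ennreal (norm (T (\<lambda>y. (b x - b y) * ?u K y) x)) \<le> G x" for K x
    proof -
      have m: "norm (T (\<lambda>y. (b x - b y) * ?H n z y) x) \<le> ?\<Theta> n z x" for n z
        by (rule commutator_le_majorant[OF H1 bH])
      have hH: "(\<lambda>y. (b x - b y) * ?H n z y) \<in> H1" for n z
      proof -
        have "(\<lambda>y. (b x - b y) * ?H n z y) = (\<lambda>y. (b x - ?B n z) * ?H n z y - (b y - ?B n z) * ?H n z y)"
          by (simp add: fun_eq_iff algebra_simps)
        then show ?thesis using H1_diff[OF H1_cmult[OF H1] bH] by simp
      qed
      have "norm (T (\<lambda>y. (b x - b y) * ?u K y) x) = norm (T (\<lambda>y. \<Sum>n\<le>K. \<Sum>z\<in>?Z n. (b x - b y) * ?H n z y) x)"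
        by (simp add: sum_distrib_left)
      also have "\<dots> \<le> (\<Sum>n\<le>K. norm (T (\<lambda>y. \<Sum>z\<in>?Z n. (b x - b y) * ?H n z y) x))"
        by (intro T_sum H1_sum hH)
      also have "\<dots> \<le> (\<Sum>n\<le>K. \<Sum>z\<in>?Z n. norm (T (\<lambda>y. (b x - b y) * ?H n z y) x))"
        by (intro sum_mono T_sum hH)
      also have "\<dots> \<le> (\<Sum>n\<le>K. \<Sum>z\<in>?Z n. ?\<Theta> n z x)" by (intro sum_mono m)
      finally have "ennreal (norm (T (\<lambda>y. (b x - b y) * ?u K y) x)) \<le> ennreal (\<Sum>n\<le>K. \<Sum>z\<in>?Z n. ?\<Theta> n z x)" by (rule ennreal_leI)
      also have "\<dots> = (\<Sum>n\<le>K. \<Sum>z\<in>?Z n. ennreal (?\<Theta> n z x))"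
        using \<Theta>0 by (simp add: sum_nonneg flip: sum_ennreal)
      also have "\<dots> \<le> G x" unfolding G_def by (intro sum_le_suminf) auto
      finally show ?thesis .
    qed
    obtain s where s: "strict_mono (s :: nat \<Rightarrow> nat)" and
      sa: "AE x in lebesgue. (\<lambda>n. T (\<lambda>y. f y - ?u (s n) y) x) \<longlonglongrightarrow> 0 \<and> (\<lambda>n. T (\<lambda>y. b y * f y - (\<Sum>i\<le>s n. b y * ?p i y)) x) \<longlonglongrightarrow> 0"
    proof -
      have "(\<lambda>y. f y - ?u K y) \<in> H1" for K by (intro H1_diff fl uH)
      moreover have "(\<lambda>y. b y * f y - (\<Sum>i\<le>K. b y * ?p i y)) \<in> H1" for K
        using bp by (intro H1_diff bfl H1_sum) auto
      ultimately show ?thesis using T_tendsto_subseq[OF _ _ fl(2) bfl(2)] that by blast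
    qed
    have "AE x in lebesgue. ennreal (norm (commutator b T f x)) \<le> G x"
      using sa
    proof eventually_elim
      case (elim x)
      let ?e1 = "\<lambda>n. T (\<lambda>y. f y - ?u (s n) y) x" and ?e2 = "\<lambda>n. T (\<lambda>y. b y * f y - (\<Sum>i\<le>s n. b y * ?p i y)) x"
      \<comment> \<open>With u the K-th partial sum, (b(x) - b) f is (b(x) - b) u + b(x) (f - u) - b
        (f - u), and b(x) is a scalar for \<open>T\<close>.\<close>
      have le: "norm (commutator b T f x) \<le> norm (T (\<lambda>y. (b x - b y) * ?u K y) x) + (norm (b x) * norm (T (\<lambda>y. f y - ?u K y) x) + norm (T (\<lambda>y. b y * f y - (\<Sum>i\<le>K. b y * ?p i y)) x))" for K
      proof -
        let ?a = "\<lambda>y. (b x - b y) * ?u K y" and ?c = "\<lambda>y. f y - ?u K y" and ?d = "\<lambda>y. b y * f y - (\<Sum>i\<le>K. b y * ?p i y)"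
        have cH: "?c \<in> H1" by (intro H1_diff fl uH)
        have dH: "?d \<in> H1" using bp by (intro H1_diff bfl H1_sum) auto
        have aH: "?a \<in> H1"
        proof -
          have "?a = (\<lambda>y. b x * ?u K y - b y * ?u K y)" by (simp add: fun_eq_iff left_diff_distrib)
          then show ?thesis using H1_diff[OF H1_cmult[OF uH] buH] by simp
        qed
        have eq: "commutator b T f x = T (\<lambda>y. ?a y + (b x * ?c y + (-1) * ?d y)) x"
        proof -
          have "(\<Sum>i\<le>K. b y * ?p i y) = b y * ?u K y" for y by (simp only: sum_distrib_left)
          then have "(\<lambda>y. (b x - b y) * f y) = (\<lambda>y. ?a y + (b x * ?c y + (-1) * ?d y))"
            by (simp only: fun_eq_iff) (simp add: algebra_simps)
          then show ?thesis unfolding commutator_def by (simp only:)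
        qed
        have "norm (commutator b T f x) \<le> norm (T ?a x) + norm (T (\<lambda>y. b x * ?c y + (-1) * ?d y) x)"
          unfolding eq by (rule T_add[OF aH H1_add[OF H1_cmult[OF cH] H1_cmult[OF dH]]])
        also have "\<dots> \<le> norm (T ?a x) + (norm (b x) * norm (T ?c x) + norm (T ?d x))"
          using T_sublinear[OF cH dH, of "b x" "-1" x] by (simp only: norm_minus_cancel norm_one mult_1 add_left_mono)
        finally show ?thesis .
      qed
      have "(\<lambda>n. norm (b x) * norm (?e1 n) + norm (?e2 n)) \<longlonglongrightarrow> norm (b x) * norm (0::'k) + norm (0::'k)"
        using elim by (intro tendsto_intros) auto
      then have "(\<lambda>n. G x + ennreal (norm (b x) * norm (?e1 n) + norm (?e2 n))) \<longlonglongrightarrow> G x + ennreal 0"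
        by (intro tendsto_add tendsto_const tendsto_ennrealI) simp
      then have "(\<lambda>n. G x + ennreal (norm (b x) * norm (?e1 n) + norm (?e2 n))) \<longlonglongrightarrow> G x" by simp
      moreover have "ennreal (norm (commutator b T f x)) \<le> G x + ennreal (norm (b x) * norm (?e1 n) + norm (?e2 n))" for n
      proof -
        have "ennreal (norm (commutator b T f x)) \<le> ennreal (norm (T (\<lambda>y. (b x - b y) * ?u (s n) y) x)) + ennreal (norm (b x) * norm (?e1 n) + norm (?e2 n))"
          using ennreal_leI[OF le[of "s n"]] by (simp only: ennreal_plus norm_ge_zero add_nonneg_nonneg mult_nonneg_nonneg)
        also have "\<dots> \<le> G x + ennreal (norm (b x) * norm (?e1 n) + norm (?e2 n))" by (intro add_right_mono uG)
        finally show ?thesis .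
      qed
      ultimately show ?case by (intro LIMSEQ_le_const) auto
    qed
    then have "(\<integral>\<^sup>+x. ennreal (norm (commutator b T f x)) \<partial>lebesgue) \<le> (\<integral>\<^sup>+x. G x \<partial>lebesgue)"
      by (rule nn_integral_mono_AE)
    with GI show ?thesis using bfl by auto
  qed
  have "C5 * ?C0 > 0" using C5 C0 by (rule mult_pos_pos)
  then show thesis by (rule that) (fact main)
qed

end

section \<open>Cutoffs in Hardy--Sobolev spaces\<close>

lemma tendsto_0_mono_ennreal:
  fixes u v :: "'a \<Rightarrow> ennreal"
  assumes "\<And>n. u n \<le> v n" and "(v \<longlongrightarrow> 0) F"
  shows "(u \<longlongrightarrow> 0) F"
  by (rule tendsto_sandwich[OF _ _ tendsto_const assms(2)]) (use assms(1) in \<open>auto intro: always_eventually\<close>)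

text \<open>The bump is normalised at the origin; by continuity its dilates then converge to 1
  pointwise.\<close>

lemma cutoff_exists:
  obtains \<eta> :: "real^'n \<Rightarrow> real" where "test_function \<eta>" "\<eta> 0 = 1" "\<And>x. norm x \<ge> 1 \<Longrightarrow> \<eta> x = 0"
proof
  have b0: "bump (0 :: real^'n) > 0" by (rule bump_0)
  have "smooth (\<lambda>x::real^'n. 1 / bump (0 :: real^'n))" by (intro smooth_alg_smooth smooth_alg.const)
  then show "test_function (\<lambda>x::real^'n. bump x * (1 / bump (0 :: real^'n)))"
    by (intro test_function_mult test_function_bump)
  show "bump (0 :: real^'n) * (1 / bump (0 :: real^'n)) = 1" using b0 by simp
  show "bump x * (1 / bump (0 :: real^'n)) = 0" if "norm x \<ge> 1" for x :: "real^'n" using bump_outside[OF that] by simp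
qed

definition dilate :: "nat \<Rightarrow> (real^'n \<Rightarrow> real) \<Rightarrow> real^'n \<Rightarrow> real" where
  "dilate n u x = u ((1 / real (Suc n)) *\<^sub>R x)"

lemma test_function_dilate: "test_function u \<Longrightarrow> test_function (dilate n u)"
  using test_function_affine[of u "1 / real (Suc n)" 0] by (simp add: dilate_def[abs_def])

lemma partial_dilate: "smooth u \<Longrightarrow> partial j (dilate n u) x = 1 / real (Suc n) * dilate n (partial j u) x"
  using partial_affine[of u j 0 "1 / real (Suc n)" x] by (simp add: dilate_def[abs_def])

lemma dilate_Lipschitz:
  assumes L: "\<And>x y. \<bar>u x - u y\<bar> \<le> \<Lambda> * norm (x - y)"
  shows "\<bar>dilate n u x - dilate n u y\<bar> \<le> \<Lambda> / real (Suc n) * norm (x - y)"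
proof -
  have "\<bar>dilate n u x - dilate n u y\<bar> \<le> \<Lambda> * norm ((1 / real (Suc n)) *\<^sub>R x - (1 / real (Suc n)) *\<^sub>R y)"
    unfolding dilate_def by (rule L)
  also have "norm ((1 / real (Suc n)) *\<^sub>R x - (1 / real (Suc n)) *\<^sub>R y) = 1 / real (Suc n) * norm (x - y)"
    unfolding scaleR_diff_right[symmetric] norm_scaleR by simp
  finally show ?thesis by simp
qed

lemma dilate_tendsto:
  assumes u: "test_function u"
  shows "(\<lambda>n. dilate n u x) \<longlonglongrightarrow> u 0"
proof -
  have "(\<lambda>n. (1 / real (Suc n)) *\<^sub>R x) \<longlonglongrightarrow> 0 *\<^sub>R x"
    by (intro tendsto_scaleR tendsto_const LIMSEQ_Suc lim_1_over_n)
  then have "(\<lambda>n. (1 / real (Suc n)) *\<^sub>R x) \<longlonglongrightarrow> 0" by simp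
  moreover have "isCont u 0"
    using smooth_continuous[OF test_function_smooth[OF u], of UNIV] by (simp add: continuous_on_eq_continuous_at)
  ultimately show ?thesis unfolding dilate_def by (rule isCont_tendsto_compose[rotated])
qed

lemma test_scaleR_integrable:
  fixes f :: "real^'n \<Rightarrow> 'k::{real_normed_field,euclidean_space}"
  assumes f: "integrable lebesgue f" and u: "test_function u"
  shows "integrable lebesgue (\<lambda>x. u x *\<^sub>R f x)"
proof -
  obtain B where B: "\<And>x. \<bar>u x\<bar> \<le> B" using test_function_bounded[OF u] by blast
  have "u \<in> borel_measurable lebesgue" using test_function_measurable[OF u] by (intro measurable_completion) simp
  then show ?thesis by (rule integrable_bounded_scaleR[OF f _ B])
qed

section \<open>Weak derivatives under linear combination and multiplication\<close>

lemma has_weak_partial_lincomb: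
  fixes f g f' g' :: "real^'n \<Rightarrow> 'k::{real_normed_field,euclidean_space}"
  assumes i: "integrable lebesgue f" "integrable lebesgue g" "integrable lebesgue f'" "integrable lebesgue g'"
    and w: "has_weak_partial j f g" "has_weak_partial j f' g'"
  shows "has_weak_partial j (\<lambda>x. \<alpha> * f x + \<beta> * f' x) (\<lambda>x. \<alpha> * g x + \<beta> * g' x)"
  unfolding has_weak_partial_def
proof (intro conjI allI impI)
  show "loc_integrable (\<lambda>x. \<alpha> * f x + \<beta> * f' x)" "loc_integrable (\<lambda>x. \<alpha> * g x + \<beta> * g' x)"
    using i by (intro integrable_imp_loc_integrable Bochner_Integration.integrable_add integrable_mult_right; simp)+
  have split: "(LINT x|lebesgue. v x *\<^sub>R (\<alpha> * p x + \<beta> * p' x)) = \<alpha> * (LINT x|lebesgue. v x *\<^sub>R p x) + \<beta> * (LINT x|lebesgue. v x *\<^sub>R p' x)"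
    if v: "test_function v" and p: "integrable lebesgue p" "integrable lebesgue p'" for v and p p' :: "real^'n \<Rightarrow> 'k"
  proof -
    have "(LINT x|lebesgue. v x *\<^sub>R (\<alpha> * p x + \<beta> * p' x)) = (LINT x|lebesgue. \<alpha> * (v x *\<^sub>R p x) + \<beta> * (v x *\<^sub>R p' x))"
      by (simp add: scaleR_add_right)
    also have "\<dots> = (LINT x|lebesgue. \<alpha> * (v x *\<^sub>R p x)) + (LINT x|lebesgue. \<beta> * (v x *\<^sub>R p' x))"
      by (intro Bochner_Integration.integral_add integrable_mult_right test_scaleR_integrable p v)
    also have "\<dots> = \<alpha> * (LINT x|lebesgue. v x *\<^sub>R p x) + \<beta> * (LINT x|lebesgue. v x *\<^sub>R p' x)"
      by (simp only: integral_mult_right_zero)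
    finally show ?thesis .
  qed
  fix \<phi> :: "real^'n \<Rightarrow> real" assume \<phi>: "test_function \<phi>"
  have "(LINT x|lebesgue. partial j \<phi> x *\<^sub>R f x) = - (LINT x|lebesgue. \<phi> x *\<^sub>R g x)"
    "(LINT x|lebesgue. partial j \<phi> x *\<^sub>R f' x) = - (LINT x|lebesgue. \<phi> x *\<^sub>R g' x)"
    using w \<phi> by (auto simp: has_weak_partial_def)
  then show "(LINT x|lebesgue. partial j \<phi> x *\<^sub>R (\<alpha> * f x + \<beta> * f' x)) = - (LINT x|lebesgue. \<phi> x *\<^sub>R (\<alpha> * g x + \<beta> * g' x))"
    by (simp only: split[OF \<phi> i(2,4)] split[OF test_function_partial[OF \<phi>] i(1,3)]) simp
qed

text \<open>The weak derivative of f is tested with u \<phi>, and the classical derivative of this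
  product is expanded.\<close>

lemma has_weak_partial_test_mult:
  fixes f g :: "real^'n \<Rightarrow> 'k::{real_normed_field,euclidean_space}"
  assumes i: "integrable lebesgue f" "integrable lebesgue g" and w: "has_weak_partial j f g" and u: "test_function u"
  shows "has_weak_partial j (\<lambda>x. u x *\<^sub>R f x) (\<lambda>x. u x *\<^sub>R g x + partial j u x *\<^sub>R f x)"
  unfolding has_weak_partial_def
proof (intro conjI allI impI)
  have u': "test_function (partial j u)" by (rule test_function_partial[OF u])
  have I: "integrable lebesgue (\<lambda>x. u x *\<^sub>R f x)" "integrable lebesgue (\<lambda>x. u x *\<^sub>R g x)" "integrable lebesgue (\<lambda>x. partial j u x *\<^sub>R f x)"
    by (intro test_scaleR_integrable i u u')+
  show "loc_integrable (\<lambda>x. u x *\<^sub>R f x)" "loc_integrable (\<lambda>x. u x *\<^sub>R g x + partial j u x *\<^sub>R f x)"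
    by (intro integrable_imp_loc_integrable Bochner_Integration.integrable_add I)+
  fix \<phi> :: "real^'n \<Rightarrow> real" assume \<phi>: "test_function \<phi>"
  have u\<phi>: "test_function (\<lambda>x. u x * \<phi> x)" by (intro test_function_mult u test_function_smooth \<phi>)
  have "(LINT x|lebesgue. partial j (\<lambda>x. u x * \<phi> x) x *\<^sub>R f x) = - (LINT x|lebesgue. (u x * \<phi> x) *\<^sub>R g x)"
    using w u\<phi> by (auto simp: has_weak_partial_def)
  moreover have "(LINT x|lebesgue. partial j (\<lambda>x. u x * \<phi> x) x *\<^sub>R f x)
      = (LINT x|lebesgue. partial j \<phi> x *\<^sub>R (u x *\<^sub>R f x)) + (LINT x|lebesgue. \<phi> x *\<^sub>R (partial j u x *\<^sub>R f x))"
  proof (subst Bochner_Integration.integral_add[symmetric])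
    show "integrable lebesgue (\<lambda>x. partial j \<phi> x *\<^sub>R (u x *\<^sub>R f x))" "integrable lebesgue (\<lambda>x. \<phi> x *\<^sub>R (partial j u x *\<^sub>R f x))"
      by (intro test_scaleR_integrable I \<phi> test_function_partial)+
    show "(LINT x|lebesgue. partial j (\<lambda>x. u x * \<phi> x) x *\<^sub>R f x) = (LINT x|lebesgue. partial j \<phi> x *\<^sub>R (u x *\<^sub>R f x) + \<phi> x *\<^sub>R (partial j u x *\<^sub>R f x))"
      unfolding partial_mult[OF test_function_smooth[OF u] test_function_smooth[OF \<phi>]] by (simp add: scaleR_add_left mult.commute)
  qed
  moreover have "(LINT x|lebesgue. \<phi> x *\<^sub>R (u x *\<^sub>R g x + partial j u x *\<^sub>R f x))
      = (LINT x|lebesgue. (u x * \<phi> x) *\<^sub>R g x) + (LINT x|lebesgue. \<phi> x *\<^sub>R (partial j u x *\<^sub>R f x))"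
  proof (subst Bochner_Integration.integral_add[symmetric])
    show "integrable lebesgue (\<lambda>x. (u x * \<phi> x) *\<^sub>R g x)" "integrable lebesgue (\<lambda>x. \<phi> x *\<^sub>R (partial j u x *\<^sub>R f x))"
      by (intro test_scaleR_integrable I \<phi> u\<phi> i)+
    show "(LINT x|lebesgue. \<phi> x *\<^sub>R (u x *\<^sub>R g x + partial j u x *\<^sub>R f x)) = (LINT x|lebesgue. (u x * \<phi> x) *\<^sub>R g x + \<phi> x *\<^sub>R (partial j u x *\<^sub>R f x))"
      by (simp add: scaleR_add_right mult.commute)
  qed
  ultimately show "(LINT x|lebesgue. partial j \<phi> x *\<^sub>R (u x *\<^sub>R f x)) = - (LINT x|lebesgue. \<phi> x *\<^sub>R (u x *\<^sub>R g x + partial j u x *\<^sub>R f x))"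
    by (simp add: algebra_simps)
qed

lemma H11_D: "f \<in> H11 \<Longrightarrow> f \<in> H1"
  by (simp add: H11_def)

lemma H11_weak_partials:
  assumes "f \<in> H11"
  obtains g where "\<And>j. g j \<in> H1" "\<And>j. has_weak_partial j f (g j)"
proof -
  have "\<forall>j. \<exists>g. g \<in> H1 \<and> has_weak_partial j f g" using assms by (auto simp: H11_def)
  then show ?thesis using that by metis
qed

text \<open>\<open>weak_partial\<close> chooses one weak derivative; all of them agree almost
  everywhere and \<open>H1_norm\<close> does not distinguish them, so any weak derivatives at hand
  may be used.\<close>

lemma H11_norm_eq:
  fixes f :: "real^'n \<Rightarrow> 'k::{real_normed_field,euclidean_space}"
  assumes w: "\<And>j. has_weak_partial j f (g j)"
  shows "H11_norm f = H1_norm f + (\<Sum>j\<in>UNIV. H1_norm (g j))"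
proof -
  have "H1_norm (weak_partial j f) = H1_norm (g j)" for j
  proof (rule H1_norm_cong_AE)
    have w': "has_weak_partial j f (weak_partial j f)" unfolding weak_partial_def by (rule someI[of "has_weak_partial j f", OF w[of j]])
    show "weak_partial j f \<in> borel_measurable lebesgue" "g j \<in> borel_measurable lebesgue"
      using w' w[of j] by (auto simp: has_weak_partial_def intro: loc_integrable_measurable)
    show "AE x in lebesgue. weak_partial j f x = g j x" by (rule AE_completion[OF weak_partial_unique[OF w' w]])
  qed
  then show ?thesis by (simp add: H11_norm_def)
qed

lemma H1_norm_lincomb:
  fixes f g :: "real^'n \<Rightarrow> 'k::{real_normed_field,euclidean_space}"
  assumes f: "f \<in> H1" and g: "g \<in> H1"
  shows "H1_norm (\<lambda>x. \<alpha> * f x + \<beta> * g x) \<le> ennreal (norm \<alpha>) * H1_norm f + ennreal (norm \<beta>) * H1_norm g"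
  by (rule order_trans[OF H1_norm_add add_mono[OF H1_norm_cmult H1_norm_cmult]]) (use H1_D(1)[OF f] H1_D(1)[OF g] in simp_all)

lemma H11_lincomb:
  fixes f g :: "real^'n \<Rightarrow> 'k::{real_normed_field,euclidean_space}"
  assumes f: "f \<in> H11" and g: "g \<in> H11"
  shows "(\<lambda>x. \<alpha> * f x + \<beta> * g x) \<in> H11"
    and "H11_norm (\<lambda>x. \<alpha> * f x + \<beta> * g x) \<le> ennreal (norm \<alpha>) * H11_norm f + ennreal (norm \<beta>) * H11_norm g"
proof -
  obtain f' where f': "\<And>j. f' j \<in> H1" "\<And>j. has_weak_partial j f (f' j)" by (fact H11_weak_partials[OF f])
  obtain g' where g': "\<And>j. g' j \<in> H1" "\<And>j. has_weak_partial j g (g' j)" by (fact H11_weak_partials[OF g])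
  have w: "has_weak_partial j (\<lambda>x. \<alpha> * f x + \<beta> * g x) (\<lambda>x. \<alpha> * f' j x + \<beta> * g' j x)" for j
    by (intro has_weak_partial_lincomb H1_D(1) H11_D f g f' g')
  have "(\<lambda>x. \<alpha> * f x + \<beta> * g x) \<in> H1" "\<And>j. (\<lambda>x. \<alpha> * f' j x + \<beta> * g' j x) \<in> H1"
    by (intro H1_add H1_cmult H11_D f g f' g')+
  then show "(\<lambda>x. \<alpha> * f x + \<beta> * g x) \<in> H11" using w by (auto simp: H11_def)
  have "H11_norm (\<lambda>x. \<alpha> * f x + \<beta> * g x) \<le> (ennreal (norm \<alpha>) * H1_norm f + ennreal (norm \<beta>) * H1_norm g)
      + (\<Sum>j\<in>UNIV. ennreal (norm \<alpha>) * H1_norm (f' j) + ennreal (norm \<beta>) * H1_norm (g' j))"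
    unfolding H11_norm_eq[OF w] by (intro add_mono sum_mono H1_norm_lincomb H11_D f g f' g')
  also have "\<dots> = ennreal (norm \<alpha>) * H11_norm f + ennreal (norm \<beta>) * H11_norm g"
    unfolding H11_norm_eq[OF f'(2)] H11_norm_eq[OF g'(2)]
    by (simp add: sum.distrib sum_distrib_left distrib_left ac_simps)
  finally show "H11_norm (\<lambda>x. \<alpha> * f x + \<beta> * g x) \<le> ennreal (norm \<alpha>) * H11_norm f + ennreal (norm \<beta>) * H11_norm g" .
qed

lemma H11_diff:
  fixes f g :: "real^'n \<Rightarrow> 'k::{real_normed_field,euclidean_space}"
  assumes "f \<in> H11" and "g \<in> H11"
  shows "(\<lambda>x. f x - g x) \<in> H11" and "H11_norm (\<lambda>x. f x - g x) \<le> H11_norm f + H11_norm g"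
  using H11_lincomb[OF assms, of 1 "-1"] by simp_all

lemma L1_norms_le_H11_norm:
  fixes f :: "real^'n \<Rightarrow> 'k::{real_normed_field,euclidean_space}"
  assumes f: "f \<in> H1" and g: "\<And>j. g j \<in> H1" and w: "\<And>j. has_weak_partial j f (g j)"
  shows "L1_norm f + (\<Sum>j\<in>UNIV. L1_norm (g j)) \<le> H11_norm f"
  unfolding H11_norm_eq[OF w] by (intro add_mono sum_mono L1_norm_le_H1_norm H1_D(1) f g)

lemma H11_norm_finite: "f \<in> H11 \<Longrightarrow> H11_norm f < \<infinity>"
proof -
  assume f: "f \<in> H11"
  obtain f' where f': "\<And>j. f' j \<in> H1" "\<And>j. has_weak_partial j f (f' j)" by (fact H11_weak_partials[OF f])
  show ?thesis unfolding H11_norm_eq[OF f'(2)] using H1_D(2)[OF H11_D[OF f]] H1_D(2)[OF f'(1)] by (simp add: less_top)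
qed

text \<open>In \<open>H1_norm_mult\<close> the first term tends to 0 by dominated convergence, with
  A times the maximal function of G as majorant, and the second because the Lipschitz constants tend
  to 0. The supremum of |v| would not do: for 1 - \<eta>(x/n) it does not tend to 0.\<close>

lemma H1_mult_tendsto:
  fixes v :: "nat \<Rightarrow> real^'n \<Rightarrow> real" and G :: "real^'n \<Rightarrow> 'k::{real_normed_field,euclidean_space}"
  assumes G: "G \<in> H1" and v: "\<And>n. v n \<in> borel_measurable borel" and A: "\<And>n x. \<bar>v n x\<bar> \<le> A"
    and L: "\<And>n x y. \<bar>v n x - v n y\<bar> \<le> \<Lambda> n * norm (x - y)" "\<And>n. \<Lambda> n \<ge> 0" "\<Lambda> \<longlonglongrightarrow> 0"
    and lim: "\<And>x. (\<lambda>n. v n x) \<longlonglongrightarrow> 0"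
  shows "(\<lambda>y. v n y *\<^sub>R G y) \<in> H1" and "(\<lambda>n. H1_norm (\<lambda>y. v n y *\<^sub>R G y)) \<longlonglongrightarrow> 0"
proof -
  obtain \<kappa> where \<kappa>: "\<kappa> > 0" and E: "\<And>(v :: real^'n \<Rightarrow> real) A \<Lambda> (f :: real^'n \<Rightarrow> 'k).
     v \<in> borel_measurable borel \<Longrightarrow> (\<And>x. \<bar>v x\<bar> \<le> A) \<Longrightarrow> (\<And>x y. \<bar>v x - v y\<bar> \<le> \<Lambda> * norm (x - y)) \<Longrightarrow> \<Lambda> \<ge> 0 \<Longrightarrow> integrable lebesgue f \<Longrightarrow>
     H1_norm (\<lambda>y. v y *\<^sub>R f y) \<le> (\<integral>\<^sup>+x. ennreal \<bar>v x\<bar> * maximal_L f x \<partial>lebesgue) + ennreal (\<Lambda> * \<kappa>) * L1_norm f"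
    by (fact H1_norm_mult)
  have Gi: "integrable lebesgue G" by (rule H1_D(1)[OF G])
  have [measurable]: "maximal_L G \<in> borel_measurable lebesgue" "v n \<in> borel_measurable lebesgue" for n
    using maximal_L_measurable[OF Gi] v by (auto intro: measurable_completion)
  have A0: "A \<ge> 0" using A[of 0 0] by simp
  have fin: "(\<integral>\<^sup>+x. ennreal A * maximal_L G x \<partial>lebesgue) < \<infinity>"
    using H1_D(2)[OF G] by (simp add: nn_integral_cmult H1_norm_def[symmetric] ennreal_mult_less_top)
  have le: "ennreal \<bar>v n x\<bar> * maximal_L G x \<le> ennreal A * maximal_L G x" for n x
    using A by (intro mult_right_mono ennreal_leI) auto
  have bound: "H1_norm (\<lambda>y. v n y *\<^sub>R G y) \<le> (\<integral>\<^sup>+x. ennreal \<bar>v n x\<bar> * maximal_L G x \<partial>lebesgue) + ennreal (\<Lambda> n * \<kappa>) * L1_norm G" for n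
    by (rule E[OF v A L(1,2) Gi])
  have "(\<integral>\<^sup>+x. ennreal \<bar>v n x\<bar> * maximal_L G x \<partial>lebesgue) \<le> (\<integral>\<^sup>+x. ennreal A * maximal_L G x \<partial>lebesgue)"
    by (intro nn_integral_mono le)
  then have "H1_norm (\<lambda>y. v n y *\<^sub>R G y) < \<infinity>"
    using bound[of n] fin integrable_L1_norm[OF Gi] by (auto intro!: le_less_trans[OF bound] simp: ennreal_mult_less_top)
  moreover have "integrable lebesgue (\<lambda>y. v n y *\<^sub>R G y)" by (rule integrable_bounded_scaleR[OF Gi _ A]) measurable
  ultimately show "(\<lambda>y. v n y *\<^sub>R G y) \<in> H1" by (simp add: H1_def)
  have "(\<lambda>n. \<integral>\<^sup>+x. ennreal \<bar>v n x\<bar> * maximal_L G x \<partial>lebesgue) \<longlonglongrightarrow> (\<integral>\<^sup>+x. 0 \<partial>(lebesgue :: (real^'n) measure))"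
  proof (rule nn_integral_dominated_convergence[where w="\<lambda>x. ennreal A * maximal_L G x"])
    have "AE x in lebesgue. maximal_L G x \<noteq> \<infinity>"
      using H1_D(2)[OF G] by (intro nn_integral_PInf_AE) (auto simp: H1_norm_def)
    then show "AE x in lebesgue. (\<lambda>n. ennreal \<bar>v n x\<bar> * maximal_L G x) \<longlonglongrightarrow> 0"
    proof eventually_elim
      case (elim x)
      have "(\<lambda>n. \<bar>v n x\<bar>) \<longlonglongrightarrow> 0" using lim[of x] by (simp add: tendsto_rabs_zero_iff)
      from tendsto_ennrealI[OF this] have "(\<lambda>n. maximal_L G x * ennreal \<bar>v n x\<bar>) \<longlonglongrightarrow> maximal_L G x * ennreal 0"
        using elim by (intro ennreal_tendsto_cmult) (auto simp: less_top)
      then show ?case by (simp add: mult.commute)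
    qed
  qed (use le fin in auto)
  moreover have "(\<lambda>n. ennreal (\<Lambda> n * \<kappa>) * L1_norm G) \<longlonglongrightarrow> 0"
  proof -
    have "(\<lambda>n. \<Lambda> n * \<kappa>) \<longlonglongrightarrow> 0 * \<kappa>" by (intro tendsto_intros L(3))
    from tendsto_ennrealI[OF this] have "(\<lambda>n. L1_norm G * ennreal (\<Lambda> n * \<kappa>)) \<longlonglongrightarrow> L1_norm G * ennreal (0 * \<kappa>)"
      using integrable_L1_norm[OF Gi] by (intro ennreal_tendsto_cmult) auto
    then show ?thesis by (simp add: mult.commute)
  qed
  ultimately have "(\<lambda>n. (\<integral>\<^sup>+x. ennreal \<bar>v n x\<bar> * maximal_L G x \<partial>lebesgue) + ennreal (\<Lambda> n * \<kappa>) * L1_norm G) \<longlonglongrightarrow> 0 + 0"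
    by (intro tendsto_add) simp_all
  then show "(\<lambda>n. H1_norm (\<lambda>y. v n y *\<^sub>R G y)) \<longlonglongrightarrow> 0"
    by (intro tendsto_0_mono_ennreal[OF bound]) simp
qed

text \<open>The multiplier 1 - \<eta>(x/(n+1)) is bounded, tends to 0 pointwise because \<eta>(0) =
  1, and has Lipschitz constant of order 1/n.\<close>

lemma H1_cutoff:
  fixes G :: "real^'n \<Rightarrow> 'k::{real_normed_field,euclidean_space}"
  assumes \<eta>: "test_function \<eta>" "\<eta> 0 = 1" and G: "G \<in> H1"
  shows "(\<lambda>x. dilate n \<eta> x *\<^sub>R G x) \<in> H1" and "(\<lambda>n. H1_norm (\<lambda>x. G x - dilate n \<eta> x *\<^sub>R G x)) \<longlonglongrightarrow> 0"
proof -
  obtain B where B: "\<And>x. \<bar>\<eta> x\<bar> \<le> B" using test_function_bounded[OF \<eta>(1)] by blast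
  obtain \<Lambda> where \<Lambda>: "\<Lambda> \<ge> 0" "\<And>x y. \<bar>\<eta> x - \<eta> y\<bar> \<le> \<Lambda> * norm (x - y)" using test_function_Lipschitz[OF \<eta>(1)] by blast
  let ?v = "\<lambda>n x. 1 - dilate n \<eta> x"
  have m: "?v n \<in> borel_measurable borel" for n
    using test_function_measurable[OF test_function_dilate[OF \<eta>(1), of n]] by measurable
  have bd: "\<bar>?v n x\<bar> \<le> 1 + B" for n x using B[of "(1 / real (Suc n)) *\<^sub>R x"] by (simp add: dilate_def)
  have lip: "\<bar>?v n x - ?v n y\<bar> \<le> \<Lambda> / real (Suc n) * norm (x - y)" for n x y
    using dilate_Lipschitz[of \<eta> \<Lambda> n x y, OF \<Lambda>(2)] by (simp add: abs_minus_commute)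
  have lip0: "\<Lambda> / real (Suc n) \<ge> 0" for n using \<Lambda>(1) by simp
  have lipl: "(\<lambda>n. \<Lambda> / real (Suc n)) \<longlonglongrightarrow> 0" by (rule LIMSEQ_Suc[OF lim_const_over_n])
  have lim: "(\<lambda>n. ?v n x) \<longlonglongrightarrow> 0" for x
    using tendsto_diff[OF tendsto_const dilate_tendsto[OF \<eta>(1), of x], of 1] \<eta>(2) by simp
  note * = H1_mult_tendsto[OF G m bd lip lip0 lipl lim]
  have eq: "(\<lambda>y. ?v n y *\<^sub>R G y) = (\<lambda>y. G y - dilate n \<eta> y *\<^sub>R G y)" for n by (simp add: scaleR_diff_left)
  show "(\<lambda>x. dilate n \<eta> x *\<^sub>R G x) \<in> H1" using H1_diff[OF G *(1)[of n]] by (simp add: scaleR_diff_left)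
  show "(\<lambda>n. H1_norm (\<lambda>x. G x - dilate n \<eta> x *\<^sub>R G x)) \<longlonglongrightarrow> 0" using *(2) unfolding eq .
qed

text \<open>The chain rule contributes a factor 1/(n+1), so the multiplier tends to 0 uniformly and
  its Lipschitz constant is of order 1/n^2.\<close>

lemma H1_cutoff_partial:
  fixes G :: "real^'n \<Rightarrow> 'k::{real_normed_field,euclidean_space}"
  assumes \<eta>: "test_function \<eta>" and G: "G \<in> H1"
  shows "(\<lambda>x. partial j (dilate n \<eta>) x *\<^sub>R G x) \<in> H1" and "(\<lambda>n. H1_norm (\<lambda>x. partial j (dilate n \<eta>) x *\<^sub>R G x)) \<longlonglongrightarrow> 0"
proof -
  let ?u = "partial j \<eta>"
  have u: "test_function ?u" by (rule test_function_partial[OF \<eta>])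
  obtain B where B: "\<And>x. \<bar>?u x\<bar> \<le> B" using test_function_bounded[OF u] by blast
  obtain \<Lambda> where \<Lambda>: "\<Lambda> \<ge> 0" "\<And>x y. \<bar>?u x - ?u y\<bar> \<le> \<Lambda> * norm (x - y)" using test_function_Lipschitz[OF u] by blast
  let ?c = "\<lambda>n. 1 / real (Suc n)"
  let ?v = "\<lambda>n x. partial j (dilate n \<eta>) x"
  have v: "?v n x = ?c n * dilate n ?u x" for n x by (rule partial_dilate[OF test_function_smooth[OF \<eta>]])
  have c: "0 \<le> ?c n" "?c n \<le> 1" for n by auto
  have m: "?v n \<in> borel_measurable borel" for n
    by (intro test_function_measurable test_function_partial test_function_dilate \<eta>)
  have B0: "B \<ge> 0" using B[of 0] by simp
  have vb: "\<bar>?v n x\<bar> \<le> ?c n * B" for n x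
    unfolding v abs_mult using B by (simp add: dilate_def divide_right_mono)
  have bd: "\<bar>?v n x\<bar> \<le> B" for n x
    using vb[of n x] mult_right_mono[OF c(2)[of n] B0] by linarith
  have lip: "\<bar>?v n x - ?v n y\<bar> \<le> (?c n * (\<Lambda> / real (Suc n))) * norm (x - y)" for n x y
  proof -
    have "\<bar>?v n x - ?v n y\<bar> = ?c n * \<bar>dilate n ?u x - dilate n ?u y\<bar>"
      unfolding v right_diff_distrib[symmetric] abs_mult by simp
    also have "\<dots> \<le> ?c n * (\<Lambda> / real (Suc n) * norm (x - y))"
      by (intro mult_left_mono dilate_Lipschitz \<Lambda>(2) c)
    finally show ?thesis by (simp only: mult.assoc)
  qed
  have lip0: "?c n * (\<Lambda> / real (Suc n)) \<ge> 0" for n using \<Lambda>(1) by simp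
  have cl: "?c \<longlonglongrightarrow> 0" by (rule LIMSEQ_Suc[OF lim_1_over_n])
  have lipl: "(\<lambda>n. ?c n * (\<Lambda> / real (Suc n))) \<longlonglongrightarrow> 0"
    using tendsto_mult[OF cl LIMSEQ_Suc[OF lim_const_over_n[of \<Lambda>]]] by simp
  have lim: "(\<lambda>n. ?v n x) \<longlonglongrightarrow> 0" for x
  proof (rule Lim_null_comparison)
    show "\<forall>\<^sub>F n in sequentially. norm (?v n x) \<le> ?c n * B" using vb by simp
    show "(\<lambda>n. ?c n * B) \<longlonglongrightarrow> 0" using tendsto_mult[OF cl tendsto_const[of B]] by simp
  qed
  note * = H1_mult_tendsto[OF G m bd lip lip0 lipl lim]
  show "(\<lambda>x. ?v n x *\<^sub>R G x) \<in> H1" by (rule *(1))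
  show "(\<lambda>n. H1_norm (\<lambda>x. ?v n x *\<^sub>R G x)) \<longlonglongrightarrow> 0" by (rule *(2))
qed

text \<open>Compact support is expressed by boxes [-N, N)^d because these are unions of dyadic
  cubes.\<close>

definition H11_boxed :: "(real^'n \<Rightarrow> 'k::{real_normed_field,euclidean_space}) set" where
  "H11_boxed = {f \<in> H11. \<exists>N. \<forall>y. f y \<noteq> 0 \<longrightarrow> (\<forall>i. - real N \<le> y $ i \<and> y $ i < real N)}"

lemma H11_boxed_D: "f \<in> H11_boxed \<Longrightarrow> f \<in> H11"
  by (simp add: H11_boxed_def)

lemma H11_boxed_lincomb:
  assumes f: "f \<in> H11_boxed" and g: "g \<in> H11_boxed"
  shows "(\<lambda>x. \<alpha> * f x + \<beta> * g x) \<in> H11_boxed"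
proof -
  obtain N where N: "\<And>y. f y \<noteq> 0 \<Longrightarrow> \<forall>i. - real N \<le> y $ i \<and> y $ i < real N" using f by (auto simp: H11_boxed_def)
  obtain M where M: "\<And>y. g y \<noteq> 0 \<Longrightarrow> \<forall>i. - real M \<le> y $ i \<and> y $ i < real M" using g by (auto simp: H11_boxed_def)
  have "\<forall>i. - real (N + M) \<le> y $ i \<and> y $ i < real (N + M)" if "\<alpha> * f y + \<beta> * g y \<noteq> 0" for y
  proof -
    have "f y \<noteq> 0 \<or> g y \<noteq> 0" using that by auto
    then have "(\<forall>i. - real N \<le> y $ i \<and> y $ i < real N) \<or> (\<forall>i. - real M \<le> y $ i \<and> y $ i < real M)"
      using N[of y] M[of y] by blast
    then show ?thesis
    proof
      assume *: "\<forall>i. - real N \<le> y $ i \<and> y $ i < real N"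
      show ?thesis
      proof
        fix i show "- real (N + M) \<le> y $ i \<and> y $ i < real (N + M)" using *[rule_format, of i] by simp
      qed
    next
      assume *: "\<forall>i. - real M \<le> y $ i \<and> y $ i < real M"
      show ?thesis
      proof
        fix i show "- real (N + M) \<le> y $ i \<and> y $ i < real (N + M)" using *[rule_format, of i] by simp
      qed
    qed
  qed
  then show ?thesis unfolding H11_boxed_def using H11_lincomb(1)[OF H11_boxed_D[OF f] H11_boxed_D[OF g], of \<alpha> \<beta>] by blast
qed

lemma H11_boxed_diff: "f \<in> H11_boxed \<Longrightarrow> g \<in> H11_boxed \<Longrightarrow> (\<lambda>x. f x - g x) \<in> H11_boxed"
  using H11_boxed_lincomb[of f g 1 "-1"] by simp

text \<open>By the Leibniz rule the error of a derivative consists of a cutoff error for that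
  derivative and a term in which the derivative falls on \<eta>; both tend to 0 in
  \<open>H1\<close>.\<close>

lemma H11_cutoff:
  fixes f :: "real^'n \<Rightarrow> 'k::{real_normed_field,euclidean_space}"
  assumes \<eta>: "test_function \<eta>" "\<eta> 0 = 1" "\<And>x. norm x \<ge> 1 \<Longrightarrow> \<eta> x = 0" and f: "f \<in> H11"
  shows "(\<lambda>x. dilate n \<eta> x *\<^sub>R f x) \<in> H11_boxed"
    and "(\<lambda>n. H11_norm (\<lambda>x. f x - dilate n \<eta> x *\<^sub>R f x)) \<longlonglongrightarrow> 0"
proof -
  obtain g where g: "\<And>j. g j \<in> H1" "\<And>j. has_weak_partial j f (g j)" by (fact H11_weak_partials[OF f])
  have fH: "f \<in> H1" by (rule H11_D[OF f])
  let ?g = "\<lambda>n j x. dilate n \<eta> x *\<^sub>R g j x + partial j (dilate n \<eta>) x *\<^sub>R f x"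
  have w: "has_weak_partial j (\<lambda>x. dilate n \<eta> x *\<^sub>R f x) (?g n j)" for n j
    by (intro has_weak_partial_test_mult H1_D(1) fH g test_function_dilate \<eta>)
  have uH: "(\<lambda>x. dilate n \<eta> x *\<^sub>R f x) \<in> H1" for n by (rule H1_cutoff(1)[OF \<eta>(1,2) fH])
  have gH: "?g n j \<in> H1" for n j
    by (intro H1_add H1_cutoff(1)[OF \<eta>(1,2) g(1)] H1_cutoff_partial(1)[OF \<eta>(1) fH])
  have in_H11: "(\<lambda>x. dilate n \<eta> x *\<^sub>R f x) \<in> H11" for n unfolding H11_def using uH gH w by blast
  have "\<forall>i. - real (Suc n) \<le> y $ i \<and> y $ i < real (Suc n)" if "dilate n \<eta> y *\<^sub>R f y \<noteq> 0" for y
  proof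
    fix i
    have "\<not> norm ((1 / real (Suc n)) *\<^sub>R y) \<ge> 1" using that \<eta>(3)[of "(1 / real (Suc n)) *\<^sub>R y"] by (auto simp: dilate_def)
    then have "norm y < real (Suc n)" by (simp add: divide_simps)
    then show "- real (Suc n) \<le> y $ i \<and> y $ i < real (Suc n)" using component_le_norm_cart[of y i] by linarith
  qed
  then show "(\<lambda>x. dilate n \<eta> x *\<^sub>R f x) \<in> H11_boxed" using in_H11[of n] unfolding H11_boxed_def by blast
  have wd: "has_weak_partial j (\<lambda>x. f x - dilate n \<eta> x *\<^sub>R f x) (\<lambda>x. g j x - ?g n j x)" for n j
    using has_weak_partial_lincomb[where \<alpha>=1 and \<beta>="-1", OF H1_D(1)[OF fH] H1_D(1)[OF g(1)[of j]] H1_D(1)[OF uH[of n]] H1_D(1)[OF gH[of n j]] g(2)[of j] w[of j n]]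
    by (simp only: mult_1 mult_minus_left diff_conv_add_uminus)
  have le: "H1_norm (\<lambda>x. g j x - ?g n j x) \<le> H1_norm (\<lambda>x. g j x - dilate n \<eta> x *\<^sub>R g j x) + H1_norm (\<lambda>x. partial j (dilate n \<eta>) x *\<^sub>R f x)" for n j
  proof -
    have eq: "(\<lambda>x. g j x - ?g n j x) = (\<lambda>x. (g j x - dilate n \<eta> x *\<^sub>R g j x) - partial j (dilate n \<eta>) x *\<^sub>R f x)"
      by (simp add: fun_eq_iff algebra_simps)
    show ?thesis unfolding eq
      by (intro H1_norm_diff H1_D(1) H1_diff g H1_cutoff(1)[OF \<eta>(1,2) g(1)] H1_cutoff_partial(1)[OF \<eta>(1) fH])
  qed
  have lim: "(\<lambda>n. H1_norm (\<lambda>x. f x - dilate n \<eta> x *\<^sub>R f x) + (\<Sum>j\<in>UNIV. H1_norm (\<lambda>x. g j x - dilate n \<eta> x *\<^sub>R g j x) + H1_norm (\<lambda>x. partial j (dilate n \<eta>) x *\<^sub>R f x)))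
     \<longlonglongrightarrow> 0 + (\<Sum>j\<in>(UNIV::'n set). 0 + 0)"
    by (intro tendsto_add tendsto_sum H1_cutoff(2)[OF \<eta>(1,2)] H1_cutoff_partial(2)[OF \<eta>(1)] fH g)
  show "(\<lambda>n. H11_norm (\<lambda>x. f x - dilate n \<eta> x *\<^sub>R f x)) \<longlonglongrightarrow> 0"
  proof (rule tendsto_0_mono_ennreal)
    show "H11_norm (\<lambda>x. f x - dilate n \<eta> x *\<^sub>R f x) \<le> H1_norm (\<lambda>x. f x - dilate n \<eta> x *\<^sub>R f x) + (\<Sum>j\<in>UNIV. H1_norm (\<lambda>x. g j x - dilate n \<eta> x *\<^sub>R g j x) + H1_norm (\<lambda>x. partial j (dilate n \<eta>) x *\<^sub>R f x))" for n
      unfolding H11_norm_eq[OF wd] by (intro add_left_mono sum_mono le)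
    show "(\<lambda>n. H1_norm (\<lambda>x. f x - dilate n \<eta> x *\<^sub>R f x) + (\<Sum>j\<in>UNIV. H1_norm (\<lambda>x. g j x - dilate n \<eta> x *\<^sub>R g j x) + H1_norm (\<lambda>x. partial j (dilate n \<eta>) x *\<^sub>R f x))) \<longlonglongrightarrow> 0"
      using lim by simp
  qed
qed

section \<open>The commutator\<close>

text \<open>\<open>ennreal\<close> sends negative reals to 0, so the integral measures the positive
  part of F.\<close>

lemma AE_nonpos_of_small_integral:
  assumes F: "F \<in> borel_measurable M" and le: "\<And>n. (\<integral>\<^sup>+x. ennreal (F x) \<partial>M) \<le> e n" and e: "e \<longlonglongrightarrow> (0::ennreal)"
  shows "AE x in M. F x \<le> 0"
proof -
  have "(\<integral>\<^sup>+x. ennreal (F x) \<partial>M) \<le> 0" by (rule LIMSEQ_le_const[OF e]) (use le in auto)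
  then have "AE x in M. ennreal (F x) = 0" using F by (subst (asm) le_zero_eq, subst (asm) nn_integral_0_iff_AE) auto
  then show ?thesis by eventually_elim (simp add: ennreal_eq_0_iff)
qed

text \<open>By Fatou's lemma the limes inferior of |h_n - a| vanishes almost everywhere, and it
  equals |c - a|.\<close>

lemma AE_eq_of_L1_limit:
  fixes h :: "nat \<Rightarrow> 'a \<Rightarrow> real"
  assumes [measurable]: "\<And>n. h n \<in> borel_measurable M" "a \<in> borel_measurable M"
    and l: "(\<lambda>n. \<integral>\<^sup>+x. ennreal \<bar>h n x - a x\<bar> \<partial>M) \<longlonglongrightarrow> 0" and p: "AE x in M. (\<lambda>n. h n x) \<longlonglongrightarrow> c x"
  shows "AE x in M. a x = c x"
proof -
  have "(\<integral>\<^sup>+x. liminf (\<lambda>n. ennreal \<bar>h n x - a x\<bar>) \<partial>M) \<le> liminf (\<lambda>n. \<integral>\<^sup>+x. ennreal \<bar>h n x - a x\<bar> \<partial>M)"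
    by (rule nn_integral_liminf) measurable
  also have "\<dots> = 0" by (rule lim_imp_Liminf[OF sequentially_bot l])
  finally have "(\<integral>\<^sup>+x. liminf (\<lambda>n. ennreal \<bar>h n x - a x\<bar>) \<partial>M) = 0" by simp
  then have "AE x in M. liminf (\<lambda>n. ennreal \<bar>h n x - a x\<bar>) = 0" by (subst (asm) nn_integral_0_iff_AE) measurable
  with p show ?thesis
  proof eventually_elim
    case (elim x)
    have "(\<lambda>n. ennreal \<bar>h n x - a x\<bar>) \<longlonglongrightarrow> ennreal \<bar>c x - a x\<bar>" by (intro tendsto_intros elim)
    from lim_imp_Liminf[OF sequentially_bot this] show ?case using elim by (simp add: ennreal_eq_0_iff)
  qed
qed

section \<open>The modulus of the commutator and its extension\<close>

context KL_commutator
begin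

text \<open>Exactly the functions for which (c - b) f lies in \<open>H1\<close> for every scalar c.
  They form a linear space on which the commutator is defined at every point x.\<close>

definition bounded_products :: "(real^'n \<Rightarrow> 'k) set" where
  "bounded_products = {f \<in> H1. (\<lambda>y. b y * f y) \<in> H1}"

lemma bounded_products_lincomb:
  assumes f: "f \<in> bounded_products" and g: "g \<in> bounded_products"
  shows "(\<lambda>y. \<alpha> * f y + \<beta> * g y) \<in> bounded_products"
proof -
  have "(\<lambda>y. \<alpha> * (b y * f y) + \<beta> * (b y * g y)) \<in> H1" "(\<lambda>y. \<alpha> * f y + \<beta> * g y) \<in> H1"
    using f g by (auto simp: bounded_products_def intro!: H1_add H1_cmult)
  then show ?thesis by (simp add: bounded_products_def algebra_simps)
qed

lemma commutator_argument_H1: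
  assumes f: "f \<in> bounded_products"
  shows "(\<lambda>y. (c - b y) * f y) \<in> H1"
proof -
  have "(\<lambda>y. c * f y - b y * f y) \<in> H1" using f by (intro H1_diff H1_cmult) (auto simp: bounded_products_def)
  then show ?thesis by (simp add: left_diff_distrib)
qed

lemma commutator_lincomb:
  assumes f: "f \<in> bounded_products" and g: "g \<in> bounded_products"
  shows "norm (commutator b T (\<lambda>y. \<alpha> * f y + \<beta> * g y) x) \<le> norm \<alpha> * norm (commutator b T f x) + norm \<beta> * norm (commutator b T g x)"
proof -
  have "(\<lambda>y. (b x - b y) * (\<alpha> * f y + \<beta> * g y)) = (\<lambda>y. \<alpha> * ((b x - b y) * f y) + \<beta> * ((b x - b y) * g y))"
    by (simp add: fun_eq_iff algebra_simps)
  then show ?thesis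
    unfolding commutator_def using T_sublinear[OF commutator_argument_H1[OF f] commutator_argument_H1[OF g]] by simp
qed

text \<open>Sublinearity for f = (f - g) + g and for g = -(f - g) + f gives a reverse triangle
  inequality, which controls the modulus of the commutator and not its phase.\<close>

lemma commutator_diff:
  assumes f: "f \<in> bounded_products" and g: "g \<in> bounded_products"
  shows "\<bar>norm (commutator b T f x) - norm (commutator b T g x)\<bar> \<le> norm (commutator b T (\<lambda>y. f y - g y) x)"
proof -
  have d: "(\<lambda>y. f y - g y) \<in> bounded_products" using bounded_products_lincomb[OF f g, of 1 "-1"] by simp
  have "norm (commutator b T f x) \<le> norm (commutator b T (\<lambda>y. f y - g y) x) + norm (commutator b T g x)"
    using commutator_lincomb[OF d g, of 1 1 x] by simp
  moreover have "norm (commutator b T g x) \<le> norm (commutator b T (\<lambda>y. f y - g y) x) + norm (commutator b T f x)"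
    using commutator_lincomb[OF d f, of "-1" 1 x] by simp
  ultimately show ?thesis by linarith
qed

lemma commutator_le:
  assumes f: "f \<in> bounded_products"
  shows "norm (commutator b T f x) \<le> norm (b x) * norm (T f x) + norm (T (\<lambda>y. b y * f y) x)"
proof -
  have "(\<lambda>y. (b x - b y) * f y) = (\<lambda>y. b x * f y + (-1) * (b y * f y))" by (simp add: fun_eq_iff algebra_simps)
  moreover have "f \<in> H1" "(\<lambda>y. b y * f y) \<in> H1" using f by (auto simp: bounded_products_def)
  ultimately show ?thesis unfolding commutator_def using T_sublinear[of f "\<lambda>y. b y * f y" "b x" "-1" x] by simp
qed

text \<open>For a constant in place of the first \<open>b\<close> the function is measurable in \<open>x\<close>, and it is Lipschitz
  in that constant.\<close>

lemma commutator_measurable: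
  assumes f: "f \<in> bounded_products"
  shows "(\<lambda>x. norm (commutator b T f x)) \<in> borel_measurable lebesgue"
proof -
  define F where "F = (\<lambda>c x. norm (T (\<lambda>y. (c - b y) * f y) x))"
  have fH: "f \<in> H1" using f by (simp add: bounded_products_def)
  have F: "F c \<in> borel_measurable lebesgue" for c
    unfolding F_def using T_measurable[OF commutator_argument_H1[OF f]] by measurable
  have le: "F c x \<le> F c' x + norm (c - c') * norm (T f x)" for c c' x
  proof -
    have "(\<lambda>y. (c - b y) * f y) = (\<lambda>y. 1 * ((c' - b y) * f y) + (c - c') * f y)" by (simp add: fun_eq_iff algebra_simps)
    then show ?thesis unfolding F_def using T_sublinear[OF commutator_argument_H1[OF f] fH, of 1 c' "c - c'" x] by simp
  qed
  \<comment> \<open>b is approximated by simple functions; for each of them the composed function is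
    glued from finitely many measurable functions \<open>F c\<close>.\<close>
  obtain s where s: "\<And>i. simple_function lebesgue (s i)" and sl: "\<And>x. (\<lambda>i. s i x) \<longlonglongrightarrow> b x"
    using borel_measurable_implies_sequence_metric[OF b_measurable, of 0] by auto
  have Fs: "(\<lambda>x. F (s i x) x) \<in> borel_measurable lebesgue" for i
  proof (rule measurable_compose_countable'[where I="range (s i)"])
    show "F c \<in> borel_measurable lebesgue" for c by (rule F)
    have fin: "finite (range (s i))" using simple_functionD(1)[OF s, of i] by simp
    then show "countable (range (s i))" by (rule countable_finite)
    show "s i \<in> measurable lebesgue (count_space (range (s i)))"
      using simple_functionD(2)[OF s] by (auto simp: measurable_count_space_eq2[OF fin])
  qed
  have Fl: "(\<lambda>i. F (s i x) x) \<longlonglongrightarrow> F (b x) x" for x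
  proof (rule Lim_transform)
    show "(\<lambda>i. F (b x) x) \<longlonglongrightarrow> F (b x) x" by simp
    show "(\<lambda>i. F (s i x) x - F (b x) x) \<longlonglongrightarrow> 0"
    proof (rule Lim_null_comparison)
      show "\<forall>\<^sub>F i in sequentially. norm (F (s i x) x - F (b x) x) \<le> norm (s i x - b x) * norm (T f x)"
      proof (rule always_eventually, rule allI)
        fix i
        show "norm (F (s i x) x - F (b x) x) \<le> norm (s i x - b x) * norm (T f x)"
          using le[of "s i x" x "b x"] le[of "b x" x "s i x"] by (simp add: norm_minus_commute abs_le_iff)
      qed
      have "(\<lambda>i. norm (s i x - b x) * norm (T f x)) \<longlonglongrightarrow> norm (b x - b x) * norm (T f x)" by (intro tendsto_intros sl)
      then show "(\<lambda>i. norm (s i x - b x) * norm (T f x)) \<longlonglongrightarrow> 0" by simp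
    qed
  qed
  have "(\<lambda>x. F (b x) x) \<in> borel_measurable lebesgue" by (rule borel_measurable_LIMSEQ_real[OF Fl Fs])
  then show ?thesis by (simp add: F_def commutator_def)
qed

lemma boxed_bound:
  obtains C where "C > 0" and "\<And>f. f \<in> H11_boxed \<Longrightarrow> f \<in> bounded_products \<and> L1_norm (\<lambda>x. norm (commutator b T f x)) \<le> ennreal C * H11_norm f"
proof -
  obtain C where C: "C > 0" and E: "\<And>f g N. integrable lebesgue f \<Longrightarrow> (\<And>j. integrable lebesgue (g j)) \<Longrightarrow> (\<And>j. has_weak_partial j f (g j)) \<Longrightarrow>
     (\<And>y. f y \<noteq> 0 \<Longrightarrow> \<forall>i. - real N \<le> y $ i \<and> y $ i < real N) \<Longrightarrow>
     (\<lambda>y. b y * f y) \<in> H1 \<and>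
     (\<integral>\<^sup>+x. ennreal (norm (commutator b T f x)) \<partial>lebesgue) \<le> ennreal C * (L1_norm f + (\<Sum>j\<in>UNIV. L1_norm (g j)))"
    by (fact compact_support_bound)
  have "f \<in> bounded_products \<and> L1_norm (\<lambda>x. norm (commutator b T f x)) \<le> ennreal C * H11_norm f" if f: "f \<in> H11_boxed" for f
  proof -
    obtain g where g: "\<And>j. g j \<in> H1" "\<And>j. has_weak_partial j f (g j)" by (fact H11_weak_partials[OF H11_boxed_D[OF f]])
    obtain N where N: "\<And>y. f y \<noteq> 0 \<Longrightarrow> \<forall>i. - real N \<le> y $ i \<and> y $ i < real N" using f by (auto simp: H11_boxed_def)
    have fH: "f \<in> H1" by (rule H11_D[OF H11_boxed_D[OF f]])
    have *: "(\<lambda>y. b y * f y) \<in> H1 \<and>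
     (\<integral>\<^sup>+x. ennreal (norm (commutator b T f x)) \<partial>lebesgue) \<le> ennreal C * (L1_norm f + (\<Sum>j\<in>UNIV. L1_norm (g j)))"
      by (rule E[of f g N]) (fact H1_D(1)[OF fH] H1_D(1)[OF g(1)] g(2) N)+
    have "ennreal C * (L1_norm f + (\<Sum>j\<in>UNIV. L1_norm (g j))) \<le> ennreal C * H11_norm f"
      by (intro mult_left_mono L1_norms_le_H11_norm fH g) simp
    with * fH show ?thesis by (auto simp: bounded_products_def L1_norm_def)
  qed
  with C show thesis by (rule that)
qed

text \<open>Along cutoffs of f the moduli are Cauchy in \<open>L1\<close> by the reverse triangle
  inequality. The limit is characterised by all approximating sequences at once, so it does not
  depend on the cutoff function, and later arguments may use cutoffs of their own.\<close>

lemma commutator_extension: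
  assumes E: "\<And>f. f \<in> H11_boxed \<Longrightarrow> f \<in> bounded_products \<and> L1_norm (\<lambda>x. norm (commutator b T f x)) \<le> ennreal C * H11_norm f"
    and f: "f \<in> H11"
  shows "\<exists>a. (\<forall>x. 0 \<le> a x) \<and> integrable lebesgue a \<and> (\<forall>u. (\<forall>n. u n \<in> H11_boxed) \<longrightarrow> (\<lambda>n. H11_norm (\<lambda>x. f x - u n x)) \<longlonglongrightarrow> 0 \<longrightarrow>
     (\<lambda>n. L1_norm (\<lambda>x. norm (commutator b T (u n) x) - a x)) \<longlonglongrightarrow> 0)"
proof -
  let ?N = "\<lambda>f x. norm (commutator b T f x)"
  have diff: "L1_norm (\<lambda>x. ?N u x - ?N w x) \<le> ennreal C * (H11_norm (\<lambda>x. f x - u x) + H11_norm (\<lambda>x. f x - w x))"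
    if u: "u \<in> H11_boxed" and w: "w \<in> H11_boxed" for u w
  proof -
    have "L1_norm (\<lambda>x. ?N u x - ?N w x) \<le> L1_norm (?N (\<lambda>y. u y - w y))"
      unfolding L1_norm_def using commutator_diff E u w by (intro nn_integral_mono ennreal_leI) simp
    also have "\<dots> \<le> ennreal C * H11_norm (\<lambda>y. u y - w y)" using E H11_boxed_diff[OF u w] by blast
    also have "(\<lambda>y. u y - w y) = (\<lambda>y. (f y - w y) - (f y - u y))" by simp
    also have "H11_norm (\<lambda>y. (f y - w y) - (f y - u y)) \<le> H11_norm (\<lambda>x. f x - w x) + H11_norm (\<lambda>x. f x - u x)"
      by (intro H11_diff(2) H11_diff(1) f H11_boxed_D u w)
    finally show ?thesis by (simp add: mult_left_mono add.commute)
  qed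
  obtain \<eta> :: "real^'n \<Rightarrow> real" where \<eta>: "test_function \<eta>" "\<eta> 0 = 1" "\<And>x. norm x \<ge> 1 \<Longrightarrow> \<eta> x = 0" by (fact cutoff_exists)
  define w where "w = (\<lambda>n x. dilate n \<eta> x *\<^sub>R f x)"
  have w: "w n \<in> H11_boxed" for n unfolding w_def by (rule H11_cutoff(1)[OF \<eta> f])
  have wl: "(\<lambda>n. H11_norm (\<lambda>x. f x - w n x)) \<longlonglongrightarrow> 0" unfolding w_def by (rule H11_cutoff(2)[OF \<eta> f])
  have Ni: "integrable lebesgue (?N u)" if u: "u \<in> H11_boxed" for u
  proof (rule integrableI_L1_norm)
    show "?N u \<in> borel_measurable lebesgue" using E[OF u] by (intro commutator_measurable) simp
    have "L1_norm (?N u) \<le> ennreal C * H11_norm u" using E[OF u] by simp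
    then show "L1_norm (?N u) < \<infinity>" using H11_norm_finite[OF H11_boxed_D[OF u]]
      by (auto simp: ennreal_mult_less_top intro: le_less_trans)
  qed
  have "\<exists>v. integrable lebesgue v \<and> (\<lambda>n. \<integral>\<^sup>+x. ennreal \<bar>?N (w n) x - v x\<bar> \<partial>lebesgue) \<longlonglongrightarrow> 0"
  proof (rule L1_complete)
    show "integrable lebesgue (?N (w n))" for n by (rule Ni[OF w])
    fix e :: real assume e: "e > 0"
    have "(\<lambda>n. ennreal C * H11_norm (\<lambda>x. f x - w n x)) \<longlonglongrightarrow> ennreal C * 0" by (intro ennreal_tendsto_cmult wl) simp
    moreover have "(0::ennreal) < ennreal (e / 2)" using e by simp
    ultimately obtain N where N: "\<And>n. n \<ge> N \<Longrightarrow> ennreal C * H11_norm (\<lambda>x. f x - w n x) < ennreal (e / 2)"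
      using order_tendstoD(2)[of "\<lambda>n. ennreal C * H11_norm (\<lambda>x. f x - w n x)" 0 sequentially "ennreal (e / 2)"]
      by (auto simp: eventually_sequentially)
    show "\<exists>N. \<forall>m\<ge>N. \<forall>n\<ge>N. (\<integral>\<^sup>+x. ennreal \<bar>?N (w m) x - ?N (w n) x\<bar> \<partial>lebesgue) < ennreal e"
    proof (intro exI allI impI)
      fix m n assume mn: "m \<ge> N" "n \<ge> N"
      have "(\<integral>\<^sup>+x. ennreal \<bar>?N (w m) x - ?N (w n) x\<bar> \<partial>lebesgue) \<le> ennreal C * H11_norm (\<lambda>x. f x - w m x) + ennreal C * H11_norm (\<lambda>x. f x - w n x)"
        using diff[OF w w, of m n] by (simp add: L1_norm_def distrib_left)
      also have "\<dots> < ennreal (e / 2) + ennreal (e / 2)" by (rule add_strict_mono[OF N[OF mn(1)] N[OF mn(2)]])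
      also have "\<dots> = ennreal e" using e by (simp flip: ennreal_plus)
      finally show "(\<integral>\<^sup>+x. ennreal \<bar>?N (w m) x - ?N (w n) x\<bar> \<partial>lebesgue) < ennreal e" .
    qed
  qed
  then obtain v where v: "integrable lebesgue v" and vl: "(\<lambda>n. \<integral>\<^sup>+x. ennreal \<bar>?N (w n) x - v x\<bar> \<partial>lebesgue) \<longlonglongrightarrow> 0" by blast
  have vm[measurable]: "v \<in> borel_measurable lebesgue" using v by auto
  show ?thesis
  \<comment> \<open>The limit v is nonnegative only almost everywhere. Its absolute value is
    nonnegative everywhere and lies no further from the nonnegative moduli.\<close>
  proof (intro exI[of _ "\<lambda>x. \<bar>v x\<bar>"] conjI allI impI)
    show "integrable lebesgue (\<lambda>x. \<bar>v x\<bar>)" using v by simp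
    fix u :: "nat \<Rightarrow> real^'n \<Rightarrow> 'k" assume u: "\<forall>n. u n \<in> H11_boxed" and ul: "(\<lambda>n. H11_norm (\<lambda>x. f x - u n x)) \<longlonglongrightarrow> 0"
    have "(\<lambda>n. ennreal C * (H11_norm (\<lambda>x. f x - u n x) + H11_norm (\<lambda>x. f x - w n x)) + (\<integral>\<^sup>+x. ennreal \<bar>?N (w n) x - v x\<bar> \<partial>lebesgue)) \<longlonglongrightarrow> ennreal C * (0 + 0) + 0"
      by (intro tendsto_add ennreal_tendsto_cmult wl ul vl) simp
    then have lim: "(\<lambda>n. ennreal C * (H11_norm (\<lambda>x. f x - u n x) + H11_norm (\<lambda>x. f x - w n x)) + (\<integral>\<^sup>+x. ennreal \<bar>?N (w n) x - v x\<bar> \<partial>lebesgue)) \<longlonglongrightarrow> 0" by simp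
    show "(\<lambda>n. L1_norm (\<lambda>x. ?N (u n) x - \<bar>v x\<bar>)) \<longlonglongrightarrow> 0"
    proof (rule tendsto_0_mono_ennreal[OF _ lim])
      fix n
      have [measurable]: "?N (u n) \<in> borel_measurable lebesgue" "?N (w n) \<in> borel_measurable lebesgue"
        using Ni[OF w[of n]] Ni[of "u n"] u by auto
      have "L1_norm (\<lambda>x. ?N (u n) x - \<bar>v x\<bar>) \<le> (\<integral>\<^sup>+x. ennreal \<bar>?N (u n) x - ?N (w n) x\<bar> + ennreal \<bar>?N (w n) x - v x\<bar> \<partial>lebesgue)"
        unfolding L1_norm_def
      proof (rule nn_integral_mono)
        fix x
        have "norm (?N (u n) x - \<bar>v x\<bar>) \<le> \<bar>?N (u n) x - ?N (w n) x\<bar> + \<bar>?N (w n) x - v x\<bar>"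
        proof -
          have "norm (p - \<bar>q\<bar>) \<le> \<bar>p - r\<bar> + \<bar>r - q\<bar>" if "r \<ge> 0" for p q r :: real
            using that by (auto simp: abs_if)
          from this[OF norm_ge_zero] show ?thesis .
        qed
        then have "ennreal (norm (?N (u n) x - \<bar>v x\<bar>)) \<le> ennreal (\<bar>?N (u n) x - ?N (w n) x\<bar> + \<bar>?N (w n) x - v x\<bar>)" by (rule ennreal_leI)
        then show "ennreal (norm (?N (u n) x - \<bar>v x\<bar>)) \<le> ennreal \<bar>?N (u n) x - ?N (w n) x\<bar> + ennreal \<bar>?N (w n) x - v x\<bar>" by simp
      qed
      also have "\<dots> = L1_norm (\<lambda>x. ?N (u n) x - ?N (w n) x) + (\<integral>\<^sup>+x. ennreal \<bar>?N (w n) x - v x\<bar> \<partial>lebesgue)"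
        unfolding L1_norm_def real_norm_def by (rule nn_integral_add) measurable
      also have "\<dots> \<le> ennreal C * (H11_norm (\<lambda>x. f x - u n x) + H11_norm (\<lambda>x. f x - w n x)) + (\<integral>\<^sup>+x. ennreal \<bar>?N (w n) x - v x\<bar> \<partial>lebesgue)"
        using u by (intro add_right_mono diff w) simp
      finally show "L1_norm (\<lambda>x. ?N (u n) x - \<bar>v x\<bar>) \<le> ennreal C * (H11_norm (\<lambda>x. f x - u n x) + H11_norm (\<lambda>x. f x - w n x)) + (\<integral>\<^sup>+x. ennreal \<bar>?N (w n) x - v x\<bar> \<partial>lebesgue)" .
    qed
  qed simp
qed

text \<open>A single point x with (b(x) - b) f in \<open>H1\<close> is enough, because b f = b(x) f
  - (b(x) - b) f; such a point exists since Lebesgue measure is not zero.\<close>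

lemma commutator_domain_bounded_products:
  assumes f: "f \<in> commutator_domain b"
  shows "f \<in> bounded_products"
proof -
  have fH: "f \<in> H1" using f by (auto simp: commutator_domain_def intro: H11_D)
  have ae: "AE x in lebesgue. (\<lambda>y. (b x - b y) * f y) \<in> H1" using f by (simp add: commutator_domain_def)
  have "\<not> (AE x in (lebesgue :: (real^'n) measure). False)"
  proof -
    have "\<not> (AE x in (lborel :: (real^'n) measure). False)" by (simp add: AE_iff_null null_sets_def)
    then show ?thesis by (simp add: AE_completion_iff)
  qed
  then have "ae_filter (lebesgue :: (real^'n) measure) \<noteq> bot" by (simp only: trivial_limit_def not_False_eq_True)
  then obtain x where x: "(\<lambda>y. (b x - b y) * f y) \<in> H1" using eventually_happens'[OF _ ae] by blast
  have "(\<lambda>y. b x * f y - (b x - b y) * f y) \<in> H1" by (intro H1_diff H1_cmult fH x)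
  then show ?thesis using fH by (simp add: bounded_products_def left_diff_distrib)
qed

lemma boxed_commutator_domain:
  assumes "f \<in> H11_boxed" "f \<in> bounded_products"
  shows "f \<in> commutator_domain b"
  using assms commutator_argument_H1[OF assms(2)] by (simp add: commutator_domain_def H11_boxed_D)

text \<open>A closability argument. The support of f may be unbounded, but b f lies in
  \<open>H1\<close> and multiplication by a cutoff commutes with multiplication by b. Hence the
  cutoffs converge to f together with their products with b, and the moduli of the commutators
  converge almost everywhere along a subsequence.\<close>

lemma commutator_extension_eq:
  assumes E: "\<And>f. f \<in> H11_boxed \<Longrightarrow> f \<in> bounded_products"
    and f: "f \<in> commutator_domain b" and a: "integrable lebesgue a"
    and lim: "\<And>u. (\<And>n. u n \<in> H11_boxed) \<Longrightarrow> (\<lambda>n. H11_norm (\<lambda>x. f x - u n x)) \<longlonglongrightarrow> 0 \<Longrightarrow>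
     (\<lambda>n. L1_norm (\<lambda>x. norm (commutator b T (u n) x) - a x)) \<longlonglongrightarrow> 0"
  shows "AE x in lebesgue. a x = norm (commutator b T f x)"
proof -
  obtain \<eta> :: "real^'n \<Rightarrow> real" where \<eta>: "test_function \<eta>" "\<eta> 0 = 1" "\<And>x. norm x \<ge> 1 \<Longrightarrow> \<eta> x = 0" by (fact cutoff_exists)
  define u where "u = (\<lambda>n x. dilate n \<eta> x *\<^sub>R f x)"
  have fH11: "f \<in> H11" using f by (simp add: commutator_domain_def)
  have u: "u n \<in> H11_boxed" for n unfolding u_def by (rule H11_cutoff(1)[OF \<eta> fH11])
  have ul: "(\<lambda>n. H11_norm (\<lambda>x. f x - u n x)) \<longlonglongrightarrow> 0" unfolding u_def by (rule H11_cutoff(2)[OF \<eta> fH11])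
  note fB = commutator_domain_bounded_products[OF f]
  have uB: "u n \<in> bounded_products" for n by (rule E[OF u])
  have dB: "(\<lambda>y. f y - u n y) \<in> bounded_products" for n using bounded_products_lincomb[OF fB uB, of 1 "-1" n] by simp
  have fH: "f \<in> H1" "(\<lambda>y. b y * f y) \<in> H1" using fB by (auto simp: bounded_products_def)
  have dH: "(\<lambda>y. f y - u n y) \<in> H1" "(\<lambda>y. b y * (f y - u n y)) \<in> H1" for n using dB[of n] by (auto simp: bounded_products_def)
  have l1: "(\<lambda>n. H1_norm (\<lambda>y. f y - u n y)) \<longlonglongrightarrow> 0" unfolding u_def by (rule H1_cutoff(2)[OF \<eta>(1,2) fH(1)])
  have l2: "(\<lambda>n. H1_norm (\<lambda>y. b y * (f y - u n y))) \<longlonglongrightarrow> 0"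
    using H1_cutoff(2)[OF \<eta>(1,2) fH(2)] by (simp add: u_def right_diff_distrib)
  obtain r :: "nat \<Rightarrow> nat" where r: "strict_mono r"
    and ae: "AE x in lebesgue. (\<lambda>n. T (\<lambda>y. f y - u (r n) y) x) \<longlonglongrightarrow> 0 \<and> (\<lambda>n. T (\<lambda>y. b y * (f y - u (r n) y)) x) \<longlonglongrightarrow> 0"
    using T_tendsto_subseq[OF dH l1 l2] by blast
  show ?thesis
  proof (rule AE_eq_of_L1_limit)
    show "(\<lambda>x. norm (commutator b T (u (r n)) x)) \<in> borel_measurable lebesgue" for n by (rule commutator_measurable[OF uB])
    show "a \<in> borel_measurable lebesgue" using a by auto
    show "(\<lambda>n. \<integral>\<^sup>+x. ennreal \<bar>norm (commutator b T (u (r n)) x) - a x\<bar> \<partial>lebesgue) \<longlonglongrightarrow> 0"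
      using LIMSEQ_subseq_LIMSEQ[OF lim[OF u ul] r] by (simp add: L1_norm_def o_def)
    show "AE x in lebesgue. (\<lambda>n. norm (commutator b T (u (r n)) x)) \<longlonglongrightarrow> norm (commutator b T f x)"
      using ae
    proof eventually_elim
      case (elim x)
      show ?case
      proof (rule Lim_transform)
        show "(\<lambda>n. norm (commutator b T f x)) \<longlonglongrightarrow> norm (commutator b T f x)" by simp
        show "(\<lambda>n. norm (commutator b T (u (r n)) x) - norm (commutator b T f x)) \<longlonglongrightarrow> 0"
        proof (rule Lim_null_comparison)
          let ?e = "\<lambda>n. norm (b x) * norm (T (\<lambda>y. f y - u (r n) y) x) + norm (T (\<lambda>y. b y * (f y - u (r n) y)) x)"
          show "\<forall>\<^sub>F n in sequentially. norm (norm (commutator b T (u (r n)) x) - norm (commutator b T f x)) \<le> ?e n"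
          proof (rule always_eventually, rule allI)
            fix n
            show "norm (norm (commutator b T (u (r n)) x) - norm (commutator b T f x)) \<le> ?e n"
              using commutator_diff[OF fB uB[of "r n"], of x] commutator_le[OF dB[of "r n"], of x]
              unfolding real_norm_def by linarith
          qed
          have "?e \<longlonglongrightarrow> norm (b x) * norm (0::'k) + norm (0::'k)" using elim by (intro tendsto_intros) auto
          then show "?e \<longlonglongrightarrow> 0" by simp
        qed
      qed
    qed
  qed
qed

lemma bounded: "commutator_bounded b T"
proof -
  obtain C where C: "C > 0" and E: "\<And>f. f \<in> H11_boxed \<Longrightarrow> f \<in> bounded_products \<and> L1_norm (\<lambda>x. norm (commutator b T f x)) \<le> ennreal C * H11_norm f"
    by (fact boxed_bound)
  obtain \<eta> :: "real^'n \<Rightarrow> real" where \<eta>: "test_function \<eta>" "\<eta> 0 = 1" "\<And>x. norm x \<ge> 1 \<Longrightarrow> \<eta> x = 0" by (fact cutoff_exists)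
  define u where "u = (\<lambda>f n x. dilate n \<eta> x *\<^sub>R (f x :: 'k))"
  have u: "u f n \<in> H11_boxed" if "f \<in> H11" for f n unfolding u_def by (rule H11_cutoff(1)[OF \<eta> that])
  have ul: "(\<lambda>n. H11_norm (\<lambda>x. f x - u f n x)) \<longlonglongrightarrow> 0" if "f \<in> H11" for f unfolding u_def by (rule H11_cutoff(2)[OF \<eta> that])
  let ?N = "\<lambda>f x. norm (commutator b T f x)"
  define P where "P = (\<lambda>f a. (\<forall>x. 0 \<le> a x) \<and> integrable lebesgue a \<and> (\<forall>u. (\<forall>n. u n \<in> H11_boxed) \<longrightarrow> (\<lambda>n. H11_norm (\<lambda>x. f x - u n x)) \<longlonglongrightarrow> 0 \<longrightarrow>
     (\<lambda>n. L1_norm (\<lambda>x. ?N (u n) x - a x)) \<longlonglongrightarrow> 0))"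
  \<comment> \<open>The value 0 outside \<open>H11\<close> makes \<open>A\<close> nonnegative for
    every argument.\<close>
  define A where "A = (\<lambda>f. if f \<in> H11 then SOME a. P f a else (\<lambda>_. 0))"
  have PA: "P f (A f)" if "f \<in> H11" for f
  proof -
    have "\<exists>a. P f a" unfolding P_def by (rule commutator_extension[OF _ that]) (rule E)
    then have "P f (SOME a. P f a)" by (rule someI_ex)
    then show ?thesis using that by (simp only: A_def if_True)
  qed
  have A0: "0 \<le> A f x" for f x using PA[of f] by (cases "f \<in> H11") (auto simp: P_def A_def)
  have Ai: "integrable lebesgue (A f)" if "f \<in> H11" for f using PA[OF that] by (simp add: P_def)
  have Al: "(\<lambda>n. L1_norm (\<lambda>x. ?N (v n) x - A f x)) \<longlonglongrightarrow> 0"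
    if "f \<in> H11" and "\<And>n. v n \<in> H11_boxed" and "(\<lambda>n. H11_norm (\<lambda>x. f x - v n x)) \<longlonglongrightarrow> 0" for f v
    using PA[OF that(1)] that(2,3) by (simp add: P_def)
  have dense: "\<exists>g\<in>commutator_domain b. H11_norm (\<lambda>x. f x - g x) < e" if f: "f \<in> H11" and e: "e > 0" for f e
  proof -
    obtain n where "H11_norm (\<lambda>x. f x - u f n x) < e"
      using order_tendstoD(2)[OF ul[OF f] e] by (auto simp: eventually_sequentially)
    moreover have "u f n \<in> commutator_domain b" using E[OF u[OF f]] u[OF f] by (intro boxed_commutator_domain) auto
    ultimately show ?thesis by blast
  qed
  have agree: "AE x in lebesgue. A f x = ?N f x" if f: "f \<in> commutator_domain b" for f
  proof -
    have fH: "f \<in> H11" using f by (simp add: commutator_domain_def)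
    show ?thesis by (rule commutator_extension_eq[OF _ f Ai[OF fH]]) (use E Al[OF fH] in blast)+
  qed
  have bound: "L1_norm (A f) \<le> ennreal C * H11_norm f" if f: "f \<in> H11" for f
  proof -
    \<comment> \<open>The cutoff is written as f - (f - u), so in the limit its norm costs no more
      than that of f and the constant of the boxed case is kept.\<close>
    have le: "L1_norm (A f) \<le> ennreal C * (H11_norm f + H11_norm (\<lambda>x. f x - u f n x)) + L1_norm (\<lambda>x. ?N (u f n) x - A f x)" for n
    proof -
      note un = u[OF f, of n]
      have [measurable]: "?N (u f n) \<in> borel_measurable lebesgue" "A f \<in> borel_measurable lebesgue"
        using commutator_measurable[OF conjunct1[OF E[OF un]]] Ai[OF f] by auto
      have "L1_norm (A f) \<le> (\<integral>\<^sup>+x. ennreal (norm (?N (u f n) x)) + ennreal (norm (?N (u f n) x - A f x)) \<partial>lebesgue)"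
        unfolding L1_norm_def
      proof (rule nn_integral_mono)
        fix x
        have "norm (A f x) \<le> norm (?N (u f n) x) + norm (?N (u f n) x - A f x)"
          using norm_triangle_ineq4[of "?N (u f n) x" "?N (u f n) x - A f x"] by simp
        from ennreal_leI[OF this] show "ennreal (norm (A f x)) \<le> ennreal (norm (?N (u f n) x)) + ennreal (norm (?N (u f n) x - A f x))"
          by (simp only: ennreal_plus norm_ge_zero)
      qed
      also have "\<dots> = L1_norm (?N (u f n)) + L1_norm (\<lambda>x. ?N (u f n) x - A f x)"
        unfolding L1_norm_def by (rule nn_integral_add) measurable
      also have "\<dots> \<le> ennreal C * H11_norm (u f n) + L1_norm (\<lambda>x. ?N (u f n) x - A f x)"
        using E[OF un] by (intro add_right_mono) simp
      also have "H11_norm (u f n) \<le> H11_norm f + H11_norm (\<lambda>x. f x - u f n x)"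
        using H11_diff(2)[OF f H11_diff(1)[OF f H11_boxed_D[OF un]]] by simp
      finally show ?thesis by (simp add: mult_left_mono)
    qed
    have "(\<lambda>n. ennreal C * (H11_norm f + H11_norm (\<lambda>x. f x - u f n x)) + L1_norm (\<lambda>x. ?N (u f n) x - A f x)) \<longlonglongrightarrow> ennreal C * (H11_norm f + 0) + 0"
      by (intro tendsto_add ennreal_tendsto_cmult tendsto_const ul f Al u) simp
    then have "L1_norm (A f) \<le> ennreal C * (H11_norm f + 0) + 0" by (rule LIMSEQ_le_const) (use le in auto)
    then show ?thesis by simp
  qed
  have sub: "AE x in lebesgue. A (\<lambda>y. \<alpha> * f y + \<beta> * g y) x \<le> norm \<alpha> * A f x + norm \<beta> * A g x"
    if f: "f \<in> H11" and g: "g \<in> H11" for f g \<alpha> \<beta>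
  proof -
    let ?h = "\<lambda>y. \<alpha> * f y + \<beta> * g y" and ?v = "\<lambda>n y. \<alpha> * u f n y + \<beta> * u g n y"
    have h: "?h \<in> H11" by (rule H11_lincomb(1)[OF f g])
    have v: "?v n \<in> H11_boxed" for n by (rule H11_boxed_lincomb[OF u[OF f] u[OF g]])
    \<comment> \<open>Multiplication by the cutoff is linear, so the combinations of the cutoffs are
      the cutoffs of the combination and approximate it.\<close>
    have veq: "u ?h n = ?v n" for n by (simp add: u_def fun_eq_iff scaleR_add_right)
    have vl: "(\<lambda>n. H11_norm (\<lambda>x. ?h x - ?v n x)) \<longlonglongrightarrow> 0" using ul[OF h] unfolding veq .
    let ?D = "\<lambda>f n x. ?N (u f n) x - A f x"
    let ?F = "\<lambda>x. A ?h x - (norm \<alpha> * A f x + norm \<beta> * A g x)"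
    define e where "e = (\<lambda>n. L1_norm (\<lambda>x. ?N (?v n) x - A ?h x) + (ennreal (norm \<alpha>) * L1_norm (?D f n) + ennreal (norm \<beta>) * L1_norm (?D g n)))"
    have "AE x in lebesgue. ?F x \<le> 0"
    proof (rule AE_nonpos_of_small_integral)
      show "?F \<in> borel_measurable lebesgue" using Ai[OF f] Ai[OF g] Ai[OF h] by auto
      have "e \<longlonglongrightarrow> 0 + (ennreal (norm \<alpha>) * 0 + ennreal (norm \<beta>) * 0)"
        unfolding e_def by (intro tendsto_add ennreal_tendsto_cmult Al f g h u ul v vl) simp_all
      then show "e \<longlonglongrightarrow> 0" by simp
      fix n
      have [measurable]: "?N (u f n) \<in> borel_measurable lebesgue" "?N (u g n) \<in> borel_measurable lebesgue" "?N (?v n) \<in> borel_measurable lebesgue"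
        "A f \<in> borel_measurable lebesgue" "A g \<in> borel_measurable lebesgue" "A ?h \<in> borel_measurable lebesgue"
        using commutator_measurable[OF conjunct1[OF E[OF u[OF f]]]] commutator_measurable[OF conjunct1[OF E[OF u[OF g]]]]
          commutator_measurable[OF conjunct1[OF E[OF v]]] Ai[OF f] Ai[OF g] Ai[OF h] by auto
      have "(\<integral>\<^sup>+x. ennreal (?F x) \<partial>lebesgue) \<le> (\<integral>\<^sup>+x. ennreal (norm (?N (?v n) x - A ?h x)) + (ennreal (norm \<alpha>) * ennreal (norm (?D f n x)) + ennreal (norm \<beta>) * ennreal (norm (?D g n x))) \<partial>lebesgue)"
      proof (rule nn_integral_mono)
        fix x
        have 1: "?N (?v n) x \<le> norm \<alpha> * ?N (u f n) x + norm \<beta> * ?N (u g n) x"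
          using E[OF u[OF f]] E[OF u[OF g]] by (intro commutator_lincomb) auto
        have 2: "norm \<alpha> * ?D f n x \<le> norm \<alpha> * norm (?D f n x)" "norm \<beta> * ?D g n x \<le> norm \<beta> * norm (?D g n x)"
          by (intro mult_left_mono; simp)+
        have 3: "A ?h x \<le> ?N (?v n) x + norm (?N (?v n) x - A ?h x)" unfolding real_norm_def by linarith
        have "?F x \<le> norm (?N (?v n) x - A ?h x) + (norm \<alpha> * norm (?D f n x) + norm \<beta> * norm (?D g n x))"
          using 1 2 3 unfolding right_diff_distrib by linarith
        then have "ennreal (?F x) \<le> ennreal (norm (?N (?v n) x - A ?h x) + (norm \<alpha> * norm (?D f n x) + norm \<beta> * norm (?D g n x)))"
          by (rule ennreal_leI)
        then show "ennreal (?F x) \<le> ennreal (norm (?N (?v n) x - A ?h x)) + (ennreal (norm \<alpha>) * ennreal (norm (?D f n x)) + ennreal (norm \<beta>) * ennreal (norm (?D g n x)))"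
          by (simp only: ennreal_plus norm_ge_zero add_nonneg_nonneg mult_nonneg_nonneg ennreal_mult)
      qed
      also have "\<dots> = e n"
        unfolding e_def L1_norm_def by (simp add: nn_integral_add nn_integral_cmult)
      finally show "(\<integral>\<^sup>+x. ennreal (?F x) \<partial>lebesgue) \<le> e n" .
    qed
    then show ?thesis by eventually_elim simp
  qed
  show ?thesis
    unfolding commutator_bounded_def using dense A0 agree Ai bound sub by (intro conjI exI[of _ A] exI[of _ C]) blast+
qed

end

theorem theorem7p4:
  fixes T :: "(real^'n \<Rightarrow> 'k::{real_normed_field,euclidean_space}) \<Rightarrow> real^'n \<Rightarrow> 'k"
    and b :: "real^'n \<Rightarrow> 'k"
  assumes "3 \<le> CARD('n)"
    and "T \<in> class_K"
    and "b \<in> BMO"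
  shows "commutator_bounded b T"
proof -
  interpret KL_commutator T b by unfold_locales (fact assms)+
  show ?thesis by (rule bounded)
qed

end
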